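(* There are an absolute constant $C>0$ and, for every integer $k\geq 1$, a polynomial $q_k(n)$ in $n$ of degree at most $Ck$ (that is, of degree $O(k)$) such that the following holds. Let $n\geq 1$, let $Q_1,\ldots,Q_k$ be real polynomials of degree at most $2$ in $n$ variables, let $X=\{x\in\mathbb{R}^n\mid Q_1(x)=\ldots=Q_k(x)=0\}$ and $M=X\cap\overline{B}^n$. Assume that $M$ is a submanifold without boundary of $B^n$ (in particular $M\subset B^n$) and a complete intersection of codimension $k$, i.e. the gradients $\nabla Q_1(x),\ldots,\nabla Q_k(x)$ are linearly independent at every point $x\in M$. Then the sum of the geodesic diameters of the connected components of $M$ is bounded from above by $q_k(n)$.
   Context: $B^n$ and $\overline{B}^n$ denote the open and closed Euclidean unit balls of $\mathbb{R}^n$ centred at the origin. For a connected component $M_i$ of $M$, the geodesic distance between $x,y\in M_i$ is the infimum of the (Euclidean) lengths of paths joining $x$ to $y$ inside $M_i$; the geodesic diameter of $M_i$ is the supremum of the geodesic distances between two points of $M_i$. *)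

theory Defs
  imports "HOL-Analysis.Analysis" "HOL-Library.Poly_Mapping"
begin

text \<open>
  The dimension \<open>n\<close> is quantified inside the main statement, so points of real \<open>n\<close>-space are
  functions \<open>nat \<Rightarrow> real\<close> vanishing at all \<open>i \<ge> n\<close>, that is, elements of
  \<open>topspace (Euclidean_space n)\<close>; coordinates are numbered \<open>0, \<dots>, n - 1\<close>.
  The \<open>dist\<close> of the type \<open>nat \<Rightarrow> real\<close> is not the Euclidean distance and is never used.
\<close>

definition eucl_norm :: "nat \<Rightarrow> (nat \<Rightarrow> real) \<Rightarrow> real" where
  "eucl_norm n x = L2_set x {..<n}"

definition eucl_dist :: "nat \<Rightarrow> (nat \<Rightarrow> real) \<Rightarrow> (nat \<Rightarrow> real) \<Rightarrow> real" where
  "eucl_dist n x y = eucl_norm n (\<lambda>i. x i - y i)"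

definition open_unit_ball :: "nat \<Rightarrow> (nat \<Rightarrow> real) set" where
  "open_unit_ball n = {x \<in> topspace (Euclidean_space n). eucl_norm n x < 1}"

definition closed_unit_ball :: "nat \<Rightarrow> (nat \<Rightarrow> real) set" where
  "closed_unit_ball n = {x \<in> topspace (Euclidean_space n). eucl_norm n x \<le> 1}"


text \<open>
  Real multivariate polynomials: a monomial is a finitely supported exponent vector, and a
  polynomial is a finitely supported map from monomials to coefficients.
\<close>

type_synonym real_mpoly = "(nat \<Rightarrow>\<^sub>0 nat) \<Rightarrow>\<^sub>0 real"

definition monomial_degree :: "(nat \<Rightarrow>\<^sub>0 nat) \<Rightarrow> nat" where
  "monomial_degree m = (\<Sum>i\<in>Poly_Mapping.keys m. Poly_Mapping.lookup m i)"

text \<open>The polynomials in the variables \<open>0, \<dots>, n - 1\<close> of total degree at most \<open>d\<close>.\<close>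

definition mpolys_of_degree_le :: "nat \<Rightarrow> nat \<Rightarrow> real_mpoly set" where
  "mpolys_of_degree_le n d =
     {p. \<forall>m\<in>Poly_Mapping.keys p. Poly_Mapping.keys m \<subseteq> {..<n} \<and> monomial_degree m \<le> d}"

definition mpoly_eval :: "real_mpoly \<Rightarrow> (nat \<Rightarrow> real) \<Rightarrow> real" where
  "mpoly_eval p x =
     (\<Sum>m\<in>Poly_Mapping.keys p. Poly_Mapping.lookup p m *
        (\<Prod>i\<in>Poly_Mapping.keys m. x i ^ Poly_Mapping.lookup m i))"

definition zero_locus :: "nat \<Rightarrow> nat \<Rightarrow> (nat \<Rightarrow> real_mpoly) \<Rightarrow> (nat \<Rightarrow> real) set" where
  "zero_locus n k Q = {x \<in> topspace (Euclidean_space n). \<forall>j\<in>{1..k}. mpoly_eval (Q j) x = 0}"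


definition partial_deriv :: "nat \<Rightarrow> ((nat \<Rightarrow> real) \<Rightarrow> real) \<Rightarrow> (nat \<Rightarrow> real) \<Rightarrow> real" where
  "partial_deriv i f x = deriv (\<lambda>t. f (x(i := t))) (x i)"

definition gradient :: "nat \<Rightarrow> ((nat \<Rightarrow> real) \<Rightarrow> real) \<Rightarrow> (nat \<Rightarrow> real) \<Rightarrow> (nat \<Rightarrow> real)" where
  "gradient n f x = (\<lambda>i. if i < n then partial_deriv i f x else 0)"

text \<open>
  Linear independence of the family \<open>v 1, \<dots>, v k\<close> (not merely of the set of its values),
  spelled out because \<open>nat \<Rightarrow> real\<close> is not an instance of \<open>real_vector\<close>.
\<close>

definition lin_indep_family :: "nat \<Rightarrow> (nat \<Rightarrow> nat \<Rightarrow> real) \<Rightarrow> bool" where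
  "lin_indep_family k v \<longleftrightarrow>
     (\<forall>c. (\<forall>i. (\<Sum>j=1..k. c j * v j i) = 0) \<longrightarrow> (\<forall>j\<in>{1..k}. c j = 0))"

definition complete_intersection_on ::
  "nat \<Rightarrow> nat \<Rightarrow> (nat \<Rightarrow> real_mpoly) \<Rightarrow> (nat \<Rightarrow> real) set \<Rightarrow> bool" where
  "complete_intersection_on n k Q M \<longleftrightarrow>
     (\<forall>x\<in>M. lin_indep_family k (\<lambda>j. gradient n (mpoly_eval (Q j)) x))"


text \<open>\<open>Ck_on n m U f\<close>: on the open subset \<open>U\<close> of real \<open>n\<close>-space, \<open>f\<close> is of class \<open>C\<^sup>m\<close>.\<close>

primrec Ck_on ::
  "nat \<Rightarrow> nat \<Rightarrow> (nat \<Rightarrow> real) set \<Rightarrow> ((nat \<Rightarrow> real) \<Rightarrow> real) \<Rightarrow> bool" where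
  "Ck_on n 0 U f \<longleftrightarrow> continuous_map (subtopology (Euclidean_space n) U) euclideanreal f"
| "Ck_on n (Suc m) U f \<longleftrightarrow>
     continuous_map (subtopology (Euclidean_space n) U) euclideanreal f \<and>
     (\<forall>i<n. (\<forall>x\<in>U. (\<lambda>t. f (x(i := t))) differentiable (at (x i))) \<and>
            Ck_on n m U (partial_deriv i f))"

definition smooth_on :: "nat \<Rightarrow> (nat \<Rightarrow> real) set \<Rightarrow> ((nat \<Rightarrow> real) \<Rightarrow> real) \<Rightarrow> bool" where
  "smooth_on n U f \<longleftrightarrow> (\<forall>m. Ck_on n m U f)"

definition diffeo_between ::
  "nat \<Rightarrow> (nat \<Rightarrow> real) set \<Rightarrow> (nat \<Rightarrow> real) set \<Rightarrow>
   ((nat \<Rightarrow> real) \<Rightarrow> (nat \<Rightarrow> real)) \<Rightarrow> ((nat \<Rightarrow> real) \<Rightarrow> (nat \<Rightarrow> real)) \<Rightarrow> bool" where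
  "diffeo_between n U V \<phi> \<psi> \<longleftrightarrow>
     openin (Euclidean_space n) U \<and> openin (Euclidean_space n) V \<and>
     \<phi> ` U \<subseteq> V \<and> \<psi> ` V \<subseteq> U \<and> (\<forall>x\<in>U. \<psi> (\<phi> x) = x) \<and> (\<forall>y\<in>V. \<phi> (\<psi> y) = y) \<and>
     (\<forall>i<n. smooth_on n U (\<lambda>x. \<phi> x i) \<and> smooth_on n V (\<lambda>y. \<psi> y i))"

text \<open>
  \<open>M\<close> is an embedded smooth \<open>d\<close>-dimensional submanifold without boundary of \<open>B\<close>, where \<open>B\<close> is
  an open subset of real \<open>n\<close>-space: around each of its points, \<open>M\<close> is straightened by a
  diffeomorphism to the linear subspace spanned by the first \<open>d\<close> coordinates.
\<close>

definition submanifold_of ::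
  "nat \<Rightarrow> nat \<Rightarrow> (nat \<Rightarrow> real) set \<Rightarrow> (nat \<Rightarrow> real) set \<Rightarrow> bool" where
  "submanifold_of n d B M \<longleftrightarrow>
     M \<subseteq> B \<and> d \<le> n \<and>
     (\<forall>p\<in>M. \<exists>U V \<phi> \<psi>. p \<in> U \<and> U \<subseteq> B \<and> diffeo_between n U V \<phi> \<psi> \<and>
        \<phi> ` (M \<inter> U) = {y \<in> V. \<forall>i\<ge>d. y i = 0})"


text \<open>The Euclidean length of a path is the supremum of the lengths of inscribed polygons.\<close>

definition euclidean_length :: "nat \<Rightarrow> (real \<Rightarrow> (nat \<Rightarrow> real)) \<Rightarrow> ereal" where
  "euclidean_length n g =
     Sup {ereal (\<Sum>i<N. eucl_dist n (g (t i)) (g (t (Suc i)))) | (N::nat) (t :: nat \<Rightarrow> real).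
            mono_on {..N} t \<and> t ` {..N} \<subseteq> {0..1}}"

definition geodesic_dist ::
  "nat \<Rightarrow> (nat \<Rightarrow> real) set \<Rightarrow> (nat \<Rightarrow> real) \<Rightarrow> (nat \<Rightarrow> real) \<Rightarrow> ereal" where
  "geodesic_dist n S x y =
     Inf {euclidean_length n g | g.
            pathin (subtopology (Euclidean_space n) S) g \<and> g 0 = x \<and> g 1 = y}"

definition geodesic_diameter :: "nat \<Rightarrow> (nat \<Rightarrow> real) set \<Rightarrow> ereal" where
  "geodesic_diameter n S = Sup {geodesic_dist n S x y | x y. x \<in> S \<and> y \<in> S}"

text \<open>
  The sum is an unordered sum of nonnegative extended reals, so it has its intended value in
  \<open>[0, \<infinity>]\<close> even if there were infinitely many components.
\<close>

definition sum_geodesic_diameters :: "nat \<Rightarrow> (nat \<Rightarrow> real) set \<Rightarrow> ereal" where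
  "sum_geodesic_diameters n M =
     (\<Sum>\<^sub>\<infinity>S\<in>connected_components_of (subtopology (Euclidean_space n) M). geodesic_diameter n S)"

end

theory Submission
  imports Defs "Jordan_Normal_Form.Determinant"
begin

text \<open>
  Let \<open>f e\<close> be the squared distance to the point \<open>-e\<close>, up to a constant. For generic \<open>e\<close> it has on
  \<open>M\<close> only \<open>n\<^sup>O\<^sup>(\<^sup>k\<^sup>)\<close> critical points. The reason that quadrics behave so well is that the
  Lagrange equations are linear in \<open>x\<close>; the point \<open>x\<close> can be eliminated, and in the bound for the
  degree of the resulting relation the number of variables only enters as the base of a power, whose exponent
  is the number of multipliers.

  A point of \<open>M\<close> is joined to a critical point by descending along \<open>f e\<close>. The length of a gradient
  line is at most about the length of the ridge, which consists of a point of least slope \<open>\<bar>\<nabla>f\<bar>\<close>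
  in every level set: between two levels, the gradient line that descends at least as steeply as the ridge is
  not longer than the ridge. As the ridge is again given by a minimisation problem with few multipliers, its
  coordinates are algebraic functions of the level, of degree \<open>n\<^sup>O\<^sup>(\<^sup>k\<^sup>)\<close>, and so its length is at
  most \<open>n\<^sup>O\<^sup>(\<^sup>k\<^sup>)\<close>. Every component of \<open>M\<close> contains a critical point, and any two of its points are
  joined by a path that passes near each critical point at most once.

  Gradient lines are replaced by chains of points with short steps, which become Lipschitz paths in the limit,
  and the ridge is a limit of minimisers of a penalised and perturbed problem.
\<close>

subsection \<open>Polynomial functions with bounded partial degrees\<close>

text \<open>The obstacle is that a minimiser need not be unique and may jump as the level changes,
  so its coordinates cannot be treated as algebraic functions directly. The minimal value
  \<open>W\<close> is unique and continuous. A coordinate of the minimiser is minus the derivative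
  of \<open>W\<close> with respect to a linear perturbation of the objective; therefore the
  difference of two minimal values, for two neighbouring perturbations, is related algebraically to
  the level, and its variation is divided by the size of the perturbation. This requires two copies
  of the critical equations with \<open>2 * k + 1\<close> auxiliary variables each (a multiplier and
  a scaled residual per equation, one scaled residual for the level), whence the parameter
  \<open>4 * k + 2\<close> in the bound for the length, against \<open>k\<close> in the bound for
  the number of critical points. A relation found by elimination may become trivial at the
  parameters of interest. Hence parameters are chosen generically where there is a choice, and
  otherwise approached by generic ones with normalised coefficients.\<close>

definition pmon :: "nat \<Rightarrow> (nat \<Rightarrow> nat) \<Rightarrow> (nat \<Rightarrow> real) \<Rightarrow> real" where
  "pmon m \<alpha> z = (\<Prod>i<m. z i ^ \<alpha> i)"

text \<open>Exponent vectors are extensional, hence \<open>undefined\<close> from \<open>m\<close>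
  on: each monomial in \<open>m\<close> variables has exactly one exponent vector, and the box is
  finite.\<close>

definition expbox :: "nat \<Rightarrow> (nat \<Rightarrow> nat) \<Rightarrow> (nat \<Rightarrow> nat) set" where
  "expbox m d = (\<Pi>\<^sub>E i\<in>{..<m}. {..d i})"

text \<open>Degrees are bounded variable by variable instead of in total: the dimension of the space
  is then a product, in which blocks of variables with very different degrees can be counted
  separately.\<close>

definition pf :: "nat \<Rightarrow> (nat \<Rightarrow> nat) \<Rightarrow> ((nat \<Rightarrow> real) \<Rightarrow> real) \<Rightarrow> bool" where
  "pf m d f \<longleftrightarrow> (\<exists>c. \<forall>z. f z = (\<Sum>\<alpha>\<in>expbox m d. c \<alpha> * pmon m \<alpha> z))"

lemma finite_expbox [simp]: "finite (expbox m d)"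
  by (simp add: expbox_def finite_PiE)

lemma card_expbox: "card (expbox m d) = (\<Prod>i<m. Suc (d i))"
  by (simp add: expbox_def card_PiE)

lemma pf_mon:
  assumes "\<And>i. i < m \<Longrightarrow> \<gamma> i \<le> d i"
  shows "pf m d (pmon m \<gamma>)"
proof -
  let ?g = "restrict \<gamma> {..<m}"
  have "?g \<in> expbox m d" using assms by (auto simp: expbox_def)
  moreover have "pmon m ?g = pmon m \<gamma>" by (auto simp: pmon_def fun_eq_iff intro!: prod.cong)
  ultimately show ?thesis unfolding pf_def
    by (intro exI[of _ "\<lambda>\<alpha>. if \<alpha> = ?g then 1 else 0"]) (auto simp: if_distrib if_distribR sum.delta cong: if_cong)
qed

lemma pf_add:
  assumes "pf m d f" "pf m d g"
  shows "pf m d (\<lambda>z. f z + g z)"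
proof -
  from assms obtain c c' where "\<And>z. f z = (\<Sum>\<alpha>\<in>expbox m d. c \<alpha> * pmon m \<alpha> z)"
    "\<And>z. g z = (\<Sum>\<alpha>\<in>expbox m d. c' \<alpha> * pmon m \<alpha> z)" unfolding pf_def by blast
  thus ?thesis unfolding pf_def
    by (intro exI[of _ "\<lambda>\<alpha>. c \<alpha> + c' \<alpha>"]) (auto simp: sum.distrib algebra_simps)
qed

lemma pf_smult:
  assumes "pf m d f"
  shows "pf m d (\<lambda>z. a * f z)"
proof -
  from assms obtain c where "\<And>z. f z = (\<Sum>\<alpha>\<in>expbox m d. c \<alpha> * pmon m \<alpha> z)"
    unfolding pf_def by blast
  thus ?thesis unfolding pf_def
    by (intro exI[of _ "\<lambda>\<alpha>. a * c \<alpha>"]) (auto simp: sum_distrib_left algebra_simps)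
qed

lemma pf_const: "pf m d (\<lambda>z. a)"
proof -
  have "pf m d (\<lambda>z. a * pmon m (\<lambda>_. 0) z)" by (intro pf_smult pf_mon) auto
  thus ?thesis by (simp add: pmon_def)
qed

lemma pf_var:
  assumes "i < m" "1 \<le> d i"
  shows "pf m d (\<lambda>z. z i)"
proof -
  have "pf m d (pmon m (\<lambda>j. if j = i then 1 else 0))" using assms by (intro pf_mon) auto
  moreover have "pmon m (\<lambda>j. if j = i then 1 else 0) = (\<lambda>z. z i)"
  proof
    fix z :: "nat \<Rightarrow> real"
    have "pmon m (\<lambda>j. if j = i then 1 else 0) z = (\<Prod>j<m. if j = i then z i else 1)"
      unfolding pmon_def by (intro prod.cong) auto
    thus "pmon m (\<lambda>j. if j = i then 1 else 0) z = z i" using assms by (simp add: prod.delta)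
  qed
  ultimately show ?thesis by simp
qed

lemma pf_sum:
  assumes "\<And>j. j \<in> J \<Longrightarrow> pf m d (f j)"
  shows "pf m d (\<lambda>z. \<Sum>j\<in>J. f j z)"
  using assms by (induction J rule: infinite_finite_induct) (auto intro: pf_add pf_const)

lemma pf_mult:
  assumes "pf m d f" "pf m d' g" "\<And>i. i < m \<Longrightarrow> d i + d' i \<le> e i"
  shows "pf m e (\<lambda>z. f z * g z)"
proof -
  from assms obtain c c' where *: "\<And>z. f z = (\<Sum>\<alpha>\<in>expbox m d. c \<alpha> * pmon m \<alpha> z)"
    "\<And>z. g z = (\<Sum>\<alpha>\<in>expbox m d'. c' \<alpha> * pmon m \<alpha> z)" unfolding pf_def by blast
  have "pf m e (\<lambda>z. \<Sum>\<alpha>\<in>expbox m d. \<Sum>\<beta>\<in>expbox m d'. (c \<alpha> * c' \<beta>) * pmon m (\<lambda>i. \<alpha> i + \<beta> i) z)"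
  proof (intro pf_sum pf_smult pf_mon)
    fix \<alpha> \<beta> i assume "\<alpha> \<in> expbox m d" "\<beta> \<in> expbox m d'" "i < m"
    hence "\<alpha> i \<le> d i" "\<beta> i \<le> d' i" by (auto simp: expbox_def)
    thus "\<alpha> i + \<beta> i \<le> e i" using assms(3)[OF \<open>i < m\<close>] by linarith
  qed
  moreover have "pmon m (\<lambda>i. \<alpha> i + \<beta> i) z = pmon m \<alpha> z * pmon m \<beta> z" for \<alpha> \<beta> z
    by (simp add: pmon_def power_add prod.distrib)
  moreover have "f z * g z = (\<Sum>\<alpha>\<in>expbox m d. \<Sum>\<beta>\<in>expbox m d'. (c \<alpha> * c' \<beta>) * (pmon m \<alpha> z * pmon m \<beta> z))" for z
    unfolding * sum_product by (intro sum.cong refl) (simp add: mult_ac)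
  ultimately show ?thesis by simp
qed

lemma pf_mono:
  assumes "pf m d f" "\<And>i. i < m \<Longrightarrow> d i \<le> e i"
  shows "pf m e f"
  using pf_mult[OF pf_const[of m "\<lambda>_. 0" 1] assms(1), of e] assms(2) by simp

lemma pf_prod:
  assumes "finite J" "\<And>j. j \<in> J \<Longrightarrow> pf m (d j) (f j)" "\<And>i. i < m \<Longrightarrow> (\<Sum>j\<in>J. d j i) \<le> e i"
  shows "pf m e (\<lambda>z. \<Prod>j\<in>J. f j z)"
  using assms
proof (induction J arbitrary: e rule: finite_induct)
  case (insert x F)
  have "pf m (\<lambda>i. \<Sum>j\<in>F. d j i) (\<lambda>z. \<Prod>j\<in>F. f j z)" using insert by auto
  from pf_mult[OF insert.prems(1)[of x] this, of e] insert show ?case by simp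
qed (auto intro: pf_const)

lemma pf_power:
  assumes "pf m d f" "\<And>i. i < m \<Longrightarrow> k * d i \<le> e i"
  shows "pf m e (\<lambda>z. f z ^ k)"
  using pf_prod[of "{..<k}" m "\<lambda>_. d" "\<lambda>_. f" e] assms by simp

lemma pf_uminus: "pf m d f \<Longrightarrow> pf m d (\<lambda>z. - f z)"
  using pf_smult[of m d f "-1"] by simp

lemma pf_diff: "pf m d f \<Longrightarrow> pf m d g \<Longrightarrow> pf m d (\<lambda>z. f z - g z)"
  using pf_add[OF _ pf_uminus, of m d f g] by simp

lemma pf_lift:
  assumes "pf m d f" "m \<le> m'"
  shows "pf m' (\<lambda>i. if i < m then d i else 0) f"
proof -
  from assms obtain c where *: "\<And>z. f z = (\<Sum>\<alpha>\<in>expbox m d. c \<alpha> * pmon m \<alpha> z)"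
    unfolding pf_def by blast
  have "pf m' (\<lambda>i. if i < m then d i else 0)
     (\<lambda>z. \<Sum>\<alpha>\<in>expbox m d. c \<alpha> * pmon m' (\<lambda>i. if i < m then \<alpha> i else 0) z)"
    by (intro pf_sum pf_smult pf_mon) (auto simp: expbox_def)
  moreover have "pmon m' (\<lambda>i. if i < m then \<alpha> i else 0) z = pmon m \<alpha> z" for \<alpha> z
  proof -
    have "pmon m' (\<lambda>i. if i < m then \<alpha> i else 0) z = (\<Prod>i<m'. if i < m then z i ^ \<alpha> i else 1)"
      unfolding pmon_def by (intro prod.cong) auto
    also have "\<dots> = (\<Prod>i\<in>{..<m'} \<inter> {i. i < m}. z i ^ \<alpha> i)" by (simp add: prod.If_cases)
    also have "{..<m'} \<inter> {i. i < m} = {..<m}" using assms by auto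
    finally show ?thesis by (simp add: pmon_def)
  qed
  ultimately show ?thesis by (simp add: * [abs_def])
qed

lemma continuous_on_coord: "continuous_on S (\<lambda>z::'i \<Rightarrow> real. z i)"
  by (rule continuous_on_subset[OF continuous_on_product_coordinates]) auto

lemma pf_local: "pf m d f \<Longrightarrow> (\<And>i. i < m \<Longrightarrow> z i = z' i) \<Longrightarrow> f z = f z'"
  unfolding pf_def pmon_def by (auto intro!: sum.cong prod.cong)

text \<open>Gaussian elimination: the equation \<open>j0\<close> is used to eliminate an unknown
  \<open>i0\<close> with nonzero coefficient, which lowers the number of equations and of unknowns
  by one. The value \<open>s\<close> of the eliminated unknown restores the equation
  \<open>j0\<close>.\<close>

lemma underdetermined_system:
  fixes a :: "'i \<Rightarrow> 'j \<Rightarrow> real"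
  assumes "finite J" "finite I" "card J < card I"
  shows "\<exists>c. (\<exists>i\<in>I. c i \<noteq> 0) \<and> (\<forall>j\<in>J. (\<Sum>i\<in>I. c i * a i j) = 0)"
  using assms
proof (induction J arbitrary: I a rule: finite_induct)
  case empty
  then obtain i where "i \<in> I" by fastforce
  thus ?case by (intro exI[of _ "\<lambda>_. 1"]) auto
next
  case (insert j0 J)
  show ?case
  proof (cases "\<forall>i\<in>I. a i j0 = 0")
    case True
    from insert.IH[of I a] insert.prems insert.hyps obtain c where
      "\<exists>i\<in>I. c i \<noteq> 0" "\<forall>j\<in>J. (\<Sum>i\<in>I. c i * a i j) = 0" by auto
    with True show ?thesis by (intro exI[of _ c]) auto
  next
    case False
    then obtain i0 where i0: "i0 \<in> I" "a i0 j0 \<noteq> 0" by auto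
    define I' where "I' = I - {i0}"
    have I': "finite I'" "i0 \<notin> I'" "I = Set.insert i0 I'" using insert.prems i0 by (auto simp: I'_def)
    have "card J < card I'" using insert I' by simp
    from insert.IH[OF I'(1) this, of "\<lambda>i j. a i j - a i j0 / a i0 j0 * a i0 j"] obtain c where
      c: "\<exists>i\<in>I'. c i \<noteq> 0" "\<And>j. j \<in> J \<Longrightarrow> (\<Sum>i\<in>I'. c i * (a i j - a i j0 / a i0 j0 * a i0 j)) = 0" by auto
    define s where "s = - (\<Sum>i\<in>I'. c i * a i j0) / a i0 j0"
    define c' where "c' i = (if i = i0 then s else c i)" for i
    have sm: "(\<Sum>i\<in>I. c' i * a i j) = s * a i0 j + (\<Sum>i\<in>I'. c i * a i j)" for j
    proof -
      have "(\<Sum>i\<in>I'. c' i * a i j) = (\<Sum>i\<in>I'. c i * a i j)"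
        using I'(2) by (intro sum.cong) (auto simp: c'_def)
      thus ?thesis by (simp add: I'(1,2,3) c'_def)
    qed
    have "(\<Sum>i\<in>I. c' i * a i j0) = 0" unfolding sm s_def using i0 by simp
    moreover have "(\<Sum>i\<in>I. c' i * a i j) = 0" if "j \<in> J" for j
    proof -
      have "(\<Sum>i\<in>I'. c i * (a i j - a i j0 / a i0 j0 * a i0 j)) =
            (\<Sum>i\<in>I'. c i * a i j) - (\<Sum>i\<in>I'. c i * a i j0) / a i0 j0 * a i0 j"
        by (simp add: algebra_simps sum_subtractf sum_distrib_left sum_distrib_right sum_divide_distrib)
      with c(2)[OF that] show ?thesis unfolding sm s_def by simp
    qed
    moreover have "\<exists>i\<in>I. c' i \<noteq> 0" using c(1) I' by (auto simp: c'_def)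
    ultimately show ?thesis by (intro exI[of _ c']) auto
  qed
qed

lemma pf_dependent:
  assumes "finite I" "\<And>i. i \<in> I \<Longrightarrow> pf m d (f i)" "(\<Prod>i<m. Suc (d i)) < card I"
  shows "\<exists>c. (\<exists>i\<in>I. c i \<noteq> 0) \<and> (\<forall>z. (\<Sum>i\<in>I. c i * f i z) = 0)"
proof -
  have "\<forall>i\<in>I. \<exists>a. \<forall>z. f i z = (\<Sum>\<alpha>\<in>expbox m d. a \<alpha> * pmon m \<alpha> z)"
    using assms(2) by (auto simp: pf_def)
  then obtain a where a: "\<And>i z. i \<in> I \<Longrightarrow> f i z = (\<Sum>\<alpha>\<in>expbox m d. a i \<alpha> * pmon m \<alpha> z)"
    by metis
  obtain c where c: "\<exists>i\<in>I. c i \<noteq> 0" "\<And>\<alpha>. \<alpha> \<in> expbox m d \<Longrightarrow> (\<Sum>i\<in>I. c i * a i \<alpha>) = 0"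
    using underdetermined_system[of "expbox m d" I a] assms by (auto simp: card_expbox)
  have "(\<Sum>i\<in>I. c i * f i z) = 0" for z
  proof -
    have "(\<Sum>i\<in>I. c i * f i z) = (\<Sum>i\<in>I. \<Sum>\<alpha>\<in>expbox m d. c i * a i \<alpha> * pmon m \<alpha> z)"
      by (intro sum.cong) (auto simp: a sum_distrib_left mult_ac)
    also have "\<dots> = (\<Sum>\<alpha>\<in>expbox m d. (\<Sum>i\<in>I. c i * a i \<alpha>) * pmon m \<alpha> z)"
      by (subst sum.swap) (simp add: sum_distrib_right)
    also have "\<dots> = 0" using c(2) by simp
    finally show ?thesis .
  qed
  with c(1) show ?thesis by blast
qed

subsection \<open>Specialising some of the variables\<close>

text \<open>The coefficients of the specialised relation are univariate polynomials in
  \<open>s\<close>. The one at the exponent vector that \<open>\<alpha>0\<close> leaves behind is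
  not the zero polynomial, so some \<open>s\<close> arbitrarily close to \<open>s0\<close> avoids
  its finitely many roots.\<close>

lemma specialise_one:
  assumes "i0 < m" "\<alpha>0 \<in> expbox m d" "c \<alpha>0 \<noteq> 0" "(r::real) > 0"
  shows "\<exists>s c'. \<bar>s - s0\<bar> < r \<and> (\<exists>\<beta>\<in>expbox m (d(i0 := 0)). c' \<beta> \<noteq> 0) \<and>
     (\<forall>w. (\<Sum>\<alpha>\<in>expbox m d. c \<alpha> * pmon m \<alpha> (w(i0 := s))) = (\<Sum>\<beta>\<in>expbox m (d(i0 := 0)). c' \<beta> * pmon m \<beta> w))"
proof -
  define D where "D = expbox m (d(i0 := 0))"
  define b0 where "b0 = \<alpha>0(i0 := 0)"
  have b0: "b0 \<in> D" using assms(1,2) by (auto simp: b0_def D_def expbox_def PiE_iff extensional_def)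
  have bij: "bij_betw (\<lambda>(\<beta>, e). \<beta>(i0 := e)) (D \<times> {..d i0}) (expbox m d)"
  proof (rule bij_betw_byWitness[where f' = "\<lambda>\<alpha>. (\<alpha>(i0 := 0), \<alpha> i0)"])
    have *: "\<beta> i0 = 0" if "\<beta> \<in> D" for \<beta>
      using that assms(1) unfolding D_def expbox_def by (auto dest!: PiE_mem[where x = i0])
    show "\<forall>a\<in>D \<times> {..d i0}. (\<lambda>\<alpha>. (\<alpha>(i0 := 0), \<alpha> i0)) ((\<lambda>(\<beta>, e). \<beta>(i0 := e)) a) = a"
      using * by (auto simp: fun_eq_iff)
    show "(\<lambda>(\<beta>, e). \<beta>(i0 := e)) ` (D \<times> {..d i0}) \<subseteq> expbox m d"
    proof
      fix \<alpha> assume "\<alpha> \<in> (\<lambda>(\<beta>, e). \<beta>(i0 := e)) ` (D \<times> {..d i0})"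
      then obtain \<beta> e where \<alpha>: "\<alpha> = \<beta>(i0 := e)" and
        b: "\<beta> \<in> (\<Pi>\<^sub>E i\<in>{..<m}. {..(d(i0 := 0)) i})" "e \<le> d i0" by (auto simp: D_def expbox_def)
      show "\<alpha> \<in> expbox m d" unfolding \<alpha> expbox_def
      proof (rule PiE_I)
        fix i assume "i \<in> {..<m}"
        with b(1) have "\<beta> i \<in> {..(d(i0 := 0)) i}" by (rule PiE_mem)
        with b(2) show "(\<beta>(i0 := e)) i \<in> {..d i}" by (auto split: if_splits)
      next
        fix i assume "i \<notin> {..<m}"
        with b(1) assms(1) show "(\<beta>(i0 := e)) i = undefined" by (auto simp: PiE_def extensional_def)
      qed
    qed
    show "(\<lambda>\<alpha>. (\<alpha>(i0 := 0), \<alpha> i0)) ` expbox m d \<subseteq> D \<times> {..d i0}"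
    proof
      fix q assume "q \<in> (\<lambda>\<alpha>. (\<alpha>(i0 := 0), \<alpha> i0)) ` expbox m d"
      then obtain \<alpha> where q: "q = (\<alpha>(i0 := 0), \<alpha> i0)" and \<alpha>: "\<alpha> \<in> (\<Pi>\<^sub>E i\<in>{..<m}. {..d i})"
        by (auto simp: expbox_def)
      have "\<alpha>(i0 := 0) \<in> (\<Pi>\<^sub>E i\<in>{..<m}. {..(d(i0 := 0)) i})"
      proof (rule PiE_I)
        fix i assume "i \<in> {..<m}"
        with \<alpha> have "\<alpha> i \<in> {..d i}" by (rule PiE_mem)
        thus "(\<alpha>(i0 := 0)) i \<in> {..(d(i0 := 0)) i}" by auto
      next
        fix i assume "i \<notin> {..<m}"
        with \<alpha> assms(1) show "(\<alpha>(i0 := 0)) i = undefined" by (auto simp: PiE_def extensional_def)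
      qed
      moreover have "\<alpha> i0 \<in> {..d i0}" using assms(1) by (intro PiE_mem[OF \<alpha>]) auto
      ultimately show "q \<in> D \<times> {..d i0}" by (simp add: q D_def expbox_def)
    qed
    show "\<forall>a'\<in>expbox m d. (\<lambda>(\<beta>, e). \<beta>(i0 := e)) (a'(i0 := 0), a' i0) = a'" by simp
  qed
  define p where "p = (\<Sum>e\<le>d i0. monom (c (b0(i0 := e))) e)"
  have "\<alpha>0 = b0(i0 := \<alpha>0 i0)" by (simp add: b0_def)
  moreover have "\<alpha>0 i0 \<le> d i0" using assms(1,2) by (auto simp: expbox_def)
  ultimately have "coeff p (\<alpha>0 i0) \<noteq> 0" using assms(3)
    unfolding p_def by (auto simp: coeff_sum coeff_monom)
  hence "p \<noteq> 0" by auto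
  hence "finite {s. poly p s = 0}" by (simp add: poly_roots_finite)
  moreover have "infinite {s0<..<s0 + r}" using assms(4) by (simp add: infinite_Ioo)
  ultimately have "\<not> {s0<..<s0 + r} \<subseteq> {s. poly p s = 0}" using finite_subset by blast
  then obtain s where s: "s \<in> {s0<..<s0 + r}" "poly p s \<noteq> 0" by blast
  define c' where "c' \<beta> = (\<Sum>e\<le>d i0. c (\<beta>(i0 := e)) * s ^ e)" for \<beta>
  have "c' b0 = poly p s" by (simp add: c'_def p_def poly_sum poly_monom)
  with s(2) have "c' b0 \<noteq> 0" by simp
  with b0 have nz: "\<exists>\<beta>\<in>D. c' \<beta> \<noteq> 0" by blast
  have "(\<Sum>\<alpha>\<in>expbox m d. c \<alpha> * pmon m \<alpha> (w(i0 := s))) = (\<Sum>\<beta>\<in>D. c' \<beta> * pmon m \<beta> w)" for w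
  proof -
    have m: "pmon m (\<beta>(i0 := e)) (w(i0 := s)) = s ^ e * pmon m \<beta> w" if "\<beta> \<in> D" for \<beta> e
    proof -
      have b: "\<beta> i0 = 0"
        using that assms(1) unfolding D_def expbox_def by (auto dest!: PiE_mem[where x = i0])
      have sp: "{..<m} = insert i0 ({..<m} - {i0})" using assms(1) by auto
      have 1: "pmon m (\<beta>(i0 := e)) (w(i0 := s)) = s ^ e * (\<Prod>i\<in>{..<m} - {i0}. w i ^ \<beta> i)"
        unfolding pmon_def by (subst sp, subst prod.insert) (auto intro!: prod.cong)
      have 2: "pmon m \<beta> w = (\<Prod>i\<in>{..<m} - {i0}. w i ^ \<beta> i)"
        unfolding pmon_def by (subst sp, subst prod.insert) (auto simp: b)
      show ?thesis by (simp add: 1 2)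
    qed
    have "(\<Sum>\<alpha>\<in>expbox m d. c \<alpha> * pmon m \<alpha> (w(i0 := s))) =
       (\<Sum>(\<beta>, e)\<in>D \<times> {..d i0}. c (\<beta>(i0 := e)) * pmon m (\<beta>(i0 := e)) (w(i0 := s)))"
      by (subst sum.reindex_bij_betw[OF bij, symmetric]) (auto intro!: sum.cong)
    also have "\<dots> = (\<Sum>\<beta>\<in>D. \<Sum>e\<le>d i0. c (\<beta>(i0 := e)) * pmon m (\<beta>(i0 := e)) (w(i0 := s)))"
      by (simp add: sum.cartesian_product D_def)
    also have "\<dots> = (\<Sum>\<beta>\<in>D. c' \<beta> * pmon m \<beta> w)"
      by (intro sum.cong refl) (simp add: m c'_def sum_distrib_right sum_distrib_left mult_ac)
    finally show ?thesis .
  qed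
  thus ?thesis using s(1) nz unfolding D_def
    by (intro exI[of _ s] exI[of _ c'] conjI allI) (auto simp: abs_less_iff)
qed

lemma specialise_generic:
  assumes "finite A" "A \<subseteq> {..<m}" "\<exists>\<alpha>\<in>expbox m d. c \<alpha> \<noteq> 0" "(r::real) > 0"
  shows "\<exists>a c'. (\<forall>i. \<bar>a i - a0 i\<bar> < r) \<and> (\<exists>\<beta>\<in>expbox m (\<lambda>i. if i \<in> A then 0 else d i). c' \<beta> \<noteq> 0) \<and>
     (\<forall>w. (\<Sum>\<alpha>\<in>expbox m d. c \<alpha> * pmon m \<alpha> (\<lambda>i. if i \<in> A then a i else w i))
        = (\<Sum>\<beta>\<in>expbox m (\<lambda>i. if i \<in> A then 0 else d i). c' \<beta> * pmon m \<beta> w))"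
  using assms(1,2)
proof (induction A rule: finite_induct)
  case empty
  show ?case using assms by (intro exI[of _ a0] exI[of _ c]) auto
next
  case (insert i0 A)
  have "A \<subseteq> {..<m}" using insert.prems by auto
  from insert.IH[OF this] obtain a c' where ac: "\<forall>i. \<bar>a i - a0 i\<bar> < r"
    "\<exists>\<beta>\<in>expbox m (\<lambda>i. if i \<in> A then 0 else d i). c' \<beta> \<noteq> 0"
    "\<And>w. (\<Sum>\<alpha>\<in>expbox m d. c \<alpha> * pmon m \<alpha> (\<lambda>i. if i \<in> A then a i else w i))
        = (\<Sum>\<beta>\<in>expbox m (\<lambda>i. if i \<in> A then 0 else d i). c' \<beta> * pmon m \<beta> w)"
    by (elim exE conjE) (rule that, auto)
  from ac(2) obtain b where b: "b \<in> expbox m (\<lambda>i. if i \<in> A then 0 else d i)" "c' b \<noteq> 0" by blast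
  from insert.prems have "i0 < m" by auto
  from specialise_one[where c = c', OF this b assms(4), of "a0 i0"] obtain s c'' where
    s: "\<bar>s - a0 i0\<bar> < r" "\<exists>\<beta>\<in>expbox m ((\<lambda>i. if i \<in> A then 0 else d i)(i0 := 0)). c'' \<beta> \<noteq> 0"
    "\<And>w. (\<Sum>\<beta>\<in>expbox m (\<lambda>i. if i \<in> A then 0 else d i). c' \<beta> * pmon m \<beta> (w(i0 := s)))
      = (\<Sum>\<beta>\<in>expbox m ((\<lambda>i. if i \<in> A then 0 else d i)(i0 := 0)). c'' \<beta> * pmon m \<beta> w)" by blast
  have e: "(\<lambda>i. if i \<in> A then 0 else d i)(i0 := 0) = (\<lambda>i. if i \<in> insert i0 A then 0 else d i)" by auto
  have f: "(\<lambda>i. if i \<in> insert i0 A then (a(i0 := s)) i else w i) =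
     (\<lambda>i. if i \<in> A then a i else (w(i0 := s)) i)" for w using insert.hyps by auto
  show ?case
    by (rule exI[of _ "a(i0 := s)"], rule exI[of _ c''], unfold f ac(3))
       (use ac(1) s in \<open>auto simp: e simp del: fun_upd_apply, auto\<close>)
qed

subsection \<open>Compactness\<close>

lemma compact_Pi:
  fixes K :: "'i \<Rightarrow> 'a::topological_space set"
  assumes "\<And>i. compact (K i)"
  shows "compact {f. \<forall>i. f i \<in> K i}"
proof -
  have "compactin (product_topology (\<lambda>i. euclidean) UNIV) (PiE UNIV K)"
    using assms by (subst compactin_PiE) auto
  hence "compactin euclidean (PiE UNIV K)" by (simp add: euclidean_product_topology)
  moreover have "PiE UNIV K = {f. \<forall>i. f i \<in> K i}" by (auto simp: PiE_iff)
  ultimately show ?thesis by simp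
qed

text \<open>Takes the place of convergent subsequences. Some of the compact spaces used later are
  products over an uncountable index set, where sequences need not have convergent subsequences; a
  finer filter always exists.\<close>

lemma compact_subfilter:
  fixes g :: "'i \<Rightarrow> 'a::topological_space"
  assumes "compact K" "F \<noteq> bot" "eventually (\<lambda>i. g i \<in> K) F"
  shows "\<exists>x H. x \<in> K \<and> H \<le> F \<and> H \<noteq> bot \<and> (g \<longlongrightarrow> x) H"
proof -
  have "filtermap g F \<noteq> bot" using assms(2) by (simp add: filtermap_bot_iff)
  moreover have "eventually (\<lambda>y. y \<in> K) (filtermap g F)" using assms(3) by (simp add: eventually_filtermap)
  ultimately obtain x where x: "x \<in> K" "inf (nhds x) (filtermap g F) \<noteq> bot"
    using assms(1) unfolding compact_filter by blast
  define H where "H = inf F (filtercomap g (nhds x))"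
  have "H \<noteq> bot"
  proof
    assume "H = bot"
    hence "eventually (\<lambda>_. False) H" by simp
    then obtain P Q where PQ: "eventually P F" "eventually Q (filtercomap g (nhds x))" "\<And>i. P i \<Longrightarrow> Q i \<Longrightarrow> False"
      unfolding H_def eventually_inf by blast
    then obtain R where R: "eventually R (nhds x)" "\<And>i. R (g i) \<Longrightarrow> Q i"
      unfolding eventually_filtercomap by blast
    have "eventually (\<lambda>y. \<not> R y) (filtermap g F)" unfolding eventually_filtermap
      by (rule eventually_mono[OF PQ(1)]) (use PQ R in blast)
    with R(1) have "eventually (\<lambda>_. False) (inf (nhds x) (filtermap g F))"
      unfolding eventually_inf by blast
    with x(2) show False by (simp add: trivial_limit_def)
  qed
  moreover have "(g \<longlongrightarrow> x) H" unfolding H_def filterlim_def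
    using order_trans[OF filtermap_mono[OF inf.cobounded2] filtermap_filtercomap] .
  ultimately show ?thesis using x(1) unfolding H_def by (intro exI[of _ x] exI[of _ H]) (auto simp: H_def)
qed

lemma tendsto_fun_iff: "(f \<longlongrightarrow> l) F \<longleftrightarrow> (\<forall>i. ((\<lambda>x. f x i) \<longlongrightarrow> l i) F)"
  for f :: "'a \<Rightarrow> 'i \<Rightarrow> 'b::topological_space"
  using limitin_componentwise[of "\<lambda>_. euclidean" UNIV f l F]
  by (simp add: euclidean_product_topology)

lemma tendsto_fun: "(f \<longlongrightarrow> l) F \<Longrightarrow> ((\<lambda>x. f x i) \<longlongrightarrow> l i) F"
  for f :: "'a \<Rightarrow> 'i \<Rightarrow> 'b::topological_space"
  by (simp add: tendsto_fun_iff)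

lemma tendsto_pmon:
  assumes "(z \<longlongrightarrow> z0) F"
  shows "((\<lambda>i. pmon m \<alpha> (z i)) \<longlongrightarrow> pmon m \<alpha> z0) F"
  unfolding pmon_def by (intro tendsto_intros tendsto_fun[OF assms])

text \<open>Letting generic values of the variables in \<open>A\<close> tend to \<open>a0\<close> and normalising the
  coefficients keeps the relation nontrivial, even if setting these variables to \<open>a0\<close> kills it.\<close>

lemma specialise_limit:
  assumes "A \<subseteq> {..<m}" "\<exists>\<alpha>\<in>expbox m d. c \<alpha> \<noteq> 0"
  shows "\<exists>c'. (\<exists>\<beta>\<in>expbox m (\<lambda>i. if i \<in> A then 0 else d i). c' \<beta> \<noteq> (0::real)) \<and>
     (\<forall>z0. (\<forall>a. a \<longlonglongrightarrow> a0 \<longrightarrow> (\<exists>z. z \<longlonglongrightarrow> z0 \<and> (\<forall>\<^sub>F j in sequentially.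
              (\<Sum>\<alpha>\<in>expbox m d. c \<alpha> * pmon m \<alpha> (\<lambda>i. if i \<in> A then a j i else z j i)) = 0))) \<longrightarrow>
        (\<Sum>\<beta>\<in>expbox m (\<lambda>i. if i \<in> A then 0 else d i). c' \<beta> * pmon m \<beta> z0) = 0)"
proof -
  define D where "D = expbox m (\<lambda>i. if i \<in> A then 0 else d i)"
  have finA: "finite A" using assms(1) finite_subset by blast
  have "\<forall>j::nat. \<exists>a c'. (\<forall>i. \<bar>a i - a0 i\<bar> < inverse (real (Suc j))) \<and> (\<exists>\<beta>\<in>D. c' \<beta> \<noteq> 0) \<and>
     (\<forall>w. (\<Sum>\<alpha>\<in>expbox m d. c \<alpha> * pmon m \<alpha> (\<lambda>i. if i \<in> A then a i else w i))
        = (\<Sum>\<beta>\<in>D. c' \<beta> * pmon m \<beta> w))"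
    unfolding D_def
    by (rule allI, rule specialise_generic[OF finA assms]) simp
  then obtain a c' where "\<forall>j. (\<forall>i. \<bar>a j i - a0 i\<bar> < inverse (real (Suc j))) \<and> (\<exists>\<beta>\<in>D. c' j \<beta> \<noteq> 0) \<and>
     (\<forall>w. (\<Sum>\<alpha>\<in>expbox m d. c \<alpha> * pmon m \<alpha> (\<lambda>i. if i \<in> A then a j i else w i))
        = (\<Sum>\<beta>\<in>D. c' j \<beta> * pmon m \<beta> w))"
    unfolding choice_iff by blast
  hence ac: "\<And>j i. \<bar>a j i - a0 i\<bar> < inverse (real (Suc j))" "\<And>j. \<exists>\<beta>\<in>D. c' j \<beta> \<noteq> 0"
    "\<And>j w. (\<Sum>\<alpha>\<in>expbox m d. c \<alpha> * pmon m \<alpha> (\<lambda>i. if i \<in> A then a j i else w i))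
        = (\<Sum>\<beta>\<in>D. c' j \<beta> * pmon m \<beta> w)" by blast+
  have fD: "finite D" by (simp add: D_def)
  define s where "s j = (\<Sum>\<beta>\<in>D. \<bar>c' j \<beta>\<bar>)" for j
  have spos: "s j > 0" for j
  proof -
    obtain \<beta> where "\<beta> \<in> D" "c' j \<beta> \<noteq> 0" using ac(2) by blast
    thus ?thesis unfolding s_def using fD by (intro sum_pos2[of D \<beta>]) auto
  qed
  \<comment> \<open>Dividing by the sum of the absolute values puts the coefficients into a compact
    cube and keeps that sum equal to 1, so that the limit coefficients cannot all vanish.\<close>
  define b where "b j \<beta> = (if \<beta> \<in> D then c' j \<beta> / s j else 0)" for j \<beta>
  have "\<bar>b j \<beta>\<bar> \<le> 1" for j \<beta>
  proof (cases "\<beta> \<in> D")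
    case True
    hence "\<bar>c' j \<beta>\<bar> \<le> s j" unfolding s_def by (intro member_le_sum fD) auto
    thus ?thesis using spos[of j] by (simp add: b_def divide_le_eq)
  qed (simp add: b_def)
  hence "\<forall>\<^sub>F j in sequentially. b j \<in> {f. \<forall>\<beta>. f \<beta> \<in> {-1..1}}" by (auto simp: abs_le_iff minus_le_iff)
  from compact_subfilter[OF compact_Pi _ this] obtain b0 H where H: "H \<le> sequentially" "H \<noteq> bot" "(b \<longlongrightarrow> b0) H"
    by auto
  have "((\<lambda>j. \<Sum>\<beta>\<in>D. \<bar>b j \<beta>\<bar>) \<longlongrightarrow> (\<Sum>\<beta>\<in>D. \<bar>b0 \<beta>\<bar>)) H"
    by (intro tendsto_intros tendsto_fun[OF H(3)])
  moreover have "(\<Sum>\<beta>\<in>D. \<bar>b j \<beta>\<bar>) = 1" for j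
  proof -
    have "(\<Sum>\<beta>\<in>D. \<bar>b j \<beta>\<bar>) = (\<Sum>\<beta>\<in>D. \<bar>c' j \<beta>\<bar> / s j)" using spos[of j]
      by (intro sum.cong) (auto simp: b_def)
    also have "\<dots> = s j / s j" unfolding sum_divide_distrib[symmetric] by (simp add: s_def)
    finally show ?thesis using spos[of j] by simp
  qed
  ultimately have "((\<lambda>j. 1) \<longlongrightarrow> (\<Sum>\<beta>\<in>D. \<bar>b0 \<beta>\<bar>)) H" by simp
  hence "(\<Sum>\<beta>\<in>D. \<bar>b0 \<beta>\<bar>) = 1" using H(2) tendsto_unique[OF H(2) _ tendsto_const] by blast
  hence nz: "\<exists>\<beta>\<in>D. b0 \<beta> \<noteq> 0" by (rule_tac ccontr) simp
  have "a \<longlonglongrightarrow> a0"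
  proof (subst tendsto_fun_iff, intro allI)
    fix i
    show "(\<lambda>j. a j i) \<longlonglongrightarrow> a0 i"
    proof (rule LIM_zero_cancel, rule Lim_null_comparison)
      show "\<forall>\<^sub>F j in sequentially. norm (a j i - a0 i) \<le> inverse (real (Suc j))"
        using ac(1) by (auto intro!: always_eventually less_imp_le)
    qed (rule LIMSEQ_inverse_real_of_nat)
  qed
  show ?thesis unfolding D_def[symmetric]
  proof (rule exI[of _ b0], intro conjI nz allI impI)
    fix z0 :: "nat \<Rightarrow> real"
    assume *: "\<forall>a. a \<longlonglongrightarrow> a0 \<longrightarrow> (\<exists>z. z \<longlonglongrightarrow> z0 \<and> (\<forall>\<^sub>F j in sequentially.
              (\<Sum>\<alpha>\<in>expbox m d. c \<alpha> * pmon m \<alpha> (\<lambda>i. if i \<in> A then a j i else z j i)) = 0))"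
    with \<open>a \<longlonglongrightarrow> a0\<close> obtain z where z: "z \<longlonglongrightarrow> z0" "\<forall>\<^sub>F j in sequentially.
              (\<Sum>\<alpha>\<in>expbox m d. c \<alpha> * pmon m \<alpha> (\<lambda>i. if i \<in> A then a j i else z j i)) = 0" by blast
    have "\<forall>\<^sub>F j in sequentially. (\<Sum>\<beta>\<in>D. b j \<beta> * pmon m \<beta> (z j)) = 0"
    proof (rule eventually_mono[OF z(2)])
      fix j assume "(\<Sum>\<alpha>\<in>expbox m d. c \<alpha> * pmon m \<alpha> (\<lambda>i. if i \<in> A then a j i else z j i)) = 0"
      hence "(\<Sum>\<beta>\<in>D. c' j \<beta> * pmon m \<beta> (z j)) = 0" using ac(3) by simp
      moreover have "(\<Sum>\<beta>\<in>D. b j \<beta> * pmon m \<beta> (z j)) = (\<Sum>\<beta>\<in>D. c' j \<beta> * pmon m \<beta> (z j)) / s j"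
        unfolding sum_divide_distrib by (intro sum.cong) (auto simp: b_def)
      ultimately show "(\<Sum>\<beta>\<in>D. b j \<beta> * pmon m \<beta> (z j)) = 0" by simp
    qed
    hence ev: "\<forall>\<^sub>F j in H. (\<Sum>\<beta>\<in>D. b j \<beta> * pmon m \<beta> (z j)) = 0" using H(1) by (simp add: filter_leD)
    have "(z \<longlongrightarrow> z0) H" using z(1) H(1) by (rule tendsto_mono[rotated])
    hence "((\<lambda>j. \<Sum>\<beta>\<in>D. b j \<beta> * pmon m \<beta> (z j)) \<longlongrightarrow> (\<Sum>\<beta>\<in>D. b0 \<beta> * pmon m \<beta> z0)) H"
      by (intro tendsto_intros tendsto_fun[OF H(3)] tendsto_pmon)
    moreover have "((\<lambda>j. \<Sum>\<beta>\<in>D. b j \<beta> * pmon m \<beta> (z j)) \<longlongrightarrow> 0) H"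
      using ev by (simp add: tendsto_eventually)
    ultimately show "(\<Sum>\<beta>\<in>D. b0 \<beta> * pmon m \<beta> z0) = 0" using H(2) tendsto_unique by blast
  qed
qed

text \<open>\<open>F s\<close> is the homogenisation of \<open>f\<close> to degree \<open>a\<close> in \<open>x\<close>, with \<open>s\<close> as the additional variable.\<close>

definition homogenises :: "nat \<Rightarrow> nat \<Rightarrow> nat \<Rightarrow> nat \<Rightarrow> ((nat \<Rightarrow> real) \<Rightarrow> (nat \<Rightarrow> real) \<Rightarrow> real) \<Rightarrow>
    (real \<Rightarrow> (nat \<Rightarrow> real) \<Rightarrow> (nat \<Rightarrow> real) \<Rightarrow> real) \<Rightarrow> bool" where
  "homogenises n m a d f F \<longleftrightarrow> (\<forall>s x y. F s (\<lambda>i. s * x i) y = s ^ a * f x y) \<and>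
     (\<forall>m' D s X. m \<le> m' \<longrightarrow> pf m' D s \<longrightarrow> (\<forall>i<n. pf m' D (X i)) \<longrightarrow>
        pf m' (\<lambda>i. a * D i + (if i < m then d else 0)) (\<lambda>z. F (s z) (\<lambda>i. X i z) z))"

text \<open>Stands for: \<open>f x y\<close> has degree at most \<open>a\<close> in \<open>x\<close>
  and degree at most \<open>d\<close> in each of the first \<open>m\<close> entries of
  \<open>y\<close>. Coefficients are not recorded, but only what elimination uses: independence of
  the later entries of \<open>y\<close>, and a homogenisation into which polynomials for
  \<open>x\<close> can be substituted with control of the degrees.\<close>

definition xq :: "nat \<Rightarrow> nat \<Rightarrow> nat \<Rightarrow> nat \<Rightarrow> ((nat \<Rightarrow> real) \<Rightarrow> (nat \<Rightarrow> real) \<Rightarrow> real) \<Rightarrow> bool" where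
  "xq n m a d f \<longleftrightarrow> (\<forall>x y y'. (\<forall>i<m. y i = y' i) \<longrightarrow> f x y = f x y') \<and> (\<exists>F. homogenises n m a d f F)"

lemma homogenises_eq: "homogenises n m a d f F \<Longrightarrow> F s (\<lambda>i. s * x i) y = s ^ a * f x y"
  by (simp add: homogenises_def)

lemma homogenises_pf:
  assumes "homogenises n m a d f F" "m \<le> m'" "pf m' D s" "\<And>i. i < n \<Longrightarrow> pf m' D (X i)"
  shows "pf m' (\<lambda>i. a * D i + (if i < m then d else 0)) (\<lambda>z. F (s z) (\<lambda>i. X i z) z)"
  using assms by (simp add: homogenises_def)

lemma xqI:
  assumes "\<And>x y y'. (\<And>i. i < m \<Longrightarrow> y i = y' i) \<Longrightarrow> f x y = f x y'"
    "\<And>s x y. F s (\<lambda>i. s * x i) y = s ^ a * f x y"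
    "\<And>m' D s X. m \<le> m' \<Longrightarrow> pf m' D s \<Longrightarrow> (\<And>i. i < n \<Longrightarrow> pf m' D (X i)) \<Longrightarrow>
        pf m' (\<lambda>i. a * D i + (if i < m then d else 0)) (\<lambda>z. F (s z) (\<lambda>i. X i z) z)"
  shows "xq n m a d f"
proof -
  have "homogenises n m a d f F" unfolding homogenises_def using assms(2,3) by simp
  thus ?thesis unfolding xq_def using assms(1) by blast
qed

lemma xq_local: "xq n m a d f \<Longrightarrow> (\<And>i. i < m \<Longrightarrow> y i = y' i) \<Longrightarrow> f x y = f x y'"
  unfolding xq_def by blast

lemma xq_var: "i < n \<Longrightarrow> xq n m 1 0 (\<lambda>x y. x i)"
  by (rule xqI[where F = "\<lambda>s X y. X i"]) (auto intro: pf_mono)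

lemma xq_y: "pf m (\<lambda>_. d) g \<Longrightarrow> xq n m 0 d (\<lambda>x y. g y)"
  by (rule xqI[where F = "\<lambda>s X y. g y"]) (auto intro: pf_lift pf_local)

lemma xq_const: "xq n m 0 0 (\<lambda>x y. c)"
  by (rule xq_y) (rule pf_const)

lemma xq_mult:
  assumes "xq n m a d f" "xq n m a' d' g"
  shows "xq n m (a + a') (d + d') (\<lambda>x y. f x y * g x y)"
proof -
  obtain F where F: "homogenises n m a d f F" using assms(1) unfolding xq_def by blast
  have F1: "(\<And>i. i < m \<Longrightarrow> y i = y' i) \<Longrightarrow> f x y = f x y'" for x y y' by (rule xq_local[OF assms(1)])
  obtain G where G: "homogenises n m a' d' g G" using assms(2) unfolding xq_def by blast
  have G1: "(\<And>i. i < m \<Longrightarrow> y i = y' i) \<Longrightarrow> g x y = g x y'" for x y y' by (rule xq_local[OF assms(2)])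
  show ?thesis
  proof (rule xqI[where F = "\<lambda>s X y. F s X y * G s X y"])
    fix x y y' :: "nat \<Rightarrow> real" assume "\<And>i. i < m \<Longrightarrow> y i = y' i"
    thus "f x y * g x y = f x y' * g x y'" using F1 G1 by metis
  next
    fix m' D s and X :: "nat \<Rightarrow> (nat \<Rightarrow> real) \<Rightarrow> real"
    assume *: "m \<le> m'" "pf m' D s" "\<And>i. i < n \<Longrightarrow> pf m' D (X i)"
    show "pf m' (\<lambda>i. (a + a') * D i + (if i < m then d + d' else 0))
        (\<lambda>z. F (s z) (\<lambda>i. X i z) z * G (s z) (\<lambda>i. X i z) z)"
      by (rule pf_mult[OF homogenises_pf[OF F *] homogenises_pf[OF G *]]) (auto simp: algebra_simps)
  qed (simp add: homogenises_eq[OF F] homogenises_eq[OF G] power_add)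
qed

lemma xq_add:
  assumes "xq n m a d f" "xq n m a d g"
  shows "xq n m a d (\<lambda>x y. f x y + g x y)"
proof -
  obtain F where F: "homogenises n m a d f F" using assms(1) unfolding xq_def by blast
  have F1: "(\<And>i. i < m \<Longrightarrow> y i = y' i) \<Longrightarrow> f x y = f x y'" for x y y' by (rule xq_local[OF assms(1)])
  obtain G where G: "homogenises n m a d g G" using assms(2) unfolding xq_def by blast
  have G1: "(\<And>i. i < m \<Longrightarrow> y i = y' i) \<Longrightarrow> g x y = g x y'" for x y y' by (rule xq_local[OF assms(2)])
  show ?thesis
  proof (rule xqI[where F = "\<lambda>s X y. F s X y + G s X y"])
    fix x y y' :: "nat \<Rightarrow> real" assume "\<And>i. i < m \<Longrightarrow> y i = y' i"
    thus "f x y + g x y = f x y' + g x y'" using F1 G1 by metis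
  next
    fix m' D s and X :: "nat \<Rightarrow> (nat \<Rightarrow> real) \<Rightarrow> real"
    assume *: "m \<le> m'" "pf m' D s" "\<And>i. i < n \<Longrightarrow> pf m' D (X i)"
    show "pf m' (\<lambda>i. a * D i + (if i < m then d else 0))
        (\<lambda>z. F (s z) (\<lambda>i. X i z) z + G (s z) (\<lambda>i. X i z) z)"
      by (rule pf_add[OF homogenises_pf[OF F *] homogenises_pf[OF G *]])
  qed (simp add: homogenises_eq[OF F] homogenises_eq[OF G] algebra_simps)
qed

text \<open>A larger degree in \<open>x\<close> is reached by multiplying the homogenisation with a
  power of \<open>s\<close>.\<close>

lemma xq_mono:
  assumes "xq n m a d f" "a \<le> a'" "d \<le> d'"
  shows "xq n m a' d' f"
proof -
  obtain F where F: "homogenises n m a d f F" using assms(1) unfolding xq_def by blast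
  have F1: "(\<And>i. i < m \<Longrightarrow> y i = y' i) \<Longrightarrow> f x y = f x y'" for x y y' by (rule xq_local[OF assms(1)])
  show ?thesis
  proof (rule xqI[where F = "\<lambda>s X y. s ^ (a' - a) * F s X y"])
    fix s :: real and x y
    show "s ^ (a' - a) * F s (\<lambda>i. s * x i) y = s ^ a' * f x y"
      using assms(2) by (simp add: homogenises_eq[OF F] power_add[symmetric])
  next
    fix m' D s and X :: "nat \<Rightarrow> (nat \<Rightarrow> real) \<Rightarrow> real"
    assume *: "m \<le> m'" "pf m' D s" "\<And>i. i < n \<Longrightarrow> pf m' D (X i)"
    have e: "(a' - a) * t + a * t = a' * t" for t :: nat
      using assms(2) by (metis add_mult_distrib le_add_diff_inverse2)
    have le: "(a' - a) * D i + (a * D i + (if i < m then d else 0)) \<le> a' * D i + (if i < m then d' else 0)" for i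
      using assms(3) e[of "D i"] by auto
    show "pf m' (\<lambda>i. a' * D i + (if i < m then d' else 0)) (\<lambda>z. s z ^ (a' - a) * F (s z) (\<lambda>i. X i z) z)"
      by (rule pf_mult[OF pf_power[OF *(2) order_refl] homogenises_pf[OF F *]])
        (assumption, rule le)
  qed (rule F1)
qed

lemma xq_sum:
  assumes "\<And>j. j \<in> J \<Longrightarrow> xq n m a d (f j)"
  shows "xq n m a d (\<lambda>x y. \<Sum>j\<in>J. f j x y)"
  using assms
  by (induction J rule: infinite_finite_induct) (auto intro: xq_add xq_mono[OF xq_const])

lemma xq_smult: "xq n m a d f \<Longrightarrow> xq n m a d (\<lambda>x y. c * f x y)"
  using xq_mult[OF xq_const] by fastforce

lemma xq_diff: "xq n m a d f \<Longrightarrow> xq n m a d g \<Longrightarrow> xq n m a d (\<lambda>x y. f x y - g x y)"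
  using xq_add[OF _ xq_smult[of n m a d g "-1"]] by simp

lemma xq_pf:
  assumes "xq n m a d f"
  shows "pf m (\<lambda>_. d) (f x)"
proof -
  obtain F where F: "homogenises n m a d f F" using assms unfolding xq_def by blast
  have "pf m (\<lambda>i. a * 0 + (if i < m then d else 0)) (\<lambda>z. F 1 (\<lambda>i. x i) z)"
    by (rule homogenises_pf[OF F, where s = "\<lambda>_. 1" and X = "\<lambda>i z. x i" and D = "\<lambda>_. 0"]) (auto intro: pf_const)
  moreover have "F 1 (\<lambda>i. x i) z = f x z" for z using homogenises_eq[OF F, of 1 x z] by simp
  ultimately have "pf m (\<lambda>i. a * 0 + (if i < m then d else 0)) (f x)" by simp
  thus ?thesis by (rule pf_mono) auto
qed

section \<open>Elimination of the linear unknown by Cramer's rule\<close>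

lemma pf_line:
  assumes "pf m d f"
  shows "\<exists>p. \<forall>s. f (\<lambda>i. y i + s * (y' i - y i)) = poly p s"
proof -
  from assms obtain c where *: "\<And>z. f z = (\<Sum>\<alpha>\<in>expbox m d. c \<alpha> * pmon m \<alpha> z)"
    unfolding pf_def by blast
  have "f (\<lambda>i. y i + s * (y' i - y i)) =
     poly (\<Sum>\<alpha>\<in>expbox m d. Polynomial.smult (c \<alpha>) (\<Prod>i<m. [:y i, y' i - y i:] ^ \<alpha> i)) s" for s
    by (simp add: * poly_sum poly_prod pmon_def)
  thus ?thesis by blast
qed

text \<open>By the Leibniz formula the determinant is a sum of products of \<open>n\<close> entries
  of degree 2, and the entries of the adjugate are signed minors, whose degree
  \<open>2 * (n - 1)\<close> is rounded up. At the point \<open>y0\<close> the matrix is a nonzero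
  multiple of the identity, which shows that \<open>\<Delta>\<close> is not the zero
  polynomial.\<close>

lemma pf_adjugate:
  assumes "\<And>i j. i < n \<Longrightarrow> j < n \<Longrightarrow> pf m (\<lambda>_. 2) (A i j)"
    and "\<And>i j. i < n \<Longrightarrow> j < n \<Longrightarrow> A i j y0 = (if i = j then s else 0)" "s \<noteq> 0"
  shows "\<exists>\<Delta> adj. pf m (\<lambda>_. 2 * n) \<Delta> \<and> (\<forall>i<n. \<forall>j<n. pf m (\<lambda>_. 2 * n) (adj i j)) \<and> \<Delta> y0 \<noteq> 0 \<and>
     (\<forall>y. \<forall>i<n. \<forall>j<n. (\<Sum>l<n. adj i l y * A l j y) = (if i = j then \<Delta> y else 0))"
proof -
  define Mt where "Mt y = Matrix.mat n n (\<lambda>(i, j). A i j y)" for y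
  have Mt: "Mt y \<in> carrier_mat n n" for y by (simp add: Mt_def)
  have pf_det: "pf m (\<lambda>_. 2 * k) (\<lambda>y. Determinant.det (Matrix.mat k k (\<lambda>(i, j). C i j y)))"
    if "\<And>i j. i < k \<Longrightarrow> j < k \<Longrightarrow> pf m (\<lambda>_. 2) (C i j)" for k and C :: "nat \<Rightarrow> nat \<Rightarrow> (nat \<Rightarrow> real) \<Rightarrow> real"
  proof -
    have "pf m (\<lambda>_. 2 * k) (\<lambda>y. \<Sum>p | p permutes {0..<k}. signof p * (\<Prod>i = 0..<k. C i (p i) y))"
    proof (intro pf_sum pf_smult)
      fix p assume "p \<in> {p. p permutes {0..<k}}"
      hence p: "p permutes {0..<k}" by simp
      show "pf m (\<lambda>_. 2 * k) (\<lambda>y. \<Prod>i = 0..<k. C i (p i) y)"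
      proof (rule pf_prod[where d = "\<lambda>_ _. 2"])
        fix j assume "j \<in> {0..<k}"
        moreover from this have "p j \<in> {0..<k}" using permutes_in_image[OF p] by blast
        ultimately show "pf m (\<lambda>_. 2) (C j (p j))" using that by auto
      qed auto
    qed
    moreover have "Determinant.det (Matrix.mat k k (\<lambda>(i, j). C i j y)) =
        (\<Sum>p | p permutes {0..<k}. signof p * (\<Prod>i = 0..<k. C i (p i) y))" for y
    proof -
      have "(\<Prod>i = 0..<k. Matrix.mat k k (\<lambda>(i, j). C i j y) $$ (i, p i)) = (\<Prod>i = 0..<k. C i (p i) y)"
        if "p permutes {0..<k}" for p
        using permutes_in_image[OF that] by (intro prod.cong refl) auto
      thus ?thesis by (subst det_def'[of _ k]) (auto intro!: sum.cong)
    qed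
    ultimately show ?thesis by simp
  qed
  define \<Delta> where "\<Delta> y = Determinant.det (Mt y)" for y
  define adj where "adj i j y = adj_mat (Mt y) $$ (i, j)" for i j y
  have "pf m (\<lambda>_. 2 * n) \<Delta>" unfolding \<Delta>_def Mt_def by (rule pf_det) (use assms in auto)
  moreover have "pf m (\<lambda>_. 2 * n) (adj i j)" if ij: "i < n" "j < n" for i j
  proof -
    define C where "C a b y = A (if a < j then a else Suc a) (if b < i then b else Suc b) y" for a b y
    have C: "pf m (\<lambda>_. 2) (C a b)" if "a < n - 1" "b < n - 1" for a b
      unfolding C_def using that ij by (intro assms(1)) auto
    have eq: "adj i j y = (- 1) ^ (j + i) * Determinant.det (Matrix.mat (n - 1) (n - 1) (\<lambda>(a, b). C a b y))" for y
    proof -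
      have "mat_delete (Mt y) j i = Matrix.mat (n - 1) (n - 1) (\<lambda>(a, b). C a b y)"
        unfolding mat_delete_def Mt_def C_def using ij by (intro eq_matI) auto
      thus ?thesis unfolding adj_def adj_mat_def cofactor_def using ij by (simp add: Mt_def)
    qed
    have "pf m (\<lambda>_. 2 * (n - 1)) (adj i j)" unfolding eq [abs_def] by (intro pf_smult pf_det C)
    thus ?thesis by (rule pf_mono) auto
  qed
  moreover have "\<Delta> y0 \<noteq> 0"
  proof -
    have "Mt y0 = s \<cdot>\<^sub>m 1\<^sub>m n" unfolding Mt_def using assms(2) by (intro eq_matI) auto
    thus ?thesis using assms(3) by (simp add: \<Delta>_def)
  qed
  moreover have "(\<Sum>l<n. adj i l y * A l j y) = (if i = j then \<Delta> y else 0)" if "i < n" "j < n" for i j y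
  proof -
    have "(adj_mat (Mt y) * Mt y) $$ (i, j) = (\<Sum>l = 0..<n. adj_mat (Mt y) $$ (i, l) * Mt y $$ (l, j))"
      using that adj_mat(1)[OF Mt[of y]] Mt[of y] by (simp add: scalar_prod_def)
    also have "\<dots> = (\<Sum>l<n. adj i l y * A l j y)"
      using that by (intro sum.cong) (auto simp: adj_def Mt_def)
    finally show ?thesis using that adj_mat(3)[OF Mt[of y]] by (cases "i = j") (simp_all add: \<Delta>_def)
  qed
  ultimately show ?thesis by blast
qed

lemma prod_lessThan_add: "(\<Prod>i<a + b. f i) = (\<Prod>i<a. f i) * (\<Prod>i<b. f (a + i))" for f :: "nat \<Rightarrow> 'a::comm_monoid_mult"
  by (induction b) (auto simp: mult_ac)

text \<open>With \<open>D = (m + 1) * (4 * n + 6)\<close> this is \<open>2 * (D + 1) ^ m\<close>.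
  The degree \<open>E\<close> of the relation must make \<open>(E + 1) ^ (m + 1)\<close> exceed
  \<open>2 * ((D + 1) * (E + 1)) ^ m\<close>; the powers of \<open>E + 1\<close> cancel except for
  one, which leaves this value. The exponent is \<open>m\<close>, while \<open>n\<close> occurs in
  the base only.\<close>

definition elim_degree :: "nat \<Rightarrow> nat \<Rightarrow> nat" where
  "elim_degree n m = 2 * ((m + 1) * (4 * n + 6) + 1) ^ m"

text \<open>The quotient of the two powers is \<open>(1 + 2 * S / N) ^ n\<close> with
  \<open>N = 4 * S * n + 1\<close>, hence at most \<open>exp (1 / 2)\<close>, which is less than 2
  because \<open>exp 1\<close> is at most 3. Clearing denominators raises each degree in
  \<open>V\<close> by \<open>2 * S\<close>; if these degrees are large enough from the start, this
  costs less than a factor 2 in the dimension.\<close>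

lemma power_ratio_bound:
  fixes S n :: nat
  shows "(4 * S * n + 2 * S + 1) ^ n < 2 * (4 * S * n + 1) ^ n"
proof -
  define N where "N = real (4 * S * n + 1)"
  have N: "N > 0" unfolding N_def of_nat_0_less_iff by simp
  have "real ((4 * S * n + 2 * S + 1) ^ n) = (N * (1 + 2 * S / N)) ^ n"
    using N by (simp add: distrib_left) (simp add: N_def add_ac)
  also have "\<dots> = N ^ n * (1 + 2 * S / N) ^ n" by (simp add: power_mult_distrib)
  also have "(1 + 2 * S / N) ^ n \<le> exp (2 * S / N) ^ n"
    by (rule power_mono) (use N in \<open>auto simp: exp_ge_add_one_self\<close>)
  also have "exp (2 * S / N) ^ n = exp (n * (2 * S / N))" by (rule exp_of_nat_mult[symmetric])
  also have "n * (2 * S / N) \<le> 1 / 2" using N by (simp add: field_simps) (simp add: N_def)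
  also have "exp (1 / 2 :: real) < 2"
  proof (rule power_less_imp_less_base)
    show "exp (1 / 2 :: real) ^ 2 < 2 ^ 2" using exp_le by (simp flip: exp_of_nat_mult)
  qed auto
  finally have "real ((4 * S * n + 2 * S + 1) ^ n) < N ^ n * 2" using N by simp
  also have "\<dots> = real (2 * (4 * S * n + 1) ^ n)" by (simp add: N_def)
  finally show ?thesis by linarith
qed

text \<open>The unknown \<open>x\<close> is eliminated by Cramer's rule. After clearing denominators, the monomials in
  \<open>V\<close> and \<open>P\<close> become polynomials in \<open>y\<close> and \<open>V\<close> only, and there are too many of them to be
  linearly independent. The degrees in \<open>V\<close> are left unbounded; this makes the count independent
  of them.\<close>

theorem elimination:
  assumes A: "\<And>i j. i < n \<Longrightarrow> j < n \<Longrightarrow> pf m (\<lambda>_. 2) (A i j)"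
    and A0: "\<And>i j. i < n \<Longrightarrow> j < n \<Longrightarrow> A i j y0 = (if i = j then s else 0)" "s \<noteq> 0"
    and B: "\<And>i. i < n \<Longrightarrow> pf m (\<lambda>_. 2) (B i)"
    and P: "\<And>l. l \<le> m \<Longrightarrow> xq n m 2 2 (P l)"
  defines "V \<equiv> \<lambda>i x y. (\<Sum>j<n. A i j y * x j) - B i y"
  shows "\<exists>N c. (\<exists>\<alpha>\<in>expbox (n + (m + 1)) (\<lambda>i. if i < n then N else elim_degree n m). c \<alpha> \<noteq> 0) \<and>
     (\<forall>x y. (\<forall>i\<ge>n. x i = 0) \<longrightarrow> (\<Sum>\<alpha>\<in>expbox (n + (m + 1)) (\<lambda>i. if i < n then N else elim_degree n m).
        c \<alpha> * pmon (n + (m + 1)) \<alpha> (\<lambda>i. if i < n then V i x y else P (i - n) x y)) = 0)"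
proof -
  define D where "D = (m + 1) * (4 * n + 6)"
  define E where "E = elim_degree n m"
  have E: "E = 2 * (D + 1) ^ m" by (simp add: E_def elim_degree_def D_def)
  \<comment> \<open>Upper bound for the total exponent of the \<open>m + 1\<close> polynomials
    \<open>P l\<close> in a monomial of the box.\<close>
  define S where "S = (m + 1) * E"
  define N where "N = 4 * S * n"
  define Ibox where "Ibox = expbox (n + (m + 1)) (\<lambda>i. if i < n then N else E)"
  obtain \<Delta> adj where \<Delta>: "pf m (\<lambda>_. 2 * n) \<Delta>" "\<Delta> y0 \<noteq> 0"
     and adj: "\<And>i j. i < n \<Longrightarrow> j < n \<Longrightarrow> pf m (\<lambda>_. 2 * n) (adj i j)"
       "\<And>y i j. i < n \<Longrightarrow> j < n \<Longrightarrow> (\<Sum>l<n. adj i l y * A l j y) = (if i = j then \<Delta> y else 0)"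
  proof -
    have "\<exists>\<Delta> adj. pf m (\<lambda>_. 2 * n) \<Delta> \<and> (\<forall>i<n. \<forall>j<n. pf m (\<lambda>_. 2 * n) (adj i j)) \<and> \<Delta> y0 \<noteq> 0 \<and>
      (\<forall>y. \<forall>i<n. \<forall>j<n. (\<Sum>l<n. adj i l y * A l j y) = (if i = j then \<Delta> y else 0))"
      by (rule pf_adjugate[of n m A y0 s]) (use A A0 in auto)
    thus ?thesis using that by blast
  qed
  have "\<forall>l. \<exists>F. l \<le> m \<longrightarrow> homogenises n m 2 2 (P l) F"
    using P unfolding xq_def by blast
  then obtain F where F: "\<And>l. l \<le> m \<Longrightarrow> homogenises n m 2 2 (P l) (F l)"
    unfolding choice_iff by blast
  \<comment> \<open>In \<open>z\<close> the first \<open>m\<close> variables are \<open>y\<close>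
    and the next \<open>n\<close> stand for the values of \<open>V\<close>. Since \<open>B\<close>
    plus \<open>V\<close> equals \<open>A\<close> applied to \<open>x\<close>, multiplication with
    the adjugate gives \<open>\<Delta>\<close> times \<open>x\<close>.\<close>
  define X where "X i z = (if i < n then \<Sum>j<n. adj i j z * (B j z + z (m + j)) else 0)" for i and z :: "nat \<Rightarrow> real"
  define D1 where "D1 = (\<lambda>i. if i < m then 2 * n + 2 else 1)"
  have pf\<Delta>: "pf (m + n) D1 \<Delta>"
    by (rule pf_mono[OF pf_lift[OF \<Delta>(1)]]) (auto simp: D1_def)
  have pfX: "pf (m + n) D1 (X i)" if "i < n" for i
  proof -
    have "pf (m + n) D1 (\<lambda>z. \<Sum>j<n. adj i j z * (B j z + z (m + j)))"
    proof (intro pf_sum)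
      fix j assume "j \<in> {..<n}"
      hence j: "j < n" by simp
      have "pf (m + n) (\<lambda>i. if i < m then 2 else 1) (\<lambda>z. B j z + z (m + j))"
        by (intro pf_add pf_mono[OF pf_lift[OF B[OF j]]] pf_var) (use j in auto)
      from pf_mult[OF pf_lift[OF adj(1)[OF that j], of "m + n"] this]
      show "pf (m + n) D1 (\<lambda>z. adj i j z * (B j z + z (m + j)))" by (auto simp: D1_def)
    qed
    thus ?thesis using that by (simp add: X_def [abs_def])
  qed
  \<comment> \<open>This is \<open>\<Delta> ^ 2\<close> times \<open>P l\<close>. The degree of
    \<open>X\<close> in \<open>y\<close> is \<open>2 * n\<close> from the adjugate plus 2 from
    \<open>B\<close>; degree 2 in \<open>x\<close> and degree 2 in \<open>y\<close> of
    \<open>P l\<close> then give \<open>2 * (2 * n + 2) + 2 = 4 * n + 6\<close>.\<close>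
  define Ph where "Ph l z = F l (\<Delta> z) (\<lambda>i. X i z) z" for l z
  have pfPh: "pf (m + n) (\<lambda>i. if i < m then 4 * n + 6 else 2) (Ph l)" if "l \<le> m" for l
    unfolding Ph_def by (rule pf_mono[OF homogenises_pf[OF F[OF that] _ pf\<Delta>]]) (use pfX in \<open>auto simp: D1_def\<close>)
  define wt where "wt \<alpha> = (\<Sum>l<m+1. \<alpha> (n + l))" for \<alpha> :: "nat \<Rightarrow> nat"
  have wt: "wt \<alpha> \<le> S" if "\<alpha> \<in> Ibox" for \<alpha>
  proof -
    have "\<alpha> (n + l) \<le> E" if "l < m + 1" for l
      using PiE_mem[OF \<open>\<alpha> \<in> Ibox\<close>[unfolded Ibox_def expbox_def], of "n + l"] that by auto
    hence "wt \<alpha> \<le> (\<Sum>l<m+1. E)" unfolding wt_def by (intro sum_mono) auto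
    thus ?thesis by (simp add: S_def)
  qed
  \<comment> \<open>Every factor \<open>Ph\<close> contributes \<open>\<Delta> ^ 2\<close>; the last
    power of \<open>\<Delta>\<close> fills the exponent up to \<open>2 * S\<close>, so that all
    monomials are multiplied by the same factor.\<close>
  define f where "f \<alpha> z = (\<Prod>i<n. z (m + i) ^ \<alpha> i) * ((\<Prod>l<m+1. Ph l z ^ \<alpha> (n + l)) * \<Delta> z ^ (2 * (S - wt \<alpha>)))"
    for \<alpha> and z :: "nat \<Rightarrow> real"
  define Df where "Df = (\<lambda>i. if i < m then S * (4 * n + 6) else N + 2 * S)"
  have pff: "pf (m + n) Df (f \<alpha>)" if \<alpha>: "\<alpha> \<in> Ibox" for \<alpha>
  proof -
    have 1: "pf (m + n) (\<lambda>i. if i < m then 0 else N) (\<lambda>z. \<Prod>i<n. z (m + i) ^ \<alpha> i)"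
    proof (rule pf_prod[where d = "\<lambda>j i. if i = m + j then \<alpha> j else 0"])
      fix j assume j: "j \<in> {..<n}"
      show "pf (m + n) (\<lambda>i. if i = m + j then \<alpha> j else 0) (\<lambda>z. z (m + j) ^ \<alpha> j)"
        by (rule pf_power[where d = "\<lambda>i. if i = m + j then 1 else 0"], rule pf_var) (use j in auto)
    next
      fix i assume i: "i < m + n"
      show "(\<Sum>j<n. if i = m + j then \<alpha> j else 0) \<le> (if i < m then 0 else N)"
      proof (cases "i < m")
        case False
        hence im: "i - m < n" using i by auto
        have "(\<Sum>j<n. if i = m + j then \<alpha> j else 0) = (\<Sum>j<n. if j = i - m then \<alpha> j else 0)"
          using False by (intro sum.cong) auto
        also have "\<dots> = \<alpha> (i - m)" using im by (simp add: sum.delta)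
        also have "\<dots> \<le> N" using PiE_mem[OF \<alpha>[unfolded Ibox_def expbox_def], of "i - m"] im by auto
        finally show ?thesis using False by simp
      qed auto
    qed auto
    have 2: "pf (m + n) (\<lambda>i. wt \<alpha> * (if i < m then 4 * n + 6 else 2)) (\<lambda>z. \<Prod>l<m+1. Ph l z ^ \<alpha> (n + l))"
      by (rule pf_prod[where d = "\<lambda>l i. \<alpha> (n + l) * (if i < m then 4 * n + 6 else 2)"])
        (auto intro!: pf_power[OF pfPh] simp: wt_def sum_distrib_right simp del: sum.lessThan_Suc)
    have 3: "pf (m + n) (\<lambda>i. (S - wt \<alpha>) * (if i < m then 4 * n + 6 else 2)) (\<lambda>z. \<Delta> z ^ (2 * (S - wt \<alpha>)))"
      by (rule pf_power[OF pf\<Delta>]) (auto simp: D1_def)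
    have ws: "wt \<alpha> * t + (S - wt \<alpha>) * t = S * t" for t
      using wt[OF \<alpha>] by (metis add_mult_distrib le_add_diff_inverse)
    have 4: "pf (m + n) (\<lambda>i. S * (if i < m then 4 * n + 6 else 2))
        (\<lambda>z. (\<Prod>l<m+1. Ph l z ^ \<alpha> (n + l)) * \<Delta> z ^ (2 * (S - wt \<alpha>)))"
      by (rule pf_mult[OF 2 3]) (simp only: ws order_refl)
    show ?thesis unfolding f_def by (rule pf_mult[OF 1 4]) (auto simp: Df_def)
  qed
  have cnt: "(\<Prod>i<m+n. Suc (Df i)) < card Ibox"
  proof -
    have "(\<Prod>i<m+n. Suc (Df i)) = (S * (4 * n + 6) + 1) ^ m * (N + 2 * S + 1) ^ n"
      by (simp add: prod_lessThan_add Df_def)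
    also have "S * (4 * n + 6) + 1 \<le> (D + 1) * (E + 1)" by (simp add: S_def D_def algebra_simps)
    hence "(S * (4 * n + 6) + 1) ^ m \<le> ((D + 1) * (E + 1)) ^ m" by (rule power_mono) simp
    hence "(S * (4 * n + 6) + 1) ^ m * (N + 2 * S + 1) ^ n \<le> ((D + 1) * (E + 1)) ^ m * (N + 2 * S + 1) ^ n"
      by (rule mult_right_mono) simp
    also have "\<dots> < ((D + 1) * (E + 1)) ^ m * (2 * (N + 1) ^ n)"
      using power_ratio_bound[of S n] by (intro mult_strict_left_mono) (auto simp: N_def)
    also have "\<dots> = E * (E + 1) ^ m * (N + 1) ^ n" by (subst power_mult_distrib, subst E) (simp only: mult_ac)
    also have "\<dots> \<le> (E + 1) * (E + 1) ^ m * (N + 1) ^ n" by (intro mult_right_mono) auto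
    also have "\<dots> = card Ibox" unfolding Ibox_def card_expbox prod_lessThan_add by simp
    finally show ?thesis .
  qed
  obtain c where c: "\<exists>\<alpha>\<in>Ibox. c \<alpha> \<noteq> 0" "\<And>z. (\<Sum>\<alpha>\<in>Ibox. c \<alpha> * f \<alpha> z) = 0"
    using pf_dependent[of Ibox "m + n" Df f] pff cnt by (auto simp: Ibox_def)
  define \<Psi> where "\<Psi> x y = (\<Sum>\<alpha>\<in>Ibox. c \<alpha> * pmon (n + (m + 1)) \<alpha> (\<lambda>i. if i < n then V i x y else P (i - n) x y))" for x y
  have key: "\<Delta> y ^ (2 * S) * \<Psi> x y = 0" if x: "\<forall>i\<ge>n. x i = 0" for x y
  proof -
    define z where "z i = (if i < m then y i else V (i - m) x y)" for i
    have loc: "g z = g y" if "pf m d g" for d g by (rule pf_local[OF that]) (simp add: z_def)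
    have \<Delta>z: "\<Delta> z = \<Delta> y" by (rule loc[OF \<Delta>(1)])
    have Xz: "X i z = \<Delta> y * x i" for i
    proof (cases "i < n")
      case True
      have "X i z = (\<Sum>l<n. adj i l y * (\<Sum>j<n. A l j y * x j))"
        using True loc[OF adj(1)[OF True]] loc[OF B]
        by (auto simp: X_def V_def z_def intro!: sum.cong)
      also have "\<dots> = (\<Sum>j<n. (\<Sum>l<n. adj i l y * A l j y) * x j)"
        by (simp add: sum_distrib_left sum_distrib_right mult_ac) (rule sum.swap)
      also have "\<dots> = (\<Sum>j<n. (if i = j then \<Delta> y else 0) * x j)"
        using adj(2)[OF True] by (intro sum.cong) auto
      also have "\<dots> = (\<Sum>j<n. if i = j then \<Delta> y * x j else 0)" by (intro sum.cong) auto
      also have "\<dots> = \<Delta> y * x i" using True by simp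
      finally show ?thesis .
    qed (use x in \<open>auto simp: X_def\<close>)
    have Phz: "Ph l z = \<Delta> y ^ 2 * P l x y" if "l \<le> m" for l
      unfolding Ph_def Xz \<Delta>z homogenises_eq[OF F[OF that]] using xq_local[OF P[OF that], of z y x] by (simp add: z_def)
    have "f \<alpha> z = \<Delta> y ^ (2 * S) * pmon (n + (m + 1)) \<alpha> (\<lambda>i. if i < n then V i x y else P (i - n) x y)" if "\<alpha> \<in> Ibox" for \<alpha>
    proof -
      have "(\<Prod>l<m+1. Ph l z ^ \<alpha> (n + l)) = (\<Prod>l<m+1. \<Delta> y ^ (2 * \<alpha> (n + l)) * P l x y ^ \<alpha> (n + l))"
        by (intro prod.cong) (auto simp: Phz power_mult_distrib power_mult)
      also have "\<dots> = \<Delta> y ^ (2 * wt \<alpha>) * (\<Prod>l<m+1. P l x y ^ \<alpha> (n + l))"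
        unfolding prod.distrib wt_def sum_distrib_left power_sum by simp
      finally have "(\<Prod>l<m+1. Ph l z ^ \<alpha> (n + l)) * \<Delta> z ^ (2 * (S - wt \<alpha>))
          = \<Delta> y ^ (2 * wt \<alpha> + 2 * (S - wt \<alpha>)) * (\<Prod>l<m+1. P l x y ^ \<alpha> (n + l))"
        by (simp only: \<Delta>z power_add) (simp only: mult_ac)
      also have "2 * wt \<alpha> + 2 * (S - wt \<alpha>) = 2 * S" using wt[OF that] by simp
      finally have "f \<alpha> z = (\<Prod>i<n. z (m + i) ^ \<alpha> i) * (\<Delta> y ^ (2 * S) * (\<Prod>l<m+1. P l x y ^ \<alpha> (n + l)))"
        by (simp only: f_def)
      thus ?thesis unfolding pmon_def prod_lessThan_add[of _ n "m + 1"] z_def by (simp del: prod.lessThan_Suc)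
    qed
    hence "(\<Sum>\<alpha>\<in>Ibox. c \<alpha> * f \<alpha> z) = \<Delta> y ^ (2 * S) * \<Psi> x y"
      unfolding \<Psi>_def sum_distrib_left by (intro sum.cong) auto
    thus ?thesis using c(2) by simp
  qed
  have "\<Psi> x y = 0" if x: "\<forall>i\<ge>n. x i = 0" for x y
  proof -
    \<comment> \<open>The factor \<open>\<Delta> y ^ (2 * S)\<close> has to be cancelled also where
      \<open>\<Delta> y\<close> vanishes. On the line from \<open>y\<close> to \<open>y0\<close>
      everything is a univariate polynomial, and \<open>\<Delta>\<close> is not zero at the end of
      the line.\<close>
    define ln where "ln s = (\<lambda>i. y i + s * (y0 i - y i))" for s
    have ex: "\<exists>p. \<forall>s. g (ln s) = poly p s" if "pf m d g" for g d
      unfolding ln_def by (rule pf_line[OF that])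
    obtain p where p: "\<And>s. \<Delta> (ln s) = poly p s" using ex[OF \<Delta>(1)] by blast
    have "poly p 1 \<noteq> 0" using \<Delta>(2) p[of 1] by (simp add: ln_def)
    hence "p \<noteq> 0" by auto
    have "\<exists>q. \<forall>s. V i x (ln s) = poly q s" if "i < n" for i
    proof -
      have "pf m (\<lambda>_. 2) (V i x)" unfolding V_def
        by (intro pf_diff pf_sum B that) (use pf_smult[OF A[OF that]] in \<open>simp add: mult.commute\<close>)
      thus ?thesis by (rule ex)
    qed
    moreover have "\<exists>q. \<forall>s. P l x (ln s) = poly q s" if "l \<le> m" for l
      by (rule ex[OF xq_pf[OF P[OF that]]])
    ultimately have "\<exists>q. \<forall>s. (if i < n then V i x (ln s) else P (i - n) x (ln s)) = poly q s" if "i < n + (m + 1)" for i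
      using that by (cases "i < n") simp_all
    then obtain q where q: "\<And>i s. i < n + (m + 1) \<Longrightarrow> (if i < n then V i x (ln s) else P (i - n) x (ln s)) = poly (q i) s"
      by metis
    define r where "r = (\<Sum>\<alpha>\<in>Ibox. Polynomial.smult (c \<alpha>) (\<Prod>i<n + (m + 1). q i ^ \<alpha> i))"
    have r: "\<Psi> x (ln s) = poly r s" for s
      unfolding \<Psi>_def r_def poly_sum poly_smult poly_prod poly_power pmon_def
      by (intro sum.cong refl arg_cong2[of _ _ _ _ "(*)"] prod.cong) (auto simp only: q lessThan_iff)
    have "poly (p ^ (2 * S) * r) s = 0" for s
      using key[OF x, of "ln s"] by (simp add: p r)
    hence "p ^ (2 * S) * r = 0" using poly_all_0_iff_0 by blast
    with \<open>p \<noteq> 0\<close> have "r = 0" by simp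
    with r[of 0] show ?thesis by (simp add: ln_def)
  qed
  thus ?thesis using c(1) unfolding \<Psi>_def Ibox_def E_def by (intro exI[of _ N] exI[of _ c]) blast
qed

subsection \<open>Euclidean norms of real sequences\<close>

definition Rn :: "nat \<Rightarrow> (nat \<Rightarrow> real) set" where
  "Rn n = {x. \<forall>i\<ge>n. x i = 0}"

lemma topspace_Euclidean_space_Rn: "topspace (Euclidean_space n) = Rn n"
  by (simp add: topspace_Euclidean_space Rn_def)

lemma eucl_norm_nonneg [simp]: "0 \<le> eucl_norm n x"
  by (simp add: eucl_norm_def)

lemma eucl_dist_nonneg [simp]: "0 \<le> eucl_dist n x y"
  by (simp add: eucl_dist_def)

lemma eucl_dist_self [simp]: "eucl_dist n x x = 0"
  by (simp add: eucl_dist_def eucl_norm_def L2_set_def)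

lemma eucl_dist_commute: "eucl_dist n x y = eucl_dist n y x"
  unfolding eucl_dist_def eucl_norm_def L2_set_def by (simp add: power2_commute)

lemma eucl_norm_add: "eucl_norm n (\<lambda>i. x i + y i) \<le> eucl_norm n x + eucl_norm n y"
  unfolding eucl_norm_def by (rule L2_set_triangle_ineq)

lemma eucl_dist_triangle: "eucl_dist n x z \<le> eucl_dist n x y + eucl_dist n y z"
  using eucl_norm_add[of n "\<lambda>i. x i - y i" "\<lambda>i. y i - z i"] by (simp add: eucl_dist_def)

lemma eucl_norm_scale: "eucl_norm n (\<lambda>i. c * x i) = \<bar>c\<bar> * eucl_norm n x"
  unfolding eucl_norm_def L2_set_def
  by (simp add: power_mult_distrib sum_distrib_left[symmetric] real_sqrt_mult)

lemma coord_le_eucl_norm: "i < n \<Longrightarrow> \<bar>x i\<bar> \<le> eucl_norm n x"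
proof -
  assume "i < n"
  hence "x i ^ 2 \<le> (\<Sum>i<n. x i ^ 2)" by (intro member_le_sum) auto
  hence "sqrt (x i ^ 2) \<le> sqrt (\<Sum>i<n. x i ^ 2)" by (rule real_sqrt_le_mono)
  thus ?thesis by (simp add: eucl_norm_def L2_set_def)
qed

lemma coord_le_eucl_dist: "i < n \<Longrightarrow> \<bar>x i - y i\<bar> \<le> eucl_dist n x y"
  unfolding eucl_dist_def by (rule coord_le_eucl_norm[of i n "\<lambda>i. x i - y i"])

lemma eucl_norm_le_sum: "eucl_norm n x \<le> (\<Sum>i<n. \<bar>x i\<bar>)"
  unfolding eucl_norm_def by (rule L2_set_le_sum_abs)

lemma eucl_norm_square: "eucl_norm n x ^ 2 = (\<Sum>i<n. x i ^ 2)"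
  unfolding eucl_norm_def L2_set_def by (simp add: sum_nonneg)

lemma eucl_norm_eq_0_iff: "eucl_norm n x = 0 \<longleftrightarrow> (\<forall>i<n. x i = 0)"
  unfolding eucl_norm_def by (auto simp: L2_set_eq_0_iff)

lemma eucl_dist_eq_0: "x \<in> Rn n \<Longrightarrow> y \<in> Rn n \<Longrightarrow> eucl_dist n x y = 0 \<Longrightarrow> x = y"
  unfolding eucl_dist_def eucl_norm_eq_0_iff Rn_def by (rule ext) (metis (mono_tags) eq_iff_diff_eq_0 mem_Collect_eq not_le)

lemma eucl_norm_Cauchy: "\<bar>\<Sum>i<n. x i * y i\<bar> \<le> eucl_norm n x * eucl_norm n y"
proof -
  have "\<bar>\<Sum>i<n. x i * y i\<bar> \<le> (\<Sum>i<n. \<bar>x i\<bar> * \<bar>y i\<bar>)"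
    by (rule order_trans[OF sum_abs]) (simp add: abs_mult)
  also have "\<dots> \<le> eucl_norm n x * eucl_norm n y" unfolding eucl_norm_def by (rule L2_set_mult_ineq)
  finally show ?thesis .
qed

lemma eucl_norm_local: "(\<And>i. i < n \<Longrightarrow> x i = y i) \<Longrightarrow> eucl_norm n x = eucl_norm n y"
  unfolding eucl_norm_def L2_set_def by auto

lemma tendsto_eucl_norm:
  assumes "\<And>i. i < n \<Longrightarrow> ((\<lambda>j. f j i) \<longlongrightarrow> x i) F"
  shows "((\<lambda>j. eucl_norm n (f j)) \<longlongrightarrow> eucl_norm n x) F"
  unfolding eucl_norm_def L2_set_def by (intro tendsto_intros assms) auto

lemma tendsto_eucl_dist:
  assumes "(f \<longlongrightarrow> x) F" "(g \<longlongrightarrow> y) F"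
  shows "((\<lambda>j. eucl_dist n (f j) (g j)) \<longlongrightarrow> eucl_dist n x y) F"
  unfolding eucl_dist_def by (intro tendsto_eucl_norm tendsto_intros tendsto_fun[OF assms(1)] tendsto_fun[OF assms(2)])

text \<open>The topology of \<open>nat \<Rightarrow> real\<close> is the product topology; on
  \<open>Rn n\<close> only finitely many coordinates vary, so it is the Euclidean one.\<close>

lemma tendsto_Rn_iff:
  assumes "\<forall>\<^sub>F j in F. f j \<in> Rn n" "x \<in> Rn n"
  shows "(f \<longlongrightarrow> x) F \<longleftrightarrow> ((\<lambda>j. eucl_dist n (f j) x) \<longlongrightarrow> 0) F"
proof
  assume "(f \<longlongrightarrow> x) F"
  from tendsto_eucl_dist[OF this tendsto_const, of n x] show "((\<lambda>j. eucl_dist n (f j) x) \<longlongrightarrow> 0) F" by simp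
next
  assume *: "((\<lambda>j. eucl_dist n (f j) x) \<longlongrightarrow> 0) F"
  show "(f \<longlongrightarrow> x) F" unfolding tendsto_fun_iff
  proof
    fix i
    show "((\<lambda>j. f j i) \<longlongrightarrow> x i) F"
    proof (rule LIM_zero_cancel, rule Lim_null_comparison[OF _ *])
      show "\<forall>\<^sub>F j in F. norm (f j i - x i) \<le> eucl_dist n (f j) x"
        using assms(1)
      proof eventually_elim
        case (elim j)
        thus ?case using coord_le_eucl_dist[of i n "f j" x] assms(2)
          by (cases "i < n") (auto simp: Rn_def)
      qed
    qed
  qed
qed

lemma continuous_on_eucl_norm:
  assumes "\<And>i. i < n \<Longrightarrow> continuous_on S (\<lambda>y. f y i)"
  shows "continuous_on S (\<lambda>y. eucl_norm n (f y))"
  unfolding eucl_norm_def L2_set_def by (intro continuous_intros assms) auto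

lemma continuous_on_eucl_dist: "continuous_on S (\<lambda>y. eucl_dist n y x)"
  unfolding eucl_dist_def by (intro continuous_on_eucl_norm continuous_intros continuous_on_coord)

lemma closed_Rn: "closed (Rn n)"
proof -
  have "Rn n = (\<Inter>i\<in>{n..}. {x. x i = 0})" by (auto simp: Rn_def)
  also have "closed \<dots>" by (intro closed_INT ballI closed_Collect_eq continuous_on_coord continuous_on_const)
  finally show ?thesis .
qed

lemma compact_eucl_cball:
  assumes "x \<in> Rn n"
  shows "compact {y \<in> Rn n. eucl_dist n y x \<le> R}"
proof -
  let ?K = "\<lambda>i. if i < n then {x i - R..x i + R} else {0}"
  have "compact {y. \<forall>i. y i \<in> ?K i}" by (intro compact_Pi) auto
  moreover have "closed (Rn n \<inter> {y. eucl_dist n y x \<le> R})"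
    by (intro closed_Int closed_Rn closed_Collect_le continuous_on_eucl_dist continuous_on_const)
  ultimately have "compact ({y. \<forall>i. y i \<in> ?K i} \<inter> (Rn n \<inter> {y. eucl_dist n y x \<le> R}))"
    by (rule compact_Int_closed)
  also have "{y. \<forall>i. y i \<in> ?K i} \<inter> (Rn n \<inter> {y. eucl_dist n y x \<le> R}) = {y \<in> Rn n. eucl_dist n y x \<le> R}"
  proof safe
    fix y i assume "y \<in> Rn n" "eucl_dist n y x \<le> R"
    thus "y i \<in> ?K i" using coord_le_eucl_dist[of i n y x] by (auto simp: Rn_def abs_le_iff)
  qed
  finally show ?thesis .
qed

text \<open>The vertex of the parabola with a positive leading coefficient \<open>B'\<close> above
  \<open>B\<close> would give a negative value. Serves to read off first-order conditions from
  minimality.\<close>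

lemma linear_quadratic_nonneg_imp_0:
  fixes A B :: real
  assumes "\<And>\<tau>. 0 \<le> \<tau> * A + \<tau> ^ 2 * B"
  shows "A = 0"
proof (rule ccontr)
  assume A: "A \<noteq> 0"
  define B' where "B' = \<bar>B\<bar> + 1"
  have B': "B' > 0" unfolding B'_def by linarith
  define t where "t = - A / (2 * B')"
  have "t * A + t ^ 2 * B \<le> t * A + t ^ 2 * B'" unfolding B'_def by (intro add_left_mono mult_left_mono) auto
  moreover have "t * A = - (A ^ 2) / (2 * B')" using B' by (simp add: t_def power2_eq_square)
  moreover have "t ^ 2 * B' = A ^ 2 / (4 * B')" using B' by (simp add: t_def power2_eq_square)
  moreover have "- (A ^ 2) / (2 * B') + A ^ 2 / (4 * B') = - (A ^ 2 / (4 * B'))" using B' by (simp add: field_simps)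
  moreover have "A ^ 2 / (4 * B') > 0" using A B' by simp
  ultimately show False using assms[of t] by linarith
qed

lemma DERIV_sqrt_at_0:
  assumes "(g has_real_derivative d) (at 0)" "g 0 > 0" "e = d / (2 * sqrt (g 0))"
  shows "((\<lambda>t. sqrt (g t)) has_real_derivative e) (at 0)"
proof -
  have "(sqrt \<circ> g has_real_derivative (inverse (sqrt (g 0)) / 2) * d) (at 0)"
    by (rule DERIV_chain[OF DERIV_real_sqrt[OF assms(2)] assms(1)])
  moreover have "(inverse (sqrt (g 0)) / 2) * d = e" unfolding assms(3) using assms(2) by (simp add: field_simps)
  ultimately show ?thesis by (simp only: o_def)
qed

subsection \<open>Systems of quadratic equations\<close>

locale quadrics =
  fixes n k :: nat and c :: "nat \<Rightarrow> real" and b :: "nat \<Rightarrow> nat \<Rightarrow> real" and S :: "nat \<Rightarrow> nat \<Rightarrow> nat \<Rightarrow> real"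
  assumes S_sym: "S j i l = S j l i"
begin

definition Qv :: "nat \<Rightarrow> (nat \<Rightarrow> real) \<Rightarrow> real" where
  "Qv j x = c j + (\<Sum>i<n. b j i * x i) + (\<Sum>i<n. \<Sum>l<n. S j i l * (x i * x l))"

definition G :: "nat \<Rightarrow> (nat \<Rightarrow> real) \<Rightarrow> nat \<Rightarrow> real" where
  "G j x i = b j i + 2 * (\<Sum>l<n. S j i l * x l)"

definition qf :: "nat \<Rightarrow> (nat \<Rightarrow> real) \<Rightarrow> real" where
  "qf j d = (\<Sum>i<n. \<Sum>l<n. S j i l * (d i * d l))"

definition CS :: "nat \<Rightarrow> real" where
  "CS j = (\<Sum>i<n. \<Sum>l<n. \<bar>S j i l\<bar>)"

definition M :: "(nat \<Rightarrow> real) set" where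
  "M = {x \<in> Rn n. eucl_norm n x \<le> 1 \<and> (\<forall>j<k. Qv j x = 0)}"

text \<open>The transposed Jacobian of the system applied to \<open>\<omega>\<close>; cut off at
  \<open>n\<close>, so that it is a vector of \<open>Rn n\<close>.\<close>

definition comb :: "(nat \<Rightarrow> real) \<Rightarrow> (nat \<Rightarrow> real) \<Rightarrow> nat \<Rightarrow> real" where
  "comb \<omega> x i = (if i < n then \<Sum>j<k. \<omega> j * G j x i else 0)"

text \<open>The Taylor expansion at \<open>x\<close>, exact because the function is quadratic:
  \<open>G\<close> is the gradient and \<open>qf\<close> the whole remainder.\<close>

lemma Qv_add: "Qv j (\<lambda>i. x i + d i) = Qv j x + (\<Sum>i<n. G j x i * d i) + qf j d"
proof -
  have "(\<Sum>i<n. \<Sum>l<n. S j i l * (d i * x l)) = (\<Sum>i<n. \<Sum>l<n. S j i l * (x i * d l))"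
    by (subst sum.swap) (simp add: S_sym mult_ac)
  moreover have "(\<Sum>i<n. \<Sum>l<n. S j i l * ((x i + d i) * (x l + d l))) = (\<Sum>i<n. \<Sum>l<n. S j i l * (x i * x l))
     + (\<Sum>i<n. \<Sum>l<n. S j i l * (x i * d l)) + (\<Sum>i<n. \<Sum>l<n. S j i l * (d i * x l)) + qf j d"
    unfolding qf_def sum.distrib[symmetric] by (intro sum.cong refl) (simp add: algebra_simps)
  moreover have "(\<Sum>i<n. G j x i * d i) = (\<Sum>i<n. b j i * d i) + 2 * (\<Sum>i<n. \<Sum>l<n. S j i l * (d i * x l))"
    unfolding G_def sum_distrib_left sum.distrib[symmetric]
    by (intro sum.cong refl) (simp add: algebra_simps sum_distrib_left)
  moreover have "(\<Sum>i<n. b j i * (x i + d i)) = (\<Sum>i<n. b j i * x i) + (\<Sum>i<n. b j i * d i)"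
    by (simp add: algebra_simps sum.distrib)
  ultimately show ?thesis unfolding Qv_def by linarith
qed

lemma qf_scale: "qf j (\<lambda>i. t * d i) = t ^ 2 * qf j d"
  unfolding qf_def sum_distrib_left by (intro sum.cong) (auto simp: power2_eq_square)

lemma abs_qf_le: "\<bar>qf j d\<bar> \<le> CS j * eucl_norm n d ^ 2"
proof -
  have "\<bar>qf j d\<bar> \<le> (\<Sum>i<n. \<Sum>l<n. \<bar>S j i l * (d i * d l)\<bar>)"
    unfolding qf_def by (intro order_trans[OF sum_abs] sum_mono order_refl)
  also have "\<dots> \<le> (\<Sum>i<n. \<Sum>l<n. \<bar>S j i l\<bar> * eucl_norm n d ^ 2)"
    unfolding abs_mult power2_eq_square
    by (intro sum_mono mult_left_mono mult_mono coord_le_eucl_norm) auto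
  also have "\<dots> = CS j * eucl_norm n d ^ 2" by (simp add: CS_def sum_distrib_right)
  finally show ?thesis .
qed

lemma CS_nonneg: "0 \<le> CS j" unfolding CS_def by (intro sum_nonneg) auto

lemma tendsto_Qv: "(f \<longlongrightarrow> x) F \<Longrightarrow> ((\<lambda>j. Qv l (f j)) \<longlongrightarrow> Qv l x) F"
  unfolding Qv_def by (intro tendsto_intros tendsto_fun[of f x F])

lemma tendsto_G: "(f \<longlongrightarrow> x) F \<Longrightarrow> ((\<lambda>j. G l (f j) i) \<longlongrightarrow> G l x i) F"
  unfolding G_def by (intro tendsto_intros tendsto_fun[of f x F])

lemma continuous_on_Qv: "continuous_on A (Qv j)"
  unfolding Qv_def by (intro continuous_intros continuous_on_coord)

lemma tendsto_comb: "(f \<longlongrightarrow> x) F \<Longrightarrow> (w \<longlongrightarrow> \<omega>) F \<Longrightarrow> ((\<lambda>j. comb (w j) (f j) i) \<longlongrightarrow> comb \<omega> x i) F"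
  unfolding comb_def by (cases "i < n") (auto intro!: tendsto_intros tendsto_fun[of w \<omega> F] tendsto_G)

lemma comb_scale: "comb (\<lambda>j. t * \<omega> j) x i = t * comb \<omega> x i"
  by (simp add: comb_def sum_distrib_left mult_ac)

lemma compact_M: "compact M"
proof -
  have "M = {y \<in> Rn n. eucl_dist n y (\<lambda>_. 0) \<le> 1} \<inter> (\<Inter>j\<in>{..<k}. {x. Qv j x = 0})"
    by (auto simp: M_def eucl_dist_def)
  moreover have "closed (\<Inter>j\<in>{..<k}. {x. Qv j x = 0})"
    by (intro closed_INT ballI closed_Collect_eq continuous_on_Qv continuous_on_const)
  ultimately show ?thesis using compact_eucl_cball[of "\<lambda>_. 0" n 1] by (auto simp: Rn_def)
qed

lemma M_Rn: "x \<in> M \<Longrightarrow> x \<in> Rn n"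
  by (simp add: M_def)

end

section \<open>Regular systems: uniform independence of the gradients and solvability near
  \<open>M\<close>\<close>

locale regular_quadrics = quadrics +
  assumes M_interior: "x \<in> M \<Longrightarrow> eucl_norm n x < 1"
    and M_regular: "x \<in> M \<Longrightarrow> (\<And>i. i < n \<Longrightarrow> (\<Sum>j<k. \<omega> j * G j x i) = 0) \<Longrightarrow> j < k \<Longrightarrow> \<omega> j = 0"
begin

text \<open>Otherwise the multipliers, scaled to length 1, would have a limit point of length 1 that
  is a linear dependence of the gradients at \<open>z\<close>.\<close>

lemma comb_lower_bound_limit:
  assumes F: "F \<noteq> bot" and x: "(x \<longlongrightarrow> z) F" and z: "z \<in> M"
    and w: "\<And>j. eucl_norm k (w j) \<noteq> 0"
  shows "\<exists>\<kappa>>0. \<not> (\<forall>\<^sub>F j in F. eucl_norm n (comb (w j) (x j)) < \<kappa> * eucl_norm k (w j))"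
proof (rule ccontr)
  assume "\<not> ?thesis"
  hence ev: "\<forall>\<^sub>F j in F. eucl_norm n (comb (w j) (x j)) < \<kappa> * eucl_norm k (w j)" if "\<kappa> > 0" for \<kappa>
    using that by auto
  define u where "u j i = (if i < k then inverse (eucl_norm k (w j)) * w j i else 0)" for j i
  have pos: "eucl_norm k (w j) > 0" for j using w[of j] by (simp add: order_less_le)
  have nu: "eucl_norm k (u j) = 1" for j
  proof -
    have "eucl_norm k (u j) = eucl_norm k (\<lambda>i. inverse (eucl_norm k (w j)) * w j i)"
      by (rule eucl_norm_local) (simp add: u_def)
    thus ?thesis using pos[of j] by (simp add: eucl_norm_scale)
  qed
  have "u j \<in> {y \<in> Rn k. eucl_dist k y (\<lambda>_. 0) \<le> 1}" for j
    using nu[of j] by (auto simp: eucl_dist_def Rn_def u_def)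
  moreover have "compact {y \<in> Rn k. eucl_dist k y (\<lambda>_. 0) \<le> 1}"
    by (rule compact_eucl_cball) (simp add: Rn_def)
  ultimately obtain u0 H where H: "H \<le> F" "H \<noteq> bot" "(u \<longlongrightarrow> u0) H"
    using compact_subfilter[of _ F u] F by (metis (no_types, lifting) always_eventually)
  have "((\<lambda>j. eucl_norm k (u j)) \<longlongrightarrow> eucl_norm k u0) H"
    by (intro tendsto_eucl_norm tendsto_fun[OF H(3)])
  hence "eucl_norm k u0 = 1" using tendsto_unique[OF H(2) _ tendsto_const] by (simp add: nu)
  have xH: "(x \<longlongrightarrow> z) H" using tendsto_mono[OF H(1) x] .
  have "((\<lambda>j. eucl_norm n (comb (u j) (x j))) \<longlongrightarrow> eucl_norm n (comb u0 z)) H"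
    by (intro tendsto_eucl_norm tendsto_comb xH H(3))
  moreover have "((\<lambda>j. eucl_norm n (comb (u j) (x j))) \<longlongrightarrow> 0) H"
  proof (rule tendstoI)
    fix \<kappa> :: real assume "\<kappa> > 0"
    from ev[OF this] have "\<forall>\<^sub>F j in H. eucl_norm n (comb (w j) (x j)) < \<kappa> * eucl_norm k (w j)"
      using H(1) by (simp add: filter_leD)
    thus "\<forall>\<^sub>F j in H. dist (eucl_norm n (comb (u j) (x j))) 0 < \<kappa>"
    proof eventually_elim
      case (elim j)
      have "eucl_norm n (comb (u j) (x j)) = eucl_norm n (\<lambda>i. inverse (eucl_norm k (w j)) * comb (w j) (x j) i)"
        unfolding comb_scale[symmetric] by (rule eucl_norm_local) (auto simp: comb_def u_def)
      also have "\<dots> = eucl_norm n (comb (w j) (x j)) / eucl_norm k (w j)"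
        using pos[of j] by (simp add: eucl_norm_scale divide_inverse)
      also have "\<dots> < \<kappa>" using elim pos[of j] by (simp add: divide_less_eq)
      finally show ?case by simp
    qed
  qed
  ultimately have "eucl_norm n (comb u0 z) = 0" using tendsto_unique[OF H(2)] by blast
  hence "(\<Sum>j<k. u0 j * G j z i) = 0" if "i < n" for i
    using that unfolding eucl_norm_eq_0_iff by (auto simp: comb_def)
  hence "\<forall>j<k. u0 j = 0" using M_regular[OF z] by blast
  hence "eucl_norm k u0 = 0" by (simp add: eucl_norm_eq_0_iff)
  with \<open>eucl_norm k u0 = 1\<close> show False by simp
qed

text \<open>The quantitative form of regularity, valid at all points of the space near
  \<open>z\<close> and not just at points of \<open>M\<close>: residuals are decreased, and
  multipliers are bounded, at points off \<open>M\<close>.\<close>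

lemma local_independence:
  assumes "z \<in> M"
  shows "\<exists>\<kappa>>0. \<exists>\<rho>>0. \<forall>x\<in>Rn n. eucl_dist n x z \<le> \<rho> \<longrightarrow> (\<forall>\<omega>. \<kappa> * eucl_norm k \<omega> \<le> eucl_norm n (comb \<omega> x))"
proof (rule ccontr)
  assume neg: "\<not> ?thesis"
  have "\<exists>x \<omega>. x \<in> Rn n \<and> eucl_dist n x z \<le> inverse (real (Suc m)) \<and>
     eucl_norm n (comb \<omega> x) < inverse (real (Suc m)) * eucl_norm k \<omega>" for m
  proof -
    have "inverse (real (Suc m)) > 0" by simp
    thus ?thesis using neg by (meson not_le)
  qed
  then obtain x \<omega> where x: "\<And>m. x m \<in> Rn n" "\<And>m. eucl_dist n (x m) z \<le> inverse (real (Suc m))"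
     "\<And>m. eucl_norm n (comb (\<omega> m) (x m)) < inverse (real (Suc m)) * eucl_norm k (\<omega> m)" by metis
  have "(\<lambda>m. eucl_dist n (x m) z) \<longlonglongrightarrow> 0"
    by (rule Lim_null_comparison[OF _ LIMSEQ_inverse_real_of_nat]) (use x(2) in auto)
  hence lim: "x \<longlonglongrightarrow> z" using tendsto_Rn_iff[of x n sequentially z] x(1) M_Rn[OF assms] by simp
  have "eucl_norm k (\<omega> m) \<noteq> 0" for m using x(3)[of m] eucl_norm_nonneg[of n "comb (\<omega> m) (x m)"]
    by (metis mult_zero_right not_less)
  from comb_lower_bound_limit[where w = \<omega>, OF _ lim assms this] obtain \<kappa> where \<kappa>: "\<kappa> > 0"
    "\<not> (\<forall>\<^sub>F j in sequentially. eucl_norm n (comb (\<omega> j) (x j)) < \<kappa> * eucl_norm k (\<omega> j))" by auto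
  have "\<forall>\<^sub>F m in sequentially. inverse (real (Suc m)) < \<kappa>"
    using LIMSEQ_inverse_real_of_nat \<kappa>(1) by (rule order_tendstoD)
  hence "\<forall>\<^sub>F j in sequentially. eucl_norm n (comb (\<omega> j) (x j)) < \<kappa> * eucl_norm k (\<omega> j)"
  proof eventually_elim
    case (elim m)
    have "inverse (real (Suc m)) * eucl_norm k (\<omega> m) \<le> \<kappa> * eucl_norm k (\<omega> m)"
      using elim by (intro mult_right_mono) auto
    with x(3)[of m] show ?case by linarith
  qed
  with \<kappa>(2) show False by blast
qed

definition resid :: "(nat \<Rightarrow> real) \<Rightarrow> (nat \<Rightarrow> real) \<Rightarrow> real" where
  "resid x a = eucl_norm k (\<lambda>j. Qv j x - a j)"

text \<open>Metric regularity of \<open>Q\<close> near \<open>z\<close>: a minimiser of the residual plus a small multiple of the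
  distance to \<open>x\<close> must have residual zero, as otherwise one could decrease the residual at a rate
  bounded from below.\<close>

lemma solve_near:
  assumes "z \<in> M"
  shows "\<exists>\<kappa>>0. \<exists>r>0. \<forall>x\<in>Rn n. \<forall>a. eucl_dist n x z < r \<longrightarrow> resid x a < r \<longrightarrow>
     (\<exists>y\<in>Rn n. (\<forall>j<k. Qv j y = a j) \<and> \<kappa> * eucl_dist n y x \<le> resid x a)"
proof -
  obtain \<kappa>0 \<rho> where k0: "\<kappa>0 > 0" "\<rho> > 0"
    and ind: "\<And>x \<omega>. x \<in> Rn n \<Longrightarrow> eucl_dist n x z \<le> \<rho> \<Longrightarrow> \<kappa>0 * eucl_norm k \<omega> \<le> eucl_norm n (comb \<omega> x)"
    using local_independence[OF assms] by metis
  \<comment> \<open>Per unit of length the residual can be decreased at a rate of at least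
    \<open>\<kappa>0\<close>, so a penalty of half that rate is outweighed strictly. The choice of
    \<open>r\<close> below keeps the minimiser inside the ball around \<open>x\<close> and within
    distance \<open>\<rho>\<close> of \<open>z\<close>.\<close>
  define \<kappa> where "\<kappa> = \<kappa>0 / 2"
  have kpos: "\<kappa> > 0" using k0 by (simp add: \<kappa>_def)
  define r where "r = min (\<rho> / 2) (\<kappa> * \<rho> / 2)"
  have rpos: "r > 0" using k0 kpos by (simp add: r_def)
  have "\<exists>y\<in>Rn n. (\<forall>j<k. Qv j y = a j) \<and> \<kappa> * eucl_dist n y x \<le> resid x a"
    if x: "x \<in> Rn n" and xz: "eucl_dist n x z < r" and res: "resid x a < r" for x a
  proof -
    define K where "K = {y \<in> Rn n. eucl_dist n y x \<le> \<rho> / 2}"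
    define \<psi> where "\<psi> y = resid y a + \<kappa> * eucl_dist n y x" for y
    have "x \<in> K" using x k0 by (simp add: K_def)
    have "continuous_on K \<psi>" unfolding \<psi>_def resid_def
      by (intro continuous_intros continuous_on_eucl_norm continuous_on_Qv continuous_on_eucl_dist)
    then obtain y where y: "y \<in> K" "\<And>y'. y' \<in> K \<Longrightarrow> \<psi> y \<le> \<psi> y'"
      using continuous_attains_inf[of K \<psi>] compact_eucl_cball[OF x, of "\<rho> / 2"] \<open>x \<in> K\<close>
      unfolding K_def[symmetric] by blast
    have "\<psi> y \<le> resid x a" using y(2)[OF \<open>x \<in> K\<close>] by (simp add: \<psi>_def)
    hence dy: "\<kappa> * eucl_dist n y x \<le> resid x a" using eucl_norm_nonneg[of k "\<lambda>j. Qv j y - a j"] unfolding \<psi>_def resid_def by linarith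
    hence "\<kappa> * eucl_dist n y x < \<kappa> * (\<rho> / 2)" using res by (simp add: r_def)
    hence dy2: "eucl_dist n y x < \<rho> / 2" using kpos by simp
    have yR: "y \<in> Rn n" using y(1) by (simp add: K_def)
    have yz: "eucl_dist n y z \<le> \<rho>" using eucl_dist_triangle[of n y z x] dy2 xz by (simp add: r_def)
    have "resid y a = 0"
    proof (rule ccontr)
      assume "resid y a \<noteq> 0"
      hence Rpos: "resid y a > 0" by (simp add: resid_def order_less_le)
      define \<omega> where "\<omega> j = Qv j y - a j" for j
      have Rw: "resid y a = eucl_norm k \<omega>" by (simp add: resid_def \<omega>_def [abs_def])
      define \<theta> where "\<theta> = comb \<omega> y"
      have \<theta>: "\<kappa>0 * resid y a \<le> eucl_norm n \<theta>" unfolding Rw \<theta>_def by (rule ind[OF yR yz])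
      define s where "s j = (\<Sum>i<n. G j y i * \<theta> i)" for j
      define yt where "yt \<tau> = (\<lambda>i. y i + (- \<tau>) * \<theta> i)" for \<tau>
      have Qt: "Qv j (yt \<tau>) = Qv j y - \<tau> * s j + \<tau> ^ 2 * qf j \<theta>" for j \<tau>
        unfolding yt_def Qv_add qf_scale by (simp add: s_def sum_distrib_left sum_negf mult_ac)
      have ws: "(\<Sum>j<k. \<omega> j * s j) = eucl_norm n \<theta> ^ 2"
      proof -
        have "(\<Sum>j<k. \<omega> j * s j) = (\<Sum>j<k. \<Sum>i<n. \<omega> j * G j y i * \<theta> i)"
          by (simp add: s_def sum_distrib_left mult_ac)
        also have "\<dots> = (\<Sum>i<n. (\<Sum>j<k. \<omega> j * G j y i) * \<theta> i)"
          by (subst sum.swap) (simp add: sum_distrib_right)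
        also have "\<dots> = (\<Sum>i<n. \<theta> i ^ 2)" by (intro sum.cong) (auto simp: \<theta>_def comb_def power2_eq_square)
        finally show ?thesis by (simp add: eucl_norm_square)
      qed
      \<comment> \<open>A majorant of \<open>\<psi>\<close> along the ray \<open>yt\<close> with the
        same value at 0. It is differentiable there: the distance is replaced by its linear bound
        from the triangle inequality, and the root is taken of a positive number.\<close>
      define \<phi> where "\<phi> \<tau> = sqrt (\<Sum>j<k. (\<omega> j - \<tau> * s j + \<tau> ^ 2 * qf j \<theta>) ^ 2) + \<kappa> * (eucl_dist n y x + \<tau> * eucl_norm n \<theta>)" for \<tau>
      have sq: "sqrt (\<Sum>j<k. \<omega> j ^ 2) = resid y a" by (simp add: Rw eucl_norm_def L2_set_def)
      have spos: "(\<Sum>j<k. \<omega> j ^ 2) > 0" using Rpos sq by (metis real_sqrt_gt_0_iff)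
      have "((\<lambda>\<tau>. \<Sum>j<k. (\<omega> j - \<tau> * s j + \<tau> ^ 2 * qf j \<theta>) ^ 2) has_real_derivative (\<Sum>j<k. 2 * \<omega> j * (- s j))) (at 0)"
        by (rule DERIV_sum) (auto intro!: derivative_eq_intros)
      moreover have "(\<Sum>j<k. 2 * \<omega> j * (- s j)) = - 2 * eucl_norm n \<theta> ^ 2"
        unfolding ws[symmetric] sum_distrib_left by (intro sum.cong) auto
      ultimately have "((\<lambda>\<tau>. \<Sum>j<k. (\<omega> j - \<tau> * s j + \<tau> ^ 2 * qf j \<theta>) ^ 2) has_real_derivative - 2 * eucl_norm n \<theta> ^ 2) (at 0)"
        by simp
      hence d1: "((\<lambda>\<tau>. sqrt (\<Sum>j<k. (\<omega> j - \<tau> * s j + \<tau> ^ 2 * qf j \<theta>) ^ 2)) has_real_derivative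
         - (eucl_norm n \<theta> ^ 2 / resid y a)) (at 0)"
        by (rule DERIV_sqrt_at_0) (use spos sq in simp_all)
      have "(\<phi> has_real_derivative - (eucl_norm n \<theta> ^ 2 / resid y a) + \<kappa> * eucl_norm n \<theta>) (at 0)"
        unfolding \<phi>_def by (rule DERIV_add[OF d1]) (auto intro!: derivative_eq_intros)
      moreover have "- (eucl_norm n \<theta> ^ 2 / resid y a) + \<kappa> * eucl_norm n \<theta> < 0"
      proof -
        have tp: "eucl_norm n \<theta> > 0" using \<theta> Rpos k0(1) by (meson mult_pos_pos less_le_trans)
        have "\<kappa> * resid y a < eucl_norm n \<theta>"
        proof -
          have "\<kappa> * resid y a < \<kappa>0 * resid y a" using Rpos k0(1) by (simp add: \<kappa>_def)
          thus ?thesis using \<theta> by linarith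
        qed
        hence "\<kappa> < eucl_norm n \<theta> / resid y a" using Rpos by (simp add: less_divide_eq)
        hence "\<kappa> * eucl_norm n \<theta> < eucl_norm n \<theta> / resid y a * eucl_norm n \<theta>" using tp by (rule mult_strict_right_mono)
        thus ?thesis by (simp add: power2_eq_square)
      qed
      ultimately obtain \<delta> where \<delta>: "\<delta> > 0" "\<And>h. h > 0 \<Longrightarrow> h < \<delta> \<Longrightarrow> \<phi> (0 + h) < \<phi> 0"
        using DERIV_neg_dec_right by blast
      define h where "h = min (\<delta> / 2) ((\<rho> / 2 - eucl_dist n y x) / (eucl_norm n \<theta> + 1))"
      have h: "h > 0" "h < \<delta>" using \<delta>(1) dy2 by (auto simp: h_def add_nonneg_pos)
      have "h * (eucl_norm n \<theta> + 1) \<le> \<rho> / 2 - eucl_dist n y x"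
      proof -
        have "eucl_norm n \<theta> + 1 > 0" using eucl_norm_nonneg[of n \<theta>] by linarith
        moreover have "h \<le> (\<rho> / 2 - eucl_dist n y x) / (eucl_norm n \<theta> + 1)" unfolding h_def by (rule min.cobounded2)
        ultimately show ?thesis by (simp only: pos_le_divide_eq)
      qed
      hence ht: "eucl_dist n y x + h * eucl_norm n \<theta> \<le> \<rho> / 2" using h(1) by (simp add: algebra_simps)
      have dt: "eucl_dist n (yt h) x \<le> eucl_dist n y x + h * eucl_norm n \<theta>"
      proof -
        have "eucl_dist n (yt h) y = h * eucl_norm n \<theta>"
          unfolding eucl_dist_def yt_def using eucl_norm_scale[of n "-h" \<theta>] h(1) by simp
        thus ?thesis using eucl_dist_triangle[of n "yt h" x y] by linarith
      qed
      have "yt h \<in> K" using ht dt yR by (auto simp: K_def yt_def Rn_def \<theta>_def comb_def)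
      hence "\<psi> y \<le> \<psi> (yt h)" by (rule y(2))
      also have "\<dots> \<le> \<phi> h"
      proof -
        have "resid (yt h) a = sqrt (\<Sum>j<k. (\<omega> j - h * s j + h ^ 2 * qf j \<theta>) ^ 2)"
          unfolding resid_def eucl_norm_def L2_set_def Qt \<omega>_def by (simp add: algebra_simps)
        thus ?thesis using dt kpos by (simp add: \<psi>_def \<phi>_def)
      qed
      also have "\<dots> < \<phi> 0" using \<delta>(2)[OF h] by simp
      also have "\<phi> 0 = \<psi> y" by (simp add: \<phi>_def \<psi>_def sq)
      finally show False by simp
    qed
    hence "\<forall>j<k. Qv j y = a j" by (simp add: resid_def eucl_norm_eq_0_iff)
    with yR dy show ?thesis by blast
  qed
  thus ?thesis using kpos rpos by blast
qed

text \<open>Provides the points demanded by \<open>specialise_limit\<close> when the values of the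
  equations are specialised to 0: for any small right-hand sides there are solutions close to a
  given point of \<open>M\<close>.\<close>

lemma solve_sequence:
  assumes "z \<in> M" "\<And>j. j < k \<Longrightarrow> (\<lambda>m. a m j) \<longlonglongrightarrow> 0"
  shows "\<exists>x. (\<forall>m. x m \<in> Rn n) \<and> x \<longlonglongrightarrow> z \<and> (\<forall>\<^sub>F m in sequentially. \<forall>j<k. Qv j (x m) = a m j)"
proof -
  obtain \<kappa> r where kr: "\<kappa> > 0" "r > 0" "\<And>x a. x \<in> Rn n \<Longrightarrow> eucl_dist n x z < r \<Longrightarrow> resid x a < r \<Longrightarrow>
     (\<exists>y\<in>Rn n. (\<forall>j<k. Qv j y = a j) \<and> \<kappa> * eucl_dist n y x \<le> resid x a)"
    using solve_near[OF assms(1)] by metis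
  have zR: "z \<in> Rn n" using M_Rn[OF assms(1)] .
  have Qz: "j < k \<Longrightarrow> Qv j z = 0" for j using assms(1) by (simp add: M_def)
  have lim: "(\<lambda>m. resid z (a m)) \<longlonglongrightarrow> 0"
  proof -
    have "(\<lambda>m. resid z (a m)) \<longlonglongrightarrow> eucl_norm k (\<lambda>j. Qv j z - 0)"
      unfolding resid_def by (intro tendsto_eucl_norm tendsto_intros assms(2))
    moreover have "eucl_norm k (\<lambda>j. Qv j z - 0) = 0" unfolding eucl_norm_eq_0_iff using Qz by simp
    ultimately show ?thesis by simp
  qed
  \<comment> \<open>While the right-hand side is still too large, any point of the space serves as a
    default value.\<close>
  have "\<exists>y\<in>Rn n. resid z (a m) < r \<longrightarrow> (\<forall>j<k. Qv j y = a m j) \<and> \<kappa> * eucl_dist n y z \<le> resid z (a m)" for m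
    using kr(3)[OF zR, of "a m"] kr(2) zR by (cases "resid z (a m) < r") auto
  then obtain x where x: "\<And>m. x m \<in> Rn n" "\<And>m. resid z (a m) < r \<Longrightarrow> (\<forall>j<k. Qv j (x m) = a m j)"
    "\<And>m. resid z (a m) < r \<Longrightarrow> \<kappa> * eucl_dist n (x m) z \<le> resid z (a m)" by metis
  have ev: "\<forall>\<^sub>F m in sequentially. resid z (a m) < r" using lim kr(2) by (rule order_tendstoD)
  have "(\<lambda>m. eucl_dist n (x m) z) \<longlonglongrightarrow> 0"
  proof (rule Lim_null_comparison)
    show "\<forall>\<^sub>F m in sequentially. norm (eucl_dist n (x m) z) \<le> resid z (a m) / \<kappa>"
      using ev by eventually_elim (use x(3) kr(1) in \<open>simp add: field_simps\<close>)
    show "(\<lambda>m. resid z (a m) / \<kappa>) \<longlonglongrightarrow> 0" using tendsto_divide_zero[OF lim] .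
  qed
  hence "x \<longlonglongrightarrow> z" using tendsto_Rn_iff[of x n sequentially z] x(1) zR by simp
  moreover have "\<forall>\<^sub>F m in sequentially. \<forall>j<k. Qv j (x m) = a m j"
    using ev by eventually_elim (use x(2) in auto)
  ultimately show ?thesis using x(1) by blast
qed

end

lemma sum_lessThan_add: "(\<Sum>i<a + b. f i) = (\<Sum>i<a. f i) + (\<Sum>i<b. f (a + i))" for f :: "nat \<Rightarrow> 'a::comm_monoid_add"
  by (induction b) (auto simp: add_ac)

lemma specialise_genericE:
  assumes "finite A" "A \<subseteq> {..<m}" "\<exists>\<alpha>\<in>expbox m d. c \<alpha> \<noteq> 0" "(r::real) > 0"
  obtains a c' where "\<And>i. \<bar>a i - a0 i\<bar> < r" "\<exists>\<beta>\<in>expbox m (\<lambda>i. if i \<in> A then 0 else d i). c' \<beta> \<noteq> 0"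
     "\<And>w. (\<Sum>\<alpha>\<in>expbox m d. c \<alpha> * pmon m \<alpha> (\<lambda>i. if i \<in> A then a i else w i))
        = (\<Sum>\<beta>\<in>expbox m (\<lambda>i. if i \<in> A then 0 else d i). c' \<beta> * pmon m \<beta> w)"
proof -
  obtain a where "\<exists>c'. (\<forall>i. \<bar>a i - a0 i\<bar> < r) \<and> (\<exists>\<beta>\<in>expbox m (\<lambda>i. if i \<in> A then 0 else d i). c' \<beta> \<noteq> 0) \<and>
     (\<forall>w. (\<Sum>\<alpha>\<in>expbox m d. c \<alpha> * pmon m \<alpha> (\<lambda>i. if i \<in> A then a i else w i))
        = (\<Sum>\<beta>\<in>expbox m (\<lambda>i. if i \<in> A then 0 else d i). c' \<beta> * pmon m \<beta> w))"
    using specialise_generic[OF assms] by (rule exE)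
  then obtain c' where *: "(\<forall>i. \<bar>a i - a0 i\<bar> < r) \<and> (\<exists>\<beta>\<in>expbox m (\<lambda>i. if i \<in> A then 0 else d i). c' \<beta> \<noteq> 0) \<and>
     (\<forall>w. (\<Sum>\<alpha>\<in>expbox m d. c \<alpha> * pmon m \<alpha> (\<lambda>i. if i \<in> A then a i else w i))
        = (\<Sum>\<beta>\<in>expbox m (\<lambda>i. if i \<in> A then 0 else d i). c' \<beta> * pmon m \<beta> w))" by (rule exE)
  show ?thesis
    by (rule that[OF *[THEN conjunct1, rule_format] *[THEN conjunct2, THEN conjunct1]
      *[THEN conjunct2, THEN conjunct2, rule_format]])
qed

lemma eliminationE:
  assumes "\<And>i j. i < n \<Longrightarrow> j < n \<Longrightarrow> pf m (\<lambda>_. 2) (A i j)"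
    and "\<And>i j. i < n \<Longrightarrow> j < n \<Longrightarrow> A i j y0 = (if i = j then s else 0)" "s \<noteq> 0"
    and "\<And>i. i < n \<Longrightarrow> pf m (\<lambda>_. 2) (B i)"
    and "\<And>l. l \<le> m \<Longrightarrow> xq n m 2 2 (P l)"
    and "r = n + (m + 1)"
  obtains N c where "\<exists>\<alpha>\<in>expbox r (\<lambda>i. if i < n then N else elim_degree n m). c \<alpha> \<noteq> 0"
     "\<And>x y. (\<forall>i\<ge>n. x i = 0) \<Longrightarrow> (\<Sum>\<alpha>\<in>expbox r (\<lambda>i. if i < n then N else elim_degree n m).
        c \<alpha> * pmon r \<alpha> (\<lambda>i. if i < n then (\<Sum>j<n. A i j y * x j) - B i y else P (i - n) x y)) = 0"
proof -
  obtain N where "\<exists>c. (\<exists>\<alpha>\<in>expbox r (\<lambda>i. if i < n then N else elim_degree n m). c \<alpha> \<noteq> 0) \<and>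
     (\<forall>x y. (\<forall>i\<ge>n. x i = 0) \<longrightarrow> (\<Sum>\<alpha>\<in>expbox r (\<lambda>i. if i < n then N else elim_degree n m).
        c \<alpha> * pmon r \<alpha> (\<lambda>i. if i < n then (\<Sum>j<n. A i j y * x j) - B i y else P (i - n) x y)) = 0)"
    using elimination[of n m A y0 s B P, OF assms(1-5)] unfolding assms(6) by (rule exE)
  then obtain c where *: "(\<exists>\<alpha>\<in>expbox r (\<lambda>i. if i < n then N else elim_degree n m). c \<alpha> \<noteq> 0) \<and>
     (\<forall>x y. (\<forall>i\<ge>n. x i = 0) \<longrightarrow> (\<Sum>\<alpha>\<in>expbox r (\<lambda>i. if i < n then N else elim_degree n m).
        c \<alpha> * pmon r \<alpha> (\<lambda>i. if i < n then (\<Sum>j<n. A i j y * x j) - B i y else P (i - n) x y)) = 0)"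
    by (rule exE)
  show ?thesis by (rule that[OF *[THEN conjunct1] *[THEN conjunct2, rule_format]]) blast
qed

section \<open>The function \<open>f\<close> on \<open>M\<close>: critical points, slope and
  descent\<close>

context quadrics
begin

definition f :: "(nat \<Rightarrow> real) \<Rightarrow> (nat \<Rightarrow> real) \<Rightarrow> real" where
  "f e x = (\<Sum>i<n. x i ^ 2 + 2 * e i * x i)"

definition xi :: "(nat \<Rightarrow> real) \<Rightarrow> (nat \<Rightarrow> real) \<Rightarrow> (nat \<Rightarrow> real) \<Rightarrow> nat \<Rightarrow> real" where
  "xi e \<eta> x i = (if i < n then 2 * (x i + e i) - comb \<eta> x i else 0)"

definition Crit :: "(nat \<Rightarrow> real) \<Rightarrow> (nat \<Rightarrow> real) set" where
  "Crit e = {x \<in> M. \<exists>\<eta>. \<forall>i<n. xi e \<eta> x i = 0}"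

lemma f_add: "f e (\<lambda>i. x i + d i) = f e x + (\<Sum>i<n. 2 * (x i + e i) * d i) + eucl_norm n d ^ 2"
  unfolding f_def eucl_norm_square sum.distrib[symmetric]
  by (intro sum.cong refl) (simp add: power2_eq_square algebra_simps)

lemma tendsto_f: "(g \<longlongrightarrow> x) F \<Longrightarrow> ((\<lambda>j. f e (g j)) \<longlongrightarrow> f e x) F"
  unfolding f_def by (intro tendsto_intros tendsto_fun[of g x F])

lemma tendsto_xi: "(g \<longlongrightarrow> x) F \<Longrightarrow> (w \<longlongrightarrow> \<eta>) F \<Longrightarrow> ((\<lambda>j. xi e (w j) (g j) i) \<longlongrightarrow> xi e \<eta> x i) F"
  unfolding xi_def by (cases "i < n") (auto intro!: tendsto_intros tendsto_fun[of g x F] tendsto_comb)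

lemma xi_local: "(\<And>j. j < k \<Longrightarrow> \<eta> j = \<eta>' j) \<Longrightarrow> xi e \<eta> x = xi e \<eta>' x"
  unfolding xi_def comb_def by (auto intro!: ext sum.cong)

definition CL :: "(nat \<Rightarrow> real) \<Rightarrow> real" where
  "CL \<eta> = 1 + (\<Sum>j<k. \<bar>\<eta> j\<bar> * CS j)"

lemma CL_pos: "CL \<eta> > 0"
  unfolding CL_def by (intro add_pos_nonneg sum_nonneg mult_nonneg_nonneg CS_nonneg) auto

text \<open>On \<open>M\<close>, the functions \<open>f\<close> and \<open>f - (\<Sum>j<k. \<eta> j * Qv j)\<close> agree, and the second one has
  gradient \<open>xi e \<eta>\<close>.\<close>

lemma f_diff:
  assumes "x \<in> M" "y \<in> M"
  shows "\<bar>f e y - f e x - (\<Sum>i<n. xi e \<eta> x i * (y i - x i))\<bar> \<le> CL \<eta> * eucl_dist n y x ^ 2"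
proof -
  define d where "d i = y i - x i" for i
  have y: "y = (\<lambda>i. x i + d i)" by (simp add: d_def)
  have nd: "eucl_norm n d = eucl_dist n y x" by (simp add: d_def [abs_def] eucl_dist_def)
  have Q: "(\<Sum>i<n. G j x i * d i) = - qf j d" if "j < k" for j
    using Qv_add[of j x d] assms that unfolding y by (simp add: M_def)
  have "(\<Sum>i<n. xi e \<eta> x i * d i) = (\<Sum>i<n. 2 * (x i + e i) * d i) - (\<Sum>i<n. (\<Sum>j<k. \<eta> j * G j x i) * d i)"
    by (simp add: xi_def comb_def algebra_simps sum_subtractf)
  also have "(\<Sum>i<n. (\<Sum>j<k. \<eta> j * G j x i) * d i) = (\<Sum>j<k. \<eta> j * (\<Sum>i<n. G j x i * d i))"
    by (simp add: sum_distrib_left sum_distrib_right mult_ac) (rule sum.swap)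
  also have "\<dots> = - (\<Sum>j<k. \<eta> j * qf j d)" using Q by (simp add: sum_negf)
  finally have "f e y - f e x - (\<Sum>i<n. xi e \<eta> x i * d i) = eucl_norm n d ^ 2 - (\<Sum>j<k. \<eta> j * qf j d)"
    unfolding y f_add by simp
  also have "\<bar>\<dots>\<bar> \<le> eucl_norm n d ^ 2 + (\<Sum>j<k. \<bar>\<eta> j * qf j d\<bar>)"
    using sum_abs[of "\<lambda>j. \<eta> j * qf j d" "{..<k}"] zero_le_power2[of "eucl_norm n d"] by linarith
  also have "\<dots> \<le> eucl_norm n d ^ 2 + (\<Sum>j<k. \<bar>\<eta> j\<bar> * (CS j * eucl_norm n d ^ 2))"
    unfolding abs_mult by (intro add_left_mono sum_mono mult_left_mono abs_qf_le) auto
  also have "\<dots> = CL \<eta> * eucl_norm n d ^ 2"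
    by (simp add: CL_def algebra_simps sum_distrib_left sum_distrib_right)
  finally show ?thesis unfolding nd d_def .
qed

end

context regular_quadrics
begin

text \<open>By independence of the gradients, the norm of \<open>xi\<close> grows with the
  multipliers: outside the ball of radius \<open>R\<close> it is at least its value at multiplier 0.
  The minimising multiplier turns \<open>xi\<close> into the projection of the gradient of
  \<open>f\<close> to the tangent space, whose length is the slope.\<close>

lemma slope_attained:
  assumes "z \<in> M"
  shows "\<exists>\<eta>. \<forall>\<eta>'. eucl_norm n (xi e \<eta> z) \<le> eucl_norm n (xi e \<eta>' z)"
proof -
  obtain \<kappa> \<rho> where k0: "\<kappa> > 0" "\<rho> > 0"
    and ind: "\<And>x \<omega>. x \<in> Rn n \<Longrightarrow> eucl_dist n x z \<le> \<rho> \<Longrightarrow> \<kappa> * eucl_norm k \<omega> \<le> eucl_norm n (comb \<omega> x)"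
    using local_independence[OF assms] by metis
  have indz: "\<kappa> * eucl_norm k \<omega> \<le> eucl_norm n (comb \<omega> z)" for \<omega>
    using ind[of z \<omega>] k0(2) M_Rn[OF assms] by simp
  define g where "g = xi e (\<lambda>_. 0) z"
  define R where "R = 2 * eucl_norm n g / \<kappa>"
  define K where "K = {y \<in> Rn k. eucl_dist k y (\<lambda>_. 0) \<le> R}"
  have R0: "R \<ge> 0" using k0(1) by (simp add: R_def)
  have K0: "(\<lambda>_. 0) \<in> K" using R0 by (simp add: K_def Rn_def)
  have "compact K" unfolding K_def by (rule compact_eucl_cball) (simp add: Rn_def)
  moreover have "continuous_on K (\<lambda>\<eta>. eucl_norm n (xi e \<eta> z))"
    unfolding xi_def comb_def
    by (intro continuous_on_eucl_norm) (auto intro!: continuous_intros continuous_on_coord)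
  ultimately obtain \<eta> where l: "\<eta> \<in> K" "\<And>\<eta>'. \<eta>' \<in> K \<Longrightarrow> eucl_norm n (xi e \<eta> z) \<le> eucl_norm n (xi e \<eta>' z)"
    using continuous_attains_inf[of K "\<lambda>\<eta>. eucl_norm n (xi e \<eta> z)"] K0 by blast
  have "eucl_norm n (xi e \<eta> z) \<le> eucl_norm n (xi e \<eta>' z)" for \<eta>'
  proof -
    define \<eta>1 where "\<eta>1 j = (if j < k then \<eta>' j else 0)" for j
    have eq: "xi e \<eta>' z = xi e \<eta>1 z" by (rule xi_local) (simp add: \<eta>1_def)
    show ?thesis
    proof (cases "\<eta>1 \<in> K")
      case True
      thus ?thesis using l(2) eq by simp
    next
      case False
      hence "eucl_norm k \<eta>1 > R" by (auto simp: K_def Rn_def \<eta>1_def eucl_dist_def)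
      hence "2 * eucl_norm n g \<le> \<kappa> * eucl_norm k \<eta>1" using k0(1) by (simp add: R_def field_simps)
      also have "\<dots> \<le> eucl_norm n (comb \<eta>1 z)" by (rule indz)
      also have "comb \<eta>1 z = (\<lambda>i. g i + (-1) * xi e \<eta>1 z i)" by (auto simp: g_def xi_def comb_def)
      also have "eucl_norm n \<dots> \<le> eucl_norm n g + eucl_norm n (xi e \<eta>1 z)"
        using eucl_norm_add[of n g "\<lambda>i. (-1) * xi e \<eta>1 z i"] eucl_norm_scale[of n "-1" "xi e \<eta>1 z"] by simp
      finally have "eucl_norm n g \<le> eucl_norm n (xi e \<eta>1 z)" by simp
      moreover have "eucl_norm n (xi e \<eta> z) \<le> eucl_norm n g" using l(2)[OF K0] by (simp add: g_def)
      ultimately show ?thesis using eq by simp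
    qed
  qed
  thus ?thesis by blast
qed

lemma slope_orthogonal:
  assumes "\<forall>\<eta>'. eucl_norm n (xi e \<eta> z) \<le> eucl_norm n (xi e \<eta>' z)" "j < k"
  shows "(\<Sum>i<n. G j z i * xi e \<eta> z i) = 0"
proof -
  have "0 \<le> \<tau> * (- 2 * (\<Sum>i<n. G j z i * xi e \<eta> z i)) + \<tau> ^ 2 * (\<Sum>i<n. G j z i ^ 2)" for \<tau>
  proof -
    define \<eta>' where "\<eta>' l = \<eta> l + (if l = j then \<tau> else 0)" for l
    have "(\<Sum>l<k. \<eta>' l * G l z i) = (\<Sum>l<k. \<eta> l * G l z i) + \<tau> * G j z i" for i
    proof -
      have "(\<Sum>l<k. \<eta>' l * G l z i) = (\<Sum>l<k. \<eta> l * G l z i + (if l = j then \<tau> * G j z i else 0))"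
        by (intro sum.cong) (auto simp: \<eta>'_def algebra_simps)
      thus ?thesis using assms(2) by (simp add: sum.distrib)
    qed
    hence eq: "xi e \<eta>' z i = xi e \<eta> z i - \<tau> * G j z i" if "i < n" for i using that by (simp add: xi_def comb_def)
    have "eucl_norm n (xi e \<eta> z) ^ 2 \<le> eucl_norm n (xi e \<eta>' z) ^ 2"
      using assms(1) by (intro power_mono) auto
    also have "\<dots> = (\<Sum>i<n. (xi e \<eta> z i) ^ 2 + (\<tau> * (- 2 * (G j z i * xi e \<eta> z i)) + \<tau> ^ 2 * G j z i ^ 2))"
      unfolding eucl_norm_square by (intro sum.cong refl) (simp add: eq power2_eq_square algebra_simps)
    also have "\<dots> = eucl_norm n (xi e \<eta> z) ^ 2 + (\<tau> * (- 2 * (\<Sum>i<n. G j z i * xi e \<eta> z i)) + \<tau> ^ 2 * (\<Sum>i<n. G j z i ^ 2))"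
      unfolding eucl_norm_square by (simp only: sum.distrib sum_distrib_left)
    finally show ?thesis by simp
  qed
  from linear_quadratic_nonneg_imp_0[OF this] show ?thesis by simp
qed

text \<open>A move by \<open>\<sigma>\<close> against the projected gradient changes each equation
  by exactly \<open>\<sigma> ^ 2\<close> times its quadratic part, the linear part being zero by
  orthogonality. \<open>solve_near\<close> then leads back to \<open>M\<close> with a correction of
  order \<open>\<sigma> ^ 2\<close>, which affects the length and the decrease of \<open>f\<close>
  in second order only.\<close>

lemma descent_step:
  assumes "z \<in> M" "z \<notin> Crit e"
  shows "\<exists>\<eta> C \<sigma>0. C > 0 \<and> \<sigma>0 > 0 \<and> eucl_norm n (xi e \<eta> z) > 0 \<and>
    (\<forall>\<sigma>. 0 < \<sigma> \<longrightarrow> \<sigma> < \<sigma>0 \<longrightarrow> (\<exists>y\<in>M. eucl_dist n y z \<le> \<sigma> * eucl_norm n (xi e \<eta> z) + C * \<sigma> ^ 2 \<and>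
       f e z - f e y \<ge> \<sigma> * eucl_norm n (xi e \<eta> z) ^ 2 - C * \<sigma> ^ 2))"
proof -
  obtain \<eta> where l: "\<forall>\<eta>'. eucl_norm n (xi e \<eta> z) \<le> eucl_norm n (xi e \<eta>' z)"
    using slope_attained[OF assms(1)] by blast
  define m where "m = eucl_norm n (xi e \<eta> z)"
  have "m \<noteq> 0" using assms unfolding m_def eucl_norm_eq_0_iff Crit_def by auto
  hence m: "m > 0" by (simp add: m_def order_less_le)
  obtain \<kappa> r where kr: "\<kappa> > 0" "r > 0" "\<And>x a. x \<in> Rn n \<Longrightarrow> eucl_dist n x z < r \<Longrightarrow> resid x a < r \<Longrightarrow>
     (\<exists>y\<in>Rn n. (\<forall>j<k. Qv j y = a j) \<and> \<kappa> * eucl_dist n y x \<le> resid x a)"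
    using solve_near[OF assms(1)] by metis
  have Qz: "j < k \<Longrightarrow> Qv j z = 0" for j using assms(1) by (simp add: M_def)
  define C1 where "C1 = eucl_norm k (\<lambda>j. qf j (xi e \<eta> z))"
  have C1: "C1 \<ge> 0" by (simp add: C1_def)
  define C2 where "C2 = C1 / \<kappa>"
  have C2: "C2 \<ge> 0" using C1 kr(1) by (simp add: C2_def)
  \<comment> \<open>The summands account for the correction (\<open>C2\<close>), for its effect on
    the linear part of \<open>f\<close> (\<open>m * C2\<close>), and for the second-order error of
    \<open>f\<close> over the whole move.\<close>
  define C where "C = 1 + C2 + m * C2 + CL \<eta> * (m + C2) ^ 2"
  have Cpos: "C \<ge> 1" unfolding C_def using C2 m CL_pos[of \<eta>] by (simp add: add_increasing add_nonneg_nonneg)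
  have nz: "eucl_norm n z < 1" using M_interior[OF assms(1)] .
  \<comment> \<open>The quotients with numerator \<open>r\<close> keep the moved point and its
    residual within the reach of \<open>solve_near\<close>; the last quotient keeps the corrected
    point in the ball.\<close>
  define \<sigma>0 where "\<sigma>0 = min (min 1 (r / (C1 + 1))) (min (r / m) ((1 - eucl_norm n z) / (m + C2)))"
  have mC2: "m + C2 > 0" using m C2 by linarith
  have s0: "\<sigma>0 > 0" unfolding \<sigma>0_def using kr m C1 nz mC2 by (simp add: add_nonneg_pos)
  have "\<exists>y\<in>M. eucl_dist n y z \<le> \<sigma> * m + C * \<sigma> ^ 2 \<and> f e z - f e y \<ge> \<sigma> * m ^ 2 - C * \<sigma> ^ 2"
    if \<sigma>: "0 < \<sigma>" "\<sigma> < \<sigma>0" for \<sigma>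
  proof -
    have \<sigma>1: "\<sigma> < 1" "\<sigma> < r / (C1 + 1)" "\<sigma> < r / m" "\<sigma> < (1 - eucl_norm n z) / (m + C2)"
      using \<sigma>(2) by (auto simp: \<sigma>0_def)
    have ss: "\<sigma> ^ 2 \<le> \<sigma>" using \<sigma>(1) \<sigma>1(1) by (simp add: power2_eq_square mult_left_le)
    define x where "x = (\<lambda>i. z i + (- \<sigma>) * xi e \<eta> z i)"
    have xR: "x \<in> Rn n" using M_Rn[OF assms(1)] by (simp add: x_def Rn_def xi_def)
    have dx: "eucl_dist n x z = \<sigma> * m"
      unfolding eucl_dist_def x_def m_def using eucl_norm_scale[of n "- \<sigma>" "xi e \<eta> z"] \<sigma>(1) by simp
    have Qx: "Qv j x = \<sigma> ^ 2 * qf j (xi e \<eta> z)" if "j < k" for j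
    proof -
      have "(\<Sum>i<n. G j z i * (- \<sigma> * xi e \<eta> z i)) = - \<sigma> * (\<Sum>i<n. G j z i * xi e \<eta> z i)"
        by (simp add: sum_distrib_left mult_ac)
      thus ?thesis unfolding x_def Qv_add qf_scale using slope_orthogonal[OF l that] Qz[OF that] by simp
    qed
    have rx: "resid x (\<lambda>_. 0) = \<sigma> ^ 2 * C1"
    proof -
      have "resid x (\<lambda>_. 0) = eucl_norm k (\<lambda>j. \<sigma> ^ 2 * qf j (xi e \<eta> z))"
        unfolding resid_def by (rule eucl_norm_local) (simp add: Qx)
      thus ?thesis by (simp add: C1_def eucl_norm_scale)
    qed
    have "eucl_dist n x z < r" using dx \<sigma>1(3) m by (simp add: field_simps)
    moreover have "resid x (\<lambda>_. 0) < r"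
    proof -
      have "\<sigma> ^ 2 * C1 \<le> \<sigma> * (C1 + 1)" using ss C1 \<sigma>(1) by (intro mult_mono) auto
      also have "\<dots> < r" using \<sigma>1(2) C1 by (simp add: field_simps)
      finally show ?thesis by (simp add: rx)
    qed
    ultimately obtain y where y: "y \<in> Rn n" "\<And>j. j < k \<Longrightarrow> Qv j y = 0" "\<kappa> * eucl_dist n y x \<le> resid x (\<lambda>_. 0)"
      using kr(3)[OF xR] by metis
    have yx: "eucl_dist n y x \<le> C2 * \<sigma> ^ 2" using y(3) kr(1) by (simp add: rx C2_def field_simps)
    have yz: "eucl_dist n y z \<le> \<sigma> * m + C2 * \<sigma> ^ 2" using eucl_dist_triangle[of n y z x] yx dx by linarith
    have s2: "C2 * \<sigma> ^ 2 \<le> C2 * \<sigma>" using ss C2 by (rule mult_left_mono)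
    have yz2: "eucl_dist n y z \<le> \<sigma> * (m + C2)" using yz s2 by (simp add: algebra_simps)
    have "\<sigma> * (m + C2) < 1 - eucl_norm n z" using \<sigma>1(4) mC2 by (simp add: field_simps)
    moreover have "eucl_norm n y \<le> eucl_dist n y z + eucl_norm n z"
      using eucl_norm_add[of n "\<lambda>i. y i - z i" z] by (simp add: eucl_dist_def)
    ultimately have "eucl_norm n y \<le> 1" using yz2 by linarith
    hence yM: "y \<in> M" using y by (simp add: M_def)
    have "(\<Sum>i<n. xi e \<eta> z i * (y i - z i)) = (\<Sum>i<n. xi e \<eta> z i * (y i - x i)) - \<sigma> * (\<Sum>i<n. xi e \<eta> z i ^ 2)"
      unfolding sum_distrib_left sum_subtractf[symmetric]
      by (intro sum.cong refl) (simp add: x_def algebra_simps power2_eq_square)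
    also have "(\<Sum>i<n. xi e \<eta> z i ^ 2) = m ^ 2" by (simp add: m_def eucl_norm_square)
    finally have e1: "(\<Sum>i<n. xi e \<eta> z i * (y i - z i)) = (\<Sum>i<n. xi e \<eta> z i * (y i - x i)) - \<sigma> * m ^ 2" .
    have "\<bar>\<Sum>i<n. xi e \<eta> z i * (y i - x i)\<bar> \<le> m * eucl_dist n y x"
      unfolding m_def eucl_dist_def by (rule eucl_norm_Cauchy)
    also have "\<dots> \<le> m * (C2 * \<sigma> ^ 2)" using yx m by (intro mult_left_mono) auto
    finally have e2: "\<bar>\<Sum>i<n. xi e \<eta> z i * (y i - x i)\<bar> \<le> m * C2 * \<sigma> ^ 2" by (simp add: mult_ac)
    have "CL \<eta> * eucl_dist n y z ^ 2 \<le> CL \<eta> * (\<sigma> * (m + C2)) ^ 2"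
      using yz2 CL_pos[of \<eta>] by (intro mult_left_mono power_mono) auto
    also have "\<dots> = CL \<eta> * (m + C2) ^ 2 * \<sigma> ^ 2" by (simp add: power_mult_distrib mult_ac)
    finally have e3: "CL \<eta> * eucl_dist n y z ^ 2 \<le> CL \<eta> * (m + C2) ^ 2 * \<sigma> ^ 2" .
    have Ceq: "C * \<sigma> ^ 2 = \<sigma> ^ 2 + C2 * \<sigma> ^ 2 + m * C2 * \<sigma> ^ 2 + CL \<eta> * (m + C2) ^ 2 * \<sigma> ^ 2"
      by (simp add: C_def algebra_simps)
    have p: "\<sigma> ^ 2 \<ge> 0" "C2 * \<sigma> ^ 2 \<ge> 0" "m * C2 * \<sigma> ^ 2 \<ge> 0" "CL \<eta> * (m + C2) ^ 2 * \<sigma> ^ 2 \<ge> 0"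
      using C2 m CL_pos[of \<eta>] by auto
    have "f e z - f e y \<ge> \<sigma> * m ^ 2 - C * \<sigma> ^ 2"
      using f_diff[OF assms(1) yM, of e \<eta>] e1 e2 e3 Ceq p by linarith
    moreover have "eucl_dist n y z \<le> \<sigma> * m + C * \<sigma> ^ 2" using yz Ceq p by linarith
    ultimately show ?thesis using yM by blast
  qed
  thus ?thesis using m Cpos s0 unfolding m_def
    by (intro exI[of _ \<eta>] exI[of _ C] exI[of _ \<sigma>0] conjI allI impI) auto
qed

end

subsection \<open>Counting critical points\<close>

lemma univariate_root_count:
  assumes "\<exists>\<beta>\<in>expbox r d. c \<beta> \<noteq> 0" "i0 < r" "\<And>i. i < r \<Longrightarrow> i \<noteq> i0 \<Longrightarrow> d i = 0"
  shows "\<exists>p. p \<noteq> 0 \<and> degree p \<le> d i0 \<and> (\<forall>w. (\<Sum>\<beta>\<in>expbox r d. c \<beta> * pmon r \<beta> w) = poly p (w i0))"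
proof -
  define p where "p = (\<Sum>\<beta>\<in>expbox r d. monom (c \<beta>) (\<beta> i0))"
  have le: "\<beta> i \<le> d i" if "\<beta> \<in> expbox r d" "i < r" for \<beta> i
    using PiE_mem[OF that(1)[unfolded expbox_def], of i] that(2) by simp
  have "poly p (w i0) = (\<Sum>\<beta>\<in>expbox r d. c \<beta> * pmon r \<beta> w)" for w
  proof -
    have "pmon r \<beta> w = w i0 ^ \<beta> i0" if "\<beta> \<in> expbox r d" for \<beta>
    proof -
      have "pmon r \<beta> w = (\<Prod>i<r. if i = i0 then w i0 ^ \<beta> i0 else 1)"
        unfolding pmon_def using le[OF that] assms(3) by (intro prod.cong) fastforce+
      thus ?thesis using assms(2) by simp
    qed
    thus ?thesis by (simp add: p_def poly_sum poly_monom)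
  qed
  moreover have "degree p \<le> d i0" unfolding p_def
    by (intro degree_sum_le) (auto intro!: order_trans[OF degree_monom_le] le assms(2))
  moreover have "p \<noteq> 0"
  proof -
    obtain \<beta>0 where b: "\<beta>0 \<in> expbox r d" "c \<beta>0 \<noteq> 0" using assms(1) by blast
    have inj: "\<beta> = \<beta>0" if "\<beta> \<in> expbox r d" "\<beta> i0 = \<beta>0 i0" for \<beta>
    proof (rule PiE_ext[OF that(1)[unfolded expbox_def] b(1)[unfolded expbox_def]])
      fix i assume "i \<in> {..<r}"
      thus "\<beta> i = \<beta>0 i" using le[OF that(1), of i] le[OF b(1), of i] assms(3)[of i] that(2) by (cases "i = i0") auto
    qed
    have "coeff p (\<beta>0 i0) = (\<Sum>\<beta>\<in>expbox r d. if \<beta> i0 = \<beta>0 i0 then c \<beta> else 0)"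
      by (simp add: p_def coeff_sum coeff_monom)
    also have "\<dots> = (\<Sum>\<beta>\<in>expbox r d. if \<beta> = \<beta>0 then c \<beta>0 else 0)"
      by (intro sum.cong refl) (use inj in auto)
    also have "\<dots> = c \<beta>0" using b(1) by simp
    finally show ?thesis using b(2) by auto
  qed
  ultimately show ?thesis by metis
qed

text \<open>On the moment curve \<open>s ^ i\<close>, each nonzero \<open>d\<close> gives a nonzero
  polynomial in \<open>s\<close>, so all but finitely many \<open>s\<close> will do.\<close>

lemma separating_vector:
  fixes D :: "(nat \<Rightarrow> real) set"
  assumes "finite D" "\<And>d. d \<in> D \<Longrightarrow> \<exists>i<n. d i \<noteq> 0"
  shows "\<exists>u. \<forall>d\<in>D. (\<Sum>i<n. u i * d i) \<noteq> 0"
proof -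
  define p where "p d = (\<Sum>i<n. monom (d i) i)" for d :: "nat \<Rightarrow> real"
  have pnz: "p d \<noteq> 0" if d: "d \<in> D" for d
  proof -
    obtain i where i: "i < n" "d i \<noteq> 0" using assms(2)[OF d] by blast
    have "coeff (p d) i = d i" using i(1) by (simp add: p_def coeff_sum coeff_monom)
    thus ?thesis using i(2) by auto
  qed
  have "finite (\<Union>d\<in>D. {s. poly (p d) s = 0})" using assms(1) pnz by (auto simp: poly_roots_finite)
  then obtain s where s: "s \<notin> (\<Union>d\<in>D. {s. poly (p d) s = 0})" using ex_new_if_finite[OF infinite_UNIV_char_0] by blast
  have "(\<Sum>i<n. s ^ i * d i) = poly (p d) s" for d by (simp add: p_def poly_sum poly_monom mult_ac)
  thus ?thesis using s by (intro exI[of _ "\<lambda>i. s ^ i"]) auto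
qed

lemma pmon_local: "(\<And>i. i < m \<Longrightarrow> z i = z' i) \<Longrightarrow> pmon m \<alpha> z = pmon m \<alpha> z'"
  unfolding pmon_def by (intro prod.cong) auto

context regular_quadrics
begin

lemma Qv_local: "(\<And>i. i < n \<Longrightarrow> x i = y i) \<Longrightarrow> Qv j x = Qv j y"
  unfolding Qv_def by (intro arg_cong2[of _ _ _ _ "(+)"] sum.cong refl) auto

text \<open>Elimination is applied to the pair of \<open>x\<close> and a vector \<open>u\<close>,
  with the identity \<open>2 * u = 2 * u\<close> as a second block of linear equations; the
  multipliers are the only nonlinear variables, so the exponent remains \<open>k\<close>. The last
  polynomial is the inner product of \<open>u\<close> and \<open>x\<close>. Keeping \<open>u\<close>
  as an unknown allows it to be chosen generically later: a fixed \<open>u\<close> might kill the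
  relation. The values of the equations are specialised to 0 in the limit.\<close>

lemma critical_relation:
  "\<exists>N c. (\<exists>\<beta>\<in>expbox (2 * n + (k + 1)) (\<lambda>i. if i \<in> {2*n..<2*n+k} then 0 else if i < 2 * n then N else elim_degree (2 * n) k). c \<beta> \<noteq> 0) \<and>
     (\<forall>x\<in>M. \<forall>\<eta> u. (\<Sum>\<beta>\<in>expbox (2 * n + (k + 1)) (\<lambda>i. if i \<in> {2*n..<2*n+k} then 0 else if i < 2 * n then N else elim_degree (2 * n) k).
         c \<beta> * pmon (2 * n + (k + 1)) \<beta> (\<lambda>i. if i < n then 2 * x i - comb \<eta> x i
         else if i < 2 * n then 2 * u (i - n) else \<Sum>l<n. u l * x l)) = 0)"
proof -
  define A where "A i j y = (if i < n \<and> j < n then (if i = j then 2 else 0) - 2 * (\<Sum>l<k. S l i j * y l)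
      else if i = j then 2 else 0)" for i j and y :: "nat \<Rightarrow> real"
  define B where "B i y = (if i < n then \<Sum>l<k. b l i * y l else 0)" for i and y :: "nat \<Rightarrow> real"
  define P where "P l x y = (if l < k then Qv l x else \<Sum>i<n. x (n + i) * x i)" for l and x y :: "nat \<Rightarrow> real"
  define V where "V i x y = (\<Sum>j<2*n. A i j y * x j) - B i y" for i x y
  define r where "r = 2 * n + (k + 1)"
  have pfA: "pf k (\<lambda>_. 2) (A i j)" for i j
  proof -
    have "pf k (\<lambda>_. 2) (\<lambda>y. (if i = j then 2 else 0) - 2 * (\<Sum>l<k. S l i j * y l))"
      by (intro pf_diff pf_const pf_smult pf_sum pf_var) auto
    thus ?thesis unfolding A_def by (cases "i < n \<and> j < n") (auto intro: pf_const)
  qed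
  have pfB: "pf k (\<lambda>_. 2) (B i)" for i
    unfolding B_def by (cases "i < n") (auto intro!: pf_const pf_smult pf_sum pf_var)
  have v: "xq (2 * n) k 1 0 (\<lambda>x y. x i)" if "i < 2 * n" for i by (rule xq_var[OF that])
  have vv: "xq (2 * n) k 2 0 (\<lambda>x y. x i * x j)" if "i < 2 * n" "j < 2 * n" for i j
    using xq_mult[OF v[OF that(1)] v[OF that(2)]] by (simp add: numeral_2_eq_2)
  have xqP: "xq (2 * n) k 2 2 (P l)" for l
  proof (cases "l < k")
    case True
    have "xq (2 * n) k 2 0 (\<lambda>x y. Qv l x)" unfolding Qv_def
      by (intro xq_add xq_sum xq_smult vv xq_mono[OF xq_const] xq_mono[OF v]) auto
    moreover have "P l = (\<lambda>x y. Qv l x)" using True by (auto simp: P_def fun_eq_iff)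
    ultimately show ?thesis by (simp add: xq_mono)
  next
    case False
    have "xq (2 * n) k 2 0 (\<lambda>x y. \<Sum>i<n. x (n + i) * x i)" by (intro xq_sum vv) auto
    moreover have "P l = (\<lambda>x y. \<Sum>i<n. x (n + i) * x i)" using False by (auto simp: P_def fun_eq_iff)
    ultimately show ?thesis by (simp add: xq_mono)
  qed
  have A0: "A i j (\<lambda>_. 0) = (if i = j then 2 else 0)" for i j by (auto simp: A_def)
  obtain N c where c: "\<exists>\<alpha>\<in>expbox r (\<lambda>i. if i < 2 * n then N else elim_degree (2 * n) k). c \<alpha> \<noteq> 0"
     "\<And>x y. (\<forall>i\<ge>2*n. x i = 0) \<Longrightarrow> (\<Sum>\<alpha>\<in>expbox r (\<lambda>i. if i < 2 * n then N else elim_degree (2 * n) k).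
        c \<alpha> * pmon r \<alpha> (\<lambda>i. if i < 2 * n then V i x y else P (i - 2 * n) x y)) = 0"
    by (rule eliminationE[of "2 * n" k A "\<lambda>_. 0" 2 B P r, OF pfA A0 _ pfB xqP r_def, folded V_def]) auto
  define I where "I = {2*n..<2*n+k}"
  define d where "d = (\<lambda>i. if i < 2 * n then N else elim_degree (2 * n) k)"
  have I: "I \<subseteq> {..<r}" by (auto simp: I_def r_def)
  obtain c' where c0: "(\<exists>\<beta>\<in>expbox r (\<lambda>i. if i \<in> I then 0 else d i). c' \<beta> \<noteq> (0::real)) \<and>
     (\<forall>z0. (\<forall>a. a \<longlonglongrightarrow> (\<lambda>_. 0) \<longrightarrow> (\<exists>z. z \<longlonglongrightarrow> z0 \<and> (\<forall>\<^sub>F j in sequentially.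
              (\<Sum>\<alpha>\<in>expbox r d. c \<alpha> * pmon r \<alpha> (\<lambda>i. if i \<in> I then a j i else z j i)) = 0))) \<longrightarrow>
        (\<Sum>\<beta>\<in>expbox r (\<lambda>i. if i \<in> I then 0 else d i). c' \<beta> * pmon r \<beta> z0) = 0)"
    using specialise_limit[OF I c(1)[folded d_def]] by (rule exE)
  note c' = c0[THEN conjunct1] c0[THEN conjunct2, rule_format]
  have main: "(\<Sum>\<beta>\<in>expbox r (\<lambda>i. if i \<in> I then 0 else d i). c' \<beta> * pmon r \<beta> (\<lambda>i. if i < n then 2 * x i - comb \<eta> x i
         else if i < 2 * n then 2 * u (i - n) else \<Sum>l<n. u l * x l)) = 0" if x: "x \<in> M" for x \<eta> u
  proof (rule c'(2))
    fix a :: "nat \<Rightarrow> nat \<Rightarrow> real" assume a: "a \<longlonglongrightarrow> (\<lambda>_. 0)"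
    have "(\<lambda>m. a m (2 * n + j)) \<longlonglongrightarrow> 0" for j using tendsto_fun[OF a, of "2 * n + j"] by simp
    then obtain X where X: "\<And>m. X m \<in> Rn n" "X \<longlonglongrightarrow> x" "\<forall>\<^sub>F m in sequentially. \<forall>j<k. Qv j (X m) = a m (2 * n + j)"
      using solve_sequence[OF x, of "\<lambda>m j. a m (2 * n + j)"] by blast
    define Z where "Z x = (\<lambda>i. if i < n then 2 * x i - comb \<eta> x i
         else if i < 2 * n then 2 * u (i - n) else \<Sum>l<n. u l * x l)" for x
    define xh where "xh m i = (if i < n then X m i else if i < 2 * n then u (i - n) else 0)" for m i
    have VZ: "V i (xh m) \<eta> = Z (X m) i" if "i < 2 * n" for i m
    proof (cases "i < n")
      case True
      have "(\<Sum>j<2*n. A i j \<eta> * xh m j) = (\<Sum>j<n. A i j \<eta> * xh m j) + (\<Sum>j<n. A i (n + j) \<eta> * xh m (n + j))"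
        by (simp add: mult_2 sum_lessThan_add)
      also have "(\<Sum>j<n. A i (n + j) \<eta> * xh m (n + j)) = 0" using True by (simp add: A_def)
      also have "(\<Sum>j<n. A i j \<eta> * xh m j) = (\<Sum>j<n. (if i = j then 2 * X m j else 0) - 2 * ((\<Sum>l<k. S l i j * \<eta> l) * X m j))"
        using True by (intro sum.cong) (auto simp: A_def xh_def algebra_simps)
      also have "\<dots> = 2 * X m i - 2 * (\<Sum>j<n. (\<Sum>l<k. S l i j * \<eta> l) * X m j)"
        unfolding sum_subtractf sum_distrib_left[symmetric] using True by simp
      also have "(\<Sum>j<n. (\<Sum>l<k. S l i j * \<eta> l) * X m j) = (\<Sum>l<k. \<eta> l * (\<Sum>j<n. S l i j * X m j))"
        by (simp add: sum_distrib_left sum_distrib_right mult_ac) (rule sum.swap)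
      finally have "V i (xh m) \<eta> = 2 * X m i - 2 * (\<Sum>l<k. \<eta> l * (\<Sum>j<n. S l i j * X m j)) - (\<Sum>l<k. b l i * \<eta> l)"
        using True by (simp add: V_def B_def)
      also have "\<dots> = 2 * X m i - comb \<eta> (X m) i"
        using True by (simp add: comb_def G_def algebra_simps sum.distrib sum_distrib_left)
      finally show ?thesis using True by (simp add: Z_def)
    next
      case False
      have "(\<Sum>j<2*n. A i j \<eta> * xh m j) = (\<Sum>j<2*n. if j = i then 2 * xh m i else 0)"
        using False by (intro sum.cong) (auto simp: A_def)
      thus ?thesis using False that by (simp add: V_def B_def Z_def xh_def)
    qed
    have "(Z \<circ> X) \<longlonglongrightarrow> Z x" unfolding tendsto_fun_iff
    proof
      fix i
      have "(\<lambda>m. comb \<eta> (X m) i) \<longlonglongrightarrow> comb \<eta> x i" by (rule tendsto_comb[OF X(2) tendsto_const])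
      thus "(\<lambda>m. (Z \<circ> X) m i) \<longlonglongrightarrow> Z x i" unfolding Z_def o_def
        by (cases "i < n"; cases "i < 2 * n") (auto intro!: tendsto_intros tendsto_fun[OF X(2)])
    qed
    moreover have "\<forall>\<^sub>F m in sequentially. (\<Sum>\<alpha>\<in>expbox r d. c \<alpha> * pmon r \<alpha> (\<lambda>i. if i \<in> I then a m i else (Z \<circ> X) m i)) = 0"
      using X(3)
    proof eventually_elim
      case (elim m)
      have "pmon r \<alpha> (\<lambda>i. if i \<in> I then a m i else (Z \<circ> X) m i) =
            pmon r \<alpha> (\<lambda>i. if i < 2 * n then V i (xh m) \<eta> else P (i - 2 * n) (xh m) \<eta>)" for \<alpha>
      proof (rule pmon_local)
        fix i assume i: "i < r"
        have q: "Qv l (xh m) = Qv l (X m)" for l by (rule Qv_local) (simp add: xh_def)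
        consider "i < 2 * n" | "i \<in> I" | "i = 2 * n + k" using i by (force simp: I_def r_def)
        thus "(if i \<in> I then a m i else (Z \<circ> X) m i) = (if i < 2 * n then V i (xh m) \<eta> else P (i - 2 * n) (xh m) \<eta>)"
        proof cases
          case 2
          hence "i - 2 * n < k" "2 * n + (i - 2 * n) = i" by (auto simp: I_def)
          thus ?thesis using 2 elim[rule_format, of "i - 2 * n"] by (auto simp: I_def P_def q)
        next
          case 3
          thus ?thesis by (auto simp: I_def P_def Z_def xh_def intro!: sum.cong)
        qed (auto simp: VZ I_def)
      qed
      thus ?case using c(2)[of "xh m" \<eta>] by (simp add: d_def xh_def)
    qed
    ultimately show "\<exists>z. z \<longlonglongrightarrow> (\<lambda>i. if i < n then 2 * x i - comb \<eta> x i
         else if i < 2 * n then 2 * u (i - n) else \<Sum>l<n. u l * x l) \<and> (\<forall>\<^sub>F j in sequentially.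
              (\<Sum>\<alpha>\<in>expbox r d. c \<alpha> * pmon r \<alpha> (\<lambda>i. if i \<in> I then a j i else z j i)) = 0)"
      unfolding Z_def by blast
  qed
  show ?thesis unfolding r_def[symmetric] I_def[symmetric]
    using c'(1) main unfolding d_def by blast
qed

text \<open>With the first block of the relation specialised to \<open>- 2 * e\<close> for a generic
  \<open>e\<close>, the relation holds at all critical points of \<open>f e\<close>. A separating
  \<open>u\<close> makes it a polynomial equation of bounded degree for the inner products with
  \<open>u\<close>, which are distinct at distinct critical points.\<close>

lemma critical_points_bounded:
  "\<exists>e. (\<forall>i. \<bar>e i\<bar> \<le> 1) \<and> finite (Crit e) \<and> card (Crit e) \<le> elim_degree (2 * n) k"
proof -
  define E where "E = elim_degree (2 * n) k"
  define r where "r = 2 * n + (k + 1)"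
  obtain N c where c0: "(\<exists>\<beta>\<in>expbox r (\<lambda>i. if i \<in> {2*n..<2*n+k} then 0 else if i < 2 * n then N else E). c \<beta> \<noteq> 0) \<and>
     (\<forall>x\<in>M. \<forall>\<eta> u. (\<Sum>\<beta>\<in>expbox r (\<lambda>i. if i \<in> {2*n..<2*n+k} then 0 else if i < 2 * n then N else E).
         c \<beta> * pmon r \<beta> (\<lambda>i. if i < n then 2 * x i - comb \<eta> x i
         else if i < 2 * n then 2 * u (i - n) else \<Sum>l<n. u l * x l)) = 0)"
    using critical_relation[folded E_def r_def] by blast
  note c = c0[THEN conjunct1] c0[THEN conjunct2, rule_format]
  define d where "d = (\<lambda>i. if i \<in> {2*n..<2*n+k} then 0 else if i < 2 * n then N else E)"
  have "{..<n} \<subseteq> {..<r}" by (auto simp: r_def)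
  then obtain a c1 where
    a: "\<And>i. \<bar>a i - 0\<bar> < 2" and c1: "\<exists>\<beta>\<in>expbox r (\<lambda>i. if i \<in> {..<n} then 0 else d i). c1 \<beta> \<noteq> 0"
    "\<And>w. (\<Sum>\<alpha>\<in>expbox r d. c \<alpha> * pmon r \<alpha> (\<lambda>i. if i \<in> {..<n} then a i else w i))
        = (\<Sum>\<beta>\<in>expbox r (\<lambda>i. if i \<in> {..<n} then 0 else d i). c1 \<beta> * pmon r \<beta> w)"
    by (rule specialise_genericE[OF finite_lessThan _ c(1)[folded d_def], of n 2 "\<lambda>_. 0"]) auto
  \<comment> \<open>At a critical point \<open>2 * x i - comb \<eta> x i\<close> equals
    \<open>- 2 * e i\<close>, which must be the specialised value \<open>a i\<close>; the radius 2
    around 0 makes the entries of \<open>e\<close> at most 1.\<close>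
  define e where "e i = - a i / 2" for i
  define d1 where "d1 = (\<lambda>i. if i \<in> {..<n} then 0 else d i)"
  have crit: "(\<Sum>\<beta>\<in>expbox r d1. c1 \<beta> * pmon r \<beta> (\<lambda>i. if i < 2 * n then 2 * u (i - n) else \<Sum>l<n. u l * x l)) = 0"
    if "x \<in> Crit e" for x u
  proof -
    from that obtain \<eta> where x: "x \<in> M" "\<And>i. i < n \<Longrightarrow> xi e \<eta> x i = 0" by (auto simp: Crit_def)
    have "(\<Sum>\<beta>\<in>expbox r d1. c1 \<beta> * pmon r \<beta> (\<lambda>i. if i < 2 * n then 2 * u (i - n) else \<Sum>l<n. u l * x l)) =
      (\<Sum>\<alpha>\<in>expbox r d. c \<alpha> * pmon r \<alpha> (\<lambda>i. if i \<in> {..<n} then a i else if i < 2 * n then 2 * u (i - n) else \<Sum>l<n. u l * x l))"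
      unfolding d1_def by (rule c1(2)[symmetric])
    also have "(\<lambda>i. if i \<in> {..<n} then a i else if i < 2 * n then 2 * u (i - n) else \<Sum>l<n. u l * x l)
      = (\<lambda>i. if i < n then 2 * x i - comb \<eta> x i else if i < 2 * n then 2 * u (i - n) else \<Sum>l<n. u l * x l)"
    proof -
      have "2 * x i - comb \<eta> x i = a i" if "i < n" for i using x(2)[OF that] that by (simp add: xi_def e_def)
      thus ?thesis by auto
    qed
    finally show ?thesis using c(2)[OF x(1), of \<eta> u] by (simp add: d_def)
  qed
  \<comment> \<open>The separating vector depends on the points to be separated, and finiteness of
    \<open>Crit e\<close> is not yet known; therefore the bound is shown for finite subsets.\<close>
  have bound: "card F \<le> E" if F: "finite F" "F \<subseteq> Crit e" for F
  proof -
    define D where "D = (\<lambda>(x, y) i. x i - y i) ` {p \<in> F \<times> F. fst p \<noteq> snd p}"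
    have finD: "finite D" unfolding D_def
    proof (rule finite_imageI)
      show "finite {p \<in> F \<times> F. fst p \<noteq> snd p}" by (rule finite_subset[of _ "F \<times> F"]) (use F(1) in auto)
    qed
    have Dbd: "\<bar>d i\<bar> \<le> 2" if "d \<in> D" "i < n" for d i
    proof -
      from that obtain x y where xy: "x \<in> F" "y \<in> F" "d = (\<lambda>i. x i - y i)" by (auto simp: D_def)
      have "x \<in> M" "y \<in> M" using xy F(2) by (auto simp: Crit_def)
      hence "\<bar>x i\<bar> \<le> 1" "\<bar>y i\<bar> \<le> 1"
        using coord_le_eucl_norm[OF that(2), of x] coord_le_eucl_norm[OF that(2), of y] by (auto simp: M_def)
      thus ?thesis by (auto simp: xy(3))
    qed
    have "\<exists>i<n. d i \<noteq> 0" if "d \<in> D" for d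
    proof -
      from that obtain x y where xy: "x \<in> F" "y \<in> F" "x \<noteq> y" "d = (\<lambda>i. x i - y i)" by (auto simp: D_def)
      have "x \<in> Rn n" "y \<in> Rn n" using xy F(2) M_Rn by (auto simp: Crit_def)
      moreover obtain i where "x i \<noteq> y i" using xy(3) by blast
      ultimately have "i < n" unfolding Rn_def by (metis (mono_tags, lifting) mem_Collect_eq not_less)
      thus ?thesis using \<open>x i \<noteq> y i\<close> xy(4) by auto
    qed
    from separating_vector[OF finD this] obtain u0 where u0: "\<And>d. d \<in> D \<Longrightarrow> (\<Sum>i<n. u0 i * d i) \<noteq> 0" by auto
    obtain \<delta> where \<delta>: "\<delta> > 0" "\<And>d. d \<in> D \<Longrightarrow> \<bar>\<Sum>i<n. u0 i * d i\<bar> \<ge> \<delta>"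
    proof (cases "D = {}")
      case False
      show ?thesis by (rule that[of "Min ((\<lambda>d. \<bar>\<Sum>i<n. u0 i * d i\<bar>) ` D)"]) (use False finD u0 in auto)
    qed (use that[of 1] in auto)
    \<comment> \<open>Differences of points of the ball have entries at most 2, so a change of
      \<open>u0\<close> by less than \<open>\<rho>\<close> moves each inner product by at most
      \<open>2 * n * \<rho>\<close>, which is less than \<open>\<delta>\<close>.\<close>
    define \<rho> where "\<rho> = \<delta> / (2 * real n + 1)"
    have \<rho>: "\<rho> > 0" using \<delta>(1) by (simp add: \<rho>_def)
    have "{n..<2*n} \<subseteq> {..<r}" by (auto simp: r_def)
    then obtain a2 c2 where
      a2: "\<And>i. \<bar>a2 i - 2 * u0 (i - n)\<bar> < 2 * \<rho>" and c2: "\<exists>\<beta>\<in>expbox r (\<lambda>i. if i \<in> {n..<2*n} then 0 else d1 i). c2 \<beta> \<noteq> 0"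
      "\<And>w. (\<Sum>\<alpha>\<in>expbox r d1. c1 \<alpha> * pmon r \<alpha> (\<lambda>i. if i \<in> {n..<2*n} then a2 i else w i))
        = (\<Sum>\<beta>\<in>expbox r (\<lambda>i. if i \<in> {n..<2*n} then 0 else d1 i). c2 \<beta> * pmon r \<beta> w)"
      by (rule specialise_genericE[OF finite_atLeastLessThan _ c1(1)[folded d1_def], of n "2 * n" "2 * \<rho>" "\<lambda>i. 2 * u0 (i - n)"]) (use \<rho> in auto)
    define d2 where "d2 = (\<lambda>i. if i \<in> {n..<2*n} then 0 else d1 i)"
    define u where "u i = a2 (n + i) / 2" for i
    have du: "\<bar>u i - u0 i\<bar> < \<rho>" for i using a2[of "n + i"] by (simp add: u_def abs_less_iff)
    have sep: "(\<Sum>i<n. u i * d i) \<noteq> 0" if "d \<in> D" for d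
    proof -
      have "\<bar>\<Sum>i<n. (u i - u0 i) * d i\<bar> \<le> (\<Sum>i<n. \<rho> * 2)"
      proof (rule order_trans[OF sum_abs], rule sum_mono)
        fix i assume "i \<in> {..<n}"
        hence "\<bar>u i - u0 i\<bar> * \<bar>d i\<bar> \<le> \<rho> * 2"
          using less_imp_le[OF du[of i]] Dbd[OF that, of i] \<rho> by (intro mult_mono) auto
        thus "\<bar>(u i - u0 i) * d i\<bar> \<le> \<rho> * 2" by (simp add: abs_mult)
      qed
      also have "\<dots> = 2 * real n * \<rho>" by simp
      also have "\<dots> < \<delta>"
      proof -
        have "\<delta> = (2 * real n + 1) * \<rho>" unfolding \<rho>_def by (simp add: field_simps)
        thus ?thesis using \<rho> by (simp add: algebra_simps)
      qed
      finally have "\<bar>(\<Sum>i<n. u i * d i) - (\<Sum>i<n. u0 i * d i)\<bar> < \<delta>"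
        by (simp add: sum_subtractf algebra_simps)
      thus ?thesis using \<delta>(2)[OF that] by auto
    qed
    have "i = 2 * n + k" if "i < r" "d2 i \<noteq> 0" for i
      using that by (auto simp: d2_def d1_def d_def r_def split: if_splits)
    hence z2: "\<And>i. i < r \<Longrightarrow> i \<noteq> 2 * n + k \<Longrightarrow> d2 i = 0" by blast
    have "\<exists>p. p \<noteq> 0 \<and> degree p \<le> d2 (2 * n + k) \<and> (\<forall>w. (\<Sum>\<beta>\<in>expbox r d2. c2 \<beta> * pmon r \<beta> w) = poly p (w (2 * n + k)))"
      by (rule univariate_root_count[OF c2(1)[folded d2_def] _ z2]) (auto simp: r_def)
    then obtain p where p: "p \<noteq> 0" "degree p \<le> d2 (2 * n + k)" "\<And>w. (\<Sum>\<beta>\<in>expbox r d2. c2 \<beta> * pmon r \<beta> w) = poly p (w (2 * n + k))"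
      by blast
    have "poly p (\<Sum>l<n. u l * x l) = 0" if "x \<in> F" for x
    proof -
      define w where "w i = (if i < 2 * n then 2 * u (i - n) else \<Sum>l<n. u l * x l)" for i
      have "poly p (\<Sum>l<n. u l * x l) = poly p (w (2 * n + k))" by (simp add: w_def)
      also have "\<dots> = (\<Sum>\<alpha>\<in>expbox r d1. c1 \<alpha> * pmon r \<alpha> (\<lambda>i. if i \<in> {n..<2*n} then a2 i else w i))"
        unfolding p(3)[symmetric] d2_def c2(2) ..
      also have "\<dots> = (\<Sum>\<alpha>\<in>expbox r d1. c1 \<alpha> * pmon r \<alpha> (\<lambda>i. if i < n then 0 else w i))"
      proof (rule sum.cong[OF refl], rule arg_cong2[of _ _ _ _ "(*)", OF refl])
        fix \<alpha> assume "\<alpha> \<in> expbox r d1"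
        hence z: "\<alpha> i = 0" if "i < n" for i
          using PiE_mem[of \<alpha> "{..<r}" "\<lambda>i. {..d1 i}" i] that by (auto simp: expbox_def d1_def r_def)
        show "pmon r \<alpha> (\<lambda>i. if i \<in> {n..<2*n} then a2 i else w i) = pmon r \<alpha> (\<lambda>i. if i < n then 0 else w i)"
          unfolding pmon_def by (intro prod.cong) (auto simp: z w_def u_def)
      qed
      also have "\<dots> = (\<Sum>\<alpha>\<in>expbox r d1. c1 \<alpha> * pmon r \<alpha> w)"
      proof (rule sum.cong[OF refl], rule arg_cong2[of _ _ _ _ "(*)", OF refl])
        fix \<alpha> assume "\<alpha> \<in> expbox r d1"
        hence z: "\<alpha> i = 0" if "i < n" for i
          using PiE_mem[of \<alpha> "{..<r}" "\<lambda>i. {..d1 i}" i] that by (auto simp: expbox_def d1_def r_def)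
        show "pmon r \<alpha> (\<lambda>i. if i < n then 0 else w i) = pmon r \<alpha> w"
          unfolding pmon_def by (intro prod.cong) (auto simp: z)
      qed
      also have "\<dots> = 0" unfolding w_def using crit[of x u] that F(2) by auto
      finally show ?thesis .
    qed
    hence "(\<lambda>x. \<Sum>l<n. u l * x l) ` F \<subseteq> {s. poly p s = 0}" by auto
    hence "card ((\<lambda>x. \<Sum>l<n. u l * x l) ` F) \<le> card {s. poly p s = 0}"
      by (rule card_mono[OF poly_roots_finite[OF p(1)]])
    also have "\<dots> \<le> degree p" by (rule card_poly_roots_bound[OF p(1)])
    also have "\<dots> \<le> E" using p(2) by (simp add: d2_def d1_def d_def)
    also have "card ((\<lambda>x. \<Sum>l<n. u l * x l) ` F) = card F"
    proof (rule card_image, rule inj_onI, rule ccontr)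
      fix x y assume xy: "x \<in> F" "y \<in> F" "(\<Sum>l<n. u l * x l) = (\<Sum>l<n. u l * y l)" "x \<noteq> y"
      hence "(\<lambda>i. x i - y i) \<in> D" by (force simp: D_def)
      from sep[OF this] xy(3) show False by (simp add: algebra_simps sum_subtractf)
    qed
    finally show ?thesis .
  qed
  have "finite (Crit e)"
  proof (rule ccontr)
    assume "infinite (Crit e)"
    then obtain F where "finite F" "card F = Suc E" "F \<subseteq> Crit e" using infinite_arbitrarily_large by blast
    thus False using bound[of F] by simp
  qed
  moreover have "\<bar>e i\<bar> \<le> 1" for i using a[of i] by (simp add: e_def)
  ultimately show ?thesis using bound[of "Crit e"] unfolding E_def by blast
qed

end

subsection \<open>Variation of algebraic functions\<close>

text \<open>The coefficient \<open>q\<close> of a fixed power of the first variable is a nonzero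
  polynomial in the second one. For values \<open>s\<close> outside its roots, the relation remains
  a nontrivial equation for the first variable.\<close>

lemma two_variable_relation:
  assumes "\<exists>\<beta>\<in>expbox r d. c \<beta> \<noteq> 0" "i1 < r" "i2 < r" "i1 \<noteq> i2"
    "\<And>i. i < r \<Longrightarrow> i \<noteq> i1 \<Longrightarrow> i \<noteq> i2 \<Longrightarrow> d i = 0"
  shows "\<exists>Z. finite Z \<and> (\<forall>s. s \<notin> Z \<longrightarrow> (\<exists>p. p \<noteq> 0 \<and> degree p \<le> d i1 \<and>
     (\<forall>w. w i2 = s \<longrightarrow> (\<Sum>\<beta>\<in>expbox r d. c \<beta> * pmon r \<beta> w) = poly p (w i1))))"
proof -
  have le: "\<beta> i \<le> d i" if "\<beta> \<in> expbox r d" "i < r" for \<beta> i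
    using PiE_mem[OF that(1)[unfolded expbox_def], of i] that(2) by simp
  obtain \<beta>0 where b: "\<beta>0 \<in> expbox r d" "c \<beta>0 \<noteq> 0" using assms(1) by blast
  have inj: "\<beta> = \<beta>0" if "\<beta> \<in> expbox r d" "\<beta> i1 = \<beta>0 i1" "\<beta> i2 = \<beta>0 i2" for \<beta>
  proof (rule PiE_ext[OF that(1)[unfolded expbox_def] b(1)[unfolded expbox_def]])
    fix i assume "i \<in> {..<r}"
    thus "\<beta> i = \<beta>0 i" using le[OF that(1), of i] le[OF b(1), of i] assms(5)[of i] that(2,3)
      by (cases "i = i1"; cases "i = i2") auto
  qed
  have pm: "pmon r \<beta> w = w i1 ^ \<beta> i1 * w i2 ^ \<beta> i2" if "\<beta> \<in> expbox r d" for \<beta> w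
  proof -
    have "pmon r \<beta> w = (\<Prod>i<r. (if i = i1 then w i1 ^ \<beta> i1 else 1) * (if i = i2 then w i2 ^ \<beta> i2 else 1))"
      unfolding pmon_def using le[OF that] assms(4,5) by (intro prod.cong) fastforce+
    thus ?thesis using assms(2,3) by (simp add: prod.distrib)
  qed
  define q where "q = (\<Sum>\<beta>\<in>expbox r d. if \<beta> i1 = \<beta>0 i1 then monom (c \<beta>) (\<beta> i2) else 0)"
  have "coeff q (\<beta>0 i2) = (\<Sum>\<beta>\<in>expbox r d. if \<beta> = \<beta>0 then c \<beta>0 else 0)"
    unfolding q_def coeff_sum by (intro sum.cong refl) (use inj in \<open>auto simp: coeff_monom\<close>)
  also have "\<dots> = c \<beta>0" using b(1) by simp
  finally have qnz: "q \<noteq> 0" using b(2) by auto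
  show ?thesis
  proof (intro exI[of _ "{s. poly q s = 0}"] conjI allI impI)
    show "finite {s. poly q s = 0}" by (rule poly_roots_finite[OF qnz])
    fix s assume "s \<notin> {s. poly q s = 0}"
    hence qs: "poly q s \<noteq> 0" by simp
    define p where "p = (\<Sum>\<beta>\<in>expbox r d. monom (c \<beta> * s ^ \<beta> i2) (\<beta> i1))"
    have "coeff p (\<beta>0 i1) = poly q s"
      unfolding p_def q_def coeff_sum poly_sum by (intro sum.cong refl) (auto simp: coeff_monom poly_monom)
    hence "p \<noteq> 0" using qs by auto
    moreover have "degree p \<le> d i1" unfolding p_def
      by (intro degree_sum_le) (auto intro!: order_trans[OF degree_monom_le] le assms(2))
    moreover have "(\<Sum>\<beta>\<in>expbox r d. c \<beta> * pmon r \<beta> w) = poly p (w i1)" if "w i2 = s" for w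
      unfolding p_def poly_sum using that by (intro sum.cong refl) (simp add: pm poly_monom)
    ultimately show "\<exists>p. p \<noteq> 0 \<and> degree p \<le> d i1 \<and>
       (\<forall>w. w i2 = s \<longrightarrow> (\<Sum>\<beta>\<in>expbox r d. c \<beta> * pmon r \<beta> w) = poly p (w i1))" by blast
  qed
qed

text \<open>The total variation is the integral over all levels of the number of crossings of the level.\<close>

lemma variation_le_of_level_sets:
  fixes g :: "real \<Rightarrow> real"
  assumes cont: "continuous_on {lo..hi} g"
    and Z: "finite Z" "\<And>s. s \<notin> Z \<Longrightarrow> finite {\<tau> \<in> {lo..hi}. g \<tau> = s} \<and> card {\<tau> \<in> {lo..hi}. g \<tau> = s} \<le> E"
    and B: "\<And>\<tau>. \<tau> \<in> {lo..hi} \<Longrightarrow> \<bar>g \<tau>\<bar> \<le> B"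
    and t: "\<And>i. i \<le> N \<Longrightarrow> t i \<in> {lo..hi}" "\<And>i. i < N \<Longrightarrow> t i < t (Suc i)"
  shows "(\<Sum>i<N. \<bar>g (t (Suc i)) - g (t i)\<bar>) \<le> 2 * B * real E"
proof -
  \<comment> \<open>Open intervals: a level in \<open>J i\<close> differs from both end values,
    hence is attained strictly between \<open>t i\<close> and \<open>t (Suc i)\<close>, and
    crossings for different \<open>i\<close> are different points.\<close>
  define J where "J i = {min (g (t i)) (g (t (Suc i)))<..<max (g (t i)) (g (t (Suc i)))}" for i
  have B0: "B \<ge> 0" using B[OF t(1)[of 0]] by simp
  have mono: "t i \<le> t j" if "i \<le> j" "j \<le> N" for i j
    using that
  proof (induction j rule: dec_induct)
    case (step j)
    thus ?case using t(2)[of j] by simp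
  qed simp
  have cnt: "card {i. i < N \<and> s \<in> J i} \<le> E" if "s \<notin> Z" for s
  proof -
    have "\<exists>\<tau>. t i < \<tau> \<and> \<tau> < t (Suc i) \<and> g \<tau> = s" if "i < N" "s \<in> J i" for i
    proof -
      have "t i < t (Suc i)" by (rule t(2)[OF that(1)])
      have c: "continuous_on {t i..t (Suc i)} g"
        by (rule continuous_on_subset[OF cont]) (use t(1)[of i] t(1)[of "Suc i"] that(1) in auto)
      have "\<exists>\<tau>\<ge>t i. \<tau> \<le> t (Suc i) \<and> g \<tau> = s"
      proof (cases "g (t i) \<le> g (t (Suc i))")
        case True
        thus ?thesis using that(2) \<open>t i < t (Suc i)\<close> c by (intro IVT') (auto simp: J_def)
      next
        case False
        thus ?thesis using that(2) \<open>t i < t (Suc i)\<close> c by (intro IVT2') (auto simp: J_def)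
      qed
      then obtain \<tau> where \<tau>: "t i \<le> \<tau>" "\<tau> \<le> t (Suc i)" "g \<tau> = s" by blast
      have "\<tau> \<noteq> t i" "\<tau> \<noteq> t (Suc i)" using \<tau>(3) that(2) by (auto simp: J_def)
      thus ?thesis using \<tau> by (intro exI[of _ \<tau>]) auto
    qed
    then obtain \<tau> where \<tau>: "\<And>i. i < N \<Longrightarrow> s \<in> J i \<Longrightarrow> t i < \<tau> i \<and> \<tau> i < t (Suc i) \<and> g (\<tau> i) = s" by metis
    have "\<tau> i < \<tau> j" if "i < j" "i < N" "j < N" "s \<in> J i" "s \<in> J j" for i j
      using \<tau>[of i] \<tau>[of j] mono[of "Suc i" j] that by fastforce
    hence "inj_on \<tau> {i. i < N \<and> s \<in> J i}"
      by (intro inj_onI) (metis (mono_tags, lifting) mem_Collect_eq nat_neq_iff order_less_irrefl)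
    hence "card {i. i < N \<and> s \<in> J i} = card (\<tau> ` {i. i < N \<and> s \<in> J i})" by (simp add: card_image)
    also have "\<dots> \<le> card {\<tau> \<in> {lo..hi}. g \<tau> = s}"
    proof (rule card_mono)
      show "\<tau> ` {i. i < N \<and> s \<in> J i} \<subseteq> {\<tau> \<in> {lo..hi}. g \<tau> = s}"
      proof safe
        fix i assume i: "i < N" "s \<in> J i"
        show "g (\<tau> i) = s" "\<tau> i \<in> {lo..hi}"
          using \<tau>[OF i] t(1)[of i] t(1)[of "Suc i"] i(1) by auto
      qed
    qed (use Z(2)[OF that] in blast)
    also have "\<dots> \<le> E" using Z(2)[OF that] by blast
    finally show ?thesis .
  qed
  have int: "integrable lborel (indicator (J i) :: real \<Rightarrow> real)" for i
    unfolding J_def by (rule integrable_real_indicator) (auto simp: emeasure_lborel_Ioo)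
  have "(\<Sum>i<N. \<bar>g (t (Suc i)) - g (t i)\<bar>) = (\<Sum>i<N. integral\<^sup>L lborel (indicator (J i)))"
    by (intro sum.cong refl) (auto simp: J_def max_def min_def)
  also have "\<dots> = integral\<^sup>L lborel (\<lambda>s. \<Sum>i<N. indicator (J i) s)"
    by (rule Bochner_Integration.integral_sum[symmetric]) (rule int)
  also have "\<dots> \<le> integral\<^sup>L lborel (\<lambda>s. real E * indicator {-B..B} s)"
  proof (rule integral_mono_AE)
    show "integrable lborel (\<lambda>s. \<Sum>i<N. indicator (J i) s :: real)"
      by (intro Bochner_Integration.integrable_sum int)
    show "integrable lborel (\<lambda>s. real E * indicator {-B..B} s)"
      by (intro integrable_mult_right integrable_real_indicator) (auto simp: emeasure_lborel_Icc_eq)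
    have "AE s in lborel. s \<notin> Z" using Z(1) by (intro AE_not_in) (simp add: finite_imp_null_set_lborel)
    thus "AE s in lborel. (\<Sum>i<N. indicator (J i) s) \<le> real E * indicator {-B..B} s"
    proof eventually_elim
      case (elim s)
      show ?case
      proof (cases "s \<in> {-B..B}")
        case True
        have "(\<Sum>i<N. indicator (J i) s :: real) = real (card {i. i < N \<and> s \<in> J i})"
        proof -
          have "(\<Sum>i<N. indicator (J i) s :: real) = (\<Sum>i\<in>{i. i < N \<and> s \<in> J i}. 1)"
            by (rule sum.mono_neutral_cong_right) (auto simp: indicator_def)
          thus ?thesis by simp
        qed
        thus ?thesis using cnt[OF elim] True by simp
      next
        case False
        have "s \<notin> J i" if "i < N" for i
          using False B[OF t(1)[of i]] B[OF t(1)[of "Suc i"]] that by (auto simp: J_def)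
        thus ?thesis using False by simp
      qed
    qed
  qed
  also have "\<dots> = 2 * B * real E" using B0 by simp
  finally show ?thesis .
qed

subsection \<open>The penalised minimisation problem\<close>

definition Bn :: "nat \<Rightarrow> (nat \<Rightarrow> real) set" where
  "Bn n = {x \<in> Rn n. eucl_norm n x \<le> 1}"

lemma compact_Bn: "compact (Bn n)"
  using compact_eucl_cball[of "\<lambda>_. 0" n 1] by (simp add: Bn_def eucl_dist_def Rn_def)

text \<open>The entries from \<open>k\<close> on are fixed to 0, which makes the cube compact in the
  space of all sequences.\<close>

definition Cube :: "nat \<Rightarrow> real \<Rightarrow> (nat \<Rightarrow> real) set" where
  "Cube k L = {y. \<forall>j. y j \<in> (if j < k then {-L..L} else {0})}"

lemma compact_Cube: "compact (Cube k L)"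
  unfolding Cube_def by (rule compact_Pi) auto

context quadrics
begin

text \<open>The squared slope \<open>(\<Sum>l<n. (xi e \<eta> x l)\<^sup>2)\<close> is minimised over the points \<open>x\<close> of \<open>M\<close> with
  \<open>f e x = t\<close> and the multipliers \<open>\<eta>\<close>; both constraints are replaced by penalties. The penalty on
  \<open>Qv\<close> is the stronger one, so that minimisers stay inside the ball also for those \<open>t\<close> that are
  not values of \<open>f\<close> on \<open>M\<close>. The vector \<open>p\<close> collects the generic perturbations.\<close>

definition Phi :: "real \<Rightarrow> (nat \<Rightarrow> real) \<Rightarrow> (nat \<Rightarrow> real) \<Rightarrow> real \<Rightarrow> (nat \<Rightarrow> real) \<Rightarrow> (nat \<Rightarrow> real) \<Rightarrow> real" where
  "Phi \<epsilon> e p t x \<eta> = (\<Sum>l<n. (xi e \<eta> x l) ^ 2) + (\<Sum>j<k. \<epsilon> * \<eta> j ^ 2 - p (n + j) * \<eta> j)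
     + (\<Sum>j<k. (Qv j x - p (n + k + j)) ^ 2 / \<epsilon> ^ 2) + (f e x - t) ^ 2 / \<epsilon> - (\<Sum>i<n. p i * x i)"

text \<open>The multipliers are confined to a cube for compactness only: its side is so large that minimisers
  never reach its boundary.\<close>

definition Lam :: "real \<Rightarrow> real" where
  "Lam \<epsilon> = 2 + (16 * real n + real k + 1) / \<epsilon>"

definition isMin :: "real \<Rightarrow> (nat \<Rightarrow> real) \<Rightarrow> (nat \<Rightarrow> real) \<Rightarrow> real \<Rightarrow> (nat \<Rightarrow> real) \<Rightarrow> (nat \<Rightarrow> real) \<Rightarrow> bool" where
  "isMin \<epsilon> e p t x \<eta> \<longleftrightarrow> x \<in> Bn n \<and> \<eta> \<in> Cube k (Lam \<epsilon>) \<and>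
     (\<forall>x'\<in>Bn n. \<forall>\<eta>'\<in>Cube k (Lam \<epsilon>). Phi \<epsilon> e p t x \<eta> \<le> Phi \<epsilon> e p t x' \<eta>')"

definition W :: "real \<Rightarrow> (nat \<Rightarrow> real) \<Rightarrow> (nat \<Rightarrow> real) \<Rightarrow> real \<Rightarrow> real" where
  "W \<epsilon> e p t = (INF z\<in>Bn n \<times> Cube k (Lam \<epsilon>). Phi \<epsilon> e p t (fst z) (snd z))"

lemma tendsto_Phi:
  assumes "(P \<longlongrightarrow> p) F" "(T \<longlongrightarrow> t) F" "(X \<longlongrightarrow> x) F" "(Y \<longlongrightarrow> \<eta>) F"
  shows "((\<lambda>i. Phi \<epsilon> e (P i) (T i) (X i) (Y i)) \<longlongrightarrow> Phi \<epsilon> e p t x \<eta>) F"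
  unfolding Phi_def divide_inverse
  by (intro tendsto_add tendsto_diff tendsto_sum tendsto_mult tendsto_power tendsto_const
      tendsto_xi tendsto_Qv tendsto_f assms(2,3,4) tendsto_fun[OF assms(1)] tendsto_fun[OF assms(3)] tendsto_fun[OF assms(4)])

lemma Phi_minimiser: "\<epsilon> > 0 \<Longrightarrow> \<exists>x \<eta>. isMin \<epsilon> e p t x \<eta>"
proof -
  assume \<epsilon>: "\<epsilon> > 0"
  let ?K = "Bn n \<times> Cube k (Lam \<epsilon>)"
  have "Lam \<epsilon> \<ge> 0" using \<epsilon> by (simp add: Lam_def)
  hence "(\<lambda>_. 0, \<lambda>_. 0) \<in> ?K" by (auto simp: Bn_def Cube_def Rn_def eucl_norm_def L2_set_def)
  hence "?K \<noteq> {}" by blast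
  moreover have "compact ?K" by (intro compact_Times compact_Bn compact_Cube)
  moreover have "continuous_on ?K (\<lambda>z. Phi \<epsilon> e p t (fst z) (snd z))"
    unfolding continuous_on_def
    by (intro ballI tendsto_Phi tendsto_const tendsto_fst tendsto_snd tendsto_ident_at)
  ultimately obtain z where "z \<in> ?K" "\<forall>y\<in>?K. Phi \<epsilon> e p t (fst z) (snd z) \<le> Phi \<epsilon> e p t (fst y) (snd y)"
    using continuous_attains_inf[of ?K "\<lambda>z. Phi \<epsilon> e p t (fst z) (snd z)"] by blast
  thus ?thesis unfolding isMin_def by (intro exI[of _ "fst z"] exI[of _ "snd z"]) auto
qed

lemma W_eq: "isMin \<epsilon> e p t x \<eta> \<Longrightarrow> W \<epsilon> e p t = Phi \<epsilon> e p t x \<eta>"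
  unfolding W_def isMin_def by (rule cInf_eq_minimum) (auto intro!: rev_image_eqI[of "(x, \<eta>)"])

lemma W_le: "\<epsilon> > 0 \<Longrightarrow> x \<in> Bn n \<Longrightarrow> \<eta> \<in> Cube k (Lam \<epsilon>) \<Longrightarrow> W \<epsilon> e p t \<le> Phi \<epsilon> e p t x \<eta>"
  using Phi_minimiser[of \<epsilon> e p t] W_eq[of \<epsilon> e p t] unfolding isMin_def by metis

text \<open>Above, a minimiser of the limit problem is a competitor for the nearby problems. Below,
  minimisers of nearby problems accumulate in the compact domain; were their values at most
  \<open>a\<close> frequently, the limit point would have a value of at most
  \<open>a\<close>.\<close>

lemma tendsto_W:
  assumes \<epsilon>: "\<epsilon> > 0" and P: "(P \<longlongrightarrow> p) F" and T: "(T \<longlongrightarrow> t) F"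
  shows "((\<lambda>i. W \<epsilon> e (P i) (T i)) \<longlongrightarrow> W \<epsilon> e p t) F"
proof (rule order_tendstoI)
  fix a assume a: "a > W \<epsilon> e p t"
  obtain x \<eta> where m: "isMin \<epsilon> e p t x \<eta>" using Phi_minimiser[OF \<epsilon>] by blast
  have "((\<lambda>i. Phi \<epsilon> e (P i) (T i) x \<eta>) \<longlongrightarrow> Phi \<epsilon> e p t x \<eta>) F"
    by (intro tendsto_Phi P T tendsto_const)
  hence "\<forall>\<^sub>F i in F. Phi \<epsilon> e (P i) (T i) x \<eta> < a" using a W_eq[OF m] by (intro order_tendstoD) auto
  thus "\<forall>\<^sub>F i in F. W \<epsilon> e (P i) (T i) < a"
  proof eventually_elim
    case (elim i)
    have "W \<epsilon> e (P i) (T i) \<le> Phi \<epsilon> e (P i) (T i) x \<eta>" by (rule W_le[OF \<epsilon>]) (use m in \<open>auto simp: isMin_def\<close>)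
    thus ?case using elim by linarith
  qed
next
  fix a assume a: "a < W \<epsilon> e p t"
  show "\<forall>\<^sub>F i in F. a < W \<epsilon> e (P i) (T i)"
  proof (rule ccontr)
    assume neg: "\<not> ?thesis"
    define F' where "F' = inf F (principal {i. W \<epsilon> e (P i) (T i) \<le> a})"
    have "F' \<noteq> bot"
    proof
      assume "F' = bot"
      hence "eventually (\<lambda>_. False) (inf F (principal {i. W \<epsilon> e (P i) (T i) \<le> a}))" by (simp add: F'_def)
      with neg show False by (simp add: eventually_inf_principal not_le)
    qed
    have "\<forall>i. \<exists>z. isMin \<epsilon> e (P i) (T i) (fst z) (snd z)" using Phi_minimiser[OF \<epsilon>] by auto
    then obtain z where z: "\<And>i. isMin \<epsilon> e (P i) (T i) (fst (z i)) (snd (z i))" by metis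
    have "compact (Bn n \<times> Cube k (Lam \<epsilon>))" by (intro compact_Times compact_Bn compact_Cube)
    moreover have "\<forall>\<^sub>F i in F'. z i \<in> Bn n \<times> Cube k (Lam \<epsilon>)"
      using z by (auto simp: isMin_def mem_Times_iff)
    ultimately obtain z0 H where H: "z0 \<in> Bn n \<times> Cube k (Lam \<epsilon>)" "H \<le> F'" "H \<noteq> bot" "(z \<longlongrightarrow> z0) H"
      using compact_subfilter \<open>F' \<noteq> bot\<close> by blast
    have HF: "H \<le> F" using H(2) by (simp add: F'_def)
    have "((\<lambda>i. Phi \<epsilon> e (P i) (T i) (fst (z i)) (snd (z i))) \<longlongrightarrow> Phi \<epsilon> e p t (fst z0) (snd z0)) H"
      by (intro tendsto_Phi tendsto_mono[OF HF P] tendsto_mono[OF HF T] tendsto_fst[OF H(4)] tendsto_snd[OF H(4)])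
    moreover have "\<forall>\<^sub>F i in F'. Phi \<epsilon> e (P i) (T i) (fst (z i)) (snd (z i)) \<le> a"
      unfolding F'_def eventually_inf_principal using W_eq[OF z] by simp
    hence "\<forall>\<^sub>F i in H. Phi \<epsilon> e (P i) (T i) (fst (z i)) (snd (z i)) \<le> a" using H(2) by (simp add: filter_leD)
    ultimately have "Phi \<epsilon> e p t (fst z0) (snd z0) \<le> a" using H(3) by (rule tendsto_upperbound)
    thus False using W_le[OF \<epsilon>, of "fst z0" "snd z0" e p t] H(1) a by auto
  qed
qed

lemma abs_f_le:
  assumes "\<forall>i. \<bar>e i\<bar> \<le> 1" "x \<in> Bn n"
  shows "\<bar>f e x\<bar> \<le> 1 + 2 * real n"
proof -
  have xn: "eucl_norm n x \<le> 1" using assms(2) by (simp add: Bn_def)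
  have x1: "\<bar>x i\<bar> \<le> 1" if "i < n" for i using coord_le_eucl_norm[OF that, of x] xn by linarith
  have "f e x = eucl_norm n x ^ 2 + (\<Sum>i<n. 2 * e i * x i)" by (simp add: f_def eucl_norm_square sum.distrib)
  also have "\<bar>\<dots>\<bar> \<le> eucl_norm n x ^ 2 + (\<Sum>i<n. \<bar>2 * e i * x i\<bar>)"
    using sum_abs[of "\<lambda>i. 2 * e i * x i" "{..<n}"] zero_le_power2[of "eucl_norm n x"] by linarith
  also have "\<dots> \<le> 1 + (\<Sum>i<n. 2)"
  proof (intro add_mono sum_mono)
    show "eucl_norm n x ^ 2 \<le> 1" using xn by (simp add: power_le_one)
    fix i assume "i \<in> {..<n}"
    hence "\<bar>e i\<bar> * \<bar>x i\<bar> \<le> 1 * 1" using assms(1) x1 by (intro mult_mono) auto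
    thus "\<bar>2 * e i * x i\<bar> \<le> 2" by (simp add: abs_mult)
  qed
  finally show ?thesis by simp
qed

lemma slope_zero_le:
  assumes "\<forall>i. \<bar>e i\<bar> \<le> 1" "x \<in> Bn n"
  shows "(\<Sum>l<n. (xi e (\<lambda>_. 0) x l) ^ 2) \<le> 16 * real n"
proof -
  have "(\<Sum>l<n. (xi e (\<lambda>_. 0) x l) ^ 2) \<le> (\<Sum>l<n. 4 ^ 2)"
  proof (rule sum_mono)
    fix l assume "l \<in> {..<n}"
    hence l: "l < n" by simp
    have "\<bar>x l\<bar> \<le> 1" using coord_le_eucl_norm[OF l, of x] assms(2) by (simp add: Bn_def)
    hence "\<bar>2 * (x l + e l)\<bar> \<le> 4" using assms(1)[rule_format, of l] by (simp add: abs_le_iff)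
    hence "(2 * (x l + e l)) ^ 2 \<le> 4 ^ 2" by (subst abs_le_square_iff[symmetric]) simp
    thus "(xi e (\<lambda>_. 0) x l) ^ 2 \<le> 4 ^ 2" using l by (simp add: xi_def comb_def)
  qed
  thus ?thesis by simp
qed

lemma multiplier_penalty_ge:
  assumes "\<epsilon> > 0" "\<epsilon> \<le> 1" "\<bar>a\<bar> \<le> \<epsilon>"
  shows "\<epsilon> * y ^ 2 - a * y \<ge> (-1::real)"
proof -
  have "\<bar>a * y\<bar> \<le> \<epsilon> * \<bar>y\<bar>" using assms(3) by (simp add: abs_mult mult_right_mono)
  moreover have "\<epsilon> * \<bar>y\<bar> \<le> \<epsilon> * (1 + y ^ 2)"
  proof (intro mult_left_mono)
    have "0 \<le> (\<bar>y\<bar> - 1) ^ 2 + y ^ 2" by simp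
    thus "\<bar>y\<bar> \<le> 1 + y ^ 2" by (simp add: power2_diff abs_mult)
  qed (use assms in auto)
  ultimately show ?thesis using assms(1,2) by (simp add: algebra_simps)
qed

text \<open>Comparison with the zero multiplier at the same \<open>x\<close>: all penalties on
  \<open>x\<close> agree, so the terms in \<open>\<eta>\<close> sum up to at most the slope term at
  0, that is \<open>16 * n\<close>. A multiplier on the boundary of the cube would alone contribute
  more, even if each of the others contributed -1.\<close>

lemma multiplier_interior:
  assumes e: "\<forall>i. \<bar>e i\<bar> \<le> 1" and \<epsilon>: "\<epsilon> > 0" "\<epsilon> \<le> 1" and p: "\<And>i. \<bar>p i\<bar> \<le> \<epsilon>"
    and min: "isMin \<epsilon> e p t x \<eta>" and j: "j < k"
  shows "\<bar>\<eta> j\<bar> < Lam \<epsilon>"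
proof (rule ccontr)
  assume "\<not> \<bar>\<eta> j\<bar> < Lam \<epsilon>"
  hence big: "\<bar>\<eta> j\<bar> \<ge> Lam \<epsilon>" by simp
  have x: "x \<in> Bn n" using min by (simp add: isMin_def)
  have L1: "Lam \<epsilon> \<ge> 2" using \<epsilon> by (simp add: Lam_def)
  have "(\<lambda>_. 0) \<in> Cube k (Lam \<epsilon>)" using L1 by (auto simp: Cube_def)
  hence "Phi \<epsilon> e p t x \<eta> \<le> Phi \<epsilon> e p t x (\<lambda>_. 0)" using min x by (simp add: isMin_def)
  moreover have "(\<Sum>l<n. (xi e \<eta> x l) ^ 2) \<ge> 0" by (simp add: sum_nonneg)
  ultimately have le: "(\<Sum>j<k. \<epsilon> * \<eta> j ^ 2 - p (n + j) * \<eta> j) \<le> 16 * real n"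
    using slope_zero_le[OF e x] by (simp add: Phi_def)
  have "(\<Sum>i<k. \<epsilon> * \<eta> i ^ 2 - p (n + i) * \<eta> i) = (\<epsilon> * \<eta> j ^ 2 - p (n + j) * \<eta> j) + (\<Sum>i\<in>{..<k} - {j}. \<epsilon> * \<eta> i ^ 2 - p (n + i) * \<eta> i)"
    using j by (simp add: sum.remove)
  also have "\<dots> \<ge> (\<epsilon> * \<eta> j ^ 2 - p (n + j) * \<eta> j) + (\<Sum>i\<in>{..<k} - {j}. -1)"
    by (intro add_left_mono sum_mono multiplier_penalty_ge \<epsilon> p)
  also have "(\<Sum>i\<in>{..<k} - {j}. -1) = - real (card ({..<k} - {j}))" by simp
  also have "card ({..<k} - {j}) = k - 1" using j by simp
  finally have ge: "(\<Sum>j<k. \<epsilon> * \<eta> j ^ 2 - p (n + j) * \<eta> j) \<ge> \<epsilon> * \<eta> j ^ 2 - p (n + j) * \<eta> j - real k" by simp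
  have "\<bar>p (n + j) * \<eta> j\<bar> \<le> \<epsilon> * \<bar>\<eta> j\<bar>" using p[of "n + j"] by (simp add: abs_mult mult_right_mono)
  hence "\<epsilon> * (\<bar>\<eta> j\<bar> * (\<bar>\<eta> j\<bar> - 1)) \<le> \<epsilon> * \<eta> j ^ 2 - p (n + j) * \<eta> j"
    by (simp add: algebra_simps power2_eq_square abs_mult_self_eq)
  moreover have "\<epsilon> * (Lam \<epsilon> * 1) \<le> \<epsilon> * (\<bar>\<eta> j\<bar> * (\<bar>\<eta> j\<bar> - 1))"
    using big L1 \<epsilon> by (intro mult_left_mono mult_mono) auto
  moreover have "\<epsilon> * (Lam \<epsilon> * 1) = 2 * \<epsilon> + (16 * real n + real k + 1)"
    unfolding Lam_def using \<epsilon>(1) by (simp only: distrib_left mult_1_right) simp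
  ultimately show False using ge le \<epsilon>(1) by linarith
qed

end

context regular_quadrics
begin

text \<open>On the compact unit sphere the equations have no common zero, because \<open>M\<close>
  lies in the open ball.\<close>

lemma sphere_gap: "\<exists>c>0. \<forall>x\<in>Rn n. eucl_norm n x = 1 \<longrightarrow> c \<le> (\<Sum>j<k. Qv j x ^ 2)"
proof -
  define K where "K = Bn n \<inter> {x. eucl_norm n x = 1}"
  have "closed {x. eucl_norm n x = 1}"
    by (intro closed_Collect_eq continuous_on_eucl_norm continuous_on_coord continuous_on_const)
  hence K: "compact K" unfolding K_def by (intro compact_Int_closed compact_Bn)
  show ?thesis
  proof (cases "K = {}")
    case True
    thus ?thesis by (intro exI[of _ 1]) (auto simp: K_def Bn_def)
  next
    case False
    have "continuous_on K (\<lambda>x. \<Sum>j<k. Qv j x ^ 2)" by (intro continuous_intros continuous_on_Qv)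
    then obtain x where x: "x \<in> K" "\<And>y. y \<in> K \<Longrightarrow> (\<Sum>j<k. Qv j x ^ 2) \<le> (\<Sum>j<k. Qv j y ^ 2)"
      using continuous_attains_inf[OF K False] by blast
    have "(\<Sum>j<k. Qv j x ^ 2) \<noteq> 0"
    proof
      assume "(\<Sum>j<k. Qv j x ^ 2) = 0"
      hence "\<forall>j<k. Qv j x = 0" by (simp add: sum_nonneg_eq_0_iff)
      hence "x \<in> M" using x(1) by (simp add: M_def K_def Bn_def)
      from M_interior[OF this] x(1) show False by (simp add: K_def)
    qed
    moreover have "(\<Sum>j<k. Qv j x ^ 2) \<ge> 0" by (simp add: sum_nonneg)
    ultimately show ?thesis using x(2)
      by (intro exI[of _ "\<Sum>j<k. Qv j x ^ 2"]) (auto simp: K_def Bn_def)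
  qed
qed

text \<open>On the sphere \<open>Phi\<close> is at least \<open>c / (2 * \<epsilon> ^ 2)\<close> up
  to a constant, whereas at a point of \<open>M\<close> it is of order
  \<open>1 / \<epsilon>\<close>, whatever the level \<open>t\<close>. For small
  \<open>\<epsilon>\<close> a minimiser cannot lie on the sphere.\<close>

lemma minimiser_interior:
  assumes e: "\<forall>i. \<bar>e i\<bar> \<le> 1" and "M \<noteq> {}"
  shows "\<exists>\<epsilon>0>0. \<epsilon>0 \<le> 1 \<and> (\<forall>\<epsilon> p t x \<eta>. 0 < \<epsilon> \<longrightarrow> \<epsilon> < \<epsilon>0 \<longrightarrow> (\<forall>i. \<bar>p i\<bar> \<le> \<epsilon>) \<longrightarrow> \<bar>t\<bar> \<le> 2 * real n + 2 \<longrightarrow>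
     isMin \<epsilon> e p t x \<eta> \<longrightarrow> eucl_norm n x < 1)"
proof -
  obtain x0 where x0: "x0 \<in> M" using assms(2) by blast
  obtain c where c: "c > 0" "\<And>x. x \<in> Rn n \<Longrightarrow> eucl_norm n x = 1 \<Longrightarrow> c \<le> (\<Sum>j<k. Qv j x ^ 2)"
    using sphere_gap by blast
  \<comment> \<open>\<open>4 * n + 3\<close> bounds \<open>f - t\<close>, from
    \<open>1 + 2 * n\<close> for \<open>f\<close> and \<open>2 * n + 2\<close> for \<open>t\<close>;
    the rest dominates the constants \<open>18 * n + 3 * k\<close> that the two estimates of
    \<open>Phi\<close> leave.\<close>
  define C1 where "C1 = (4 * real n + 3) ^ 2 + 20 * real n + 5 * real k"
  have C1: "C1 > 0" unfolding C1_def by (intro add_pos_nonneg) auto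
  define \<epsilon>0 where "\<epsilon>0 = min 1 (c / (2 * C1))"
  have e0: "\<epsilon>0 > 0" using c(1) C1 by (simp add: \<epsilon>0_def)
  have "eucl_norm n x < 1" if \<epsilon>: "0 < \<epsilon>" "\<epsilon> < \<epsilon>0" and p: "\<And>i. \<bar>p i\<bar> \<le> \<epsilon>" and t: "\<bar>t\<bar> \<le> 2 * real n + 2"
    and min: "isMin \<epsilon> e p t x \<eta>" for \<epsilon> p t x \<eta>
  proof (rule ccontr)
    assume "\<not> eucl_norm n x < 1"
    hence x: "x \<in> Bn n" "x \<in> Rn n" "eucl_norm n x = 1" using min by (auto simp: isMin_def Bn_def)
    have \<epsilon>1: "\<epsilon> \<le> 1" "2 * \<epsilon> * C1 < c" using \<epsilon> C1 by (auto simp: \<epsilon>0_def field_simps)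
    have x0B: "x0 \<in> Bn n" using x0 by (simp add: M_def Bn_def)
    have L1: "Lam \<epsilon> \<ge> 2" using \<epsilon> by (simp add: Lam_def)
    have "(\<lambda>_. 0) \<in> Cube k (Lam \<epsilon>)" using L1 by (auto simp: Cube_def)
    hence le: "Phi \<epsilon> e p t x \<eta> \<le> Phi \<epsilon> e p t x0 (\<lambda>_. 0)" using min x0B by (simp add: isMin_def)
    have px: "\<bar>\<Sum>i<n. p i * y i\<bar> \<le> real n" if "y \<in> Bn n" for y
    proof -
      have "\<bar>\<Sum>i<n. p i * y i\<bar> \<le> (\<Sum>i<n. 1)"
      proof (rule order_trans[OF sum_abs], rule sum_mono)
        fix i assume "i \<in> {..<n}"
        hence "\<bar>y i\<bar> \<le> 1" using coord_le_eucl_norm[of i n y] that by (simp add: Bn_def)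
        hence "\<bar>p i\<bar> * \<bar>y i\<bar> \<le> 1 * 1" using p[of i] \<epsilon>1 by (intro mult_mono) auto
        thus "\<bar>p i * y i\<bar> \<le> 1" by (simp add: abs_mult)
      qed
      thus ?thesis by simp
    qed
    have p2: "p i ^ 2 / \<epsilon> ^ 2 \<le> 1" for i
    proof -
      have "p i ^ 2 \<le> \<epsilon> ^ 2" using p[of i] \<epsilon>(1) by (simp add: abs_le_square_iff[symmetric])
      thus ?thesis using \<epsilon>(1) by (simp add: divide_le_eq)
    qed
    have up: "Phi \<epsilon> e p t x0 (\<lambda>_. 0) \<le> 16 * real n + real k + (4 * real n + 3) ^ 2 / \<epsilon> + real n"
    proof -
      have Q0: "Qv j x0 = 0" if "j < k" for j using x0 that by (simp add: M_def)
      have "(\<Sum>j<k. (Qv j x0 - p (n + k + j)) ^ 2 / \<epsilon> ^ 2) \<le> (\<Sum>j<k. 1)"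
        by (intro sum_mono) (simp add: Q0 p2)
      moreover have "(f e x0 - t) ^ 2 / \<epsilon> \<le> (4 * real n + 3) ^ 2 / \<epsilon>"
      proof (intro divide_right_mono)
        have "\<bar>f e x0 - t\<bar> \<le> 4 * real n + 3" using abs_f_le[OF e x0B] t by linarith
        thus "(f e x0 - t) ^ 2 \<le> (4 * real n + 3) ^ 2" by (simp add: abs_le_square_iff[symmetric])
      qed (use \<epsilon> in auto)
      moreover have "(\<Sum>j<k. \<epsilon> * (0::real) ^ 2 - p (n + j) * 0) = 0" by simp
      ultimately show ?thesis using slope_zero_le[OF e x0B] px[OF x0B] unfolding Phi_def by simp
    qed
    have low: "Phi \<epsilon> e p t x \<eta> \<ge> c / (2 * \<epsilon> ^ 2) - real k - real k - real n"
    proof -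
      have "(\<Sum>j<k. \<epsilon> * \<eta> j ^ 2 - p (n + j) * \<eta> j) \<ge> (\<Sum>j<k. -1)"
        by (intro sum_mono multiplier_penalty_ge \<epsilon>(1) \<epsilon>1(1) p)
      moreover have "(\<Sum>j<k. (Qv j x - p (n + k + j)) ^ 2 / \<epsilon> ^ 2) \<ge> (\<Sum>j<k. Qv j x ^ 2 / (2 * \<epsilon> ^ 2) - 1)"
      proof (intro sum_mono)
        fix j
        define q where "q = p (n + k + j)"
        have "0 \<le> (Qv j x - 2 * q) ^ 2" by simp
        hence "Qv j x ^ 2 / 2 - q ^ 2 \<le> (Qv j x - q) ^ 2" by (simp add: power2_eq_square algebra_simps)
        hence "(Qv j x ^ 2 / 2 - q ^ 2) / \<epsilon> ^ 2 \<le> (Qv j x - q) ^ 2 / \<epsilon> ^ 2" by (rule divide_right_mono) simp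
        moreover have "(Qv j x ^ 2 / 2 - q ^ 2) / \<epsilon> ^ 2 = Qv j x ^ 2 / (2 * \<epsilon> ^ 2) - q ^ 2 / \<epsilon> ^ 2"
          by (simp add: diff_divide_distrib)
        ultimately show "Qv j x ^ 2 / (2 * \<epsilon> ^ 2) - 1 \<le> (Qv j x - p (n + k + j)) ^ 2 / \<epsilon> ^ 2"
          using p2[of "n + k + j"] unfolding q_def by linarith
      qed
      moreover have "(\<Sum>j<k. Qv j x ^ 2 / (2 * \<epsilon> ^ 2) - 1) = (\<Sum>j<k. Qv j x ^ 2) / (2 * \<epsilon> ^ 2) - real k"
        by (simp add: sum_subtractf sum_divide_distrib)
      moreover have "(\<Sum>j<k. Qv j x ^ 2) / (2 * \<epsilon> ^ 2) \<ge> c / (2 * \<epsilon> ^ 2)"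
        using c(2)[OF x(2,3)] by (intro divide_right_mono) auto
      moreover have "(\<Sum>l<n. (xi e \<eta> x l) ^ 2) \<ge> 0" by (simp add: sum_nonneg)
      moreover have "(f e x - t) ^ 2 / \<epsilon> \<ge> 0" using \<epsilon>(1) by simp
      moreover have "(\<Sum>j<k. -1) = - real k" by simp
      ultimately show ?thesis using px[OF x(1)] unfolding Phi_def by linarith
    qed
    have "c / (2 * \<epsilon> ^ 2) \<le> (4 * real n + 3) ^ 2 / \<epsilon> + (18 * real n + 3 * real k)" using le up low by linarith
    also have "\<dots> \<le> (4 * real n + 3) ^ 2 / \<epsilon> + (20 * real n + 5 * real k) / \<epsilon>"
    proof (intro add_left_mono)
      have "18 * real n + 3 * real k \<le> (20 * real n + 5 * real k) / 1" by simp
      also have "\<dots> \<le> (20 * real n + 5 * real k) / \<epsilon>" using \<epsilon>(1) \<epsilon>1(1) by (intro divide_left_mono) auto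
      finally show "18 * real n + 3 * real k \<le> (20 * real n + 5 * real k) / \<epsilon>" .
    qed
    also have "\<dots> = C1 / \<epsilon>" by (simp add: C1_def add_divide_distrib)
    finally have "c / (2 * \<epsilon> ^ 2) * (2 * \<epsilon> ^ 2) \<le> C1 / \<epsilon> * (2 * \<epsilon> ^ 2)" by (rule mult_right_mono) simp
    hence "c \<le> 2 * \<epsilon> * C1" using \<epsilon>(1) by (simp add: power2_eq_square mult_ac)
    thus False using \<epsilon>1(2) by simp
  qed
  moreover have "\<epsilon>0 \<le> 1" by (simp add: \<epsilon>0_def)
  ultimately show ?thesis using e0 by blast
qed

end

context quadrics
begin

text \<open>The Hessian of \<open>f\<close> minus the combination of the equations with coefficients
  \<open>\<eta>\<close>; it is the linear part of \<open>xi\<close> as an affine function of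
  \<open>x\<close>.\<close>

definition hx :: "(nat \<Rightarrow> real) \<Rightarrow> nat \<Rightarrow> nat \<Rightarrow> real" where
  "hx \<eta> l i = (if l = i then 2 else 0) - 2 * (\<Sum>j<k. \<eta> j * S j l i)"

lemma xi_affine:
  assumes "l < n"
  shows "xi e \<eta> x l = (\<Sum>i<n. hx \<eta> l i * x i) + (2 * e l - (\<Sum>j<k. \<eta> j * b j l))"
proof -
  have "(\<Sum>i<n. hx \<eta> l i * x i) = (\<Sum>i<n. (if l = i then 2 * x i else 0) - 2 * ((\<Sum>j<k. \<eta> j * S j l i) * x i))"
    by (intro sum.cong refl) (simp add: hx_def algebra_simps)
  also have "\<dots> = 2 * x l - 2 * (\<Sum>i<n. (\<Sum>j<k. \<eta> j * S j l i) * x i)"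
    using assms by (simp only: sum_subtractf sum_distrib_left[symmetric] sum.delta finite_lessThan) simp
  also have "(\<Sum>i<n. (\<Sum>j<k. \<eta> j * S j l i) * x i) = (\<Sum>j<k. \<eta> j * (\<Sum>i<n. S j l i * x i))"
    by (simp add: sum_distrib_left sum_distrib_right mult_ac) (rule sum.swap)
  finally show ?thesis
    using assms by (simp add: xi_def comb_def G_def algebra_simps sum.distrib sum_distrib_left)
qed

lemma xi_add:
  assumes "l < n"
  shows "xi e \<eta> (\<lambda>i. x i + d i) l = xi e \<eta> x l + (\<Sum>i<n. hx \<eta> l i * d i)"
  unfolding xi_affine[OF assms] by (simp add: distrib_left sum.distrib)

lemma sum_delta_mult: "i < n \<Longrightarrow> (\<Sum>m<n. g m * (if m = i then \<tau> else 0)) = g i * (\<tau>::real)"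
proof -
  assume "i < n"
  have "(\<Sum>m<n. g m * (if m = i then \<tau> else 0)) = (\<Sum>m<n. if m = i then g i * \<tau> else 0)"
    by (intro sum.cong) auto
  thus ?thesis using \<open>i < n\<close> by simp
qed

lemma eucl_norm_delta: "i < n \<Longrightarrow> eucl_norm n (\<lambda>m. if m = i then \<tau> else 0) = \<bar>\<tau>\<bar>"
proof -
  assume "i < n"
  have "(\<Sum>m<n. (if m = i then \<tau> else 0) ^ 2) = (\<Sum>m<n. if m = i then \<tau> ^ 2 else 0)"
    by (intro sum.cong) auto
  thus ?thesis using \<open>i < n\<close> by (simp add: eucl_norm_def L2_set_def)
qed

text \<open>The derivative of \<open>Phi\<close> in the direction of the coordinate \<open>i\<close>
  vanishes at an interior minimiser. The perturbations enter \<open>Phi\<close> so that the equation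
  can be solved for \<open>p i\<close>: specialising the values of the resulting polynomials means
  choosing the perturbations.\<close>

lemma minimiser_critical_x:
  assumes min: "isMin \<epsilon> e p t x \<eta>" and \<epsilon>: "\<epsilon> > 0" and x: "eucl_norm n x < 1" and i: "i < n"
  shows "p i = (\<Sum>l<n. 2 * xi e \<eta> x l * hx \<eta> l i) + 2 * (\<Sum>j<k. (Qv j x - p (n + k + j)) / \<epsilon> ^ 2 * G j x i)
     + 4 * ((f e x - t) / \<epsilon>) * (x i + e i)"
proof -
  define xt where "xt \<tau> = (\<lambda>m. x m + (if m = i then \<tau> else 0))" for \<tau>
  define \<psi> where "\<psi> \<tau> = Phi \<epsilon> e p t (xt \<tau>) \<eta>" for \<tau>
  have xiB: "xi e \<eta> (xt \<tau>) l = xi e \<eta> x l + \<tau> * hx \<eta> l i" if "l < n" for l \<tau>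
    unfolding xt_def xi_add[OF that] sum_delta_mult[OF i] by simp
  have QB: "Qv j (xt \<tau>) = Qv j x + \<tau> * G j x i + \<tau> ^ 2 * S j i i" for j \<tau>
  proof -
    have "qf j (\<lambda>m. if m = i then \<tau> else 0) = (\<Sum>m<n. (S j m i * \<tau>) * (if m = i then \<tau> else 0))"
    proof (unfold qf_def, rule sum.cong[OF refl])
      fix m
      have "(\<Sum>l<n. S j m l * ((if m = i then \<tau> else 0) * (if l = i then \<tau> else 0))) =
        (\<Sum>l<n. (S j m l * (if m = i then \<tau> else 0)) * (if l = i then \<tau> else 0))" by (simp add: mult.assoc)
      also have "\<dots> = S j m i * (if m = i then \<tau> else 0) * \<tau>" by (rule sum_delta_mult[OF i])
      finally show "(\<Sum>l<n. S j m l * ((if m = i then \<tau> else 0) * (if l = i then \<tau> else 0))) =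
         S j m i * \<tau> * (if m = i then \<tau> else 0)" by simp
    qed
    also have "\<dots> = \<tau> ^ 2 * S j i i" unfolding sum_delta_mult[OF i] by (simp add: power2_eq_square)
    finally show ?thesis unfolding xt_def Qv_add sum_delta_mult[OF i] by simp
  qed
  have fB: "f e (xt \<tau>) = f e x + \<tau> * (2 * (x i + e i)) + \<tau> ^ 2" for \<tau>
    unfolding xt_def f_add sum_delta_mult[OF i] eucl_norm_delta[OF i] by simp
  have pB: "(\<Sum>m<n. p m * xt \<tau> m) = (\<Sum>m<n. p m * x m) + \<tau> * p i" for \<tau>
    unfolding xt_def by (simp add: distrib_left sum.distrib sum_delta_mult[OF i])
  define C where "C = (\<Sum>j<k. \<epsilon> * \<eta> j ^ 2 - p (n + j) * \<eta> j) - (\<Sum>m<n. p m * x m)"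
  have \<psi>: "\<psi> = (\<lambda>\<tau>. (\<Sum>l<n. (xi e \<eta> x l + \<tau> * hx \<eta> l i) ^ 2)
      + (\<Sum>j<k. (Qv j x - p (n + k + j) + \<tau> * G j x i + \<tau> ^ 2 * S j i i) ^ 2 / \<epsilon> ^ 2)
      + (f e x - t + \<tau> * (2 * (x i + e i)) + \<tau> ^ 2) ^ 2 / \<epsilon> + (C - \<tau> * p i))"
    by (rule ext) (simp add: \<psi>_def Phi_def xiB QB fB pB C_def algebra_simps)
  have d1: "((\<lambda>\<tau>. \<Sum>l<n. (xi e \<eta> x l + \<tau> * hx \<eta> l i) ^ 2) has_real_derivative (\<Sum>l<n. 2 * xi e \<eta> x l * hx \<eta> l i)) (at 0)"
    by (rule DERIV_sum) (auto intro!: derivative_eq_intros)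
  have d2: "((\<lambda>\<tau>. \<Sum>j<k. (Qv j x - p (n + k + j) + \<tau> * G j x i + \<tau> ^ 2 * S j i i) ^ 2 / \<epsilon> ^ 2) has_real_derivative
      (\<Sum>j<k. 2 * ((Qv j x - p (n + k + j)) / \<epsilon> ^ 2 * G j x i))) (at 0)"
    by (rule DERIV_sum) (use \<epsilon> in \<open>auto intro!: derivative_eq_intros simp: field_simps power2_eq_square power4_eq_xxxx\<close>)
  have d3: "((\<lambda>\<tau>. (f e x - t + \<tau> * (2 * (x i + e i)) + \<tau> ^ 2) ^ 2 / \<epsilon>) has_real_derivative
      4 * ((f e x - t) / \<epsilon>) * (x i + e i)) (at 0)"
    using \<epsilon> by (auto intro!: derivative_eq_intros simp: field_simps)
  have d4: "((\<lambda>\<tau>. C - \<tau> * p i) has_real_derivative - p i) (at 0)"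
    by (auto intro!: derivative_eq_intros)
  have "(\<psi> has_real_derivative (\<Sum>l<n. 2 * xi e \<eta> x l * hx \<eta> l i) + (\<Sum>j<k. 2 * ((Qv j x - p (n + k + j)) / \<epsilon> ^ 2 * G j x i))
     + 4 * ((f e x - t) / \<epsilon>) * (x i + e i) + - p i) (at 0)"
    unfolding \<psi> by (intro DERIV_add d1 d2 d3 d4)
  moreover have "\<psi> 0 \<le> \<psi> \<tau>" if "\<bar>0 - \<tau>\<bar> < 1 - eucl_norm n x" for \<tau>
  proof -
    have "eucl_norm n (xt \<tau>) \<le> eucl_norm n x + \<bar>\<tau>\<bar>"
      unfolding xt_def using eucl_norm_add[of n x "\<lambda>m. if m = i then \<tau> else 0"] eucl_norm_delta[OF i] by simp
    hence "xt \<tau> \<in> Bn n" using that min i by (auto simp: Bn_def isMin_def Rn_def xt_def)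
    moreover have "xt 0 = x" by (auto simp: xt_def)
    ultimately show ?thesis using min by (simp add: \<psi>_def isMin_def)
  qed
  ultimately have "(\<Sum>l<n. 2 * xi e \<eta> x l * hx \<eta> l i) + (\<Sum>j<k. 2 * ((Qv j x - p (n + k + j)) / \<epsilon> ^ 2 * G j x i))
     + 4 * ((f e x - t) / \<epsilon>) * (x i + e i) + - p i = 0"
    using x by (intro DERIV_local_min[where d = "1 - eucl_norm n x" and f = \<psi>]) auto
  thus ?thesis by (simp add: sum_distrib_left)
qed

lemma minimiser_critical_multiplier:
  assumes min: "isMin \<epsilon> e p t x \<eta>" and y: "\<bar>\<eta> j\<bar> < Lam \<epsilon>" and j: "j < k"
  shows "p (n + j) = 2 * \<epsilon> * \<eta> j - (\<Sum>l<n. 2 * xi e \<eta> x l * G j x l)"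
proof -
  define yt where "yt \<tau> = (\<lambda>m. \<eta> m + (if m = j then \<tau> else 0))" for \<tau>
  define \<psi> where "\<psi> \<tau> = Phi \<epsilon> e p t x (yt \<tau>)" for \<tau>
  have sd: "(\<Sum>m<k. (if m = j then \<tau> else 0) * g m) = \<tau> * g j" for g and \<tau> :: real
  proof -
    have "(\<Sum>m<k. (if m = j then \<tau> else 0) * g m) = (\<Sum>m<k. if m = j then \<tau> * g j else 0)" by (intro sum.cong) auto
    thus ?thesis using j by simp
  qed
  have xiB: "xi e (yt \<tau>) x l = xi e \<eta> x l - \<tau> * G j x l" if "l < n" for l \<tau>
    using that by (simp add: xi_def comb_def yt_def distrib_right sum.distrib sd)
  define C where "C = (\<Sum>j<k. (Qv j x - p (n + k + j)) ^ 2 / \<epsilon> ^ 2) + (f e x - t) ^ 2 / \<epsilon> - (\<Sum>i<n. p i * x i)"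
  define C' where "C' = (\<Sum>m\<in>{..<k} - {j}. \<epsilon> * \<eta> m ^ 2 - p (n + m) * \<eta> m)"
  have eB: "(\<Sum>m<k. \<epsilon> * yt \<tau> m ^ 2 - p (n + m) * yt \<tau> m) = \<epsilon> * (\<eta> j + \<tau>) ^ 2 - p (n + j) * (\<eta> j + \<tau>) + C'" for \<tau>
  proof -
    have "(\<Sum>m<k. \<epsilon> * yt \<tau> m ^ 2 - p (n + m) * yt \<tau> m) = (\<epsilon> * yt \<tau> j ^ 2 - p (n + j) * yt \<tau> j) +
       (\<Sum>m\<in>{..<k} - {j}. \<epsilon> * yt \<tau> m ^ 2 - p (n + m) * yt \<tau> m)" using j by (simp add: sum.remove)
    also have "(\<Sum>m\<in>{..<k} - {j}. \<epsilon> * yt \<tau> m ^ 2 - p (n + m) * yt \<tau> m) = C'"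
      unfolding C'_def by (intro sum.cong) (auto simp: yt_def)
    finally show ?thesis by (simp add: yt_def)
  qed
  have \<psi>: "\<psi> = (\<lambda>\<tau>. (\<Sum>l<n. (xi e \<eta> x l - \<tau> * G j x l) ^ 2) + (\<epsilon> * (\<eta> j + \<tau>) ^ 2 - p (n + j) * (\<eta> j + \<tau>) + C' + C))"
    by (rule ext) (simp add: \<psi>_def Phi_def xiB eB C_def)
  have d1: "((\<lambda>\<tau>. \<Sum>l<n. (xi e \<eta> x l - \<tau> * G j x l) ^ 2) has_real_derivative (\<Sum>l<n. - (2 * xi e \<eta> x l * G j x l))) (at 0)"
    by (rule DERIV_sum) (auto intro!: derivative_eq_intros)
  have d2: "((\<lambda>\<tau>. \<epsilon> * (\<eta> j + \<tau>) ^ 2 - p (n + j) * (\<eta> j + \<tau>) + C' + C) has_real_derivative (2 * \<epsilon> * \<eta> j - p (n + j))) (at 0)"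
    by (auto intro!: derivative_eq_intros)
  have "(\<psi> has_real_derivative (\<Sum>l<n. - (2 * xi e \<eta> x l * G j x l)) + (2 * \<epsilon> * \<eta> j - p (n + j))) (at 0)"
    unfolding \<psi> by (intro DERIV_add d1 d2)
  moreover have "\<psi> 0 \<le> \<psi> \<tau>" if "\<bar>0 - \<tau>\<bar> < Lam \<epsilon> - \<bar>\<eta> j\<bar>" for \<tau>
  proof -
    have c: "\<eta> m \<in> (if m < k then {- Lam \<epsilon>..Lam \<epsilon>} else {0})" for m
      using min by (auto simp: isMin_def Cube_def)
    have "yt \<tau> m \<in> (if m < k then {- Lam \<epsilon>..Lam \<epsilon>} else {0})" for m
    proof (cases "m = j")
      case True
      thus ?thesis using that j by (auto simp: yt_def)
    next
      case False
      thus ?thesis using c[of m] by (simp add: yt_def)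
    qed
    hence "yt \<tau> \<in> Cube k (Lam \<epsilon>)" by (simp add: Cube_def)
    moreover have "yt 0 = \<eta>" by (auto simp: yt_def)
    ultimately show ?thesis using min by (simp add: \<psi>_def isMin_def)
  qed
  ultimately have "(\<Sum>l<n. - (2 * xi e \<eta> x l * G j x l)) + (2 * \<epsilon> * \<eta> j - p (n + j)) = 0"
    using y by (intro DERIV_local_min[where d = "Lam \<epsilon> - \<bar>\<eta> j\<bar>" and f = \<psi>]) auto
  thus ?thesis by (simp add: sum_negf)
qed

subsection \<open>The critical equations as a system linear in \<open>x\<close>\<close>

text \<open>Two copies of the critical equations are considered at once; \<open>o\<close> and \<open>q\<close> are the offsets of a
  copy in \<open>x\<close> and \<open>y\<close>. The entries of a copy of \<open>y\<close> are the multipliers \<open>\<eta>\<close>, then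
  \<open>\<mu> j = (Qv j x - p (n + k + j)) / \<epsilon>\<^sup>2\<close>, then \<open>\<nu> = (f e x - t) / \<epsilon>\<close>.\<close>

definition sh :: "nat \<Rightarrow> (nat \<Rightarrow> real) \<Rightarrow> nat \<Rightarrow> real" where
  "sh o' x i = x (o' + i)"

definition blkA :: "nat \<Rightarrow> nat \<Rightarrow> nat \<Rightarrow> (nat \<Rightarrow> real) \<Rightarrow> real" where
  "blkA q i j y = (\<Sum>l<n. 2 * (hx (sh q y) l i * hx (sh q y) l j)) + (\<Sum>m<k. 4 * S m i j * y (q + k + m))
     + (if i = j then 4 else 0) * y (q + 2 * k)"

definition blkB :: "(nat \<Rightarrow> real) \<Rightarrow> nat \<Rightarrow> nat \<Rightarrow> (nat \<Rightarrow> real) \<Rightarrow> real" where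
  "blkB e q i y = - ((\<Sum>l<n. 2 * ((2 * e l - (\<Sum>j<k. b j l * sh q y j)) * hx (sh q y) l i)) + (\<Sum>m<k. 2 * b m i * y (q + k + m))
     + 4 * e i * y (q + 2 * k))"

text \<open>The right-hand side is the derivative of \<open>Phi\<close> with the scaled residuals
  replaced by independent variables. For a fixed \<open>y\<close> each of \<open>xi\<close>,
  \<open>G\<close> and \<open>x i + e i\<close> is affine in \<open>x\<close> and is multiplied by
  something free of \<open>x\<close>: this is what makes the critical equations linear in
  \<open>x\<close>.\<close>

lemma blk_eq:
  assumes "i < n"
  shows "(\<Sum>j<n. blkA q i j y * x j) - blkB e q i y = (\<Sum>l<n. 2 * xi e (sh q y) x l * hx (sh q y) l i)
     + 2 * (\<Sum>j<k. y (q + k + j) * G j x i) + 4 * y (q + 2 * k) * (x i + e i)"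
proof -
  define h where "h = hx (sh q y)"
  define \<beta> where "\<beta> l = 2 * e l - (\<Sum>j<k. b j l * sh q y j)" for l
  have X: "xi e (sh q y) x l = (\<Sum>j<n. h l j * x j) + \<beta> l" if "l < n" for l
    unfolding xi_affine[OF that] by (simp add: h_def \<beta>_def mult.commute)
  have "(\<Sum>l<n. 2 * xi e (sh q y) x l * h l i) = (\<Sum>l<n. (\<Sum>j<n. 2 * (h l i * h l j) * x j) + 2 * (\<beta> l * h l i))"
    by (intro sum.cong refl) (simp add: X algebra_simps sum_distrib_left)
  also have "\<dots> = (\<Sum>j<n. (\<Sum>l<n. 2 * (h l i * h l j)) * x j) + (\<Sum>l<n. 2 * (\<beta> l * h l i))"
    unfolding sum.distrib by (subst sum.swap) (simp add: sum_distrib_right)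
  finally have 1: "(\<Sum>l<n. 2 * xi e (sh q y) x l * h l i) = (\<Sum>j<n. (\<Sum>l<n. 2 * (h l i * h l j)) * x j) + (\<Sum>l<n. 2 * (\<beta> l * h l i))" .
  have "2 * (\<Sum>j<k. y (q + k + j) * G j x i) = (\<Sum>m<k. 2 * b m i * y (q + k + m) + (\<Sum>j<n. 4 * S m i j * y (q + k + m) * x j))"
    unfolding sum_distrib_left by (intro sum.cong refl) (simp add: G_def algebra_simps sum_distrib_left)
  also have "\<dots> = (\<Sum>m<k. 2 * b m i * y (q + k + m)) + (\<Sum>j<n. (\<Sum>m<k. 4 * S m i j * y (q + k + m)) * x j)"
    unfolding sum.distrib by (subst sum.swap) (simp add: sum_distrib_right)
  finally have 2: "2 * (\<Sum>j<k. y (q + k + j) * G j x i) =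
     (\<Sum>m<k. 2 * b m i * y (q + k + m)) + (\<Sum>j<n. (\<Sum>m<k. 4 * S m i j * y (q + k + m)) * x j)" .
  have "(\<Sum>j<n. (if i = j then 4 else 0) * y (q + 2 * k) * x j) = (\<Sum>j<n. if i = j then 4 * y (q + 2 * k) * x i else 0)"
    by (intro sum.cong) auto
  hence 3: "(\<Sum>j<n. (if i = j then 4 else 0) * y (q + 2 * k) * x j) = 4 * y (q + 2 * k) * x i" using assms by simp
  have "(\<Sum>j<n. blkA q i j y * x j) = (\<Sum>j<n. (\<Sum>l<n. 2 * (h l i * h l j)) * x j) + (\<Sum>j<n. (\<Sum>m<k. 4 * S m i j * y (q + k + m)) * x j)
     + (\<Sum>j<n. (if i = j then 4 else 0) * y (q + 2 * k) * x j)"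
    unfolding sum.distrib[symmetric] blkA_def h_def by (intro sum.cong refl) (simp only: distrib_right)
  moreover have "blkB e q i y = - ((\<Sum>l<n. 2 * (\<beta> l * h l i)) + (\<Sum>m<k. 2 * b m i * y (q + k + m)) + 4 * e i * y (q + 2 * k))"
    by (simp add: blkB_def \<beta>_def h_def)
  ultimately show ?thesis using 1 2 3 unfolding h_def by (simp add: algebra_simps)
qed

text \<open>At a minimiser of \<open>Phi\<close>, the critical equations say that \<open>pa\<close> and \<open>pm\<close> are the perturbations
  \<open>p (n + j)\<close> and \<open>p (n + k + j)\<close>, that \<open>pt\<close> is \<open>t\<close>, and that \<open>pw\<close> is the minimum \<open>W\<close>.\<close>

definition pa :: "real \<Rightarrow> (nat \<Rightarrow> real) \<Rightarrow> nat \<Rightarrow> nat \<Rightarrow> nat \<Rightarrow> (nat \<Rightarrow> real) \<Rightarrow> (nat \<Rightarrow> real) \<Rightarrow> real" where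
  "pa \<epsilon> e o' q j x y = (2 * \<epsilon>) * y (q + j) - (\<Sum>l<n. 2 * (xi e (sh q y) (sh o' x) l * G j (sh o' x) l))"

definition pm :: "real \<Rightarrow> nat \<Rightarrow> nat \<Rightarrow> nat \<Rightarrow> (nat \<Rightarrow> real) \<Rightarrow> (nat \<Rightarrow> real) \<Rightarrow> real" where
  "pm \<epsilon> o' q j x y = Qv j (sh o' x) - \<epsilon> ^ 2 * y (q + k + j)"

definition pt :: "real \<Rightarrow> (nat \<Rightarrow> real) \<Rightarrow> nat \<Rightarrow> nat \<Rightarrow> (nat \<Rightarrow> real) \<Rightarrow> (nat \<Rightarrow> real) \<Rightarrow> real" where
  "pt \<epsilon> e o' q x y = f e (sh o' x) - \<epsilon> * y (q + 2 * k)"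

definition pw :: "real \<Rightarrow> (nat \<Rightarrow> real) \<Rightarrow> nat \<Rightarrow> nat \<Rightarrow> (nat \<Rightarrow> real) \<Rightarrow> (nat \<Rightarrow> real) \<Rightarrow> real" where
  "pw \<epsilon> e o' q x y = (\<Sum>l<n. xi e (sh q y) (sh o' x) l * xi e (sh q y) (sh o' x) l)
     + (\<Sum>j<k. \<epsilon> * (y (q + j) * y (q + j)) - pa \<epsilon> e o' q j x y * y (q + j))
     + (\<Sum>j<k. \<epsilon> ^ 2 * (y (q + k + j) * y (q + k + j))) + \<epsilon> * (y (q + 2 * k) * y (q + 2 * k))
     - (\<Sum>i<n. ((\<Sum>j<n. blkA q i j y * x (o' + j)) - blkB e q i y) * x (o' + i))"

lemma critical_system:
  assumes min: "isMin \<epsilon> e p t x \<eta>" and \<epsilon>: "\<epsilon> > 0" and x: "eucl_norm n x < 1" and y: "\<And>j. j < k \<Longrightarrow> \<bar>\<eta> j\<bar> < Lam \<epsilon>"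
    and shx: "\<And>i. i < n \<Longrightarrow> X (o' + i) = x i"
    and shy: "\<And>j. j < k \<Longrightarrow> Y (q + j) = \<eta> j" "\<And>j. j < k \<Longrightarrow> Y (q + k + j) = (Qv j x - p (n + k + j)) / \<epsilon> ^ 2"
      "Y (q + 2 * k) = (f e x - t) / \<epsilon>"
  shows "i < n \<Longrightarrow> (\<Sum>j<n. blkA q i j Y * X (o' + j)) - blkB e q i Y = p i"
    "j < k \<Longrightarrow> pa \<epsilon> e o' q j X Y = p (n + j)"
    "j < k \<Longrightarrow> pm \<epsilon> o' q j X Y = p (n + k + j)"
    "pt \<epsilon> e o' q X Y = t"
    "pw \<epsilon> e o' q X Y = W \<epsilon> e p t"
proof -
  have G': "G j (sh o' X) l = G j x l" for j l
    unfolding G_def by (intro arg_cong2[of _ _ _ _ "(+)"] arg_cong2[of _ _ _ _ "(*)"] sum.cong refl) (auto simp: sh_def shx)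
  have Q': "Qv j (sh o' X) = Qv j x" for j
    unfolding Qv_def by (intro arg_cong2[of _ _ _ _ "(+)"] sum.cong refl) (auto simp: sh_def shx)
  have f': "f e (sh o' X) = f e x" unfolding f_def by (intro sum.cong refl) (auto simp: sh_def shx)
  have xi': "xi e (sh q Y) (sh o' X) l = xi e \<eta> x l" if "l < n" for l
    using that shy(1) by (auto simp: xi_def comb_def G' shx) (auto simp: sh_def shx shy intro!: sum.cong)
  have hx': "hx (sh q Y) l i = hx \<eta> l i" for l i
    unfolding hx_def by (intro arg_cong2[of _ _ _ _ "(-)"] arg_cong2[of _ _ _ _ "(*)"] sum.cong refl) (auto simp: sh_def shy)
  have xo: "sh o' X i = x i" if "i < n" for i using that by (simp add: sh_def shx)
  show 1: "(\<Sum>j<n. blkA q i j Y * X (o' + j)) - blkB e q i Y = p i" if "i < n" for i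
  proof -
    have "(\<Sum>j<n. blkA q i j Y * X (o' + j)) - blkB e q i Y = (\<Sum>j<n. blkA q i j Y * sh o' X j) - blkB e q i Y"
      by (simp add: sh_def)
    also have "\<dots> = (\<Sum>l<n. 2 * xi e \<eta> x l * hx \<eta> l i)
     + 2 * (\<Sum>j<k. (Qv j x - p (n + k + j)) / \<epsilon> ^ 2 * G j x i) + 4 * ((f e x - t) / \<epsilon>) * (x i + e i)"
      unfolding blk_eq[OF that] using that by (simp add: xi' hx' G' shy xo)
    also have "\<dots> = p i" by (rule minimiser_critical_x[OF min \<epsilon> x that, symmetric])
    finally show ?thesis .
  qed
  show 2: "pa \<epsilon> e o' q j X Y = p (n + j)" if "j < k" for j
    unfolding minimiser_critical_multiplier[OF min y[OF that] that] pa_def using that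
    by (simp add: xi' G' shy mult.assoc)
  show 3: "pm \<epsilon> o' q j X Y = p (n + k + j)" if "j < k" for j
    using that \<epsilon> by (simp add: pm_def Q' shy)
  show 4: "pt \<epsilon> e o' q X Y = t" using \<epsilon> by (simp add: pt_def f' shy)
  have 5: "(\<Sum>l<n. xi e (sh q Y) (sh o' X) l * xi e (sh q Y) (sh o' X) l) = (\<Sum>l<n. (xi e \<eta> x l) ^ 2)"
    by (intro sum.cong refl) (simp add: xi' power2_eq_square)
  have 6: "(\<Sum>j<k. \<epsilon> * (Y (q + j) * Y (q + j)) - pa \<epsilon> e o' q j X Y * Y (q + j)) = (\<Sum>j<k. \<epsilon> * \<eta> j ^ 2 - p (n + j) * \<eta> j)"
    by (intro sum.cong refl) (simp add: 2 shy power2_eq_square)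
  have 7: "(\<Sum>j<k. \<epsilon> ^ 2 * (Y (q + k + j) * Y (q + k + j))) = (\<Sum>j<k. (Qv j x - p (n + k + j)) ^ 2 / \<epsilon> ^ 2)"
    using \<epsilon> by (intro sum.cong refl) (simp add: shy power2_eq_square)
  have 8: "\<epsilon> * (Y (q + 2 * k) * Y (q + 2 * k)) = (f e x - t) ^ 2 / \<epsilon>"
    using \<epsilon> by (simp add: shy power2_eq_square)
  have 9: "(\<Sum>i<n. ((\<Sum>j<n. blkA q i j Y * X (o' + j)) - blkB e q i Y) * X (o' + i)) = (\<Sum>i<n. p i * x i)"
  proof (intro sum.cong refl arg_cong2[of _ _ _ _ "(*)"])
    fix i assume "i \<in> {..<n}"
    thus "(\<Sum>j<n. blkA q i j Y * X (o' + j)) - blkB e q i Y = p i" "X (o' + i) = x i" using 1 shx by auto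
  qed
  show "pw \<epsilon> e o' q X Y = W \<epsilon> e p t"
    unfolding pw_def 5 6 7 8 9 W_eq[OF min] Phi_def ..
qed

text \<open>At \<open>y = 0\<close> the matrix \<open>hx\<close> is twice the identity, so the block
  is 8 times the identity. This supplies the point where the determinant of the system is not
  zero.\<close>

lemma blkA_0: "i < n \<Longrightarrow> j < n \<Longrightarrow> blkA q i j (\<lambda>_. 0) = (if i = j then 8 else 0)"
proof -
  assume "i < n" "j < n"
  have "(\<Sum>l<n. 2 * (hx (sh q (\<lambda>_. 0)) l i * hx (sh q (\<lambda>_. 0)) l j)) = (\<Sum>l<n. if l = i then (if i = j then 8 else 0) else 0)"
    by (intro sum.cong refl) (auto simp: hx_def sh_def)
  thus ?thesis using \<open>i < n\<close> by (simp add: blkA_def)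
qed

lemma pf_hx: "q + k \<le> m \<Longrightarrow> pf m (\<lambda>_. 1) (\<lambda>y. hx (sh q y) l i)"
proof -
  assume "q + k \<le> m"
  hence "pf m (\<lambda>_. 1) (\<lambda>y. (if l = i then 2 else 0) - 2 * (\<Sum>j<k. S j l i * y (q + j)))"
    by (intro pf_diff pf_const pf_smult pf_sum pf_var) auto
  thus ?thesis by (simp add: hx_def sh_def mult.commute)
qed

lemma pf_blkA: "q + (2 * k + 1) \<le> m \<Longrightarrow> pf m (\<lambda>_. 2) (blkA q i j)"
  unfolding blkA_def
  by (intro pf_add pf_sum pf_smult pf_mult[OF pf_hx pf_hx] pf_var) auto

lemma pf_blkB: "q + (2 * k + 1) \<le> m \<Longrightarrow> pf m (\<lambda>_. 2) (blkB e q i)"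
proof -
  assume q: "q + (2 * k + 1) \<le> m"
  have "pf m (\<lambda>_. 1) (\<lambda>y. 2 * e l - (\<Sum>j<k. b j l * y (q + j)))" for l
    by (intro pf_diff pf_const pf_smult pf_sum pf_var) (use q in auto)
  hence 1: "pf m (\<lambda>_. 1) (\<lambda>y. 2 * e l - (\<Sum>j<k. b j l * sh q y j))" for l by (simp add: sh_def)
  show ?thesis unfolding blkB_def
    by (intro pf_uminus pf_add pf_sum pf_smult pf_mult[OF 1 pf_hx] pf_var) (use q in auto)
qed

lemma xq_x1: "i < n' \<Longrightarrow> xq n' m 1 0 (\<lambda>x y. x i)"
  by (rule xq_var)

lemma xq_y1: "i < m \<Longrightarrow> xq n' m 0 1 (\<lambda>x y. y i)"
  by (rule xq_y[OF pf_var]) auto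

lemma xq_G: "o' + n \<le> n' \<Longrightarrow> xq n' m 1 0 (\<lambda>x y. G j (sh o' x) l)"
  unfolding G_def sh_def
  by (intro xq_add xq_smult xq_sum xq_mono[OF xq_const] xq_x1) auto

lemma xq_Qv: "o' + n \<le> n' \<Longrightarrow> xq n' m 2 0 (\<lambda>x y. Qv j (sh o' x))"
proof -
  assume o': "o' + n \<le> n'"
  have vv: "xq n' m 2 0 (\<lambda>x y. x (o' + i) * x (o' + l))" if "i < n" "l < n" for i l
    by (rule xq_mono[OF xq_mult[OF xq_x1 xq_x1]]) (use o' that in auto)
  show ?thesis unfolding Qv_def sh_def
    by (intro xq_add xq_smult xq_sum xq_mono[OF xq_const] xq_mono[OF xq_x1] vv) (use o' in auto)
qed

lemma xq_f: "o' + n \<le> n' \<Longrightarrow> xq n' m 2 0 (\<lambda>x y. f e (sh o' x))"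
proof -
  assume o': "o' + n \<le> n'"
  have vv: "xq n' m 2 0 (\<lambda>x y. x (o' + i) * x (o' + i))" if "i < n" for i
    by (rule xq_mono[OF xq_mult[OF xq_x1 xq_x1]]) (use o' that in auto)
  show ?thesis unfolding f_def sh_def power2_eq_square
    by (intro xq_add xq_smult xq_sum xq_mono[OF xq_x1] vv) (use o' in auto)
qed

lemma xq_xi:
  assumes "o' + n \<le> n'" "q + k \<le> m" "l < n"
  shows "xq n' m 1 1 (\<lambda>x y. xi e (sh q y) (sh o' x) l)"
proof -
  have "xq n' m 1 1 (\<lambda>x y. 2 * (x (o' + l) + e l) - (\<Sum>j<k. y (q + j) * G j (sh o' x) l))"
    by (intro xq_diff xq_smult xq_add xq_sum xq_mono[OF xq_const] xq_mono[OF xq_x1]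
        xq_mono[OF xq_mult[OF xq_y1 xq_G[OF assms(1)]]]) (use assms in auto)
  thus ?thesis using assms(3) by (simp add: xi_def comb_def sh_def)
qed

lemma xq_pa:
  assumes "o' + n \<le> n'" "q + (2 * k + 1) \<le> m" "j < k"
  shows "xq n' m 2 1 (pa \<epsilon> e o' q j)"
  unfolding pa_def
  by (intro xq_diff xq_smult xq_sum xq_mono[OF xq_y1] xq_mono[OF xq_mult[OF xq_xi xq_G]]) (use assms in auto)

lemma xq_pm:
  assumes "o' + n \<le> n'" "q + (2 * k + 1) \<le> m" "j < k"
  shows "xq n' m 2 1 (pm \<epsilon> o' q j)"
  unfolding pm_def
  by (intro xq_diff xq_smult xq_mono[OF xq_y1] xq_mono[OF xq_Qv]) (use assms in auto)

lemma xq_pt: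
  assumes "o' + n \<le> n'" "q + (2 * k + 1) \<le> m"
  shows "xq n' m 2 1 (pt \<epsilon> e o' q)"
  unfolding pt_def
  by (intro xq_diff xq_smult xq_mono[OF xq_y1] xq_mono[OF xq_f]) (use assms in auto)

text \<open>The minimum would have degree 4 in \<open>x\<close> as it stands. In \<open>pw\<close>
  the squared residuals are squares of the auxiliary variables, and \<open>p i\<close> is replaced
  by the form linear in \<open>x\<close> from the critical equations, which brings all terms down to
  degree 2 in \<open>x\<close> and in \<open>y\<close>.\<close>

lemma xq_pw:
  assumes "o' + n \<le> n'" "q + (2 * k + 1) \<le> m"
  shows "xq n' m 2 2 (pw \<epsilon> e o' q)"
proof -
  have yy: "xq n' m 2 2 (\<lambda>x y. y i * y i)" if "i < m" for i
    by (rule xq_mono[OF xq_mult[OF xq_y1 xq_y1]]) (use that in auto)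
  have 1: "xq n' m 2 2 (\<lambda>x y. xi e (sh q y) (sh o' x) l * xi e (sh q y) (sh o' x) l)" if "l < n" for l
    by (rule xq_mono[OF xq_mult[OF xq_xi xq_xi]]) (use assms that in auto)
  have 2: "xq n' m 2 2 (\<lambda>x y. pa \<epsilon> e o' q j x y * y (q + j))" if "j < k" for j
    by (rule xq_mono[OF xq_mult[OF xq_pa xq_y1]]) (use assms that in auto)
  have 3: "xq n' m 1 2 (\<lambda>x y. (\<Sum>j<n. blkA q i j y * x (o' + j)) - blkB e q i y)" for i
    by (intro xq_diff xq_sum xq_mono[OF xq_mult[OF xq_y[OF pf_blkA] xq_x1]] xq_mono[OF xq_y[OF pf_blkB]])
      (use assms in auto)
  have 4: "xq n' m 2 2 (\<lambda>x y. ((\<Sum>j<n. blkA q i j y * x (o' + j)) - blkB e q i y) * x (o' + i))" if "i < n" for i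
    by (rule xq_mono[OF xq_mult[OF 3 xq_x1]]) (use assms that in auto)
  show ?thesis unfolding pw_def
    by (intro xq_diff xq_add xq_sum xq_smult yy 1 2 4) (use assms in auto)
qed

end

section \<open>Level sets of differences of minimal values, and the variation of the
  minimisers\<close>

context regular_quadrics
begin

text \<open>The range of \<open>t\<close> exceeds by 1 the interval that contains the values of
  \<open>f\<close> on the ball, so that levels of that interval may be perturbed.\<close>

definition confined :: "real \<Rightarrow> (nat \<Rightarrow> real) \<Rightarrow> bool" where
  "confined \<epsilon> e \<longleftrightarrow> (\<forall>p t x \<eta>. (\<forall>i. \<bar>p i\<bar> \<le> \<epsilon>) \<longrightarrow> \<bar>t\<bar> \<le> 2 * real n + 2 \<longrightarrow> isMin \<epsilon> e p t x \<eta> \<longrightarrow> eucl_norm n x < 1)"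

lemma confinedD: "confined \<epsilon> e \<Longrightarrow> \<forall>i. \<bar>p i\<bar> \<le> \<epsilon> \<Longrightarrow> \<bar>t\<bar> \<le> 2 * real n + 2 \<Longrightarrow> isMin \<epsilon> e p t x \<eta> \<Longrightarrow> eucl_norm n x < 1"
  unfolding confined_def by blast

text \<open>Elimination relates \<open>t\<close>, the difference of the two minima and the perturbations; specialising the
  perturbations leaves an algebraic relation between \<open>t\<close> and \<open>W \<epsilon> e p1 t - W \<epsilon> e p0 t\<close>.\<close>

lemma level_sets_bounded:
  assumes e: "\<forall>i. \<bar>e i\<bar> \<le> 1" and \<epsilon>: "0 < \<epsilon>" "\<epsilon> \<le> 1"
    and int: "confined \<epsilon> e"
    and p0: "\<And>i. \<bar>p0 i\<bar> < \<epsilon>" "\<And>i. i \<ge> n + 2 * k \<Longrightarrow> p0 i = 0"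
    and p1: "\<And>i. \<bar>p1 i\<bar> < \<epsilon>" "\<And>i. i \<ge> n + 2 * k \<Longrightarrow> p1 i = 0"
  defines "Ts \<equiv> {- (2 * real n + 1)..2 * real n + 1}"
  shows "\<exists>Z. finite Z \<and> (\<forall>s. s \<notin> Z \<longrightarrow> finite {t \<in> Ts. W \<epsilon> e p1 t - W \<epsilon> e p0 t = s} \<and>
     card {t \<in> Ts. W \<epsilon> e p1 t - W \<epsilon> e p0 t = s} \<le> elim_degree (2 * n) (4 * k + 2))"
proof -
  \<comment> \<open>Two copies of \<open>2 * k + 1\<close> auxiliary variables; the second copy
    starts at the offset \<open>s'\<close>.\<close>
  define m where "m = 4 * k + 2"
  define s' where "s' = 2 * k + 1"
  define E where "E = elim_degree (2 * n) m"
  define r where "r = 2 * n + (m + 1)"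
  define A where "A i j y = (if i < n \<and> j < n then blkA 0 i j y else if n \<le> i \<and> n \<le> j then blkA s' (i - n) (j - n) y else 0)" for i j y
  define B where "B i y = (if i < n then blkB e 0 i y else blkB e s' (i - n) y)" for i y
  \<comment> \<open>The \<open>m + 1 = 4 * k + 3\<close> polynomials are the \<open>4 * k\<close>
    perturbations not covered by the linear equations, the difference of the two levels, the level
    of the first copy, and the difference of the two minima.\<close>
  define P where "P l x y = (if l < k then pa \<epsilon> e 0 0 l x y else if l < 2 * k then pm \<epsilon> 0 0 (l - k) x y
      else if l < 3 * k then pa \<epsilon> e n s' (l - 2 * k) x y else if l < 4 * k then pm \<epsilon> n s' (l - 3 * k) x y
      else if l = 4 * k then pt \<epsilon> e n s' x y - pt \<epsilon> e 0 0 x y else if l = 4 * k + 1 then pt \<epsilon> e 0 0 x y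
      else pw \<epsilon> e n s' x y - pw \<epsilon> e 0 0 x y)" for l x y
  have pfA: "pf m (\<lambda>_. 2) (A i j)" for i j
  proof -
    have "pf m (\<lambda>_. 2) (\<lambda>y. if i < n \<and> j < n then blkA 0 i j y else if n \<le> i \<and> n \<le> j then blkA s' (i - n) (j - n) y else 0)"
      by (cases "i < n \<and> j < n"; cases "n \<le> i \<and> n \<le> j") (auto intro!: pf_blkA pf_const simp: m_def s'_def)
    thus ?thesis by (simp add: A_def [abs_def])
  qed
  have A0: "A i j (\<lambda>_. 0) = (if i = j then 8 else 0)" if "i < 2 * n" "j < 2 * n" for i j
    using that by (auto simp: A_def blkA_0)
  have pfB: "pf m (\<lambda>_. 2) (B i)" for i
  proof -
    have "pf m (\<lambda>_. 2) (\<lambda>y. if i < n then blkB e 0 i y else blkB e s' (i - n) y)"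
      by (cases "i < n") (auto intro!: pf_blkB simp: m_def s'_def)
    thus ?thesis by (simp add: B_def [abs_def])
  qed
  have xqP: "xq (2 * n) m 2 2 (P l)" for l
  proof -
    have o1: "0 + n \<le> 2 * n" "n + n \<le> 2 * n" by auto
    have q1: "0 + (2 * k + 1) \<le> m" "s' + (2 * k + 1) \<le> m" by (auto simp: m_def s'_def)
    have a: "xq (2 * n) m 2 2 (pa \<epsilon> e 0 0 i)" "xq (2 * n) m 2 2 (pa \<epsilon> e n s' i)"
         "xq (2 * n) m 2 2 (pm \<epsilon> 0 0 i)" "xq (2 * n) m 2 2 (pm \<epsilon> n s' i)" if "i < k" for i
      by (rule xq_mono[OF xq_pa[OF o1(1) q1(1) that]] xq_mono[OF xq_pa[OF o1(2) q1(2) that]]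
          xq_mono[OF xq_pm[OF o1(1) q1(1) that]] xq_mono[OF xq_pm[OF o1(2) q1(2) that]]; simp)+
    have t: "xq (2 * n) m 2 2 (pt \<epsilon> e 0 0)" "xq (2 * n) m 2 2 (pt \<epsilon> e n s')"
      by (rule xq_mono[OF xq_pt[OF o1(1) q1(1)]] xq_mono[OF xq_pt[OF o1(2) q1(2)]]; simp)+
    note w = xq_pw[OF o1(1) q1(1)] xq_pw[OF o1(2) q1(2)]
    consider "l < k" | "k \<le> l" "l < 2 * k" | "2 * k \<le> l" "l < 3 * k" | "3 * k \<le> l" "l < 4 * k" | "l = 4 * k" | "l = 4 * k + 1" | "l > 4 * k + 1"
      by linarith
    thus ?thesis
    proof cases
      case 1 thus ?thesis using a(1)[of l] by (simp add: P_def [abs_def])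
    next
      case 2 thus ?thesis using a(3)[of "l - k"] by (simp add: P_def [abs_def])
    next
      case 3 thus ?thesis using a(2)[of "l - 2 * k"] by (simp add: P_def [abs_def])
    next
      case 4 thus ?thesis using a(4)[of "l - 3 * k"] by (simp add: P_def [abs_def])
    next
      case 5 thus ?thesis using xq_diff[OF t(2) t(1)] by (simp add: P_def [abs_def])
    next
      case 6 thus ?thesis using t(1) by (simp add: P_def [abs_def])
    next
      case 7 thus ?thesis using xq_diff[OF w(2) w(1)] by (simp add: P_def [abs_def])
    qed
  qed
  define V where "V i x y = (\<Sum>j<2*n. A i j y * x j) - B i y" for i x y
  obtain N c where c: "\<exists>\<alpha>\<in>expbox r (\<lambda>i. if i < 2 * n then N else E). c \<alpha> \<noteq> 0"
     "\<And>x y. (\<forall>i\<ge>2*n. x i = 0) \<Longrightarrow> (\<Sum>\<alpha>\<in>expbox r (\<lambda>i. if i < 2 * n then N else E).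
        c \<alpha> * pmon r \<alpha> (\<lambda>i. if i < 2 * n then V i x y else P (i - 2 * n) x y)) = 0"
    by (rule eliminationE[of "2 * n" m A "\<lambda>_. 0" 8 B P r, OF pfA A0 _ pfB xqP r_def, folded V_def E_def]) auto
  \<comment> \<open>All variables but the last two, namely the level and the difference of the
    minima. In particular the difference of the two levels is specialised, with limit 0.\<close>
  define I where "I = {..<2 * n + 4 * k + 1}"
  define D where "D = (\<lambda>i. if i \<in> I then 0 else if i < 2 * n then N else E)"
  define a0 where "a0 i = (if i < n then p0 i else if i < 2 * n then p1 (i - n) else if i < 2 * n + 2 * k then p0 (n + (i - 2 * n))
      else if i < 2 * n + 4 * k then p1 (n + (i - (2 * n + 2 * k))) else 0)" for i
  define q0 where "q0 a i = (if i < n then a i else if i < n + 2 * k then a (2 * n + (i - n)) else 0)" for a :: "nat \<Rightarrow> real" and i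
  define q1 where "q1 a i = (if i < n then a (n + i) else if i < n + 2 * k then a (2 * n + 2 * k + (i - n)) else 0)" for a :: "nat \<Rightarrow> real" and i
  have qa0: "q0 a0 = p0" using p0(2) by (auto simp: q0_def a0_def fun_eq_iff)
  have qa1: "q1 a0 = p1" using p1(2) by (auto simp: q1_def a0_def fun_eq_iff)
  have I: "I \<subseteq> {..<r}" by (auto simp: I_def r_def m_def)
  obtain c' where c0: "(\<exists>\<beta>\<in>expbox r D. c' \<beta> \<noteq> (0::real)) \<and>
     (\<forall>z0. (\<forall>a. a \<longlonglongrightarrow> a0 \<longrightarrow> (\<exists>z. z \<longlonglongrightarrow> z0 \<and> (\<forall>\<^sub>F j in sequentially.
              (\<Sum>\<alpha>\<in>expbox r (\<lambda>i. if i < 2 * n then N else E). c \<alpha> * pmon r \<alpha> (\<lambda>i. if i \<in> I then a j i else z j i)) = 0))) \<longrightarrow>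
        (\<Sum>\<beta>\<in>expbox r D. c' \<beta> * pmon r \<beta> z0) = 0)"
    using specialise_limit[OF I c(1)] unfolding D_def by (rule exE)
  define Zt where "Zt t = (\<lambda>i. if i = 2 * n + 4 * k + 1 then t else W \<epsilon> e p1 t - W \<epsilon> e p0 t)" for t
  have rel: "(\<Sum>\<beta>\<in>expbox r D. c' \<beta> * pmon r \<beta> (Zt t)) = 0" if t: "t \<in> Ts" for t
  proof (rule c0[THEN conjunct2, rule_format])
    fix a :: "nat \<Rightarrow> nat \<Rightarrow> real" assume a: "a \<longlonglongrightarrow> a0"
    \<comment> \<open>Before the limit, the second copy sits at a slightly different level;
      continuity of \<open>W\<close> brings both to the level \<open>t\<close>.\<close>
    define \<tau> where "\<tau> j = t + a j (2 * n + 4 * k)" for j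
    have l0: "(\<lambda>j. q0 (a j)) \<longlonglongrightarrow> p0"
      unfolding qa0[symmetric] tendsto_fun_iff q0_def by (auto intro!: tendsto_fun[OF a])
    have l1: "(\<lambda>j. q1 (a j)) \<longlonglongrightarrow> p1"
      unfolding qa1[symmetric] tendsto_fun_iff q1_def by (auto intro!: tendsto_fun[OF a])
    have "(\<lambda>j. a j (2 * n + 4 * k)) \<longlonglongrightarrow> 0" using tendsto_fun[OF a, of "2 * n + 4 * k"] by (simp add: a0_def)
    hence lt: "\<tau> \<longlonglongrightarrow> t" unfolding \<tau>_def using tendsto_add[OF tendsto_const] by fastforce
    have small: "\<forall>\<^sub>F j in sequentially. \<forall>i. \<bar>q j i\<bar> \<le> \<epsilon>"
      if q: "q \<longlonglongrightarrow> p" "\<And>i. \<bar>p i\<bar> < \<epsilon>" "\<And>j i. i \<ge> n + 2 * k \<Longrightarrow> q j i = 0" for q p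
    proof -
      have "\<forall>\<^sub>F j in sequentially. \<bar>q j i\<bar> < \<epsilon>" for i
        by (rule order_tendstoD(2)[OF tendsto_rabs[OF tendsto_fun[OF q(1)]] q(2)])
      hence "\<forall>\<^sub>F j in sequentially. \<forall>i\<in>{..<n + 2 * k}. \<bar>q j i\<bar> < \<epsilon>"
        by (intro eventually_ball_finite) auto
      thus ?thesis
      proof eventually_elim
        case (elim j)
        show ?case
        proof
          fix i
          show "\<bar>q j i\<bar> \<le> \<epsilon>" using bspec[OF elim, of i] q(3)[of i j] \<epsilon>(1) by (cases "i < n + 2 * k") auto
        qed
      qed
    qed
    define z where "z j = (\<lambda>i. if i = 2 * n + 4 * k + 1 then t else W \<epsilon> e (q1 (a j)) (\<tau> j) - W \<epsilon> e (q0 (a j)) t)" for j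
    have "z \<longlonglongrightarrow> Zt t" unfolding tendsto_fun_iff z_def Zt_def
      by (auto intro!: tendsto_diff tendsto_W \<epsilon>(1) l0 l1 lt)
    moreover have "\<forall>\<^sub>F j in sequentially. (\<Sum>\<alpha>\<in>expbox r (\<lambda>i. if i < 2 * n then N else E).
        c \<alpha> * pmon r \<alpha> (\<lambda>i. if i \<in> I then a j i else z j i)) = 0"
    proof -
      have "\<forall>\<^sub>F j in sequentially. \<forall>i. \<bar>q0 (a j) i\<bar> \<le> \<epsilon>"
        by (rule small[OF l0 p0(1)]) (simp add: q0_def)
      moreover have "\<forall>\<^sub>F j in sequentially. \<forall>i. \<bar>q1 (a j) i\<bar> \<le> \<epsilon>"
        by (rule small[OF l1 p1(1)]) (simp add: q1_def)
      moreover have "\<forall>\<^sub>F j in sequentially. \<bar>\<tau> j\<bar> < 2 * real n + 2"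
        by (rule order_tendstoD(2)[OF tendsto_rabs[OF lt]]) (use t in \<open>auto simp: Ts_def\<close>)
      ultimately show ?thesis
      proof eventually_elim
        case (elim j)
        obtain x0 y0 where m0: "isMin \<epsilon> e (q0 (a j)) t x0 y0" using Phi_minimiser[OF \<epsilon>(1)] by blast
        obtain x1 y1 where m1: "isMin \<epsilon> e (q1 (a j)) (\<tau> j) x1 y1" using Phi_minimiser[OF \<epsilon>(1)] by blast
        have i0: "eucl_norm n x0 < 1" by (rule confinedD[OF int elim(1) _ m0]) (use t in \<open>auto simp: Ts_def\<close>)
        have i1: "eucl_norm n x1 < 1" by (rule confinedD[OF int elim(2) _ m1]) (use elim in auto)
        have b0: "\<bar>y0 l\<bar> < Lam \<epsilon>" if "l < k" for l
          by (rule multiplier_interior[OF e \<epsilon> _ m0 that]) (use elim in auto)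
        have b1: "\<bar>y1 l\<bar> < Lam \<epsilon>" if "l < k" for l
          by (rule multiplier_interior[OF e \<epsilon> _ m1 that]) (use elim in auto)
        define X where "X i = (if i < n then x0 i else if i < 2 * n then x1 (i - n) else 0)" for i
        define Y where "Y i = (if i < k then y0 i else if i < 2 * k then (Qv (i - k) x0 - q0 (a j) (n + i)) / \<epsilon> ^ 2
            else if i = 2 * k then (f e x0 - t) / \<epsilon> else if i < s' + k then y1 (i - s')
            else if i < s' + 2 * k then (Qv (i - s' - k) x1 - q1 (a j) (n + (i - s'))) / \<epsilon> ^ 2 else (f e x1 - \<tau> j) / \<epsilon>)" for i
        have Y0: "Y (0 + l) = y0 l" "Y (0 + k + l) = (Qv l x0 - q0 (a j) (n + k + l)) / \<epsilon> ^ 2" if "l < k" for l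
          using that by (simp_all add: Y_def add.assoc)
        have Y0': "Y (0 + 2 * k) = (f e x0 - t) / \<epsilon>" by (simp add: Y_def)
        have Y1: "Y (s' + l) = y1 l" "Y (s' + k + l) = (Qv l x1 - q1 (a j) (n + k + l)) / \<epsilon> ^ 2" if "l < k" for l
          using that by (simp_all add: Y_def s'_def add.assoc)
        have Y1': "Y (s' + 2 * k) = (f e x1 - \<tau> j) / \<epsilon>" by (simp add: Y_def s'_def)
        have X0: "X (0 + i) = x0 i" "X (n + i) = x1 i" if "i < n" for i using that by (simp_all add: X_def)
        note S0a = critical_system[OF m0 \<epsilon>(1) i0 b0 X0(1) Y0 Y0']
        have S0: "\<And>i. i < n \<Longrightarrow> (\<Sum>j<n. blkA 0 i j Y * X (0 + j)) - blkB e 0 i Y = q0 (a j) i"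
          "\<And>l. l < k \<Longrightarrow> pa \<epsilon> e 0 0 l X Y = q0 (a j) (n + l)"
          "\<And>l. l < k \<Longrightarrow> pm \<epsilon> 0 0 l X Y = q0 (a j) (n + k + l)"
          "pt \<epsilon> e 0 0 X Y = t" "pw \<epsilon> e 0 0 X Y = W \<epsilon> e (q0 (a j)) (t)"
          by (rule S0a; simp)+
        note S1a = critical_system[OF m1 \<epsilon>(1) i1 b1 X0(2) Y1 Y1']
        have S1: "\<And>i. i < n \<Longrightarrow> (\<Sum>j<n. blkA s' i j Y * X (n + j)) - blkB e s' i Y = q1 (a j) i"
          "\<And>l. l < k \<Longrightarrow> pa \<epsilon> e n s' l X Y = q1 (a j) (n + l)"
          "\<And>l. l < k \<Longrightarrow> pm \<epsilon> n s' l X Y = q1 (a j) (n + k + l)"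
          "pt \<epsilon> e n s' X Y = \<tau> j" "pw \<epsilon> e n s' X Y = W \<epsilon> e (q1 (a j)) (\<tau> j)"
          by (rule S1a; simp)+
        have V0: "V i X Y = q0 (a j) i" if "i < n" for i
        proof -
          have "(\<Sum>l<2*n. A i l Y * X l) = (\<Sum>l<n. A i l Y * X l) + (\<Sum>l<n. A i (n + l) Y * X (n + l))"
            by (simp add: mult_2 sum_lessThan_add)
          also have "(\<Sum>l<n. A i (n + l) Y * X (n + l)) = 0" using that by (simp add: A_def)
          also have "(\<Sum>l<n. A i l Y * X l) = (\<Sum>l<n. blkA 0 i l Y * X (0 + l))"
            using that by (intro sum.cong) (auto simp: A_def)
          finally show ?thesis using S0(1)[OF that] that by (simp add: V_def B_def)
        qed
        have V1: "V (n + i) X Y = q1 (a j) i" if "i < n" for i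
        proof -
          have "(\<Sum>l<2*n. A (n + i) l Y * X l) = (\<Sum>l<n. A (n + i) l Y * X l) + (\<Sum>l<n. A (n + i) (n + l) Y * X (n + l))"
            by (simp add: mult_2 sum_lessThan_add)
          also have "(\<Sum>l<n. A (n + i) l Y * X l) = 0" by (simp add: A_def)
          also have "(\<Sum>l<n. A (n + i) (n + l) Y * X (n + l)) = (\<Sum>l<n. blkA s' i l Y * X (n + l))"
            by (intro sum.cong) (auto simp: A_def)
          finally show ?thesis using S1(1)[OF that] by (simp add: V_def B_def)
        qed
        have "pmon r \<alpha> (\<lambda>i. if i \<in> I then a j i else z j i) =
              pmon r \<alpha> (\<lambda>i. if i < 2 * n then V i X Y else P (i - 2 * n) X Y)" for \<alpha>
        proof (rule pmon_local)
          fix i assume i: "i < r"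
          consider "i < n" | "n \<le> i" "i < 2 * n" | l where "i = 2 * n + l" "l < k" | l where "i = 2 * n + k + l" "l < k"
            | l where "i = 2 * n + 2 * k + l" "l < k" | l where "i = 2 * n + 3 * k + l" "l < k"
            | "i = 2 * n + 4 * k" | "i = 2 * n + 4 * k + 1" | "i = 2 * n + 4 * k + 2"
          proof -
            have ex: "\<exists>l<k. i = q + l" if "q \<le> i" "i < q + k" for q
              using that by (intro exI[of _ "i - q"]) auto
            show ?thesis
            proof (cases "i < 2 * n + 4 * k")
              case True
              hence "i < n \<or> (n \<le> i \<and> i < 2 * n) \<or> (2 * n \<le> i \<and> i < 2 * n + k) \<or> (2 * n + k \<le> i \<and> i < 2 * n + k + k)
                \<or> (2 * n + 2 * k \<le> i \<and> i < 2 * n + 2 * k + k) \<or> (2 * n + 3 * k \<le> i \<and> i < 2 * n + 3 * k + k)"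
                by linarith
              thus ?thesis using that(1-6) ex by blast
            next
              case False
              hence "i = 2 * n + 4 * k \<or> i = 2 * n + 4 * k + 1 \<or> i = 2 * n + 4 * k + 2"
                using i unfolding r_def m_def by linarith
              thus ?thesis using that(7-9) by blast
            qed
          qed
          thus "(if i \<in> I then a j i else z j i) = (if i < 2 * n then V i X Y else P (i - 2 * n) X Y)"
          proof cases
            case 1 thus ?thesis by (simp add: I_def V0 q0_def)
          next
            case 2
            hence "i - n < n" "n + (i - n) = i" by auto
            thus ?thesis using V1[of "i - n"] 2 by (simp add: I_def q1_def)
          next
            case 3 thus ?thesis using S0(2)[of l] by (simp add: I_def P_def q0_def)
          next
            case 4 thus ?thesis using S0(3)[of l] by (simp add: I_def P_def q0_def add.assoc)
          next
            case 5 thus ?thesis using S1(2)[of l] by (simp add: I_def P_def q1_def)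
          next
            case 6 thus ?thesis using S1(3)[of l] by (simp add: I_def P_def q1_def algebra_simps)
          next
            case 7 thus ?thesis using S0(4) S1(4) by (simp add: I_def P_def \<tau>_def)
          next
            case 8 thus ?thesis using S0(4) by (simp add: I_def P_def z_def)
          next
            case 9 thus ?thesis using S0(5) S1(5) by (simp add: I_def P_def z_def)
          qed
        qed
        moreover have "\<forall>i\<ge>2*n. X i = 0" by (simp add: X_def)
        ultimately show ?case using c(2)[of X Y] by simp
      qed
    qed
    ultimately show "\<exists>z. z \<longlonglongrightarrow> Zt t \<and> (\<forall>\<^sub>F j in sequentially. (\<Sum>\<alpha>\<in>expbox r (\<lambda>i. if i < 2 * n then N else E).
        c \<alpha> * pmon r \<alpha> (\<lambda>i. if i \<in> I then a j i else z j i)) = 0)" by blast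
  qed
  have DI: "D i = 0" if "i < r" "i \<noteq> 2 * n + 4 * k + 1" "i \<noteq> 2 * n + 4 * k + 2" for i
    using that by (auto simp: D_def I_def r_def m_def)
  have "\<exists>Z. finite Z \<and> (\<forall>s. s \<notin> Z \<longrightarrow> (\<exists>p. p \<noteq> 0 \<and> degree p \<le> D (2 * n + 4 * k + 1) \<and>
     (\<forall>w. w (2 * n + 4 * k + 2) = s \<longrightarrow> (\<Sum>\<beta>\<in>expbox r D. c' \<beta> * pmon r \<beta> w) = poly p (w (2 * n + 4 * k + 1)))))"
    by (rule two_variable_relation[OF c0[THEN conjunct1] _ _ _ DI]) (auto simp: r_def m_def)
  then obtain Z where Z: "finite Z" "\<And>s. s \<notin> Z \<Longrightarrow> (\<exists>p. p \<noteq> 0 \<and> degree p \<le> D (2 * n + 4 * k + 1) \<and>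
     (\<forall>w. w (2 * n + 4 * k + 2) = s \<longrightarrow> (\<Sum>\<beta>\<in>expbox r D. c' \<beta> * pmon r \<beta> w) = poly p (w (2 * n + 4 * k + 1))))"
    by blast
  have "finite {t \<in> Ts. W \<epsilon> e p1 t - W \<epsilon> e p0 t = s} \<and> card {t \<in> Ts. W \<epsilon> e p1 t - W \<epsilon> e p0 t = s} \<le> E" if sZ: "s \<notin> Z" for s
  proof -
    obtain p where p: "p \<noteq> 0" "degree p \<le> D (2 * n + 4 * k + 1)"
      "\<And>w. w (2 * n + 4 * k + 2) = s \<Longrightarrow> (\<Sum>\<beta>\<in>expbox r D. c' \<beta> * pmon r \<beta> w) = poly p (w (2 * n + 4 * k + 1))"
      using Z(2)[OF sZ] by blast
    have sub: "{t \<in> Ts. W \<epsilon> e p1 t - W \<epsilon> e p0 t = s} \<subseteq> {t. poly p t = 0}"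
    proof safe
      fix t assume t: "t \<in> Ts"
      assume "s = W \<epsilon> e p1 t - W \<epsilon> e p0 t"
      thus "poly p t = 0" using p(3)[of "Zt t"] rel[OF t] by (simp add: Zt_def)
    qed
    have fin: "finite {t. poly p t = 0}" by (rule poly_roots_finite[OF p(1)])
    have "card {t \<in> Ts. W \<epsilon> e p1 t - W \<epsilon> e p0 t = s} \<le> card {t. poly p t = 0}" by (rule card_mono[OF fin sub])
    also have "\<dots> \<le> degree p" by (rule card_poly_roots_bound[OF p(1)])
    also have "\<dots> \<le> E" using p(2) by (simp add: D_def I_def)
    finally show ?thesis using finite_subset[OF sub fin] by blast
  qed
  thus ?thesis using Z(1) unfolding E_def m_def by blast
qed

lemma Phi_shift: "j < n \<Longrightarrow> Phi \<epsilon> e (p(j := p j + \<sigma>)) t x \<eta> = Phi \<epsilon> e p t x \<eta> - \<sigma> * x j"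
proof -
  assume j: "j < n"
  have "(\<Sum>i<n. (p(j := p j + \<sigma>)) i * x i) = (\<Sum>i<n. p i * x i + (if i = j then \<sigma> * x j else 0))"
    by (intro sum.cong) (auto simp: algebra_simps)
  also have "\<dots> = (\<Sum>i<n. p i * x i) + \<sigma> * x j" using j by (simp add: sum.distrib)
  finally show ?thesis using j by (simp add: Phi_def)
qed

text \<open>The minimiser for \<open>p\<close> is a competitor for the shifted problem. This is the
  one-sided half of the envelope theorem and needs no differentiability.\<close>

lemma W_shift_le:
  assumes "\<epsilon> > 0" "j < n" "isMin \<epsilon> e p t x \<eta>"
  shows "W \<epsilon> e (p(j := p j + \<sigma>)) t \<le> W \<epsilon> e p t - \<sigma> * x j"
  using W_le[OF assms(1), of x \<eta> e "p(j := p j + \<sigma>)" t] assms(3) W_eq[OF assms(3)] Phi_shift[OF assms(2)]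
  by (simp add: isMin_def)

lemma Bn_coord: "x \<in> Bn n \<Longrightarrow> i < n \<Longrightarrow> \<bar>x i\<bar> \<le> 1"
  using coord_le_eucl_norm[of i n x] by (simp add: Bn_def)

text \<open>The difference of the minima has a range of order \<open>\<sigma>\<close>, so the
  variation bound stays independent of \<open>\<sigma>\<close> after division by
  \<open>\<sigma>\<close>.\<close>

lemma W_shift_abs:
  assumes "\<epsilon> > 0" "j < n"
  shows "\<bar>W \<epsilon> e (p(j := p j + \<sigma>)) t - W \<epsilon> e p t\<bar> \<le> \<bar>\<sigma>\<bar>"
proof -
  have up: "W \<epsilon> e (p(j := p j + \<sigma>)) t \<le> W \<epsilon> e p t + \<bar>\<sigma>\<bar>" for p \<sigma>
  proof -
    obtain x \<eta> where m: "isMin \<epsilon> e p t x \<eta>" using Phi_minimiser[OF assms(1)] by blast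
    have "\<bar>x j\<bar> \<le> 1" using m assms(2) by (intro Bn_coord) (auto simp: isMin_def)
    hence "\<bar>\<sigma>\<bar> * \<bar>x j\<bar> \<le> \<bar>\<sigma>\<bar>" by (simp add: mult_left_le)
    hence "\<bar>\<sigma> * x j\<bar> \<le> \<bar>\<sigma>\<bar>" by (simp add: abs_mult)
    thus ?thesis using W_shift_le[OF assms m, of \<sigma>] by linarith
  qed
  from up[of p \<sigma>] up[of "p(j := p j + \<sigma>)" "-\<sigma>"] show ?thesis by simp
qed

text \<open>By the envelope theorem, \<open>- \<gamma> t j\<close> is the derivative of \<open>W\<close> in the perturbation \<open>v j\<close>, hence a limit of
  difference quotients whose level sets are bounded. The derivative exists because \<open>W\<close> is concave in \<open>v\<close> and
  \<open>v\<close> minimises a sum of the values of \<open>W\<close> over \<open>T\<close> plus a quadratic term.\<close>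

lemma variation_of_minimisers:
  assumes e: "\<forall>i. \<bar>e i\<bar> \<le> 1" and \<epsilon>: "0 < \<epsilon>" "\<epsilon> \<le> 1"
    and int: "confined \<epsilon> e"
    and T: "finite T" "T \<subseteq> {- (2 * real n + 1)..2 * real n + 1}"
  shows "\<exists>v \<gamma> \<eta>. (\<forall>i. \<bar>v i\<bar> \<le> \<epsilon>) \<and> (\<forall>i\<ge>n. v i = 0) \<and> (\<forall>t. isMin \<epsilon> e v t (\<gamma> t) (\<eta> t)) \<and>
    (\<forall>j<n. \<forall>N s. (\<forall>i\<le>N. s i \<in> T) \<longrightarrow> (\<forall>i<N. s i < s (Suc i)) \<longrightarrow>
       (\<Sum>i<N. \<bar>\<gamma> (s (Suc i)) j - \<gamma> (s i) j\<bar>) \<le> 2 * real (elim_degree (2 * n) (4 * k + 2)))"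
proof -
  define E where "E = elim_degree (2 * n) (4 * k + 2)"
  \<comment> \<open>Half of the admissible size leaves room for the shifted perturbation, which has
    to be smaller than \<open>\<epsilon>\<close> as well.\<close>
  define r where "r = \<epsilon> / 2"
  have r: "r > 0" "r < \<epsilon>" using \<epsilon> by (auto simp: r_def)
  \<comment> \<open>On the boundary of the cube the quadratic term is at least
    \<open>K * r ^ 2\<close>, which exceeds by \<open>r\<close> the largest possible drop
    \<open>card T * n * r\<close> of the sum of the minima. Hence the minimising \<open>v\<close> is
    interior.\<close>
  define K where "K = (real (card T) * real n + 1) / r"
  have K: "K > 0" using r by (simp add: K_def add_nonneg_pos)
  define Sv where "Sv v = (\<Sum>t\<in>T. W \<epsilon> e v t) + K * (\<Sum>i<n. v i ^ 2)" for v
  have z: "(\<lambda>_. 0) \<in> Cube n r" using r by (auto simp: Cube_def)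
  have "continuous_on (Cube n r) Sv"
    unfolding Sv_def continuous_on_def
    by (intro ballI tendsto_intros tendsto_W \<epsilon>(1)) (auto intro: tendsto_ident_at tendsto_fun)
  then obtain v where v: "v \<in> Cube n r" "\<And>v'. v' \<in> Cube n r \<Longrightarrow> Sv v \<le> Sv v'"
    using continuous_attains_inf[of "Cube n r" Sv] compact_Cube[of n r] z by blast
  have v0: "v i = 0" if "i \<ge> n" for i using v(1) that by (auto simp: Cube_def dest!: spec[of _ i])
  have vr: "\<bar>v i\<bar> \<le> r" for i
    using v(1) r by (cases "i < n") (auto simp: Cube_def v0 abs_le_iff minus_le_iff dest!: spec[of _ i])
  have vlt: "\<bar>v j\<bar> < r" if j: "j < n" for j
  proof (rule ccontr)
    assume "\<not> \<bar>v j\<bar> < r"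
    hence vj: "\<bar>v j\<bar> = r" using vr[of j] by simp
    have W0: "W \<epsilon> e v t \<ge> W \<epsilon> e (\<lambda>_. 0) t - real n * r" for t
    proof -
      obtain x \<eta> where m: "isMin \<epsilon> e v t x \<eta>" using Phi_minimiser[OF \<epsilon>(1)] by blast
      have "W \<epsilon> e (\<lambda>_. 0) t \<le> Phi \<epsilon> e (\<lambda>_. 0) t x \<eta>" using m by (intro W_le \<epsilon>(1)) (auto simp: isMin_def)
      also have "\<dots> = Phi \<epsilon> e v t x \<eta> + (\<Sum>i<n. v i * x i)" by (simp add: Phi_def v0)
      also have "(\<Sum>i<n. v i * x i) \<le> (\<Sum>i<n. r)"
      proof (rule sum_mono)
        fix i assume "i \<in> {..<n}"
        hence "\<bar>x i\<bar> \<le> 1" using m by (intro Bn_coord) (auto simp: isMin_def)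
        hence "\<bar>v i\<bar> * \<bar>x i\<bar> \<le> r * 1" using vr[of i] r by (intro mult_mono) auto
        hence "\<bar>v i * x i\<bar> \<le> r" by (simp add: abs_mult)
        thus "v i * x i \<le> r" by linarith
      qed
      finally show ?thesis by (simp add: W_eq[OF m])
    qed
    have "(\<Sum>t\<in>T. W \<epsilon> e v t) \<ge> (\<Sum>t\<in>T. W \<epsilon> e (\<lambda>_. 0) t - real n * r)" by (intro sum_mono W0)
    moreover have "(\<Sum>t\<in>T. W \<epsilon> e (\<lambda>_. 0) t - real n * r) = Sv (\<lambda>_. 0) - real (card T) * real n * r"
      by (simp add: sum_subtractf Sv_def)
    moreover have "(\<Sum>i<n. v i ^ 2) \<ge> v j ^ 2" using j by (intro member_le_sum) auto
    hence "K * (\<Sum>i<n. v i ^ 2) \<ge> K * r ^ 2" using K vj by (metis less_imp_le mult_left_mono power2_abs)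
    moreover have "K * r = real (card T) * real n + 1" using r by (simp add: K_def)
    hence "K * r ^ 2 = real (card T) * real n * r + r" by (simp add: power2_eq_square mult.assoc[symmetric] distrib_right)
    ultimately have "Sv v > Sv (\<lambda>_. 0)" using r unfolding Sv_def[of v] by linarith
    thus False using v(2)[OF z] by simp
  qed
  have "\<forall>t. \<exists>z. isMin \<epsilon> e v t (fst z) (snd z)" using Phi_minimiser[OF \<epsilon>(1)] by auto
  then obtain zz where zz: "\<And>t. isMin \<epsilon> e v t (fst (zz t)) (snd (zz t))" by metis
  define \<gamma> where "\<gamma> t = fst (zz t)" for t
  have m: "isMin \<epsilon> e v t (\<gamma> t) (snd (zz t))" for t using zz by (simp add: \<gamma>_def)
  have tv: "(\<Sum>i<N. \<bar>\<gamma> (s (Suc i)) j - \<gamma> (s i) j\<bar>) \<le> 2 * real E"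
    if j: "j < n" and s: "\<And>i. i \<le> N \<Longrightarrow> s i \<in> T" "\<And>i. i < N \<Longrightarrow> s i < s (Suc i)" for j N s
  proof (rule field_le_epsilon)
    fix \<delta> :: real assume \<delta>: "\<delta> > 0"
    \<comment> \<open>Keeps the shifted vector in the cube and makes the accumulated error
      \<open>4 * K * N * \<sigma>\<close> at most \<open>\<delta>\<close>.\<close>
    define \<sigma> where "\<sigma> = min ((r - \<bar>v j\<bar>) / 2) (\<delta> / (4 * K * real N + 1))"
    have den: "4 * K * real N + 1 > 0" using K by (simp add: add_nonneg_pos)
    have "\<sigma> \<le> (r - \<bar>v j\<bar>) / 2" unfolding \<sigma>_def by (rule min.cobounded1)
    hence \<sigma>: "\<sigma> > 0" "\<sigma> < r - \<bar>v j\<bar>" using \<delta> vlt[OF j] den by (auto simp: \<sigma>_def)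
    have \<sigma>2: "4 * K * real N * \<sigma> \<le> \<delta>"
    proof -
      have "\<sigma> \<le> \<delta> / (4 * K * real N + 1)" by (simp add: \<sigma>_def)
      hence "\<sigma> * (4 * K * real N + 1) \<le> \<delta>" using den by (simp only: pos_le_divide_eq)
      thus ?thesis using \<sigma>(1) by (simp add: algebra_simps)
    qed
    define u where "u \<tau> = v(j := v j + \<tau>)" for \<tau>
    have uC: "u \<tau> \<in> Cube n r" if "\<bar>\<tau>\<bar> \<le> \<sigma>" for \<tau>
      unfolding Cube_def
    proof (intro CollectI allI)
      fix i
      show "u \<tau> i \<in> (if i < n then {- r..r} else {0})"
        using vr[of i] v0[of i] j that \<sigma>(2) by (auto simp: u_def abs_le_iff)
    qed
    define Dl where "Dl \<tau> t = W \<epsilon> e (u \<tau>) t - W \<epsilon> e v t" for \<tau> t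
    have Dup: "Dl \<tau> t \<le> - \<tau> * \<gamma> t j" for \<tau> t
      unfolding Dl_def u_def using W_shift_le[OF \<epsilon>(1) j m, of \<tau> t] by simp
    have Dabs: "\<bar>Dl \<tau> t\<bar> \<le> \<bar>\<tau>\<bar>" for \<tau> t unfolding Dl_def u_def by (rule W_shift_abs[OF \<epsilon>(1) j])
    have sq: "(\<Sum>i<n. u \<tau> i ^ 2) = (\<Sum>i<n. v i ^ 2) + (2 * v j * \<tau> + \<tau> ^ 2)" for \<tau>
    proof -
      have "(\<Sum>i<n. u \<tau> i ^ 2) = (\<Sum>i<n. v i ^ 2 + (if i = j then 2 * v j * \<tau> + \<tau> ^ 2 else 0))"
        by (intro sum.cong) (auto simp: u_def power2_eq_square algebra_simps)
      thus ?thesis using j by (simp add: sum.distrib)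
    qed
    have Dsum: "(\<Sum>t\<in>T. Dl \<tau> t) \<ge> - K * (2 * v j * \<tau> + \<tau> ^ 2)" if "\<bar>\<tau>\<bar> \<le> \<sigma>" for \<tau>
      using v(2)[OF uC[OF that]] by (simp add: Sv_def Dl_def sq sum_subtractf algebra_simps)
    have "(\<Sum>t\<in>T. Dl \<sigma> t + Dl (- \<sigma>) t) \<ge> - 2 * K * \<sigma> ^ 2"
      using Dsum[of \<sigma>] Dsum[of "- \<sigma>"] \<sigma>(1) by (simp add: sum.distrib algebra_simps)
    moreover have neg: "Dl \<sigma> t + Dl (- \<sigma>) t \<le> 0" for t using Dup[of \<sigma> t] Dup[of "-\<sigma>" t] by simp
    \<comment> \<open>Minimality of \<open>v\<close> bounds the sum of the second differences from
      below, the linear terms cancelling. No second difference is positive, so the lower bound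
      applies to each of them; this forces \<open>Dl \<sigma> t\<close> to be
      \<open>- \<sigma> * \<gamma> t j\<close> up to order \<open>\<sigma> ^ 2\<close>.\<close>
    ultimately have each: "Dl \<sigma> t + Dl (- \<sigma>) t \<ge> - 2 * K * \<sigma> ^ 2" if "t \<in> T" for t
    proof -
      have "(\<Sum>t\<in>T. Dl \<sigma> t + Dl (- \<sigma>) t) = (Dl \<sigma> t + Dl (- \<sigma>) t) + (\<Sum>t\<in>T - {t}. Dl \<sigma> t + Dl (- \<sigma>) t)"
        by (rule sum.remove[OF T(1) that])
      moreover have "(\<Sum>t\<in>T - {t}. Dl \<sigma> t + Dl (- \<sigma>) t) \<le> 0" by (intro sum_nonpos neg)
      ultimately show ?thesis using \<open>(\<Sum>t\<in>T. Dl \<sigma> t + Dl (- \<sigma>) t) \<ge> - 2 * K * \<sigma> ^ 2\<close> by linarith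
    qed
    have close: "\<bar>Dl \<sigma> t + \<sigma> * \<gamma> t j\<bar> \<le> 2 * K * \<sigma> ^ 2" if "t \<in> T" for t
      using each[OF that] Dup[of \<sigma> t] Dup[of "-\<sigma>" t] by (simp add: abs_le_iff)
    have "\<exists>Z. finite Z \<and> (\<forall>s. s \<notin> Z \<longrightarrow> finite {t \<in> {- (2 * real n + 1)..2 * real n + 1}. W \<epsilon> e (u \<sigma>) t - W \<epsilon> e v t = s} \<and>
       card {t \<in> {- (2 * real n + 1)..2 * real n + 1}. W \<epsilon> e (u \<sigma>) t - W \<epsilon> e v t = s} \<le> E)"
      unfolding E_def
    proof (rule level_sets_bounded[OF e \<epsilon> int])
      show "\<bar>v i\<bar> < \<epsilon>" for i using vr[of i] r(2) by linarith
      show "\<bar>u \<sigma> i\<bar> < \<epsilon>" for i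
      proof (cases "i = j")
        case True
        thus ?thesis using \<sigma> r(2) by (simp add: u_def)
      next
        case False
        thus ?thesis using vr[of i] r(2) by (simp add: u_def)
      qed
      show "v i = 0" "u \<sigma> i = 0" if "i \<ge> n + 2 * k" for i using that j by (auto simp: u_def v0)
    qed
    then obtain Z where Z: "finite Z" "\<And>s. s \<notin> Z \<Longrightarrow> finite {t \<in> {- (2 * real n + 1)..2 * real n + 1}. Dl \<sigma> t = s} \<and>
       card {t \<in> {- (2 * real n + 1)..2 * real n + 1}. Dl \<sigma> t = s} \<le> E"
      unfolding Dl_def by blast
    have cont: "continuous_on {- (2 * real n + 1)..2 * real n + 1} (Dl \<sigma>)"
      unfolding Dl_def continuous_on_def by (intro ballI tendsto_diff tendsto_W \<epsilon>(1) tendsto_const tendsto_ident_at)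
    have var: "(\<Sum>i<N. \<bar>Dl \<sigma> (s (Suc i)) - Dl \<sigma> (s i)\<bar>) \<le> 2 * \<sigma> * real E"
    proof (rule variation_le_of_level_sets[OF cont Z])
      show "s i \<in> {- (2 * real n + 1)..2 * real n + 1}" if "i \<le> N" for i using s(1)[OF that] T(2) by blast
    qed (use s Dabs[of \<sigma>] \<sigma>(1) in auto)
    have "\<sigma> * (\<Sum>i<N. \<bar>\<gamma> (s (Suc i)) j - \<gamma> (s i) j\<bar>) \<le> (\<Sum>i<N. \<bar>Dl \<sigma> (s (Suc i)) - Dl \<sigma> (s i)\<bar> + 4 * K * \<sigma> ^ 2)"
      unfolding sum_distrib_left
    proof (rule sum_mono)
      fix i assume "i \<in> {..<N}"
      hence i: "i < N" by simp
      have "\<bar>\<sigma> * \<gamma> (s (Suc i)) j - \<sigma> * \<gamma> (s i) j\<bar> \<le> \<bar>Dl \<sigma> (s (Suc i)) - Dl \<sigma> (s i)\<bar> + 4 * K * \<sigma> ^ 2"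
        using close[OF s(1)[of i]] close[OF s(1)[of "Suc i"]] i by (simp add: abs_le_iff) linarith
      also have "\<bar>\<sigma> * \<gamma> (s (Suc i)) j - \<sigma> * \<gamma> (s i) j\<bar> = \<sigma> * \<bar>\<gamma> (s (Suc i)) j - \<gamma> (s i) j\<bar>"
        using \<sigma>(1) by (simp add: right_diff_distrib[symmetric] abs_mult)
      finally show "\<sigma> * \<bar>\<gamma> (s (Suc i)) j - \<gamma> (s i) j\<bar> \<le> \<bar>Dl \<sigma> (s (Suc i)) - Dl \<sigma> (s i)\<bar> + 4 * K * \<sigma> ^ 2" .
    qed
    also have "\<dots> \<le> 2 * \<sigma> * real E + real N * (4 * K * \<sigma> ^ 2)" using var by (simp add: sum.distrib)
    also have "\<dots> = \<sigma> * (2 * real E + 4 * K * real N * \<sigma>)" by (simp add: power2_eq_square algebra_simps)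
    finally have "(\<Sum>i<N. \<bar>\<gamma> (s (Suc i)) j - \<gamma> (s i) j\<bar>) \<le> 2 * real E + 4 * K * real N * \<sigma>"
      using \<sigma>(1) by (simp only: mult_le_cancel_left_pos)
    thus "(\<Sum>i<N. \<bar>\<gamma> (s (Suc i)) j - \<gamma> (s i) j\<bar>) \<le> 2 * real E + \<delta>" using \<sigma>2 by linarith
  qed
  have "\<bar>v i\<bar> \<le> \<epsilon>" for i using vr[of i] r by linarith
  thus ?thesis using v0 m tv unfolding E_def
    by (intro exI[of _ v] exI[of _ \<gamma>] exI[of _ "\<lambda>t. snd (zz t)"] conjI allI impI) blast+
qed

text \<open>The bounds on the variation of the coordinates are recast as a bounded function
  \<open>h\<close> that dominates distances. Inequalities between the values at two levels survive
  pointwise limits, and the bound on \<open>h\<close> does not depend on \<open>T\<close>.\<close>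

lemma finite_selection:
  assumes e: "\<forall>i. \<bar>e i\<bar> \<le> 1" and \<epsilon>: "0 < \<epsilon>" "\<epsilon> \<le> 1"
    and int: "confined \<epsilon> e"
    and T: "finite T" "T \<subseteq> {- (2 * real n + 1)..2 * real n + 1}"
  shows "\<exists>v \<gamma> \<eta> h. (\<forall>i. \<bar>v i\<bar> \<le> \<epsilon>) \<and> (\<forall>i\<ge>n. v i = 0) \<and> (\<forall>t. isMin \<epsilon> e v t (\<gamma> t) (\<eta> t)) \<and>
    (\<forall>t. 0 \<le> h t \<and> h t \<le> 2 * real n * real (elim_degree (2 * n) (4 * k + 2))) \<and>
    (\<forall>\<tau>\<in>T. \<forall>t\<in>T. \<tau> \<le> t \<longrightarrow> eucl_dist n (\<gamma> t) (\<gamma> \<tau>) \<le> h t - h \<tau>)"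
proof -
  define E where "E = elim_degree (2 * n) (4 * k + 2)"
  obtain v \<gamma> \<eta> where vv: "(\<forall>i. \<bar>v i\<bar> \<le> \<epsilon>) \<and> (\<forall>i\<ge>n. v i = 0) \<and> (\<forall>t. isMin \<epsilon> e v t (\<gamma> t) (\<eta> t)) \<and>
    (\<forall>j<n. \<forall>N s. (\<forall>i\<le>N. s i \<in> T) \<longrightarrow> (\<forall>i<N. s i < s (Suc i)) \<longrightarrow>
       (\<Sum>i<N. \<bar>\<gamma> (s (Suc i)) j - \<gamma> (s i) j\<bar>) \<le> 2 * real E)"
    using variation_of_minimisers[OF e \<epsilon> int T, folded E_def] by (elim exE) (erule that)
  note v = vv[THEN conjunct1] vv[THEN conjunct2, THEN conjunct1] vv[THEN conjunct2, THEN conjunct2, THEN conjunct1]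
  note tv = vv[THEN conjunct2, THEN conjunct2, THEN conjunct2, rule_format]
  define L where "L = sorted_list_of_set T"
  have L: "set L = T" "sorted_wrt (<) L" using T(1) by (auto simp: L_def)
  have Lmono: "L ! i < L ! j" if "i < j" "j < length L" for i j using sorted_wrt_nth_less[OF L(2) that] .
  define \<Delta> where "\<Delta> i = (\<Sum>j<n. \<bar>\<gamma> (L ! Suc i) j - \<gamma> (L ! i) j\<bar>)" for i
  have \<Delta>0: "\<Delta> i \<ge> 0" for i by (simp add: \<Delta>_def sum_nonneg)
  \<comment> \<open>The sum of the variations over those steps between neighbouring levels of
    \<open>T\<close> that end at or before \<open>t\<close>.\<close>
  define h where "h t = (\<Sum>i\<in>{i. Suc i < length L \<and> L ! Suc i \<le> t}. \<Delta> i)" for t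
  have h0: "h t \<ge> 0" for t unfolding h_def by (intro sum_nonneg \<Delta>0)
  have hV: "h t \<le> 2 * real n * real E" for t
  proof (cases "T = {}")
    case True
    thus ?thesis using L(1) by (simp add: h_def)
  next
    case False
    hence len: "length L > 0" using L(1) by auto
    have "h t \<le> (\<Sum>i<length L - 1. \<Delta> i)" unfolding h_def by (intro sum_mono2 \<Delta>0) auto
    also have "\<dots> = (\<Sum>j<n. \<Sum>i<length L - 1. \<bar>\<gamma> (L ! Suc i) j - \<gamma> (L ! i) j\<bar>)"
      unfolding \<Delta>_def by (rule sum.swap)
    also have "\<dots> \<le> (\<Sum>j<n. 2 * real E)"
    proof (rule sum_mono)
      fix j assume "j \<in> {..<n}"
      hence j: "j < n" by simp
      have lt: "i < length L" if "i \<le> length L - 1" for i using that len by linarith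
      show "(\<Sum>i<length L - 1. \<bar>\<gamma> (L ! Suc i) j - \<gamma> (L ! i) j\<bar>) \<le> 2 * real E"
      proof (rule tv[where s = "\<lambda>i. L ! i", OF j])
        fix i assume "i \<le> length L - 1"
        thus "L ! i \<in> T" using lt L(1) by (metis nth_mem)
      next
        fix i assume "i < length L - 1"
        thus "L ! i < L ! Suc i" by (intro Lmono) auto
      qed
    qed
    finally show ?thesis by simp
  qed
  have hb: "h (L ! b) = (\<Sum>i<b. \<Delta> i)" if b: "b < length L" for b
  proof -
    have "{i. Suc i < length L \<and> L ! Suc i \<le> L ! b} = {..<b}"
    proof safe
      fix i assume i: "Suc i < length L" "L ! Suc i \<le> L ! b"
      show "i < b" using Lmono[of b "Suc i"] i by (metis not_less not_less_eq order.strict_iff_not)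
    next
      fix i assume "i < b"
      thus "Suc i < length L" "L ! Suc i \<le> L ! b" using b Lmono[of "Suc i" b] by (cases "Suc i = b"; simp)+
    qed
    thus ?thesis by (simp add: h_def)
  qed
  have tri: "(\<Sum>j<n. \<bar>\<gamma> (L ! b) j - \<gamma> (L ! a) j\<bar>) \<le> (\<Sum>i<b. \<Delta> i) - (\<Sum>i<a. \<Delta> i)" if "a \<le> b" for a b
    using that
  proof (induction b rule: dec_induct)
    case (step b)
    have "(\<Sum>j<n. \<bar>\<gamma> (L ! Suc b) j - \<gamma> (L ! a) j\<bar>) \<le> (\<Sum>j<n. \<bar>\<gamma> (L ! b) j - \<gamma> (L ! a) j\<bar> + \<bar>\<gamma> (L ! Suc b) j - \<gamma> (L ! b) j\<bar>)"
      by (intro sum_mono) linarith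
    also have "\<dots> = (\<Sum>j<n. \<bar>\<gamma> (L ! b) j - \<gamma> (L ! a) j\<bar>) + \<Delta> b" by (simp add: sum.distrib \<Delta>_def)
    finally show ?case using step.IH by simp
  qed simp
  have "eucl_dist n (\<gamma> t) (\<gamma> \<tau>) \<le> h t - h \<tau>" if st: "\<tau> \<in> T" "t \<in> T" "\<tau> \<le> t" for \<tau> t
  proof -
    obtain a b where ab: "a < length L" "\<tau> = L ! a" "b < length L" "t = L ! b"
      using st(1,2) L(1) by (metis in_set_conv_nth)
    have "a \<le> b" using Lmono[of b a] ab st(3) by (metis not_le)
    have "eucl_dist n (\<gamma> t) (\<gamma> \<tau>) \<le> (\<Sum>j<n. \<bar>\<gamma> t j - \<gamma> \<tau> j\<bar>)" unfolding eucl_dist_def by (rule eucl_norm_le_sum)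
    also have "\<dots> \<le> h t - h \<tau>" using tri[OF \<open>a \<le> b\<close>] hb ab by simp
    finally show ?thesis .
  qed
  thus ?thesis using v h0 hV unfolding E_def
    by (intro exI[of _ v] exI[of _ \<gamma>] exI[of _ \<eta>] exI[of _ h] conjI) auto
qed

end

subsection \<open>Descending to the critical points\<close>

text \<open>Only the vertices have to lie in \<open>A\<close>. The last argument is the exact
  length, so that lengths add up under concatenation.\<close>

inductive chain :: "nat \<Rightarrow> (nat \<Rightarrow> real) set \<Rightarrow> real \<Rightarrow> (nat \<Rightarrow> real) \<Rightarrow> (nat \<Rightarrow> real) \<Rightarrow> real \<Rightarrow> bool"
  for n A \<delta> where
  chain_refl: "x \<in> A \<Longrightarrow> chain n A \<delta> x x 0"
| chain_step: "chain n A \<delta> x y L \<Longrightarrow> z \<in> A \<Longrightarrow> eucl_dist n y z \<le> \<delta> \<Longrightarrow> chain n A \<delta> x z (L + eucl_dist n y z)"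

context regular_quadrics
begin

text \<open>Bounded slopes near \<open>x\<close> force bounded multipliers by
  \<open>local_independence\<close>, so the multipliers accumulate at some \<open>\<eta>\<close>,
  and the estimate passes to the limit. The points \<open>X i\<close> may lie off
  \<open>M\<close>.\<close>

lemma slope_limit:
  assumes H: "H \<noteq> bot" and X: "(X \<longlongrightarrow> x) H" "\<And>i. X i \<in> Rn n" and x: "x \<in> M"
    and le: "\<forall>\<^sub>F i in H. eucl_norm n (xi e (Y i) (X i)) ^ 2 \<le> a ^ 2 + g i" and g: "(g \<longlongrightarrow> 0) H" and a: "a \<ge> 0"
  shows "\<exists>\<eta>. eucl_norm n (xi e \<eta> x) \<le> a"
proof -
  obtain \<kappa> \<rho> where k0: "\<kappa> > 0" "\<rho> > 0"
    and ind: "\<And>x' \<omega>. x' \<in> Rn n \<Longrightarrow> eucl_dist n x' x \<le> \<rho> \<Longrightarrow> \<kappa> * eucl_norm k \<omega> \<le> eucl_norm n (comb \<omega> x')"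
    using local_independence[OF x] by metis
  define A where "A = eucl_norm n (xi e (\<lambda>_. 0) x) + 1"
  define R where "R = (A + sqrt (a ^ 2 + 1)) / \<kappa>"
  define Y' where "Y' i j = (if j < k then Y i j else 0)" for i j
  have xiY: "xi e (Y' i) (X i) = xi e (Y i) (X i)" for i by (rule xi_local) (simp add: Y'_def)
  have "((\<lambda>i. eucl_dist n (X i) x) \<longlongrightarrow> 0) H" using tendsto_eucl_dist[OF X(1) tendsto_const, of n x] by simp
  hence "\<forall>\<^sub>F i in H. eucl_dist n (X i) x < \<rho>" using k0(2) by (rule order_tendstoD)
  moreover have "\<forall>\<^sub>F i in H. g i < 1" using g by (rule order_tendstoD) simp
  moreover have "((\<lambda>i. eucl_norm n (xi e (\<lambda>_. 0) (X i))) \<longlongrightarrow> eucl_norm n (xi e (\<lambda>_. 0) x)) H"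
    by (intro tendsto_eucl_norm tendsto_xi X(1) tendsto_const)
  hence "\<forall>\<^sub>F i in H. eucl_norm n (xi e (\<lambda>_. 0) (X i)) < A" by (rule order_tendstoD) (simp add: A_def)
  ultimately have "\<forall>\<^sub>F i in H. Y' i \<in> {y \<in> Rn k. eucl_dist k y (\<lambda>_. 0) \<le> R}"
    using le
  proof eventually_elim
    case (elim i)
    have "eucl_norm n (xi e (Y i) (X i)) ^ 2 \<le> a ^ 2 + 1" using elim by linarith
    hence 1: "eucl_norm n (xi e (Y i) (X i)) \<le> sqrt (a ^ 2 + 1)" by (rule real_le_rsqrt)
    have "\<kappa> * eucl_norm k (Y' i) \<le> eucl_norm n (comb (Y' i) (X i))" using ind[OF X(2)] elim by simp
    also have "comb (Y' i) (X i) = (\<lambda>l. xi e (\<lambda>_. 0) (X i) l + (-1) * xi e (Y' i) (X i) l)"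
      by (auto simp: xi_def comb_def)
    also have "eucl_norm n \<dots> \<le> eucl_norm n (xi e (\<lambda>_. 0) (X i)) + eucl_norm n (xi e (Y' i) (X i))"
      using eucl_norm_add[of n "xi e (\<lambda>_. 0) (X i)" "\<lambda>l. (-1) * xi e (Y' i) (X i) l"]
        eucl_norm_scale[of n "-1" "xi e (Y' i) (X i)"] by simp
    finally have "\<kappa> * eucl_norm k (Y' i) \<le> A + sqrt (a ^ 2 + 1)" using 1 elim(3) unfolding xiY by linarith
    hence "eucl_norm k (Y' i) \<le> R" using k0(1) by (simp add: R_def pos_le_divide_eq mult.commute)
    thus ?case by (simp add: eucl_dist_def Rn_def Y'_def)
  qed
  from compact_subfilter[OF compact_eucl_cball H this] obtain \<eta> H' where H': "H' \<le> H" "H' \<noteq> bot" "(Y' \<longlongrightarrow> \<eta>) H'"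
    by (auto simp: Rn_def)
  have l1: "((\<lambda>i. eucl_norm n (xi e (Y' i) (X i)) ^ 2) \<longlongrightarrow> eucl_norm n (xi e \<eta> x) ^ 2) H'"
    by (intro tendsto_power tendsto_eucl_norm tendsto_xi tendsto_mono[OF H'(1) X(1)] H'(3))
  have l2: "((\<lambda>i. a ^ 2 + g i) \<longlongrightarrow> a ^ 2 + 0) H'" by (intro tendsto_intros tendsto_mono[OF H'(1) g])
  have l3: "\<forall>\<^sub>F i in H'. eucl_norm n (xi e (Y' i) (X i)) ^ 2 \<le> a ^ 2 + g i"
    unfolding xiY using le H'(1) by (simp add: filter_leD)
  have "eucl_norm n (xi e \<eta> x) ^ 2 \<le> a ^ 2 + 0" by (rule tendsto_le[OF H'(2) l2 l1 l3])
  hence "eucl_norm n (xi e \<eta> x) \<le> a" using power2_le_imp_le[OF _ a] by simp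
  thus ?thesis by blast
qed

text \<open>A point \<open>z\<close> of \<open>M\<close> at the level \<open>t\<close> pays neither
  penalty. The error consists of the quadratic term in \<open>\<eta>'\<close> and of twice the
  perturbation term; the last assumption places \<open>\<eta>'\<close> in the cube.\<close>

lemma minimiser_energy:
  assumes e: "\<forall>i. \<bar>e i\<bar> \<le> 1" and \<epsilon>: "0 < \<epsilon>" and v: "\<forall>i. \<bar>v i\<bar> \<le> \<epsilon>" "\<forall>i\<ge>n. v i = 0"
    and min: "isMin \<epsilon> e v t x \<eta>" and z: "z \<in> M" "f e z = t" and L: "\<epsilon> * (1 + (\<Sum>j<k. \<bar>\<eta>' j\<bar>)) \<le> 1"
  shows "eucl_norm n (xi e \<eta> x) ^ 2 + (\<Sum>j<k. Qv j x ^ 2 / \<epsilon> ^ 2) + (f e x - t) ^ 2 / \<epsilon>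
     \<le> eucl_norm n (xi e \<eta>' z) ^ 2 + \<epsilon> * ((\<Sum>j<k. \<eta>' j ^ 2) + 2 * real n)"
proof -
  define \<eta>1 where "\<eta>1 j = (if j < k then \<eta>' j else 0)" for j
  have x\<eta>: "xi e \<eta>' z = xi e \<eta>1 z" by (rule xi_local) (simp add: \<eta>1_def)
  have "1 + (\<Sum>j<k. \<bar>\<eta>' j\<bar>) \<le> 1 / \<epsilon>" using L \<epsilon> by (simp add: pos_le_divide_eq mult.commute)
  also have "\<dots> \<le> (16 * real n + real k + 1) / \<epsilon>" using \<epsilon> by (intro divide_right_mono) auto
  finally have Lam: "1 + (\<Sum>j<k. \<bar>\<eta>' j\<bar>) \<le> Lam \<epsilon>" by (simp add: Lam_def)
  have "\<bar>\<eta>' j\<bar> \<le> Lam \<epsilon>" if "j < k" for j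
    using member_le_sum[of j "{..<k}" "\<lambda>j. \<bar>\<eta>' j\<bar>"] that Lam by simp
  hence "- Lam \<epsilon> \<le> \<eta>' j \<and> \<eta>' j \<le> Lam \<epsilon>" if "j < k" for j using that by (simp add: abs_le_iff minus_le_iff)
  hence "\<eta>1 \<in> Cube k (Lam \<epsilon>)" by (simp add: Cube_def \<eta>1_def)
  moreover have zB: "z \<in> Bn n" using z by (simp add: M_def Bn_def)
  ultimately have le: "Phi \<epsilon> e v t x \<eta> \<le> Phi \<epsilon> e v t z \<eta>1" using min by (simp add: isMin_def)
  have vx: "\<bar>\<Sum>i<n. v i * y i\<bar> \<le> \<epsilon> * real n" if "y \<in> Bn n" for y
  proof -
    have "\<bar>\<Sum>i<n. v i * y i\<bar> \<le> (\<Sum>i<n. \<epsilon>)"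
    proof (rule order_trans[OF sum_abs], rule sum_mono)
      fix i assume "i \<in> {..<n}"
      hence "\<bar>y i\<bar> \<le> 1" using Bn_coord[OF that] by simp
      hence "\<bar>v i\<bar> * \<bar>y i\<bar> \<le> \<epsilon> * 1" using v(1) \<epsilon> by (intro mult_mono) auto
      thus "\<bar>v i * y i\<bar> \<le> \<epsilon>" by (simp add: abs_mult)
    qed
    thus ?thesis by (simp add: mult.commute)
  qed
  have Q0: "(\<Sum>j<k. (Qv j z - v (n + k + j)) ^ 2 / \<epsilon> ^ 2) = 0"
    using z(1) v(2) by (intro sum.neutral) (auto simp: M_def)
  have "Phi \<epsilon> e v t z \<eta>1 = eucl_norm n (xi e \<eta>' z) ^ 2 + \<epsilon> * (\<Sum>j<k. \<eta>' j ^ 2) - (\<Sum>i<n. v i * z i)"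
    unfolding Phi_def Q0 x\<eta> eucl_norm_square using z(2) v(2) by (simp add: \<eta>1_def sum_distrib_left)
  moreover have "Phi \<epsilon> e v t x \<eta> = eucl_norm n (xi e \<eta> x) ^ 2 + (\<Sum>j<k. \<epsilon> * \<eta> j ^ 2) + (\<Sum>j<k. Qv j x ^ 2 / \<epsilon> ^ 2)
      + (f e x - t) ^ 2 / \<epsilon> - (\<Sum>i<n. v i * x i)"
    unfolding Phi_def eucl_norm_square using v(2) by simp
  moreover have "(\<Sum>j<k. \<epsilon> * \<eta> j ^ 2) \<ge> 0" using \<epsilon> by (intro sum_nonneg) auto
  moreover have "x \<in> Bn n" using min by (simp add: isMin_def)
  ultimately show ?thesis using le vx[of x] vx[OF zB] by (simp add: algebra_simps)
qed

text \<open>The ridge: a selection of points of least slope in the level sets of \<open>f\<close> on \<open>M\<close>, of bounded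
  total variation. The function \<open>h\<close> bounds the variation up to a given level.\<close>

lemma ridge:
  assumes e: "\<forall>i. \<bar>e i\<bar> \<le> 1" and "M \<noteq> {}"
  shows "\<exists>\<gamma> h. (\<forall>t\<in>f e ` M. \<gamma> t \<in> M \<and> f e (\<gamma> t) = t \<and>
       (\<forall>z\<in>M. f e z = t \<longrightarrow> (\<forall>\<eta>'. \<exists>\<eta>. eucl_norm n (xi e \<eta> (\<gamma> t)) \<le> eucl_norm n (xi e \<eta>' z)))) \<and>
     (\<forall>t. 0 \<le> h t \<and> h t \<le> 2 * real n * real (elim_degree (2 * n) (4 * k + 2))) \<and>
     (\<forall>\<tau>\<in>f e ` M. \<forall>t\<in>f e ` M. \<tau> \<le> t \<longrightarrow> eucl_dist n (\<gamma> t) (\<gamma> \<tau>) \<le> h t - h \<tau>)"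
proof -
  define Vb where "Vb = 2 * real n * real (elim_degree (2 * n) (4 * k + 2))"
  define I where "I = {- (2 * real n + 1)..2 * real n + 1}"
  have "\<exists>\<epsilon>0>0. \<epsilon>0 \<le> 1 \<and> (\<forall>\<epsilon>. 0 < \<epsilon> \<longrightarrow> \<epsilon> < \<epsilon>0 \<longrightarrow> confined \<epsilon> e)"
    using minimiser_interior[OF e assms(2)] unfolding confined_def by meson
  then obtain \<epsilon>0 where \<epsilon>0: "\<epsilon>0 > 0" "\<epsilon>0 \<le> 1" "\<And>\<epsilon>. 0 < \<epsilon> \<Longrightarrow> \<epsilon> < \<epsilon>0 \<Longrightarrow> confined \<epsilon> e" by blast
  \<comment> \<open>The indices of the limit process: finitely many levels together with the penalty
    parameter. The variation is controlled at one finite set of levels at a time.\<close>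
  define good where "good = (\<lambda>(T :: real set, \<epsilon>). finite T \<and> 0 < \<epsilon> \<and> \<epsilon> < \<epsilon>0)"
  define sel where "sel = (\<lambda>(T, \<epsilon>) (v, \<gamma>, \<eta>, h). (\<forall>i. \<bar>v i\<bar> \<le> \<epsilon>) \<and> (\<forall>i\<ge>n. v i = 0) \<and> (\<forall>t. isMin \<epsilon> e v t (\<gamma> t) (\<eta> t)) \<and>
    (\<forall>t. 0 \<le> h t \<and> h t \<le> Vb) \<and> (\<forall>\<tau>\<in>T \<inter> I. \<forall>t\<in>T \<inter> I. \<tau> \<le> t \<longrightarrow> eucl_dist n (\<gamma> t) (\<gamma> \<tau>) \<le> h t - h \<tau>))"
  have "\<exists>y. good i \<longrightarrow> sel i y" for i
  proof (cases "good i")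
    case True
    obtain T \<epsilon> where i: "i = (T, \<epsilon>)" by (cases i)
    have "\<exists>v \<gamma> \<eta> h. sel (T, \<epsilon>) (v, \<gamma>, \<eta>, h)" unfolding sel_def Vb_def prod.case
      by (rule finite_selection[OF e]) (use True \<epsilon>0 in \<open>auto simp: good_def i I_def\<close>)
    thus ?thesis unfolding i by blast
  qed blast
  then obtain Y where Y: "\<And>i. good i \<Longrightarrow> sel i (Y i)" by metis
  define v where "v i = fst (Y i)" for i
  define \<gamma> where "\<gamma> i = fst (snd (Y i))" for i
  define \<eta> where "\<eta> i = fst (snd (snd (Y i)))" for i
  define h where "h i = snd (snd (snd (Y i)))" for i
  have S: "(\<forall>l. \<bar>v i l\<bar> \<le> snd i)" "(\<forall>l\<ge>n. v i l = 0)" "isMin (snd i) e (v i) t (\<gamma> i t) (\<eta> i t)"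
      "0 \<le> h i t \<and> h i t \<le> Vb" "0 < snd i"
      "\<And>\<tau> t. \<tau> \<in> fst i \<inter> I \<Longrightarrow> t \<in> fst i \<inter> I \<Longrightarrow> \<tau> \<le> t \<Longrightarrow> eucl_dist n (\<gamma> i t) (\<gamma> i \<tau>) \<le> h i t - h i \<tau>"
    if "good i" for i t
    using Y[OF that] that by (auto simp: sel_def good_def v_def \<gamma>_def \<eta>_def h_def split: prod.splits)
  \<comment> \<open>Along this filter every level belongs to the finite set eventually, while the
    penalty parameter tends to 0 from above.\<close>
  define F where "F = finite_subsets_at_top (UNIV :: real set) \<times>\<^sub>F at_right (0::real)"
  have Fb: "F \<noteq> bot" by (simp add: F_def prod_filter_eq_bot)
  have lfst: "filterlim fst (finite_subsets_at_top UNIV) F" unfolding F_def by (rule filterlim_fst)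
  have lsnd: "filterlim snd (at_right 0) F" unfolding F_def by (rule filterlim_snd)
  have ev0: "(snd \<longlongrightarrow> 0) F" using lsnd by (rule filterlim_mono) (auto simp: at_within_le_nhds)
  have evt: "\<forall>\<^sub>F i in F. t \<in> fst i" for t
  proof (rule eventually_compose_filterlim[OF _ lfst])
    show "\<forall>\<^sub>F T in finite_subsets_at_top UNIV. t \<in> T"
      unfolding eventually_finite_subsets_at_top by (rule exI[of _ "{t}"]) auto
  qed
  have evg: "\<forall>\<^sub>F i in F. good i"
  proof -
    have "\<forall>\<^sub>F i in F. finite (fst i)"
      by (rule eventually_compose_filterlim[OF _ lfst]) (auto simp: eventually_finite_subsets_at_top)
    moreover have "\<forall>\<^sub>F \<epsilon> in at_right 0. 0 < \<epsilon> \<and> \<epsilon> < \<epsilon>0" using eventually_at_right_real[OF \<epsilon>0(1)] by eventually_elim auto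
    hence "\<forall>\<^sub>F i in F. 0 < snd i \<and> snd i < \<epsilon>0" by (rule eventually_compose_filterlim[OF _ lsnd])
    ultimately show ?thesis by eventually_elim (auto simp: good_def)
  qed
  \<comment> \<open>Selections are points of a product over all real levels; its compactness yields
    a limit selection and a limit of \<open>h\<close> at the same time.\<close>
  define K where "K = {g :: real \<Rightarrow> nat \<Rightarrow> real. \<forall>t. g t \<in> Bn n} \<times> {h :: real \<Rightarrow> real. \<forall>t. h t \<in> {0..Vb}}"
  have "compact K" unfolding K_def by (intro compact_Times compact_Pi compact_Bn) auto
  moreover have "\<forall>\<^sub>F i in F. (\<gamma> i, h i) \<in> K" using evg
    by eventually_elim (use S in \<open>auto simp: K_def isMin_def\<close>)
  ultimately have "\<exists>gh H. gh \<in> K \<and> H \<le> F \<and> H \<noteq> bot \<and> ((\<lambda>i. (\<gamma> i, h i)) \<longlongrightarrow> gh) H"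
    by (rule compact_subfilter[OF _ Fb])
  then obtain gh H where gh: "gh \<in> K" and H: "H \<le> F" "H \<noteq> bot" "((\<lambda>i. (\<gamma> i, h i)) \<longlongrightarrow> gh) H" by blast
  have g0: "((\<lambda>i. \<gamma> i t) \<longlongrightarrow> fst gh t) H" for t using tendsto_fun[OF tendsto_fst[OF H(3)], of t] by simp
  have h0: "((\<lambda>i. h i t) \<longlongrightarrow> snd gh t) H" for t using tendsto_fun[OF tendsto_snd[OF H(3)], of t] by simp
  have snd0: "(snd \<longlongrightarrow> 0) H" by (rule tendsto_mono[OF H(1) ev0])
  have fI: "f e x \<in> I" if "x \<in> M" for x
    using abs_f_le[OF e, of x] that by (auto simp: M_def Bn_def I_def abs_le_iff)
  have energy: "\<forall>\<^sub>F i in H. eucl_norm n (xi e (\<eta> i t) (\<gamma> i t)) ^ 2 + (\<Sum>j<k. Qv j (\<gamma> i t) ^ 2 / snd i ^ 2) + (f e (\<gamma> i t) - t) ^ 2 / snd i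
     \<le> eucl_norm n (xi e \<eta>' z) ^ 2 + snd i * ((\<Sum>j<k. \<eta>' j ^ 2) + 2 * real n) \<and> good i"
    if z: "z \<in> M" "f e z = t" for z t \<eta>'
  proof -
    have "((\<lambda>i. snd i * (1 + (\<Sum>j<k. \<bar>\<eta>' j\<bar>))) \<longlongrightarrow> 0 * (1 + (\<Sum>j<k. \<bar>\<eta>' j\<bar>))) H" by (intro tendsto_intros snd0)
    hence "\<forall>\<^sub>F i in H. snd i * (1 + (\<Sum>j<k. \<bar>\<eta>' j\<bar>)) < 1" by (rule order_tendstoD) simp
    moreover have "\<forall>\<^sub>F i in H. good i" using evg H(1) by (simp add: filter_leD)
    ultimately show ?thesis
    proof eventually_elim
      case (elim i)
      show ?case using minimiser_energy[OF e S(5)[OF elim(2)] S(1)[OF elim(2)] S(2)[OF elim(2)] S(3)[OF elim(2)] z, of \<eta>'] elim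
        by simp
    qed
  qed
  have lev: "fst gh t \<in> M \<and> f e (fst gh t) = t" if t: "t \<in> f e ` M" for t
  proof -
    obtain z where z: "z \<in> M" "f e z = t" using t by blast
    define C where "C = eucl_norm n (xi e (\<lambda>_. 0) z) ^ 2"
    define D where "D = (\<Sum>j<k. (0::real) ^ 2) + 2 * real n"
    note en = energy[OF z, of "\<lambda>_. 0", folded C_def D_def]
    have Q0: "Qv j (fst gh t) = 0" if j: "j < k" for j
    proof -
      have l1: "((\<lambda>i. Qv j (\<gamma> i t) ^ 2) \<longlongrightarrow> Qv j (fst gh t) ^ 2) H" by (intro tendsto_power tendsto_Qv g0)
      have l2: "((\<lambda>i. (C + snd i * D) * snd i ^ 2) \<longlongrightarrow> (C + 0 * D) * 0 ^ 2) H" by (intro tendsto_intros snd0)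
      have l3: "\<forall>\<^sub>F i in H. Qv j (\<gamma> i t) ^ 2 \<le> (C + snd i * D) * snd i ^ 2"
        using en
      proof eventually_elim
        case (elim i)
        have p: "snd i > 0" using S(5) elim by blast
        have "Qv j (\<gamma> i t) ^ 2 / snd i ^ 2 \<le> (\<Sum>j<k. Qv j (\<gamma> i t) ^ 2 / snd i ^ 2)"
          using j by (intro member_le_sum) auto
        also have "\<dots> \<le> C + snd i * D"
        proof -
          have "(f e (\<gamma> i t) - t) ^ 2 / snd i \<ge> 0" using p by simp
          thus ?thesis using elim zero_le_power2[of "eucl_norm n (xi e (\<eta> i t) (\<gamma> i t))"] by linarith
        qed
        finally show ?case using p by (simp add: pos_divide_le_eq)
      qed
      have "Qv j (fst gh t) ^ 2 \<le> (C + 0 * D) * 0 ^ 2" by (rule tendsto_le[OF H(2) l2 l1 l3])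
      thus ?thesis by simp
    qed
    have l1: "((\<lambda>i. (f e (\<gamma> i t) - t) ^ 2) \<longlongrightarrow> (f e (fst gh t) - t) ^ 2) H" by (intro tendsto_intros tendsto_f g0)
    have l2: "((\<lambda>i. (C + snd i * D) * snd i) \<longlongrightarrow> (C + 0 * D) * 0) H" by (intro tendsto_intros snd0)
    have l3: "\<forall>\<^sub>F i in H. (f e (\<gamma> i t) - t) ^ 2 \<le> (C + snd i * D) * snd i"
      using en
    proof eventually_elim
      case (elim i)
      have p: "snd i > 0" using S(5) elim by blast
      have "(\<Sum>j<k. Qv j (\<gamma> i t) ^ 2 / snd i ^ 2) \<ge> 0" by (intro sum_nonneg) auto
      hence "(f e (\<gamma> i t) - t) ^ 2 / snd i \<le> C + snd i * D"
        using elim zero_le_power2[of "eucl_norm n (xi e (\<eta> i t) (\<gamma> i t))"] by linarith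
      thus ?case using p by (simp add: pos_divide_le_eq)
    qed
    have "(f e (fst gh t) - t) ^ 2 \<le> (C + 0 * D) * 0" by (rule tendsto_le[OF H(2) l2 l1 l3])
    hence "f e (fst gh t) = t" by simp
    moreover have "fst gh t \<in> M" using gh Q0 by (auto simp: K_def M_def Bn_def mem_Times_iff)
    ultimately show ?thesis by blast
  qed
  have slope: "\<exists>\<eta>1. eucl_norm n (xi e \<eta>1 (fst gh t)) \<le> eucl_norm n (xi e \<eta>' z)" if z: "z \<in> M" "f e z = t" for z t \<eta>'
  proof -
    define D where "D = (\<Sum>j<k. \<eta>' j ^ 2) + 2 * real n"
    \<comment> \<open>The default value at the other indices makes all points lie in
      \<open>Rn n\<close>, as \<open>slope_limit\<close> asks.\<close>
    define X where "X i = (if good i then \<gamma> i t else (\<lambda>_. 0))" for i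
    have evgH: "\<forall>\<^sub>F i in H. good i" using evg H(1) by (simp add: filter_leD)
    have "((\<lambda>i. \<gamma> i t) \<longlongrightarrow> fst gh t) H \<longleftrightarrow> (X \<longlongrightarrow> fst gh t) H"
      by (rule filterlim_cong) (use evgH in \<open>auto simp: X_def elim: eventually_mono\<close>)
    hence X: "(X \<longlongrightarrow> fst gh t) H" using g0 by blast
    have XR: "X i \<in> Rn n" for i using S(3)[of i t] by (auto simp: X_def isMin_def Bn_def Rn_def)
    show ?thesis
    proof (rule slope_limit[OF H(2) X XR, where Y = "\<lambda>i. \<eta> i t" and g = "\<lambda>i. snd i * D"])
      show "fst gh t \<in> M" using lev[of t] z by blast
      show "\<forall>\<^sub>F i in H. eucl_norm n (xi e (\<eta> i t) (X i)) ^ 2 \<le> eucl_norm n (xi e \<eta>' z) ^ 2 + snd i * D"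
        using energy[OF z, of \<eta>', folded D_def]
      proof eventually_elim
        case (elim i)
        have p: "snd i > 0" using S(5) elim by blast
        have "(\<Sum>j<k. Qv j (\<gamma> i t) ^ 2 / snd i ^ 2) \<ge> 0" by (intro sum_nonneg) auto
        moreover have "(f e (\<gamma> i t) - t) ^ 2 / snd i \<ge> 0" using p by simp
        ultimately show ?case using elim by (simp add: X_def)
      qed
      show "((\<lambda>i. snd i * D) \<longlongrightarrow> 0) H" using tendsto_mult[OF snd0 tendsto_const, of D] by simp
    qed simp
  qed
  have mon: "eucl_dist n (fst gh t) (fst gh \<tau>) \<le> snd gh t - snd gh \<tau>" if t: "\<tau> \<in> f e ` M" "t \<in> f e ` M" "\<tau> \<le> t" for \<tau> t
  proof -
    have l1: "((\<lambda>i. eucl_dist n (\<gamma> i t) (\<gamma> i \<tau>)) \<longlongrightarrow> eucl_dist n (fst gh t) (fst gh \<tau>)) H"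
      by (intro tendsto_eucl_dist g0)
    have l2: "((\<lambda>i. h i t - h i \<tau>) \<longlongrightarrow> snd gh t - snd gh \<tau>) H" by (intro tendsto_diff h0)
    have "\<forall>\<^sub>F i in F. eucl_dist n (\<gamma> i t) (\<gamma> i \<tau>) \<le> h i t - h i \<tau>"
      using evg evt[of t] evt[of \<tau>]
      by eventually_elim (use S(6) fI t in blast)
    hence l3: "\<forall>\<^sub>F i in H. eucl_dist n (\<gamma> i t) (\<gamma> i \<tau>) \<le> h i t - h i \<tau>" using H(1) by (simp add: filter_leD)
    show ?thesis by (rule tendsto_le[OF H(2) l2 l1 l3])
  qed
  have "0 \<le> snd gh t \<and> snd gh t \<le> Vb" for t using gh by (auto simp: K_def mem_Times_iff)
  thus ?thesis using lev slope mon unfolding Vb_def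
    by (intro exI[of _ "fst gh"] exI[of _ "snd gh"] conjI ballI allI impI) blast+
qed

text \<open>Among the points \<open>y\<close> reached from \<open>x\<close> by a chain of length at
  most \<open>2 * (h (f e x) - h (f e y))\<close>, let the values of \<open>f\<close> approach their
  infimum, and let \<open>z\<close> be a limit point. If \<open>z\<close> were not critical, one
  more step would reach a point below the infimum. The bound is \<open>2 * Vb\<close> for the chain
  and 1 for the jump to \<open>z\<close>.\<close>

lemma descent_chain:
  assumes e: "\<forall>i. \<bar>e i\<bar> \<le> 1" and x: "x \<in> M" and \<delta>: "\<delta> > 0"
  shows "\<exists>p\<in>Crit e. \<exists>L. L \<le> 4 * real n * real (elim_degree (2 * n) (4 * k + 2)) + 1 \<and> chain n M \<delta> x p L"
proof -
  define Vb where "Vb = 2 * real n * real (elim_degree (2 * n) (4 * k + 2))"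
  have "M \<noteq> {}" using x by blast
  from ridge[OF e this] obtain \<gamma> h where gh: "(\<forall>t\<in>f e ` M. \<gamma> t \<in> M \<and> f e (\<gamma> t) = t \<and>
       (\<forall>z\<in>M. f e z = t \<longrightarrow> (\<forall>\<eta>'. \<exists>\<eta>. eucl_norm n (xi e \<eta> (\<gamma> t)) \<le> eucl_norm n (xi e \<eta>' z)))) \<and>
     (\<forall>t. 0 \<le> h t \<and> h t \<le> Vb) \<and>
     (\<forall>\<tau>\<in>f e ` M. \<forall>t\<in>f e ` M. \<tau> \<le> t \<longrightarrow> eucl_dist n (\<gamma> t) (\<gamma> \<tau>) \<le> h t - h \<tau>)"
    unfolding Vb_def[symmetric] by (elim exE) (erule that)
  have \<gamma>: "\<gamma> t \<in> M" "f e (\<gamma> t) = t" if "t \<in> f e ` M" for t using gh that by blast+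
  have \<gamma>s: "\<exists>\<eta>. eucl_norm n (xi e \<eta> (\<gamma> (f e z))) \<le> eucl_norm n (xi e \<eta>' z)" if "z \<in> M" for z \<eta>'
    using gh that by blast
  have hV: "0 \<le> h t" "h t \<le> Vb" for t using gh by blast+
  have hd: "eucl_dist n (\<gamma> t) (\<gamma> \<tau>) \<le> h t - h \<tau>" if "\<tau> \<in> f e ` M" "t \<in> f e ` M" "\<tau> \<le> t" for \<tau> t
    using gh that by blast
  have hm: "h (f e y) \<le> h (f e z)" if "y \<in> M" "z \<in> M" "f e y \<le> f e z" for y z
    using hd[OF imageI[OF that(1)] imageI[OF that(2)] that(3)] eucl_dist_nonneg[of n "\<gamma> (f e z)" "\<gamma> (f e y)"] by linarith
  \<comment> \<open>A step of length about \<open>\<sigma> * m\<close> lowers \<open>f\<close> by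
    about \<open>\<sigma> * m ^ 2\<close>. The slope of the ridge at this level is at most
    \<open>m\<close>, so the ridge needs about the same length for the same descent. The factor 2
    absorbs the second-order errors and makes the inequality strict.\<close>
  have step: "\<exists>y\<in>M. eucl_dist n y z < \<delta> \<and> eucl_dist n y z < 2 * (h (f e z) - h (f e y)) \<and> f e y < f e z"
    if z: "z \<in> M" "z \<notin> Crit e" for z
  proof -
    obtain \<eta> C \<sigma>0 where ds: "C > 0" "\<sigma>0 > 0" "eucl_norm n (xi e \<eta> z) > 0"
      "\<And>\<sigma>. 0 < \<sigma> \<Longrightarrow> \<sigma> < \<sigma>0 \<Longrightarrow> (\<exists>y\<in>M. eucl_dist n y z \<le> \<sigma> * eucl_norm n (xi e \<eta> z) + C * \<sigma> ^ 2 \<and>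
       f e z - f e y \<ge> \<sigma> * eucl_norm n (xi e \<eta> z) ^ 2 - C * \<sigma> ^ 2)"
      using descent_step[OF z] by blast
    define m where "m = eucl_norm n (xi e \<eta> z)"
    have m: "m > 0" using ds(3) by (simp add: m_def)
    define t where "t = f e z"
    have t: "t \<in> f e ` M" using z by (simp add: t_def)
    obtain \<eta>g where \<eta>g: "eucl_norm n (xi e \<eta>g (\<gamma> t)) \<le> m" using \<gamma>s[OF z(1)] unfolding t_def m_def by blast
    define K1 where "K1 = C + m * C / 2 + CL \<eta>g * (m + C) ^ 2 / 4"
    have K1: "K1 > 0" unfolding K1_def using ds(1) m CL_pos[of \<eta>g] by (intro add_pos_nonneg) auto
    \<comment> \<open>In this order: \<open>\<sigma> ^ 2\<close> is at most \<open>\<sigma>\<close>,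
      \<open>descent_step\<close> applies, the ridge cannot be shorter than half the step,
      \<open>f\<close> decreases, and the step is shorter than \<open>\<delta>\<close>.\<close>
    define \<sigma> where "\<sigma> = Min {1, \<sigma>0 / 2, m ^ 2 / (4 * K1), m ^ 2 / (2 * C), \<delta> / (2 * (m + C))}"
    have \<sigma>p: "\<sigma> > 0" unfolding \<sigma>_def using ds m K1 \<delta> by (simp add: add_pos_pos)
    have \<sigma>le: "\<sigma> \<le> 1" "\<sigma> \<le> \<sigma>0 / 2" "\<sigma> \<le> m ^ 2 / (4 * K1)" "\<sigma> \<le> m ^ 2 / (2 * C)" "\<sigma> \<le> \<delta> / (2 * (m + C))"
      unfolding \<sigma>_def by (rule Min_le; simp)+
    have \<sigma>m: "\<sigma> * (4 * K1) \<le> m ^ 2" "\<sigma> * (2 * C) \<le> m ^ 2" "\<sigma> * (2 * (m + C)) \<le> \<delta>"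
      using \<sigma>le(3-5) K1 ds(1) m by (simp_all add: pos_le_divide_eq add_pos_pos)
    have ss: "\<sigma> ^ 2 \<le> \<sigma>" using \<sigma>p \<sigma>le(1) by (simp add: power2_eq_square mult_left_le)
    obtain y where y: "y \<in> M" "eucl_dist n y z \<le> \<sigma> * m + C * \<sigma> ^ 2" "f e z - f e y \<ge> \<sigma> * m ^ 2 - C * \<sigma> ^ 2"
      using ds(4)[OF \<sigma>p] \<sigma>le(2) ds(2) unfolding m_def by force
    have Cs: "C * \<sigma> ^ 2 \<le> C * \<sigma>" using ss ds(1) by (intro mult_left_mono) auto
    have d1: "\<sigma> * m + C * \<sigma> ^ 2 \<le> \<sigma> * (m + C)" using Cs by (simp add: algebra_simps)
    have lt1: "eucl_dist n y z < \<delta>"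
    proof -
      have "0 < \<sigma> * (m + C)" using \<sigma>p m ds(1) by (simp add: add_pos_pos)
      moreover have "\<sigma> * (2 * (m + C)) = 2 * (\<sigma> * (m + C))" by simp
      ultimately have "\<sigma> * (m + C) < \<delta>" using \<sigma>m(3) by linarith
      thus ?thesis using y(2) d1 by linarith
    qed
    have "C * \<sigma> ^ 2 < \<sigma> * m ^ 2"
    proof -
      have "\<sigma> * (\<sigma> * (2 * C)) \<le> \<sigma> * m ^ 2" using \<sigma>m(2) \<sigma>p by (intro mult_left_mono) auto
      moreover have "C * \<sigma> ^ 2 > 0" using ds(1) \<sigma>p by simp
      ultimately show ?thesis by (simp add: power2_eq_square algebra_simps)
    qed
    hence lt2: "f e y < f e z" using y(3) by linarith
    define \<tau> where "\<tau> = f e y"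
    have \<tau>: "\<tau> \<in> f e ` M" "\<tau> \<le> t" using y lt2 by (auto simp: \<tau>_def t_def)
    define s where "s = h t - h \<tau>"
    define d where "d = eucl_dist n (\<gamma> \<tau>) (\<gamma> t)"
    have ds': "d \<le> s" using hd[OF \<tau>(1) t \<tau>(2)] by (simp add: d_def s_def eucl_dist_commute)
    have d0: "d \<ge> 0" by (simp add: d_def)
    have "\<bar>f e (\<gamma> \<tau>) - f e (\<gamma> t) - (\<Sum>i<n. xi e \<eta>g (\<gamma> t) i * (\<gamma> \<tau> i - \<gamma> t i))\<bar> \<le> CL \<eta>g * d ^ 2"
      unfolding d_def by (rule f_diff[OF \<gamma>(1)[OF t] \<gamma>(1)[OF \<tau>(1)]])
    moreover have "\<bar>\<Sum>i<n. xi e \<eta>g (\<gamma> t) i * (\<gamma> \<tau> i - \<gamma> t i)\<bar> \<le> eucl_norm n (xi e \<eta>g (\<gamma> t)) * d"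
      unfolding d_def eucl_dist_def by (rule eucl_norm_Cauchy)
    moreover have "eucl_norm n (xi e \<eta>g (\<gamma> t)) * d \<le> m * d" using \<eta>g d0 by (rule mult_right_mono)
    ultimately have fd: "t - \<tau> \<le> m * d + CL \<eta>g * d ^ 2" unfolding \<gamma>(2)[OF t] \<gamma>(2)[OF \<tau>(1)] by linarith
    \<comment> \<open>If the ridge moved by no more than half of the step, its descent would be
      \<open>\<sigma> * m ^ 2 / 2\<close> up to second order, which is too little; \<open>K1\<close>
      collects all second-order terms.\<close>
    have big: "2 * s > \<sigma> * m + C * \<sigma> ^ 2"
    proof (rule ccontr)
      assume "\<not> ?thesis"
      hence "s \<le> (\<sigma> * m + C * \<sigma> ^ 2) / 2" by simp
      hence dle: "d \<le> (\<sigma> * m + C * \<sigma> ^ 2) / 2" using ds' by linarith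
      have dle2: "d \<le> \<sigma> * (m + C) / 2" by (rule order_trans[OF dle divide_right_mono[OF d1]]) simp
      have "m * d \<le> m * ((\<sigma> * m + C * \<sigma> ^ 2) / 2)" using dle m by (intro mult_left_mono) auto
      moreover have "CL \<eta>g * d ^ 2 \<le> CL \<eta>g * (\<sigma> * (m + C) / 2) ^ 2"
        using dle2 d0 CL_pos[of \<eta>g] by (intro mult_left_mono power_mono) auto
      moreover have "\<sigma> * m ^ 2 - C * \<sigma> ^ 2 \<le> t - \<tau>" using y(3) by (simp add: t_def \<tau>_def)
      ultimately have "\<sigma> * m ^ 2 - C * \<sigma> ^ 2 \<le> m * ((\<sigma> * m + C * \<sigma> ^ 2) / 2) + CL \<eta>g * (\<sigma> * (m + C) / 2) ^ 2"
        using fd by linarith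
      moreover have "m * ((\<sigma> * m + C * \<sigma> ^ 2) / 2) + CL \<eta>g * (\<sigma> * (m + C) / 2) ^ 2 + C * \<sigma> ^ 2
          = \<sigma> ^ 2 * K1 + \<sigma> * m ^ 2 / 2"
        by (simp add: K1_def power2_eq_square field_simps)
      ultimately have "\<sigma> * m ^ 2 \<le> 2 * (\<sigma> ^ 2 * K1)" by linarith
      also have "\<dots> = \<sigma> * (\<sigma> * (4 * K1)) / 2" by (simp add: power2_eq_square)
      also have "\<dots> \<le> \<sigma> * m ^ 2 / 2" using \<sigma>m(1) \<sigma>p by (intro divide_right_mono mult_left_mono) auto
      finally show False using \<sigma>p m by simp
    qed
    have "eucl_dist n y z < 2 * (h (f e z) - h (f e y))" using big y(2) by (simp add: s_def t_def \<tau>_def)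
    thus ?thesis using y(1) lt1 lt2 by blast
  qed
  define Re where "Re = {y \<in> M. \<exists>L. chain n M \<delta> x y L \<and> L \<le> 2 * (h (f e x) - h (f e y))}"
  have "x \<in> Re" using x chain_refl[OF x, of n \<delta>] by (auto simp: Re_def intro!: exI[of _ 0])
  have bdd: "bdd_below (f e ` Re)"
  proof (rule bdd_belowI2)
    fix y assume "y \<in> Re"
    hence "y \<in> Bn n" by (simp add: Re_def M_def Bn_def)
    thus "- (1 + 2 * real n) \<le> f e y" using abs_f_le[OF e, of y] by simp
  qed
  define In where "In = Inf (f e ` Re)"
  have In_le: "In \<le> f e y" if "y \<in> Re" for y unfolding In_def using that bdd by (intro cInf_lower) auto
  have "\<exists>y\<in>Re. f e y < In + inverse (real (Suc j))" for j
  proof -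
    have "Inf (f e ` Re) < In + inverse (real (Suc j))" by (simp add: In_def)
    thus ?thesis using \<open>x \<in> Re\<close> bdd by (subst (asm) cInf_less_iff) auto
  qed
  then obtain y where y: "\<And>j. y j \<in> Re" "\<And>j. f e (y j) < In + inverse (real (Suc j))" by metis
  have yM: "y j \<in> M" for j using y(1)[of j] by (simp add: Re_def)
  obtain z H where z: "z \<in> M" and H: "H \<le> sequentially" "H \<noteq> bot" "(y \<longlongrightarrow> z) H"
    using compact_subfilter[OF compact_M, of sequentially y] yM by auto
  have "f e z = In"
  proof -
    have l1: "((\<lambda>j. f e (y j)) \<longlongrightarrow> f e z) H" by (rule tendsto_f[OF H(3)])
    have l2: "((\<lambda>j. In + inverse (real (Suc j))) \<longlongrightarrow> In + 0) H"
      by (intro tendsto_add tendsto_const tendsto_mono[OF H(1) LIMSEQ_inverse_real_of_nat])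
    have "f e z \<le> In + 0" by (rule tendsto_le[OF H(2) l2 l1]) (intro always_eventually allI less_imp_le y(2))
    moreover have "In \<le> f e z" by (rule tendsto_lowerbound[OF l1 _ H(2)]) (use In_le[OF y(1)] in auto)
    ultimately show ?thesis by simp
  qed
  have near: "\<exists>j. eucl_dist n (y j) z < r" if "r > 0" for r
  proof -
    have "((\<lambda>j. eucl_dist n (y j) z) \<longlongrightarrow> 0) H" using tendsto_eucl_dist[OF H(3) tendsto_const, of n z] by simp
    hence "\<forall>\<^sub>F j in H. eucl_dist n (y j) z < r" using that by (rule order_tendstoD)
    thus ?thesis using H(2) eventually_happens by blast
  qed
  have "z \<in> Crit e"
  proof (rule ccontr)
    assume "z \<notin> Crit e"
    from step[OF z this] obtain w where w: "w \<in> M" "eucl_dist n w z < \<delta>"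
      "eucl_dist n w z < 2 * (h (f e z) - h (f e w))" "f e w < f e z" by blast
    obtain j where j: "eucl_dist n (y j) z < min (\<delta> - eucl_dist n w z) (2 * (h (f e z) - h (f e w)) - eucl_dist n w z)"
      using near[of "min (\<delta> - eucl_dist n w z) (2 * (h (f e z) - h (f e w)) - eucl_dist n w z)"] w by auto
    have tri: "eucl_dist n (y j) w \<le> eucl_dist n (y j) z + eucl_dist n w z"
      using eucl_dist_triangle[of n "y j" w z] by (simp add: eucl_dist_commute)
    obtain L where L: "chain n M \<delta> x (y j) L" "L \<le> 2 * (h (f e x) - h (f e (y j)))" using y(1)[of j] by (auto simp: Re_def)
    have "h (f e z) \<le> h (f e (y j))" using In_le[OF y(1)[of j]] \<open>f e z = In\<close> by (intro hm z yM) simp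
    hence "L + eucl_dist n (y j) w \<le> 2 * (h (f e x) - h (f e w))" using L(2) tri j by simp
    moreover have "chain n M \<delta> x w (L + eucl_dist n (y j) w)" by (rule chain_step[OF L(1) w(1)]) (use tri j in simp)
    ultimately have "w \<in> Re" using w(1) unfolding Re_def by blast
    hence "In \<le> f e w" by (rule In_le)
    thus False using w(4) \<open>f e z = In\<close> by simp
  qed
  moreover obtain j where j: "eucl_dist n (y j) z < min \<delta> 1" using near[of "min \<delta> 1"] \<delta> by auto
  obtain L where L: "chain n M \<delta> x (y j) L" "L \<le> 2 * (h (f e x) - h (f e (y j)))" using y(1)[of j] by (auto simp: Re_def)
  have "chain n M \<delta> x z (L + eucl_dist n (y j) z)" by (rule chain_step[OF L(1) z]) (use j in simp)
  moreover have "L + eucl_dist n (y j) z \<le> 2 * Vb + 1" using L(2) j hV(2)[of "f e x"] hV(1)[of "f e (y j)"] by simp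
  ultimately show ?thesis unfolding Vb_def by (intro bexI[of _ z] exI[of _ "L + eucl_dist n (y j) z"]) auto
qed

end

subsection \<open>Geodesic distances\<close>

lemma chain_ends: "chain n A \<delta> x y L \<Longrightarrow> x \<in> A \<and> y \<in> A \<and> 0 \<le> L"
  by (induction rule: chain.induct) auto

lemma chain_mono: "chain n A \<delta> x y L \<Longrightarrow> \<delta> \<le> \<delta>' \<Longrightarrow> chain n A \<delta>' x y L"
  by (induction rule: chain.induct) (auto intro: chain.intros)

lemma chain_trans:
  assumes "chain n A \<delta> x y L1" "chain n A \<delta> y z L2"
  shows "chain n A \<delta> x z (L1 + L2)"
  using assms(2,1)
proof (induction rule: chain.induct)
  case (chain_step x' y' L z)
  from chain.chain_step[OF chain_step.IH[OF chain_step.prems] chain_step.hyps(2,3)] show ?case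
    by (simp add: add.assoc)
qed simp

lemma chain_edge: "x \<in> A \<Longrightarrow> y \<in> A \<Longrightarrow> eucl_dist n x y \<le> \<delta> \<Longrightarrow> chain n A \<delta> x y (eucl_dist n x y)"
  using chain.chain_step[OF chain.chain_refl, of x A y n \<delta>] by simp

lemma chain_sym: "chain n A \<delta> x y L \<Longrightarrow> chain n A \<delta> y x L"
proof (induction rule: chain.induct)
  case (chain_step x y L z)
  have "chain n A \<delta> z y (eucl_dist n y z)"
    using chain_edge[of z A y n \<delta>] chain_step.hyps chain_ends[OF chain_step.hyps(1)] by (simp add: eucl_dist_commute)
  from chain_trans[OF this chain_step.IH] show ?case by (simp add: add.commute)
qed (rule chain.chain_refl)

text \<open>The chain parametrised by its length, waiting at each vertex until the next is due; the
  jumps account for the additional \<open>\<delta>\<close>.\<close>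

lemma chain_step_function:
  assumes "chain n A \<delta> x y L" "A \<subseteq> Rn n" "0 \<le> \<delta>"
  shows "\<exists>g :: real \<Rightarrow> nat \<Rightarrow> real. g 0 = x \<and> (\<forall>s\<ge>L. g s = y) \<and> (\<forall>s. g s \<in> A) \<and>
     (\<forall>s s'. s \<le> s' \<longrightarrow> eucl_dist n (g s) (g s') \<le> s' - s + \<delta>)"
  using assms
proof (induction rule: chain.induct)
  case (chain_refl x)
  thus ?case by (intro exI[of _ "\<lambda>_. x"]) auto
next
  case (chain_step x y L z)
  define d where "d = eucl_dist n y z"
  have d: "0 \<le> d" "d \<le> \<delta>" using chain_step.hyps by (auto simp: d_def)
  have L: "0 \<le> L" and yA: "y \<in> A" using chain_ends[OF chain_step.hyps(1)] by auto
  obtain g where g: "g 0 = x" "\<And>s. s \<ge> L \<Longrightarrow> g s = y" "\<And>s. g s \<in> A"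
    "\<And>s s'. s \<le> s' \<Longrightarrow> eucl_dist n (g s) (g s') \<le> s' - s + \<delta>"
    using chain_step.IH[OF chain_step.prems] by blast
  define g' where "g' s = (if s < L + d then g s else z)" for s
  have "g' 0 = x"
  proof (cases "0 < L + d")
    case False
    hence "L = 0" "d = 0" using L d by auto
    moreover have "y = z" using eucl_dist_eq_0[of y n z] yA chain_step \<open>d = 0\<close> by (auto simp: d_def)
    ultimately show ?thesis using g(1) g(2)[of 0] by (simp add: g'_def)
  qed (simp add: g'_def g)
  moreover have "eucl_dist n (g' s) (g' s') \<le> s' - s + \<delta>" if "s \<le> s'" for s s'
  proof -
    consider "s' < L + d" | "s \<ge> L + d" | "s < L + d" "L + d \<le> s'" by linarith
    thus ?thesis
    proof cases
      case 3
      have "eucl_dist n (g s) z \<le> s' - s + \<delta>"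
      proof (cases "s \<le> L")
        case True
        have "eucl_dist n (g s) z \<le> eucl_dist n (g s) y + d" unfolding d_def by (rule eucl_dist_triangle)
        moreover have "eucl_dist n (g s) y \<le> L - s + \<delta>" using g(4)[OF True] g(2)[of L] by simp
        ultimately show ?thesis using 3 by linarith
      next
        case False
        thus ?thesis using g(2)[of s] d that by (simp add: d_def)
      qed
      thus ?thesis using 3 by (simp add: g'_def)
    qed (use g(4)[OF that] that chain_step.prems in \<open>auto simp: g'_def\<close>)
  qed
  moreover have "\<forall>s. g' s \<in> A" using g(3) chain_step.hyps by (simp add: g'_def)
  moreover have "\<forall>s\<ge>L + d. g' s = z" by (simp add: g'_def)
  ultimately show ?case unfolding d_def by blast
qed

text \<open>The step functions of ever finer chains, rescaled from length \<open>\<Lambda>\<close>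
  to the unit interval, have a pointwise limit by compactness of the product. The jump errors vanish
  in the limit, which makes it Lipschitz although the approximations are not continuous.\<close>

lemma chains_imp_lipschitz_path:
  assumes A: "compact A" "A \<subseteq> Rn n" and ch: "\<And>\<delta>. \<delta> > 0 \<Longrightarrow> \<exists>L\<le>\<Lambda>. chain n A \<delta> x y L"
  shows "\<exists>g :: real \<Rightarrow> nat \<Rightarrow> real. g 0 = x \<and> g 1 = y \<and> (\<forall>s. g s \<in> A) \<and>
     (\<forall>s s'. s \<le> s' \<longrightarrow> eucl_dist n (g s) (g s') \<le> \<Lambda> * (s' - s))"
proof -
  have \<Lambda>: "0 \<le> \<Lambda>" using ch[of 1] chain_ends by fastforce
  have "\<exists>g :: real \<Rightarrow> nat \<Rightarrow> real. g 0 = x \<and> g 1 = y \<and> (\<forall>s. g s \<in> A) \<and>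
     (\<forall>s s'. s \<le> s' \<longrightarrow> eucl_dist n (g s) (g s') \<le> \<Lambda> * (s' - s) + inverse (real (Suc m)))" for m
  proof -
    obtain L where L: "L \<le> \<Lambda>" "chain n A (inverse (real (Suc m))) x y L" using ch[of "inverse (real (Suc m))"] by auto
    obtain g where g: "g 0 = x" "\<And>s. s \<ge> L \<Longrightarrow> g s = y" "\<And>s. g s \<in> A"
      "\<And>s s'. s \<le> s' \<Longrightarrow> eucl_dist n (g s) (g s') \<le> s' - s + inverse (real (Suc m))"
      using chain_step_function[OF L(2) A(2)] by (metis inverse_nonnegative_iff_nonnegative of_nat_0_le_iff)
    have "eucl_dist n (g (\<Lambda> * s)) (g (\<Lambda> * s')) \<le> \<Lambda> * (s' - s) + inverse (real (Suc m))" if "s \<le> s'" for s s'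
      using g(4)[of "\<Lambda> * s" "\<Lambda> * s'"] \<Lambda> that by (simp add: mult_left_mono right_diff_distrib)
    thus ?thesis using g L(1) by (intro exI[of _ "\<lambda>s. g (\<Lambda> * s)"]) auto
  qed
  then obtain g where g: "\<And>m. g m 0 = x" "\<And>m. g m 1 = y" "\<And>m s. g m s \<in> A"
     "\<And>m s s'. s \<le> s' \<Longrightarrow> eucl_dist n (g m s) (g m s') \<le> \<Lambda> * (s' - s) + inverse (real (Suc m))" by metis
  have "\<exists>g0 H. g0 \<in> {f. \<forall>s::real. f s \<in> A} \<and> H \<le> sequentially \<and> H \<noteq> bot \<and> (g \<longlongrightarrow> g0) H"
    by (rule compact_subfilter[OF compact_Pi]) (use A g(3) in auto)
  then obtain g0 H where g0: "\<And>s. g0 s \<in> A" and H: "H \<le> sequentially" "H \<noteq> bot" "(g \<longlongrightarrow> g0) H" by blast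
  have lim: "((\<lambda>m. g m s) \<longlongrightarrow> g0 s) H" for s by (rule tendsto_fun[OF H(3)])
  have "g0 0 = x" using tendsto_unique[OF H(2) lim[of 0]] by (simp add: g(1))
  moreover have "g0 1 = y" using tendsto_unique[OF H(2) lim[of 1]] by (simp add: g(2))
  moreover have "eucl_dist n (g0 s) (g0 s') \<le> \<Lambda> * (s' - s)" if "s \<le> s'" for s s'
  proof -
    have l1: "((\<lambda>m. eucl_dist n (g m s) (g m s')) \<longlongrightarrow> eucl_dist n (g0 s) (g0 s')) H"
      by (intro tendsto_eucl_dist lim)
    have l2: "((\<lambda>m. \<Lambda> * (s' - s) + inverse (real (Suc m))) \<longlongrightarrow> \<Lambda> * (s' - s) + 0) H"
      by (intro tendsto_add tendsto_const tendsto_mono[OF H(1) LIMSEQ_inverse_real_of_nat])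
    have "eucl_dist n (g0 s) (g0 s') \<le> \<Lambda> * (s' - s) + 0"
      by (rule tendsto_le[OF H(2) l2 l1]) (intro always_eventually allI g(4) that)
    thus ?thesis by simp
  qed
  ultimately show ?thesis using g0 by blast
qed

lemma pathin_lipschitz:
  assumes "\<And>s. g s \<in> A" "A \<subseteq> Rn n" "\<And>s s'. s \<le> s' \<Longrightarrow> eucl_dist n (g s) (g s') \<le> \<Lambda> * (s' - s)"
  shows "pathin (subtopology (Euclidean_space n) A) g"
proof -
  have "continuous_on {0..1} (\<lambda>s. g s i)" for i
  proof (cases "i < n")
    case True
    have le: "\<bar>g s i - g s' i\<bar> \<le> \<Lambda> * \<bar>s - s'\<bar>" for s s'
      using coord_le_eucl_dist[OF True, of "g s" "g s'"] assms(3)[of s s'] assms(3)[of s' s]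
      by (cases "s \<le> s'") (auto simp: eucl_dist_commute abs_minus_commute)
    have "0 \<le> \<Lambda>" using le[of 0 1] by simp
    hence "\<Lambda>-lipschitz_on {0..1} (\<lambda>s. g s i)" using le by (intro lipschitz_onI) (auto simp: dist_real_def)
    thus ?thesis by (rule lipschitz_on_continuous_on)
  next
    case False
    hence "g s i = 0" for s using assms(1,2) by (auto simp: Rn_def subset_iff)
    thus ?thesis by simp
  qed
  hence "continuous_on {0..1} g" by (rule continuous_on_coordinatewise_then_product)
  moreover have "g s i = 0" if "n \<le> i" for s i using assms(1,2) that by (auto simp: Rn_def subset_iff)
  ultimately show ?thesis
    unfolding pathin_def Euclidean_space_def continuous_map_in_subtopology euclidean_product_topology
    using assms(1) by (auto simp: continuous_map_iff_continuous)
qed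

lemma euclidean_length_lipschitz:
  assumes "0 \<le> \<Lambda>" "\<And>s s'. s \<le> s' \<Longrightarrow> eucl_dist n (g s) (g s') \<le> \<Lambda> * (s' - s)"
  shows "euclidean_length n g \<le> ereal \<Lambda>"
  unfolding euclidean_length_def
proof (rule Sup_least, clarify)
  fix N :: nat and t :: "nat \<Rightarrow> real" assume t: "mono_on {..N} t" "t ` {..N} \<subseteq> {0..1}"
  have "(\<Sum>i<N. eucl_dist n (g (t i)) (g (t (Suc i)))) \<le> (\<Sum>i<N. \<Lambda> * (t (Suc i) - t i))"
    using t(1) by (intro sum_mono assms(2)) (auto simp: mono_on_def)
  also have "\<dots> = \<Lambda> * (t N - t 0)" by (simp add: sum_distrib_left[symmetric] sum_lessThan_telescope)
  also have "\<dots> \<le> \<Lambda>" using t(2) assms(1) by (intro mult_left_le) (auto simp: image_subset_iff, smt (verit) atMost_iff le0 order_refl)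
  finally show "ereal (\<Sum>i<N. eucl_dist n (g (t i)) (g (t (Suc i)))) \<le> ereal \<Lambda>" by simp
qed

text \<open>The image of the limit path is connected and contains \<open>x\<close>, so it lies in
  the component \<open>S\<close>, even though the chains may pass through other components.\<close>

lemma lipschitz_path_in_component:
  assumes A: "compact A" "A \<subseteq> Rn n" and ch: "\<And>\<delta>. \<delta> > 0 \<Longrightarrow> \<exists>L\<le>\<Lambda>. chain n A \<delta> x y L"
    and S: "S \<in> connected_components_of (subtopology (Euclidean_space n) A)" "x \<in> S"
  shows "y \<in> S \<and> geodesic_dist n S x y \<le> ereal \<Lambda>"
proof -
  let ?X = "subtopology (Euclidean_space n) A"
  obtain g where g: "g 0 = x" "g 1 = y" "\<And>s. g s \<in> A" "\<And>s s'. s \<le> s' \<Longrightarrow> eucl_dist n (g s) (g s') \<le> \<Lambda> * (s' - s)"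
    using chains_imp_lipschitz_path[OF A ch] by blast
  have \<Lambda>: "0 \<le> \<Lambda>" using order_trans[OF eucl_dist_nonneg g(4)[of 0 1]] by simp
  have p: "pathin ?X g" by (rule pathin_lipschitz[OF g(3) A(2) g(4)])
  have "S = connected_component_of_set ?X x"
    using S by (auto simp: connected_components_of_def connected_component_of_equiv intro: connected_component_of_sym)
  moreover have "x \<in> g ` {0..1}" using g(1) by force
  ultimately have sub: "g ` {0..1} \<subseteq> S" using connected_component_of_maximal[OF connectedin_path_image[OF p]] by simp
  have "y \<in> S" using sub g(2) by force
  have "pathin (subtopology (Euclidean_space n) S) g"
    using p sub by (auto simp: pathin_def continuous_map_in_subtopology)
  hence "geodesic_dist n S x y \<le> euclidean_length n g" unfolding geodesic_dist_def using g by (intro Inf_lower) blast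
  also have "\<dots> \<le> ereal \<Lambda>" by (rule euclidean_length_lipschitz[OF \<Lambda> g(4)])
  finally show ?thesis using \<open>y \<in> S\<close> by blast
qed

text \<open>Otherwise the open \<open>\<delta>\<close>-neighbourhoods of \<open>U\<close> and of its
  complement in \<open>S\<close> would disconnect \<open>S\<close>.\<close>

lemma connected_short_edge:
  assumes "connected S" "U \<subseteq> S" "U \<noteq> {}" "U \<noteq> S" "\<delta> > 0"
  shows "\<exists>z\<in>U. \<exists>w\<in>S - U. eucl_dist n z w \<le> \<delta>"
proof (rule ccontr)
  assume neg: "\<not> ?thesis"
  define N where "N T = (\<Union>z\<in>T. {w. eucl_dist n w z < \<delta>})" for T
  have op: "open (N T)" for T unfolding N_def
    by (intro open_UN ballI open_Collect_less continuous_on_eucl_dist continuous_on_const)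
  have sub: "T \<subseteq> N T" for T using assms(5) by (auto simp: N_def)
  have "N U \<inter> N (S - U) \<inter> S = {}"
  proof (rule ccontr)
    assume "N U \<inter> N (S - U) \<inter> S \<noteq> {}"
    then obtain w u v where w: "w \<in> S" "u \<in> U" "eucl_dist n w u < \<delta>" "v \<in> S - U" "eucl_dist n w v < \<delta>"
      by (auto simp: N_def)
    show False
    proof (cases "w \<in> U")
      case True
      thus ?thesis using neg w by (meson less_imp_le)
    next
      case False
      thus ?thesis using neg w by (metis DiffI eucl_dist_commute less_imp_le)
    qed
  qed
  moreover have "S \<subseteq> N U \<union> N (S - U)" using sub[of U] sub[of "S - U"] by blast
  ultimately have "N U \<inter> S = {} \<or> N (S - U) \<inter> S = {}" using connectedD[OF assms(1) op op, of U "S - U"] by blast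
  thus False using sub[of U] sub[of "S - U"] assms by blast
qed

text \<open>The set of points of \<open>P\<close> that have been reached grows as long as it does
  not serve all of \<open>S\<close>: a short edge leads from the part already served to a new point,
  which descends to a new element of \<open>P\<close>. Each element is added once and costs at most
  \<open>2 * \<Lambda> + \<delta>\<close>: back up, across the edge, and down.\<close>

lemma chain_in_connected:
  fixes \<Lambda> \<delta> :: real
  assumes P: "finite P" and S: "connected S" "S \<subseteq> A" and xy: "x \<in> S" "y \<in> S" and \<delta>: "0 < \<delta>" and \<Lambda>: "0 \<le> \<Lambda>"
    and ch: "\<And>z. z \<in> S \<Longrightarrow> \<exists>p\<in>P. \<exists>L\<le>\<Lambda>. chain n A \<delta> z p L"
  shows "\<exists>L\<le>real (card P) * (2 * \<Lambda> + \<delta>). chain n A \<delta> x y L"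
proof -
  obtain p0 L0 where p0: "p0 \<in> P" "L0 \<le> \<Lambda>" "chain n A \<delta> x p0 L0" using ch[OF xy(1)] by blast
  \<comment> \<open>The subtraction of \<open>\<Lambda> + \<delta>\<close> accounts for the start:
    the first element of \<open>P\<close> is reached by a single descent from
    \<open>x\<close>.\<close>
  define good where "good T \<longleftrightarrow> T \<subseteq> P \<and> p0 \<in> T \<and>
    (\<forall>p\<in>T. \<exists>L\<le>real (card T) * (2 * \<Lambda> + \<delta>) - \<Lambda> - \<delta>. chain n A \<delta> x p L)" for T
  have "good {p0}" using p0 by (auto simp: good_def)
  moreover have "\<forall>T. good T \<longrightarrow> card T < Suc (card P)" using P by (auto simp: good_def less_Suc_eq_le intro: card_mono)
  ultimately obtain T where T: "good T" "\<And>T'. good T' \<Longrightarrow> card T' \<le> card T"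
    using ex_has_greatest_nat[of good "{p0}" card "Suc (card P)"] by blast
  have fT: "finite T" "T \<subseteq> P" using T(1) P by (auto simp: good_def intro: finite_subset)
  define U where "U = {z \<in> S. \<exists>p\<in>T. \<exists>L\<le>\<Lambda>. chain n A \<delta> z p L}"
  have chU: "\<exists>L\<le>real (card T) * (2 * \<Lambda> + \<delta>) - \<delta>. chain n A \<delta> x z L" if z: "z \<in> U" for z
  proof -
    obtain p L where p: "p \<in> T" "L \<le> \<Lambda>" "chain n A \<delta> z p L" using z by (auto simp: U_def)
    obtain L' where L': "L' \<le> real (card T) * (2 * \<Lambda> + \<delta>) - \<Lambda> - \<delta>" "chain n A \<delta> x p L'"
      using T(1) p(1) unfolding good_def by blast
    show ?thesis using chain_trans[OF L'(2) chain_sym[OF p(3)]] L'(1) p(2) by (intro exI[of _ "L' + L"]) auto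
  qed
  have "U = S"
  proof (rule ccontr)
    assume "U \<noteq> S"
    have "x \<in> U" using T(1) p0 xy(1) by (auto simp: U_def good_def)
    moreover have "U \<subseteq> S" by (auto simp: U_def)
    ultimately obtain z w where zw: "z \<in> U" "w \<in> S - U" "eucl_dist n z w \<le> \<delta>"
      using connected_short_edge[OF S(1) _ _ \<open>U \<noteq> S\<close> \<delta>, of n] by blast
    obtain p' L' where p': "p' \<in> P" "L' \<le> \<Lambda>" "chain n A \<delta> w p' L'" using ch[of w] zw by blast
    have nT: "p' \<notin> T" using zw(2) p' by (auto simp: U_def)
    obtain L where L: "L \<le> real (card T) * (2 * \<Lambda> + \<delta>) - \<delta>" "chain n A \<delta> x z L" using chU[OF zw(1)] by blast
    have "w \<in> A" using zw S by blast
    have "chain n A \<delta> x p' (L + eucl_dist n z w + L')"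
      by (rule chain_trans[OF chain.chain_step[OF L(2) \<open>w \<in> A\<close> zw(3)] p'(3)])
    moreover have "L + eucl_dist n z w + L' \<le> real (card (insert p' T)) * (2 * \<Lambda> + \<delta>) - \<Lambda> - \<delta>"
      using L(1) zw(3) p'(2) nT fT by (simp add: algebra_simps)
    moreover have "real (card T) * (2 * \<Lambda> + \<delta>) \<le> real (card (insert p' T)) * (2 * \<Lambda> + \<delta>)"
      using nT fT \<Lambda> \<delta> by (intro mult_right_mono) auto
    hence "\<exists>L\<le>real (card (insert p' T)) * (2 * \<Lambda> + \<delta>) - \<Lambda> - \<delta>. chain n A \<delta> x p L" if "p \<in> T" for p
      using T(1) that unfolding good_def by (smt (verit))
    ultimately have "good (insert p' T)" using T(1) fT p'(1) unfolding good_def by blast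
    from T(2)[OF this] nT fT show False by simp
  qed
  hence "y \<in> U" using xy by simp
  from chU[OF this] obtain L where L: "L \<le> real (card T) * (2 * \<Lambda> + \<delta>) - \<delta>" "chain n A \<delta> x y L" by blast
  moreover have "real (card T) * (2 * \<Lambda> + \<delta>) \<le> real (card P) * (2 * \<Lambda> + \<delta>)"
    using card_mono[OF P fT(2)] \<Lambda> \<delta> by (intro mult_right_mono) auto
  ultimately show ?thesis using \<delta> by (intro exI[of _ L]) auto
qed


text \<open>Every component contains a point of \<open>P\<close>, which bounds the number of
  components, and each diameter is at most \<open>card P * (2 * \<Lambda> + 1)\<close>.\<close>

lemma sum_geodesic_diameters_le:
  fixes \<Lambda> :: real
  assumes A: "compact A" "A \<subseteq> Rn n" and P: "finite P" and \<Lambda>: "0 \<le> \<Lambda>"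
    and ch: "\<And>\<delta> x. \<delta> > 0 \<Longrightarrow> x \<in> A \<Longrightarrow> \<exists>p\<in>P. \<exists>L\<le>\<Lambda>. chain n A \<delta> x p L"
  shows "sum_geodesic_diameters n A \<le> ereal (real (card P) * (real (card P) * (2 * \<Lambda> + 1)))"
proof -
  let ?X = "subtopology (Euclidean_space n) A"
  let ?C = "connected_components_of ?X"
  define D where "D = real (card P) * (2 * \<Lambda> + 1)"
  have SA: "S \<subseteq> A" if "S \<in> ?C" for S
    using connected_components_of_subset[OF that] by simp
  have conn: "connected S" if "S \<in> ?C" for S
  proof -
    have "connectedin ?X S" by (rule connectedin_connected_components_of[OF that])
    hence "connectedin (powertop_real UNIV) S" by (auto simp: Euclidean_space_def connectedin_subtopology)
    thus ?thesis by (simp add: euclidean_product_topology)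
  qed
  have diam: "geodesic_diameter n S \<le> ereal D" if S: "S \<in> ?C" for S
    unfolding geodesic_diameter_def
  proof (rule Sup_least, clarify)
    fix x y assume xy: "x \<in> S" "y \<in> S"
    have "\<exists>L\<le>D. chain n A \<delta> x y L" if \<delta>: "\<delta> > 0" for \<delta>
    proof -
      \<comment> \<open>Restricting to edges of length at most 1 makes the bound independent of
        \<open>\<delta>\<close>.\<close>
      have m: "0 < min \<delta> 1" using \<delta> by simp
      obtain L where L: "L \<le> real (card P) * (2 * \<Lambda> + min \<delta> 1)" "chain n A (min \<delta> 1) x y L"
        using chain_in_connected[OF P conn[OF S] SA[OF S] xy m \<Lambda> ch[OF m]] SA[OF S] by blast
      have "real (card P) * (2 * \<Lambda> + min \<delta> 1) \<le> D" unfolding D_def by (intro mult_left_mono) auto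
      thus ?thesis using L(1) chain_mono[OF L(2), of \<delta>] by (intro exI[of _ L]) auto
    qed
    from lipschitz_path_in_component[OF A this S xy(1)] show "geodesic_dist n S x y \<le> ereal D" by blast
  qed
  have "\<exists>p\<in>P. p \<in> S" if S: "S \<in> ?C" for S
  proof -
    obtain x where x: "x \<in> S" using nonempty_connected_components_of[OF S] by blast
    \<comment> \<open>The end point of the descent may depend on \<open>\<delta>\<close>; since
      \<open>P\<close> is finite and chains remain valid for larger \<open>\<delta>\<close>, one end
      point serves all \<open>\<delta>\<close>.\<close>
    have "\<exists>p\<in>P. \<forall>\<delta>>0. \<exists>L\<le>\<Lambda>. chain n A \<delta> x p L"
    proof (rule ccontr)
      assume "\<not> ?thesis"
      then obtain d where d: "\<And>p. p \<in> P \<Longrightarrow> d p > 0" "\<And>p L. p \<in> P \<Longrightarrow> L \<le> \<Lambda> \<Longrightarrow> \<not> chain n A (d p) x p L" by metis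
      define \<delta> where "\<delta> = Min (insert 1 (d ` P))"
      have "\<delta> > 0" unfolding \<delta>_def using P d(1) by (subst Min_gr_iff) auto
      then obtain p L where p: "p \<in> P" "L \<le> \<Lambda>" "chain n A \<delta> x p L" using ch[of \<delta> x] SA[OF S] x by blast
      have "\<delta> \<le> d p" unfolding \<delta>_def using P p(1) by (intro Min_le) auto
      from chain_mono[OF p(3) this] d(2)[OF p(1,2)] show False by blast
    qed
    then obtain p where p: "p \<in> P" "\<And>\<delta>. \<delta> > 0 \<Longrightarrow> \<exists>L\<le>\<Lambda>. chain n A \<delta> x p L" by blast
    from lipschitz_path_in_component[OF A p(2) S x] p(1) show ?thesis by blast
  qed
  then obtain r where r: "\<And>S. S \<in> ?C \<Longrightarrow> r S \<in> P \<and> r S \<in> S" by metis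
  have "S = T" if "S \<in> ?C" "T \<in> ?C" "r S = r T" for S T
    using r[OF that(1)] r[OF that(2)] that pairwise_disjoint_connected_components_of[of ?X]
    by (auto simp: pairwise_def disjnt_iff)
  hence inj: "inj_on r ?C" by (rule inj_onI)
  have rP: "r ` ?C \<subseteq> P" using r by blast
  have fin: "finite ?C" using inj rP P by (metis finite_imageD finite_subset)
  have "sum_geodesic_diameters n A = (\<Sum>S\<in>?C. geodesic_diameter n S)"
    unfolding sum_geodesic_diameters_def using fin by (rule infsum_finite)
  also have "\<dots> \<le> (\<Sum>S\<in>?C. ereal D)" by (intro sum_mono diam)
  also have "\<dots> = ereal (real (card ?C) * D)" by simp
  also have "real (card ?C) * D \<le> real (card P) * D" using card_inj_on_le[OF inj rP P] \<Lambda> by (intro mult_right_mono) (auto simp: D_def)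
  finally show ?thesis unfolding D_def by simp
qed

subsection \<open>Quadratic polynomials\<close>

definition is_quadric :: "nat \<Rightarrow> ((nat \<Rightarrow> real) \<Rightarrow> real) \<Rightarrow> bool" where
  "is_quadric n F \<longleftrightarrow> (\<exists>c b S. (\<forall>i l. S i l = S l i) \<and>
     F = (\<lambda>x. c + (\<Sum>i<n. b i * x i) + (\<Sum>i<n. \<Sum>l<n. S i l * (x i * x l))))"

lemma is_quadricI:
  assumes "\<And>i l. S i l = S l i" "\<And>x. F x = c + (\<Sum>i<n. b i * x i) + (\<Sum>i<n. \<Sum>l<n. S i l * (x i * x l))"
  shows "is_quadric n F"
  unfolding is_quadric_def using assms by (intro exI[of _ c] exI[of _ b] exI[of _ S]) auto

lemma is_quadric_const: "is_quadric n (\<lambda>_. a)"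
  by (rule is_quadricI[where S = "\<lambda>_ _. 0" and c = a and b = "\<lambda>_. 0"]) auto

lemma is_quadric_var: "a < n \<Longrightarrow> is_quadric n (\<lambda>x. x a)"
  by (rule is_quadricI[where S = "\<lambda>_ _. 0" and c = 0 and b = "\<lambda>i. if i = a then 1 else 0"]) (auto simp: if_distribR if_distrib[of "\<lambda>u. u * _"] cong: if_cong)

lemma is_quadric_add:
  assumes "is_quadric n F" "is_quadric n H"
  shows "is_quadric n (\<lambda>x. F x + H x)"
proof -
  obtain c b S where F: "\<And>i l. S i l = S l i" "F = (\<lambda>x. c + (\<Sum>i<n. b i * x i) + (\<Sum>i<n. \<Sum>l<n. S i l * (x i * x l)))"
    using assms(1) unfolding is_quadric_def by blast
  obtain c' b' S' where H: "\<And>i l. S' i l = S' l i" "H = (\<lambda>x. c' + (\<Sum>i<n. b' i * x i) + (\<Sum>i<n. \<Sum>l<n. S' i l * (x i * x l)))"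
    using assms(2) unfolding is_quadric_def by blast
  show ?thesis
    by (rule is_quadricI[where S = "\<lambda>i l. S i l + S' i l" and c = "c + c'" and b = "\<lambda>i. b i + b' i"])
      (use F(1) H(1) in \<open>auto simp: F(2) H(2) sum.distrib distrib_right\<close>)
qed

lemma is_quadric_scale:
  assumes "is_quadric n F"
  shows "is_quadric n (\<lambda>x. a * F x)"
proof -
  obtain c b S where F: "\<And>i l. S i l = S l i" "F = (\<lambda>x. c + (\<Sum>i<n. b i * x i) + (\<Sum>i<n. \<Sum>l<n. S i l * (x i * x l)))"
    using assms(1) unfolding is_quadric_def by blast
  show ?thesis
    by (rule is_quadricI[where S = "\<lambda>i l. a * S i l" and c = "a * c" and b = "\<lambda>i. a * b i"])
      (use F(1) in \<open>auto simp: F(2) distrib_left sum_distrib_left mult.assoc\<close>)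
qed

text \<open>The coefficient matrix has to be symmetric, so the product is split evenly between the
  two positions; for \<open>a = a'\<close> both halves fall on the same entry.\<close>

lemma is_quadric_mult_var:
  assumes "a < n" "a' < n"
  shows "is_quadric n (\<lambda>x. x a * x a')"
proof (rule is_quadricI[where S = "\<lambda>i l. ((if i = a then 1 else 0) * (if l = a' then 1 else 0) + (if i = a' then 1 else 0) * (if l = a then 1 else 0)) / 2"
      and c = 0 and b = "\<lambda>_. 0"])
  fix x :: "nat \<Rightarrow> real"
  have \<delta>: "(\<Sum>i<n. \<Sum>l<n. (if i = p then 1 else 0) * (if l = q then 1 else 0) * (x i * x l)) = x p * x q" if "p < n" "q < n" for p q
  proof -
    have "(\<Sum>i<n. \<Sum>l<n. (if i = p then 1 else 0) * (if l = q then 1 else 0) * (x i * x l))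
        = (\<Sum>i<n. if i = p then x i else 0) * (\<Sum>l<n. if l = q then x l else 0)"
      unfolding sum_product by (intro sum.cong) auto
    thus ?thesis using that by simp
  qed
  have "(\<Sum>i<n. \<Sum>l<n. ((if i = a then 1 else 0) * (if l = a' then 1 else 0) + (if i = a' then 1 else 0) * (if l = a then 1 else 0)) / 2 * (x i * x l))
      = ((\<Sum>i<n. \<Sum>l<n. (if i = a then 1 else 0) * (if l = a' then 1 else 0) * (x i * x l))
        + (\<Sum>i<n. \<Sum>l<n. (if i = a' then 1 else 0) * (if l = a then 1 else 0) * (x i * x l))) / 2"
    unfolding sum.distrib[symmetric] sum_divide_distrib by (intro sum.cong refl) (simp only: distrib_right add_divide_distrib times_divide_eq_left)
  thus "x a * x a' = 0 + (\<Sum>i<n. 0 * x i) + (\<Sum>i<n. \<Sum>l<n. ((if i = a then 1 else 0) * (if l = a' then 1 else 0) + (if i = a' then 1 else 0) * (if l = a then 1 else 0)) / 2 * (x i * x l))"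
    using \<delta>[OF assms] \<delta>[OF assms(2,1)] by (simp add: mult.commute)
qed auto

lemma is_quadric_sum: "(\<And>m. m \<in> K \<Longrightarrow> is_quadric n (F m)) \<Longrightarrow> is_quadric n (\<lambda>x. \<Sum>m\<in>K. F m x)"
  by (induction K rule: infinite_finite_induct) (auto intro: is_quadric_const is_quadric_add)

text \<open>Lists the variables with multiplicity. The length of the list is the degree, so
  monomials of degree at most 2 can be treated by cases on the list.\<close>

lemma prod_power_list:
  fixes e :: "nat \<Rightarrow> nat"
  assumes "finite K"
  shows "\<exists>is. set is \<subseteq> K \<and> length is = (\<Sum>i\<in>K. e i) \<and> (\<forall>x :: nat \<Rightarrow> real. (\<Prod>i\<in>K. x i ^ e i) = prod_list (map x is))"
  using assms
proof (induction K)
  case (insert a K)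
  then obtain as where as: "set as \<subseteq> K" "length as = (\<Sum>i\<in>K. e i)" "\<forall>x :: nat \<Rightarrow> real. (\<Prod>i\<in>K. x i ^ e i) = prod_list (map x as)" by blast
  show ?case using insert.hyps as by (intro exI[of _ "replicate (e a) a @ as"]) (auto simp: prod_list_replicate)
qed auto

lemma mpoly_eval_quadric:
  assumes "p \<in> mpolys_of_degree_le n 2"
  shows "is_quadric n (mpoly_eval p)"
proof -
  have "is_quadric n (\<lambda>x. \<Prod>i\<in>Poly_Mapping.keys m. x i ^ Poly_Mapping.lookup m i)" if "m \<in> Poly_Mapping.keys p" for m
  proof -
    obtain as where as: "set as \<subseteq> Poly_Mapping.keys m" "length as = monomial_degree m"
      "\<And>x :: nat \<Rightarrow> real. (\<Prod>i\<in>Poly_Mapping.keys m. x i ^ Poly_Mapping.lookup m i) = prod_list (map x as)"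
      using prod_power_list[of "Poly_Mapping.keys m" "Poly_Mapping.lookup m"] unfolding monomial_degree_def by auto
    have "set as \<subseteq> {..<n}" "length as \<le> 2" using as assms that by (auto simp: mpolys_of_degree_le_def)
    then consider "as = []" | a where "as = [a]" "a < n" | a a' where "as = [a, a']" "a < n" "a' < n"
      by (cases as; cases "tl as") (auto simp: length_Suc_conv)
    thus ?thesis unfolding as(3) by cases (auto intro: is_quadric_const is_quadric_var is_quadric_mult_var)
  qed
  thus ?thesis unfolding mpoly_eval_def[abs_def] by (intro is_quadric_sum is_quadric_scale)
qed

context quadrics
begin

lemma partial_deriv_Qv:
  assumes "i < n"
  shows "partial_deriv i (Qv j) x = G j x i"
proof -
  have Qv: "Qv j (x(i := t)) = Qv j x + G j x i * (t - x i) + S j i i * (t - x i) ^ 2" for t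
  proof -
    define d where "d l = (if l = i then t - x i else 0)" for l
    have "x(i := t) = (\<lambda>l. x l + d l)" by (auto simp: d_def)
    moreover have "(\<Sum>l<n. G j x l * d l) = G j x i * (t - x i)"
      using assms by (simp add: d_def if_distrib[of "\<lambda>u. _ * u"] cong: if_cong)
    moreover have "qf j d = S j i i * (t - x i) ^ 2"
    proof -
      have "(\<Sum>l<n. S j m l * (d m * d l)) = (if m = i then S j i i * (t - x i) ^ 2 else 0)" for m
        using assms by (auto simp: d_def power2_eq_square if_distrib[of "\<lambda>u. _ * u"] cong: if_cong)
      thus ?thesis using assms by (simp add: qf_def)
    qed
    ultimately show ?thesis by (simp add: Qv_add)
  qed
  have "((\<lambda>t. Qv j (x(i := t))) has_real_derivative G j x i) (at (x i))"
    unfolding Qv by (auto intro!: derivative_eq_intros)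
  thus ?thesis unfolding partial_deriv_def by (rule DERIV_imp_deriv)
qed

end

section \<open>Assembling the bound\<close>

context regular_quadrics
begin

lemma sum_diameters_bound:
  "sum_geodesic_diameters n M \<le> ereal (real (elim_degree (2 * n) k) * (real (elim_degree (2 * n) k) *
     (2 * (4 * real n * real (elim_degree (2 * n) (4 * k + 2)) + 1) + 1)))"
proof -
  define \<Lambda> where "\<Lambda> = 4 * real n * real (elim_degree (2 * n) (4 * k + 2)) + 1"
  have \<Lambda>: "0 \<le> \<Lambda>" by (simp add: \<Lambda>_def)
  obtain e where e: "\<forall>i. \<bar>e i\<bar> \<le> 1" "finite (Crit e)" "card (Crit e) \<le> elim_degree (2 * n) k"
    using critical_points_bounded by blast
  have "sum_geodesic_diameters n M \<le> ereal (real (card (Crit e)) * (real (card (Crit e)) * (2 * \<Lambda> + 1)))"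
    by (rule sum_geodesic_diameters_le[OF compact_M _ e(2) \<Lambda>])
      (use M_Rn descent_chain[OF e(1)] in \<open>auto simp: \<Lambda>_def\<close>)
  also have "real (card (Crit e)) * (real (card (Crit e)) * (2 * \<Lambda> + 1))
      \<le> real (elim_degree (2 * n) k) * (real (elim_degree (2 * n) k) * (2 * \<Lambda> + 1))"
    using e(3) \<Lambda> by (intro mult_mono) auto
  finally show ?thesis unfolding \<Lambda>_def by simp
qed

end

lemma bound_of_complete_intersection:
  assumes Q: "\<forall>j\<in>{1..k}. Q j \<in> mpolys_of_degree_le n 2" and M: "M = zero_locus n k Q \<inter> closed_unit_ball n"
    and sub: "M \<subseteq> open_unit_ball n" and ci: "complete_intersection_on n k Q M"
  shows "sum_geodesic_diameters n M \<le> ereal (real (elim_degree (2 * n) k) * (real (elim_degree (2 * n) k) *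
     (2 * (4 * real n * real (elim_degree (2 * n) (4 * k + 2)) + 1) + 1)))"
proof -
  \<comment> \<open>The equations are numbered from 1 in the statement and from 0 in the locale.
    Symmetry is demanded for every index, so indices from \<open>k\<close> on receive zero
    coefficients.\<close>
  have ex: "\<forall>j. \<exists>t. (\<forall>i l. snd (snd t) i l = snd (snd t) l i) \<and> (j < k \<longrightarrow> mpoly_eval (Q (Suc j)) =
     (\<lambda>x. fst t + (\<Sum>i<n. fst (snd t) i * x i) + (\<Sum>i<n. \<Sum>l<n. snd (snd t) i l * (x i * x l))))" (is "\<forall>j. ?ex j")
  proof
    fix j show "?ex j"
    proof (cases "j < k")
    case True
    hence "is_quadric n (mpoly_eval (Q (Suc j)))" using Q by (intro mpoly_eval_quadric) auto
    then obtain c b S where "\<forall>i l. S i l = S l i"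
      "mpoly_eval (Q (Suc j)) = (\<lambda>x. c + (\<Sum>i<n. b i * x i) + (\<Sum>i<n. \<Sum>l<n. S i l * (x i * x l)))"
      unfolding is_quadric_def by blast
    thus ?thesis by (intro exI[of _ "(c, b, S)"]) auto
  next
    case False
    thus ?thesis by (intro exI[of _ "(0, (\<lambda>_. 0), (\<lambda>_ _. 0))"]) auto
  qed
  qed
  obtain t where t: "\<And>j i l. snd (snd (t j)) i l = snd (snd (t j)) l i" "\<And>j. j < k \<Longrightarrow> mpoly_eval (Q (Suc j)) =
     (\<lambda>x. fst (t j) + (\<Sum>i<n. fst (snd (t j)) i * x i) + (\<Sum>i<n. \<Sum>l<n. snd (snd (t j)) i l * (x i * x l)))" using choice[OF ex] by blast
  interpret q: quadrics n k "\<lambda>j. fst (t j)" "\<lambda>j. fst (snd (t j))" "\<lambda>j. snd (snd (t j))" by unfold_locales (rule t(1))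
  have eval: "mpoly_eval (Q (Suc j)) = q.Qv j" if "j < k" for j using t(2)[OF that] by (simp add: q.Qv_def[abs_def])
  have ball: "(\<forall>j\<in>{1..k}. R j) \<longleftrightarrow> (\<forall>j<k. R (Suc j))" for R
    by (auto simp: less_eq_Suc_le) (metis Suc_le_D Suc_le_mono)
  have M': "M = q.M"
    unfolding M q.M_def zero_locus_def closed_unit_ball_def topspace_Euclidean_space_Rn ball using eval by auto
  interpret q: regular_quadrics n k "\<lambda>j. fst (t j)" "\<lambda>j. fst (snd (t j))" "\<lambda>j. snd (snd (t j))"
  proof unfold_locales
    fix x assume x: "x \<in> q.M"
    show "eucl_norm n x < 1" using x sub by (auto simp: M' open_unit_ball_def)
    fix \<omega> j assume z: "\<And>i. i < n \<Longrightarrow> (\<Sum>j<k. \<omega> j * q.G j x i) = 0" and j: "j < k"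
    have "(\<Sum>j=1..k. \<omega> (j - 1) * gradient n (mpoly_eval (Q j)) x i) = 0" for i
    proof -
      have "(\<Sum>j=1..k. \<omega> (j - 1) * gradient n (mpoly_eval (Q j)) x i) = (\<Sum>j<k. \<omega> j * gradient n (mpoly_eval (Q (Suc j))) x i)"
        by (simp add: sum.atLeast1_atMost_eq)
      also have "\<dots> = (\<Sum>j<k. \<omega> j * (if i < n then q.G j x i else 0))"
        by (intro sum.cong) (auto simp: gradient_def eval q.partial_deriv_Qv)
      also have "\<dots> = 0" using z[of i] by (cases "i < n") auto
      finally show ?thesis .
    qed
    moreover have "lin_indep_family k (\<lambda>j. gradient n (mpoly_eval (Q j)) x)"
      using ci x by (simp add: complete_intersection_on_def M')
    ultimately have "\<forall>j\<in>{1..k}. \<omega> (j - 1) = 0"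
      unfolding lin_indep_family_def by (elim allE[of _ "\<lambda>j. \<omega> (j - 1)"]) simp
    thus "\<omega> j = 0" using j by (force simp: ball)
  qed
  show ?thesis unfolding M' by (rule q.sum_diameters_bound)
qed

theorem theorem12:
  shows "\<exists>C::real. C > 0 \<and>
    (\<forall>k::nat. k \<ge> 1 \<longrightarrow>
      (\<exists>q::real poly. real (degree q) \<le> C * real k \<and>
        (\<forall>(n::nat) (Q :: nat \<Rightarrow> real_mpoly) (M :: (nat \<Rightarrow> real) set).
           n \<ge> 1 \<longrightarrow>
           (\<forall>j\<in>{1..k}. Q j \<in> mpolys_of_degree_le n 2) \<longrightarrow>
           M = zero_locus n k Q \<inter> closed_unit_ball n \<longrightarrow>
           (\<exists>d. submanifold_of n d (open_unit_ball n) M) \<longrightarrow>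
           complete_intersection_on n k Q M \<longrightarrow>
           sum_geodesic_diameters n M \<le> ereal (poly q (real n)))))"
proof (rule exI[of _ "9::real"], intro conjI allI impI)
  fix k :: nat assume k: "k \<ge> 1"
  \<comment> \<open>\<open>elim_degree (2 * n) m\<close> as a polynomial in \<open>n\<close>: the
    factor \<open>4 * (2 * n) + 6\<close> is \<open>8 * n + 6\<close>.\<close>
  define E where "E m = Polynomial.smult 2 ([:6 * real (m + 1) + 1, 8 * real (m + 1):] ^ m)" for m
  have E: "poly (E m) (real n) = real (elim_degree (2 * n) m)" for m n
    by (simp add: E_def elim_degree_def algebra_simps)
  have dE: "degree (E m) \<le> m" for m
    using degree_power_le[of "[:6 * real (m + 1) + 1, 8 * real (m + 1):]" m] by (simp add: E_def)
  define q where "q = E k * (E k * (Polynomial.smult 2 ([:0, 4:] * E (4 * k + 2) + 1) + 1))"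
  have "degree ([:0, 4::real:] * E (4 * k + 2)) \<le> 4 * k + 3"
    using degree_mult_le[of "[:0, 4::real:]" "E (4 * k + 2)"] dE[of "4 * k + 2"] by simp
  hence "degree (Polynomial.smult 2 ([:0, 4:] * E (4 * k + 2) + 1) + 1) \<le> 4 * k + 3"
    by (intro degree_add_le order_trans[OF degree_smult_le]) auto
  \<comment> \<open>The number of critical points enters twice with degree \<open>k\<close>, the
    length of the chains once with degree \<open>4 * k + 3\<close>, where the additional 1 is the
    factor \<open>n\<close>. Since \<open>k\<close> is at least 1, the sum \<open>6 * k + 3\<close>
    is at most \<open>9 * k\<close>, whence the constant 9.\<close>
  hence "degree q \<le> 6 * k + 3"
    using degree_mult_le[of "E k" "E k * (Polynomial.smult 2 ([:0, 4:] * E (4 * k + 2) + 1) + 1)"]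
      degree_mult_le[of "E k" "Polynomial.smult 2 ([:0, 4:] * E (4 * k + 2) + 1) + 1"] dE[of k]
    unfolding q_def by linarith
  hence "degree q \<le> 9 * k" using k by linarith
  hence "real (degree q) \<le> 9 * real k" by (metis of_nat_le_iff of_nat_mult of_nat_numeral)
  moreover have "sum_geodesic_diameters n M \<le> ereal (poly q (real n))"
    if "\<forall>j\<in>{1..k}. Q j \<in> mpolys_of_degree_le n 2" "M = zero_locus n k Q \<inter> closed_unit_ball n"
      "\<exists>d. submanifold_of n d (open_unit_ball n) M" "complete_intersection_on n k Q M" for n Q M
  proof -
    have "M \<subseteq> open_unit_ball n" using that(3) by (auto simp: submanifold_of_def)
    moreover have "poly q (real n) = real (elim_degree (2 * n) k) * (real (elim_degree (2 * n) k) *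
       (2 * (4 * real n * real (elim_degree (2 * n) (4 * k + 2)) + 1) + 1))"
      by (simp add: q_def E)
    ultimately show ?thesis using bound_of_complete_intersection[OF that(1,2) _ that(4)] by simp
  qed
  ultimately show "\<exists>q::real poly. real (degree q) \<le> 9 * real k \<and>
        (\<forall>(n::nat) (Q :: nat \<Rightarrow> real_mpoly) (M :: (nat \<Rightarrow> real) set).
           n \<ge> 1 \<longrightarrow>
           (\<forall>j\<in>{1..k}. Q j \<in> mpolys_of_degree_le n 2) \<longrightarrow>
           M = zero_locus n k Q \<inter> closed_unit_ball n \<longrightarrow>
           (\<exists>d. submanifold_of n d (open_unit_ball n) M) \<longrightarrow>
           complete_intersection_on n k Q M \<longrightarrow>
           sum_geodesic_diameters n M \<le> ereal (poly q (real n)))" by blast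
qed simp

end
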